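(* Let $\Omega\subseteq\mathbb{R}^n$ be open and let $\omega$ be a weight function such that $$\exists\, H\geq 1:\quad \omega(t^2)=O(\omega(Ht)),\qquad t\to\infty.$$ Let $0\leq\delta<\rho\leq 1$ and $d'>0$. Then for any $P\in\mathcal{A}^{d,d'}_{\rho,\delta}(\Omega)$ we have $$\mathcal{E}^{\{\omega\}}(\Omega;P)=\mathcal{E}^{\{\omega\}}(\Omega)\qquad\text{and}\qquad \mathcal{E}^{(\omega)}(\Omega;P)=\mathcal{E}^{(\omega)}(\Omega).$$
   Context: The class $\mathcal{A}^{d,d'}_{\rho,\delta}(\Omega)$: it consists of the linear partial differential operators $P=p(x,D)$ of order $d$ with real-analytic coefficients in $\Omega$ (with $D=-i\partial$ and full symbol $p(x,\xi)$) such that (i) for every compact $K\subset\Omega$ there are constants $C,A,M>0$ with $|\partial_x^\alpha\partial_\xi^\beta p(x,\xi)|\leq C A^{|\alpha|+|\beta|}\alpha!\,\beta!\,|p(x,\xi)|\,|\xi|^{-\rho|\beta|+\delta|\alpha|}$ for all $x\in K$, $\xi\in\mathbb{R}^n$ with $|\xi|\geq M$, and $\alpha,\beta\in\mathbb{N}_0^n$; (ii) for every compact $K\subset\Omega$ there are constants $C,L>0$ with $|\xi|^{d'}\leq C|p(x,\xi)|$ for all $x\in K$ and $\xi\in\mathbb{R}^n$ with $|\xi|\geq L$. Weight functions: a weight function is a continuous increasing $\omega:[0,\infty)\to[0,\infty)$ with $\omega|_{[0,1]}\equiv 0$, $\omega(2t)=O(\omega(t))$ and $\log t=o(\omega(t))$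 as $t\to\infty$, and $\varphi_\omega(t):=\omega(e^t)$ convex. Put $\varphi_\omega^*(t)=\sup_{s\geq 0}(st-\varphi_\omega(s))$. $\mathcal{E}^{\{\omega\}}(\Omega)$ (resp. $\mathcal{E}^{(\omega)}(\Omega)$) is the space of smooth functions $f$ on $\Omega$ such that for every compact $K\subseteq\Omega$ there are $C,h>0$ (resp. for every compact $K\subseteq\Omega$ and every $h>0$ there is $C>0$) with $\sup_{x\in K}|D^\alpha f(x)|\leq C e^{h^{-1}\varphi_\omega^*(h|\alpha|)}$ for all $\alpha\in\mathbb{N}_0^n$. $\mathcal{E}^{\{\omega\}}(\Omega;P)$ (resp. $\mathcal{E}^{(\omega)}(\Omega;P)$), for $P$ of order $d$, is the space of distributions $u\in\mathcal{D}'(\Omega)$ such that $P^ku\in L^1_{loc}(\Omega)$ for all $k\in\mathbb{N}_0$ and for every open $V\Subset\Omega$ there are $C,h>0$ (resp. for every open $V\Subset\Omega$ and every $h>0$ there is $C>0$) with $\|P^ku\|_{L^1(V)}\leq C e^{\frac1h\varphi_\omega^*(hdk)}$ for all $k\in\mathbb{N}_0$. *)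

theory Defs
  imports "HOL-Analysis.Analysis" "HOL-Library.Landau_Symbols" "HOL-Library.FuncSet"
begin

type_synonym 'n multiindex = "'n \<Rightarrow> nat"

definition mi_abs :: "'n::finite multiindex \<Rightarrow> nat" where
  "mi_abs \<alpha> = (\<Sum>i\<in>UNIV. \<alpha> i)"

definition mi_fact :: "'n::finite multiindex \<Rightarrow> real" where
  "mi_fact \<alpha> = (\<Prod>i\<in>UNIV. fact (\<alpha> i))"

definition mi_power :: "real ^ 'n \<Rightarrow> 'n::finite multiindex \<Rightarrow> real" where
  "mi_power x \<alpha> = (\<Prod>i\<in>UNIV. (x $ i) ^ \<alpha> i)"

definition partial :: "'n::finite \<Rightarrow> (real ^ 'n \<Rightarrow> complex) \<Rightarrow> real ^ 'n \<Rightarrow> complex" where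
  "partial i f x = vector_derivative (\<lambda>t. f (x + t *\<^sub>R axis i 1)) (at 0)"

text \<open>The index type carries no order, so an enumeration of the coordinates is fixed to
  define the derivative of multi-index \<open>\<alpha>\<close>. For smooth functions the partial derivatives
  commute and the choice is immaterial.\<close>

definition coords :: "'n::finite list" where
  "coords = (SOME is. distinct is \<and> set is = UNIV)"

definition mi_partial :: "'n::finite multiindex \<Rightarrow> (real ^ 'n \<Rightarrow> complex) \<Rightarrow> real ^ 'n \<Rightarrow> complex" where
  "mi_partial \<alpha> f = foldr (\<lambda>i. partial i ^^ \<alpha> i) coords f"

text \<open>\<open>D = -\<i> \<partial>\<close>.\<close>

definition mi_D :: "'n::finite multiindex \<Rightarrow> (real ^ 'n \<Rightarrow> complex) \<Rightarrow> real ^ 'n \<Rightarrow> complex" where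
  "mi_D \<alpha> f x = (- \<i>) ^ mi_abs \<alpha> * mi_partial \<alpha> f x"

text \<open>On an open set: all iterated partial derivatives, in any order, exist and are
  differentiable, hence continuous. Values outside the set play no role.\<close>

definition smooth_on :: "(real ^ 'n::finite) set \<Rightarrow> (real ^ 'n \<Rightarrow> complex) \<Rightarrow> bool" where
  "smooth_on \<Omega> f \<longleftrightarrow> (\<forall>is. \<forall>x\<in>\<Omega>. foldr partial is f differentiable (at x))"

definition real_analytic_on :: "(real ^ 'n::finite) set \<Rightarrow> (real ^ 'n \<Rightarrow> complex) \<Rightarrow> bool" where
  "real_analytic_on \<Omega> f \<longleftrightarrow>
     (\<forall>x\<^sub>0\<in>\<Omega>. \<exists>c. \<exists>r>0. \<forall>x\<in>ball x\<^sub>0 r.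
        ((\<lambda>\<alpha>. c \<alpha> * complex_of_real (mi_power (x - x\<^sub>0) \<alpha>)) has_sum f x) UNIV)"

definition supp :: "(real ^ 'n::finite \<Rightarrow> complex) \<Rightarrow> (real ^ 'n) set" where
  "supp \<phi> = closure {x. \<phi> x \<noteq> 0}"

definition test_functions :: "(real ^ 'n::finite) set \<Rightarrow> (real ^ 'n \<Rightarrow> complex) set" where
  "test_functions \<Omega> = {\<phi>. smooth_on UNIV \<phi> \<and> compact (supp \<phi>) \<and> supp \<phi> \<subseteq> \<Omega>}"

text \<open>Distributions are represented as functionals that are \<open>undefined\<close> off the test functions,
  so that equality of functionals is equality of distributions. Continuity is expressed by
  the usual seminorm estimates on each compact subset.\<close>

definition distributions ::
    "(real ^ 'n::finite) set \<Rightarrow> ((real ^ 'n \<Rightarrow> complex) \<Rightarrow> complex) set" where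
  "distributions \<Omega> = {u \<in> extensional (test_functions \<Omega>).
     (\<forall>\<phi>\<in>test_functions \<Omega>. \<forall>\<psi>\<in>test_functions \<Omega>. u (\<lambda>x. \<phi> x + \<psi> x) = u \<phi> + u \<psi>) \<and>
     (\<forall>c. \<forall>\<phi>\<in>test_functions \<Omega>. u (\<lambda>x. c * \<phi> x) = c * u \<phi>) \<and>
     (\<forall>K. compact K \<and> K \<subseteq> \<Omega> \<longrightarrow>
        (\<exists>C N. \<forall>\<phi>\<in>test_functions \<Omega>. supp \<phi> \<subseteq> K \<longrightarrow>
           norm (u \<phi>) \<le> C * (\<Sum>\<alpha> | mi_abs \<alpha> \<le> N. SUP x. norm (mi_partial \<alpha> \<phi> x))))}"

definition L1_loc :: "(real ^ 'n::finite) set \<Rightarrow> (real ^ 'n \<Rightarrow> complex) set" where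
  "L1_loc \<Omega> = {f. \<forall>K. compact K \<and> K \<subseteq> \<Omega> \<longrightarrow> set_integrable lebesgue K f}"

definition regular_dist ::
    "(real ^ 'n::finite) set \<Rightarrow> (real ^ 'n \<Rightarrow> complex) \<Rightarrow> (real ^ 'n \<Rightarrow> complex) \<Rightarrow> complex" where
  "regular_dist \<Omega> f =
     (\<lambda>\<phi>\<in>test_functions \<Omega>. set_lebesgue_integral lebesgue \<Omega> (\<lambda>x. f x * \<phi> x))"

definition dist_D ::
    "(real ^ 'n::finite) set \<Rightarrow> 'n multiindex
      \<Rightarrow> ((real ^ 'n \<Rightarrow> complex) \<Rightarrow> complex) \<Rightarrow> (real ^ 'n \<Rightarrow> complex) \<Rightarrow> complex" where
  "dist_D \<Omega> \<alpha> u = (\<lambda>\<phi>\<in>test_functions \<Omega>. (- 1) ^ mi_abs \<alpha> * u (mi_D \<alpha> \<phi>))"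

definition dist_mult ::
    "(real ^ 'n::finite) set \<Rightarrow> (real ^ 'n \<Rightarrow> complex)
      \<Rightarrow> ((real ^ 'n \<Rightarrow> complex) \<Rightarrow> complex) \<Rightarrow> (real ^ 'n \<Rightarrow> complex) \<Rightarrow> complex" where
  "dist_mult \<Omega> a u = (\<lambda>\<phi>\<in>test_functions \<Omega>. u (\<lambda>x. a x * \<phi> x))"

text \<open>The operator \<open>P = \<Sum>\<^bsub>|\<alpha>| \<le> d\<^esub> a\<^sub>\<alpha>(x) D\<^sup>\<alpha>\<close> is represented by its order \<open>d\<close> and its
  coefficient functions \<open>a\<close>; entries of \<open>a\<close> of length greater than \<open>d\<close> are ignored.\<close>

definition pdo_coeffs ::
    "(real ^ 'n::finite) set \<Rightarrow> nat \<Rightarrow> ('n multiindex \<Rightarrow> real ^ 'n \<Rightarrow> complex) \<Rightarrow> bool" where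
  "pdo_coeffs \<Omega> d a \<longleftrightarrow>
     (\<forall>\<alpha>. mi_abs \<alpha> \<le> d \<longrightarrow> real_analytic_on \<Omega> (a \<alpha>)) \<and>
     (\<exists>\<alpha>. mi_abs \<alpha> = d \<and> (\<exists>x\<in>\<Omega>. a \<alpha> x \<noteq> 0))"

definition pdo_symbol ::
    "nat \<Rightarrow> ('n::finite multiindex \<Rightarrow> real ^ 'n \<Rightarrow> complex) \<Rightarrow> real ^ 'n \<Rightarrow> real ^ 'n \<Rightarrow> complex" where
  "pdo_symbol d a x \<xi> = (\<Sum>\<alpha> | mi_abs \<alpha> \<le> d. a \<alpha> x * complex_of_real (mi_power \<xi> \<alpha>))"

definition pdo ::
    "(real ^ 'n::finite) set \<Rightarrow> nat \<Rightarrow> ('n multiindex \<Rightarrow> real ^ 'n \<Rightarrow> complex)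
      \<Rightarrow> ((real ^ 'n \<Rightarrow> complex) \<Rightarrow> complex) \<Rightarrow> (real ^ 'n \<Rightarrow> complex) \<Rightarrow> complex" where
  "pdo \<Omega> d a u =
     (\<lambda>\<phi>\<in>test_functions \<Omega>. \<Sum>\<alpha> | mi_abs \<alpha> \<le> d. dist_mult \<Omega> (a \<alpha>) (dist_D \<Omega> \<alpha> u) \<phi>)"

definition class_A ::
    "(real ^ 'n::finite) set \<Rightarrow> nat \<Rightarrow> real \<Rightarrow> real \<Rightarrow> real
      \<Rightarrow> ('n multiindex \<Rightarrow> real ^ 'n \<Rightarrow> complex) set" where
  "class_A \<Omega> d d' \<rho> \<delta> = {a. pdo_coeffs \<Omega> d a \<and>
     (\<forall>K. compact K \<and> K \<subseteq> \<Omega> \<longrightarrow>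
        (\<exists>C A M. C > 0 \<and> A > 0 \<and> M > 0 \<and>
           (\<forall>x\<in>K. \<forall>\<xi>. norm \<xi> \<ge> M \<longrightarrow> (\<forall>\<alpha> \<beta>.
              norm (mi_partial \<alpha> (\<lambda>y. mi_partial \<beta> (\<lambda>\<eta>. pdo_symbol d a y \<eta>) \<xi>) x)
                \<le> C * A ^ (mi_abs \<alpha> + mi_abs \<beta>) * mi_fact \<alpha> * mi_fact \<beta>
                   * norm (pdo_symbol d a x \<xi>)
                   * norm \<xi> powr (- \<rho> * real (mi_abs \<beta>) + \<delta> * real (mi_abs \<alpha>)))))) \<and>
     (\<forall>K. compact K \<and> K \<subseteq> \<Omega> \<longrightarrow>
        (\<exists>C L. C > 0 \<and> L > 0 \<and>
           (\<forall>x\<in>K. \<forall>\<xi>. norm \<xi> \<ge> L \<longrightarrow> norm \<xi> powr d' \<le> C * norm (pdo_symbol d a x \<xi>))))}"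

definition weight_function :: "(real \<Rightarrow> real) \<Rightarrow> bool" where
  "weight_function \<omega> \<longleftrightarrow>
     continuous_on {0..} \<omega> \<and> mono_on {0..} \<omega> \<and>
     (\<forall>t\<ge>0. \<omega> t \<ge> 0) \<and> (\<forall>t\<in>{0..1}. \<omega> t = 0) \<and>
     (\<lambda>t. \<omega> (2 * t)) \<in> O[at_top](\<omega>) \<and>
     ln \<in> o[at_top](\<omega>) \<and>
     convex_on UNIV (\<lambda>t. \<omega> (exp t))"

text \<open>For a weight function the supremum is finite, because \<open>log t = o(\<omega>(t))\<close>.\<close>

definition young_conj :: "(real \<Rightarrow> real) \<Rightarrow> real \<Rightarrow> real" where
  "young_conj \<omega> t = (SUP s\<in>{0..}. s * t - \<omega> (exp s))"

definition E_roumieu :: "(real \<Rightarrow> real) \<Rightarrow> (real ^ 'n::finite) set \<Rightarrow> (real ^ 'n \<Rightarrow> complex) set" where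
  "E_roumieu \<omega> \<Omega> = {f. smooth_on \<Omega> f \<and>
     (\<forall>K. compact K \<and> K \<subseteq> \<Omega> \<longrightarrow> (\<exists>C>0. \<exists>h>0. \<forall>\<alpha>. \<forall>x\<in>K.
        norm (mi_D \<alpha> f x) \<le> C * exp (1 / h * young_conj \<omega> (h * real (mi_abs \<alpha>)))))}"

definition E_beurling :: "(real \<Rightarrow> real) \<Rightarrow> (real ^ 'n::finite) set \<Rightarrow> (real ^ 'n \<Rightarrow> complex) set" where
  "E_beurling \<omega> \<Omega> = {f. smooth_on \<Omega> f \<and>
     (\<forall>K. compact K \<and> K \<subseteq> \<Omega> \<longrightarrow> (\<forall>h>0. \<exists>C>0. \<forall>\<alpha>. \<forall>x\<in>K.
        norm (mi_D \<alpha> f x) \<le> C * exp (1 / h * young_conj \<omega> (h * real (mi_abs \<alpha>)))))}"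

text \<open>In the next two definitions \<open>g k\<close> is the locally integrable function, unique up to null sets,
  representing \<open>P\<^sup>k u\<close>.\<close>

definition E_roumieu_P ::
    "(real \<Rightarrow> real) \<Rightarrow> (real ^ 'n::finite) set \<Rightarrow> nat \<Rightarrow> ('n multiindex \<Rightarrow> real ^ 'n \<Rightarrow> complex)
      \<Rightarrow> ((real ^ 'n \<Rightarrow> complex) \<Rightarrow> complex) set" where
  "E_roumieu_P \<omega> \<Omega> d a = {u \<in> distributions \<Omega>.
     \<exists>g. (\<forall>k. g k \<in> L1_loc \<Omega> \<and> (pdo \<Omega> d a ^^ k) u = regular_dist \<Omega> (g k)) \<and>
       (\<forall>V. open V \<and> compact (closure V) \<and> closure V \<subseteq> \<Omega> \<longrightarrow> (\<exists>C>0. \<exists>h>0. \<forall>k.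
          set_lebesgue_integral lebesgue V (\<lambda>x. norm (g k x))
            \<le> C * exp (1 / h * young_conj \<omega> (h * real d * real k))))}"

definition E_beurling_P ::
    "(real \<Rightarrow> real) \<Rightarrow> (real ^ 'n::finite) set \<Rightarrow> nat \<Rightarrow> ('n multiindex \<Rightarrow> real ^ 'n \<Rightarrow> complex)
      \<Rightarrow> ((real ^ 'n \<Rightarrow> complex) \<Rightarrow> complex) set" where
  "E_beurling_P \<omega> \<Omega> d a = {u \<in> distributions \<Omega>.
     \<exists>g. (\<forall>k. g k \<in> L1_loc \<Omega> \<and> (pdo \<Omega> d a ^^ k) u = regular_dist \<Omega> (g k)) \<and>
       (\<forall>V. open V \<and> compact (closure V) \<and> closure V \<subseteq> \<Omega> \<longrightarrow> (\<forall>h>0. \<exists>C>0. \<forall>k.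
          set_lebesgue_integral lebesgue V (\<lambda>x. norm (g k x))
            \<le> C * exp (1 / h * young_conj \<omega> (h * real d * real k))))}"

end

theory Submission
  imports Defs "HOL-Probability.Probability"
begin

text \<open>A distribution whose iterates \<open>P\<^sup>k u\<close> grow no faster than the derivatives of an ultradifferentiable
  function is itself such a function. One inclusion is a Leibniz estimate: for smooth \<open>f\<close>, an application of \<open>P\<close>
  with analytic coefficients costs at most \<open>d\<close> derivatives, a constant and factorial growth
  (\<open>pdo_iterates_bound\<close>). The other inclusion is an elliptic regularity theorem with precise constants.

  For the regularity let \<open>g k\<close> represent \<open>P\<^sup>k u\<close> and let \<open>\<eta>\<close> be a cutoff function. The Fourier transform of
  \<open>\<eta> u\<close> at \<open>\<xi>\<close> is the pairing of \<open>u\<close> with \<open>e \<eta>\<close>, where \<open>e\<close> is the exponential of frequency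
  \<open>\<xi>\<close>. The transposed operator maps \<open>e (\<eta> / p)\<close> to \<open>e \<eta>\<close> plus a remainder \<open>e s\<close>. Dividing by the
  symbol gains \<open>|\<xi>|\<close> to the power \<open>- d'\<close>; each derivative of the symbol in \<open>\<xi>\<close> gains \<open>|\<xi>|\<close> to the
  power \<open>- \<rho>\<close> and the derivative in \<open>x\<close> that accompanies it loses at most the power \<open>\<delta>\<close>, so \<open>s\<close> is
  smaller than \<open>\<eta>\<close> by the power \<open>- (\<rho> - \<delta>)\<close> (\<open>amplitude_step\<close>). Hence in every round \<open>|\<xi>|\<close> to the
  power \<open>- \<epsilon>\<close> is gained with \<open>\<epsilon> = min d' (\<rho> - \<delta>)\<close>, at the price of one more iterate of \<open>P\<close> on
  \<open>u\<close> or of at most \<open>d\<close> derivatives of the amplitude (\<open>amplitude_pairing_decay\<close>). All bounds for the derivatives of the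
  symbol are relative to its own absolute value.

  To estimate a derivative of order \<open>l\<close> one takes a number of rounds proportional to \<open>l + 1\<close> and inverts the Fourier
  transform (\<open>local_regularity\<close>). The result bounds it by the iterates up to order \<open>q (l + 1)\<close>, a geometric factor and the
  square of the factorial of \<open>q (l + 1)\<close>, with \<open>q\<close> possibly large. The local functions are then glued
  (\<open>global_regularity\<close>).

  Such a loss would be fatal for Gevrey classes. It is harmless here: the condition
  \<open>\<omega>(t\<^sup>2) = O(\<omega>(H t))\<close> makes \<open>\<omega>\<close> grow so slowly that its Young conjugate dominates every multiple of
  \<open>l log l\<close>, and that multiplying \<open>l\<close> by a constant amounts to multiplying \<open>h\<close> by a constant
  (\<open>young_conj_absorb\<close>). Since the factor \<open>\<kappa>\<close> by which \<open>h\<close> changes does not depend on \<open>h\<close>, the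
  Roumieu class (some \<open>h\<close>) and the Beurling class (every \<open>h\<close>) are treated by the same estimates.\<close>

section \<open>Iterated partial derivatives\<close>

text \<open>Iterated derivatives are indexed by lists of directions instead of multi-indices: the Leibniz rule and all
  inductions on the order then become list inductions, and \<open>length is\<close> is the order of the derivative.
  Lists and multi-indices give the same bounds because mixed derivatives commute.\<close>

abbreviation partials :: "'n::finite list \<Rightarrow> (real ^ 'n \<Rightarrow> complex) \<Rightarrow> real ^ 'n \<Rightarrow> complex" where
  "partials is f \<equiv> foldr partial is f"

lemma has_derivative_partial:
  assumes "(f has_derivative f') (at x)"
  shows "partial i f x = f' (axis i 1)"
    and "((\<lambda>t. f (x + t *\<^sub>R axis i 1)) has_vector_derivative f' (axis i 1)) (at 0)"
proof -
  have "(f has_derivative f') (at (x + 0 *\<^sub>R axis i 1))" using assms by simp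
  moreover have "((\<lambda>t. x + t *\<^sub>R axis i 1) has_derivative (\<lambda>t. t *\<^sub>R axis i 1)) (at (0::real))"
    by (auto intro!: derivative_eq_intros)
  ultimately have "((\<lambda>t. f (x + t *\<^sub>R axis i 1)) has_derivative (\<lambda>t. f' (t *\<^sub>R axis i 1))) (at 0)"
    by (rule has_derivative_compose[rotated])
  moreover have "(\<lambda>t. f' (t *\<^sub>R axis i 1)) = (\<lambda>t. t *\<^sub>R f' (axis i 1))"
    using has_derivative_bounded_linear[OF assms] by (simp add: bounded_linear.linear linear_simps(5))
  ultimately show "((\<lambda>t. f (x + t *\<^sub>R axis i 1)) has_vector_derivative f' (axis i 1)) (at 0)"
    by (simp add: has_vector_derivative_def)
  then show "partial i f x = f' (axis i 1)"
    unfolding partial_def by (rule vector_derivative_at)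
qed

lemma partial_cong_open:
  assumes "open U" "x \<in> U" "\<And>y. y \<in> U \<Longrightarrow> f y = g y"
  shows "partial i f x = partial i g x"
proof -
  have "open ((\<lambda>t::real. x + t *\<^sub>R axis i 1) -` U)"
    by (intro open_vimage assms continuous_intros)
  moreover have "0 \<in> (\<lambda>t::real. x + t *\<^sub>R axis i 1) -` U" using assms by simp
  ultimately have "((\<lambda>t. f (x + t *\<^sub>R axis i 1)) has_vector_derivative D) (at 0) \<longleftrightarrow>
      ((\<lambda>t. g (x + t *\<^sub>R axis i 1)) has_vector_derivative D) (at 0)" for D
    using assms(3) by (auto elim!: has_vector_derivative_transform_within_open)
  then show ?thesis unfolding partial_def vector_derivative_def by simp
qed

lemma partials_cong_open:
  assumes "open U" "\<And>y. y \<in> U \<Longrightarrow> f y = g y" "x \<in> U"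
  shows "partials is f x = partials is g x"
  using assms(3)
proof (induction "is" arbitrary: x)
  case (Cons i "is")
  then show ?case by (auto intro: partial_cong_open[OF assms(1)])
qed (use assms in auto)

lemma differentiable_cong_open:
  assumes "open U" "\<And>y. y \<in> U \<Longrightarrow> f y = g y" "x \<in> U" "f differentiable (at x)"
  shows "g differentiable (at x)"
proof -
  obtain f' where "(f has_derivative f') (at x)" using assms(4) by (auto simp: differentiable_def)
  then have "(g has_derivative f') (at x)"
    by (rule has_derivative_transform_within_open[of f f' x UNIV U g]) (use assms in auto)
  then show ?thesis by (auto simp: differentiable_def)
qed

text \<open>Smoothness itself offers nothing to induct on; differentiability up to a finite order does, and smoothness
  is its conjunction over all orders.\<close>

definition diff_order :: "nat \<Rightarrow> (real ^ 'n::finite) set \<Rightarrow> (real ^ 'n \<Rightarrow> complex) \<Rightarrow> bool" where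
  "diff_order n U f \<longleftrightarrow> (\<forall>is. length is \<le> n \<longrightarrow> (\<forall>x\<in>U. partials is f differentiable (at x)))"

lemma smooth_on_iff_diff_order: "smooth_on U f \<longleftrightarrow> (\<forall>n. diff_order n U f)"
  by (auto simp: smooth_on_def diff_order_def)

lemma diff_order_0: "diff_order 0 U f \<longleftrightarrow> (\<forall>x\<in>U. f differentiable (at x))"
  by (auto simp: diff_order_def)

lemma diff_order_mono: "diff_order n U f \<Longrightarrow> m \<le> n \<Longrightarrow> diff_order m U f"
  by (auto simp: diff_order_def)

lemma diff_order_Suc:
  "diff_order (Suc n) U f \<longleftrightarrow> (\<forall>x\<in>U. f differentiable (at x)) \<and> (\<forall>i. diff_order n U (partial i f))"
proof safe
  fix x assume "diff_order (Suc n) U f" "x \<in> U"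
  then show "f differentiable (at x)" by (auto simp: diff_order_def dest!: spec[of _ "[]"])
next
  fix i assume a: "diff_order (Suc n) U f"
  show "diff_order n U (partial i f)"
    unfolding diff_order_def
  proof safe
    fix "is" x assume "length (is::'a list) \<le> n" "x \<in> U"
    then show "partials is (partial i f) differentiable (at x)"
      using a unfolding diff_order_def by (auto dest!: spec[of _ "is @ [i]"])
  qed
next
  assume a: "\<forall>x\<in>U. f differentiable (at x)" "\<forall>i. diff_order n U (partial i f)"
  show "diff_order (Suc n) U f"
    unfolding diff_order_def
  proof safe
    fix "is" x assume *: "length (is::'a list) \<le> Suc n" "x \<in> U"
    show "partials is f differentiable (at x)"
    proof (cases "is" rule: rev_cases)
      case Nil then show ?thesis using a * by simp
    next
      case (snoc js j) then show ?thesis using a * by (auto simp: diff_order_def)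
    qed
  qed
qed

lemma smooth_on_rec:
  "smooth_on U f \<longleftrightarrow> (\<forall>x\<in>U. f differentiable (at x)) \<and> (\<forall>i. smooth_on U (partial i f))"
proof
  assume "smooth_on U f"
  then have "diff_order (Suc n) U f" for n by (simp add: smooth_on_iff_diff_order)
  then show "(\<forall>x\<in>U. f differentiable (at x)) \<and> (\<forall>i. smooth_on U (partial i f))"
    unfolding diff_order_Suc smooth_on_iff_diff_order by blast
next
  assume "(\<forall>x\<in>U. f differentiable (at x)) \<and> (\<forall>i. smooth_on U (partial i f))"
  then have "diff_order (Suc n) U f" for n by (simp add: diff_order_Suc smooth_on_iff_diff_order)
  then show "smooth_on U f"
    unfolding smooth_on_iff_diff_order using diff_order_mono le_SucI by blast
qed

lemma smooth_on_imp_differentiable: "smooth_on U f \<Longrightarrow> x \<in> U \<Longrightarrow> f differentiable (at x)"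
  by (simp add: smooth_on_rec[of U f])

lemma smooth_on_partial: "smooth_on U f \<Longrightarrow> smooth_on U (partial i f)"
  by (simp add: smooth_on_rec[of U f])

lemma smooth_on_partials: "smooth_on U f \<Longrightarrow> smooth_on U (partials is f)"
  by (induction "is") (auto intro: smooth_on_partial)

lemma smooth_on_subset: "smooth_on U f \<Longrightarrow> V \<subseteq> U \<Longrightarrow> smooth_on V f"
  by (auto simp: smooth_on_def)

lemma smooth_on_Un: "smooth_on U f \<Longrightarrow> smooth_on V f \<Longrightarrow> smooth_on (U \<union> V) f"
  by (auto simp: smooth_on_def)

lemma smooth_on_continuous_on: "smooth_on U f \<Longrightarrow> continuous_on U f"
  by (meson continuous_at_imp_continuous_on differentiable_imp_continuous_within smooth_on_imp_differentiable)

lemma diff_order_cong: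
  assumes "open U" "\<And>y. y \<in> U \<Longrightarrow> f y = g y" "diff_order n U f"
  shows "diff_order n U g"
  unfolding diff_order_def
proof safe
  fix "is" x assume "length (is::'a list) \<le> n" "x \<in> U"
  then show "partials is g differentiable (at x)"
    using assms(3) partials_cong_open[of U f g _ "is"] differentiable_cong_open[of U "partials is f" "partials is g" x]
      assms(1,2) unfolding diff_order_def by simp
qed

lemma smooth_on_cong:
  assumes "open U" "\<And>y. y \<in> U \<Longrightarrow> f y = g y" "smooth_on U f"
  shows "smooth_on U g"
  unfolding smooth_on_iff_diff_order
proof
  fix n
  have "diff_order n U f" using assms(3) by (simp add: smooth_on_iff_diff_order)
  then show "diff_order n U g" using assms(1,2) diff_order_cong[of U f g n] by simp
qed

text \<open>For functions whose derivatives are explicit, such as power series and monomials, it suffices to exhibit a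
  family closed under differentiation.\<close>

lemma smooth_on_coinduct:
  assumes "open U" "X f"
    and step: "\<And>f. X f \<Longrightarrow> (\<forall>x\<in>U. f differentiable (at x)) \<and> (\<forall>i. \<exists>g. X g \<and> (\<forall>x\<in>U. partial i f x = g x))"
  shows "smooth_on U f"
proof -
  have "X f \<Longrightarrow> diff_order n U f" for n f
  proof (induction n arbitrary: f)
    case 0 then show ?case using step by (auto simp: diff_order_0)
  next
    case (Suc n)
    have "diff_order n U (partial i f)" for i
    proof -
      obtain g where g: "X g" "\<forall>x\<in>U. partial i f x = g x" using step[OF Suc.prems] by blast
      show ?thesis
        by (rule diff_order_cong[of U g "partial i f"]) (use assms(1) g Suc.IH in auto)
    qed
    then show ?case using step[OF Suc.prems] by (auto simp: diff_order_Suc)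
  qed
  then show ?thesis using assms(2) smooth_on_iff_diff_order by blast
qed

lemma partial_const [simp]: "partial i (\<lambda>x. c) = (\<lambda>x. 0)"
  by (rule ext) (use has_derivative_partial(1)[of "\<lambda>x. c" "\<lambda>x. 0"] in simp)

lemma partials_zero [simp]: "partials is (\<lambda>x. 0) = (\<lambda>x. 0)"
  by (induction "is") auto

lemma partials_const: "partials is (\<lambda>x. c) = (if is = [] then (\<lambda>x. c) else (\<lambda>x. 0))"
  by (induction "is") auto

lemma smooth_on_const [intro]: "smooth_on U (\<lambda>x. c)"
  by (auto simp: smooth_on_def partials_const)

lemma partial_add:
  assumes "f differentiable (at x)" "g differentiable (at x)"
  shows "partial i (\<lambda>x. f x + g x) x = partial i f x + partial i g x"
proof -
  obtain f' g' where "(f has_derivative f') (at x)" "(g has_derivative g') (at x)"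
    using assms by (auto simp: differentiable_def)
  then show ?thesis
    using has_derivative_partial(1)[OF has_derivative_add, of f f' x g g' i]
    by (simp add: has_derivative_partial(1))
qed

lemma partial_mult:
  assumes "f differentiable (at x)" "g differentiable (at x)"
  shows "partial i (\<lambda>x. f x * g x) x = partial i f x * g x + f x * partial i g x"
proof -
  obtain f' g' where *: "(f has_derivative f') (at x)" "(g has_derivative g') (at x)"
    using assms by (auto simp: differentiable_def)
  show ?thesis
    using has_derivative_partial(1)[OF has_derivative_mult[OF *], of i] 
      has_derivative_partial(1)[OF *(1), of i] has_derivative_partial(1)[OF *(2), of i] by simp
qed

lemma partial_cmult:
  assumes "f differentiable (at x)"
  shows "partial i (\<lambda>x. c * f x) x = c * partial i f x"
  using partial_mult[of "\<lambda>x. c" x f i] assms by simp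

lemma partial_inverse:
  assumes "f differentiable (at x)" "f x \<noteq> 0"
  shows "partial i (\<lambda>x. inverse (f x)) x = - 1 * (partial i f x * (inverse (f x) * inverse (f x)))"
proof -
  obtain f' where *: "(f has_derivative f') (at x)"
    using assms by (auto simp: differentiable_def)
  show ?thesis
    using has_derivative_partial(1)[OF Deriv.has_derivative_inverse[OF assms(2) *], of i] 
      has_derivative_partial(1)[OF *(1), of i] by simp
qed

lemma diff_order_add:
  assumes "open U" "diff_order n U f" "diff_order n U g"
  shows "diff_order n U (\<lambda>x. f x + g x)"
  using assms(2,3)
proof (induction n arbitrary: f g)
  case 0 then show ?case by (auto simp: diff_order_0)
next
  case (Suc n)
  have "diff_order n U (partial i (\<lambda>x. f x + g x))" for i
  proof (rule diff_order_cong[OF assms(1)])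
    show "diff_order n U (\<lambda>x. partial i f x + partial i g x)"
      by (rule Suc.IH) (use Suc.prems in \<open>auto simp: diff_order_Suc\<close>)
  qed (use Suc.prems in \<open>simp add: diff_order_Suc partial_add\<close>)
  then show ?case using Suc.prems by (auto simp: diff_order_Suc)
qed

lemma diff_order_mult:
  assumes "open U" "diff_order n U f" "diff_order n U g"
  shows "diff_order n U (\<lambda>x. f x * g x)"
  using assms(2,3)
proof (induction n arbitrary: f g)
  case 0 then show ?case by (auto simp: diff_order_0)
next
  case (Suc n)
  have "diff_order n U (partial i (\<lambda>x. f x * g x))" for i
  proof (rule diff_order_cong[OF assms(1)])
    show "diff_order n U (\<lambda>x. partial i f x * g x + f x * partial i g x)"
      by (intro diff_order_add[OF assms(1)] Suc.IH)
        (use Suc.prems diff_order_mono[of "Suc n" U _ n] in \<open>simp_all add: diff_order_Suc\<close>)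
  qed (use Suc.prems in \<open>simp add: diff_order_Suc partial_mult\<close>)
  then show ?case using Suc.prems by (auto simp: diff_order_Suc)
qed

text \<open>The derivative of \<open>1 / f\<close> involves \<open>1 / f\<close> only to the same order that the
  induction already controls.\<close>

lemma diff_order_inverse:
  assumes "open U" "diff_order n U f" "\<And>x. x \<in> U \<Longrightarrow> f x \<noteq> 0"
  shows "diff_order n U (\<lambda>x. inverse (f x))"
  using assms(2)
proof (induction n)
  case 0 then show ?case using assms(3) by (auto simp: diff_order_0)
next
  case (Suc n)
  have m1: "diff_order n U (\<lambda>x. -1)" using smooth_on_const[of U "-1"] by (simp add: smooth_on_iff_diff_order)
  have i: "diff_order n U (\<lambda>x. inverse (f x))" using Suc diff_order_mono le_SucI by blast
  have "diff_order n U (partial i (\<lambda>x. inverse (f x)))" for i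
  proof (rule diff_order_cong[OF assms(1)])
    show "diff_order n U (\<lambda>x. - 1 * (partial i f x * (inverse (f x) * inverse (f x))))"
      by (intro diff_order_mult[OF assms(1)] i m1) (use Suc.prems in \<open>simp add: diff_order_Suc\<close>)
    show "- 1 * (partial i f y * (inverse (f y) * inverse (f y))) = partial i (\<lambda>x. inverse (f x)) y"
      if "y \<in> U" for y
      by (rule partial_inverse[symmetric]) (use that Suc.prems assms(3) in \<open>auto simp: diff_order_Suc\<close>)
  qed
  then show ?case using Suc.prems assms(3) by (auto simp: diff_order_Suc)
qed

lemma smooth_on_add: "open U \<Longrightarrow> smooth_on U f \<Longrightarrow> smooth_on U g \<Longrightarrow> smooth_on U (\<lambda>x. f x + g x)"
  by (simp add: smooth_on_iff_diff_order diff_order_add)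

lemma smooth_on_mult: "open U \<Longrightarrow> smooth_on U f \<Longrightarrow> smooth_on U g \<Longrightarrow> smooth_on U (\<lambda>x. f x * g x)"
  by (simp add: smooth_on_iff_diff_order diff_order_mult)

lemma smooth_on_cmult: "open U \<Longrightarrow> smooth_on U f \<Longrightarrow> smooth_on U (\<lambda>x. c * f x)"
  by (intro smooth_on_mult smooth_on_const)

lemma smooth_on_diff: "open U \<Longrightarrow> smooth_on U f \<Longrightarrow> smooth_on U g \<Longrightarrow> smooth_on U (\<lambda>x. f x - g x)"
  using smooth_on_add[OF _ _ smooth_on_cmult[of U g "-1"]] by simp

lemma smooth_on_inverse: 
  "open U \<Longrightarrow> smooth_on U f \<Longrightarrow> (\<And>x. x \<in> U \<Longrightarrow> f x \<noteq> 0) \<Longrightarrow> smooth_on U (\<lambda>x. inverse (f x))"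
  by (simp add: smooth_on_iff_diff_order diff_order_inverse)

lemma smooth_on_divide: 
  "open U \<Longrightarrow> smooth_on U f \<Longrightarrow> smooth_on U g \<Longrightarrow> (\<And>x. x \<in> U \<Longrightarrow> g x \<noteq> 0) \<Longrightarrow> smooth_on U (\<lambda>x. f x / g x)"
  by (simp add: divide_inverse smooth_on_inverse smooth_on_mult)

lemma smooth_on_sum:
  "open U \<Longrightarrow> (\<And>j. j \<in> A \<Longrightarrow> smooth_on U (f j)) \<Longrightarrow> smooth_on U (\<lambda>x. \<Sum>j\<in>A. f j x)"
  by (induction A rule: infinite_finite_induct) (auto intro: smooth_on_add)

lemma partials_add:
  assumes "open U" "smooth_on U f" "smooth_on U g" "x \<in> U"
  shows "partials is (\<lambda>x. f x + g x) x = partials is f x + partials is g x"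
  using assms(4)
proof (induction "is" arbitrary: x)
  case (Cons i "is")
  have "partials (i # is) (\<lambda>x. f x + g x) x = partial i (\<lambda>x. partials is f x + partials is g x) x"
    by (simp, rule partial_cong_open[OF assms(1)]) (use Cons in auto)
  also have "\<dots> = partials (i # is) f x + partials (i # is) g x"
    using smooth_on_imp_differentiable[OF smooth_on_partials[OF assms(2)] Cons.prems, of "is"]
      smooth_on_imp_differentiable[OF smooth_on_partials[OF assms(3)] Cons.prems, of "is"]
    by (simp add: partial_add)
  finally show ?case .
qed auto

lemma partials_cmult:
  assumes "open U" "smooth_on U f" "x \<in> U"
  shows "partials is (\<lambda>x. c * f x) x = c * partials is f x"
  using assms(3)
proof (induction "is" arbitrary: x)
  case (Cons i "is")
  have "partials (i # is) (\<lambda>x. c * f x) x = partial i (\<lambda>x. c * partials is f x) x"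
    by (simp, rule partial_cong_open[OF assms(1)]) (use Cons in auto)
  also have "\<dots> = c * partials (i # is) f x"
    using smooth_on_imp_differentiable[OF smooth_on_partials[OF assms(2)] Cons.prems, of "is"]
    by (simp add: partial_cmult)
  finally show ?case .
qed auto

lemma partials_sum:
  assumes "open U" "\<And>j. j \<in> A \<Longrightarrow> smooth_on U (f j)" "x \<in> U"
  shows "partials is (\<lambda>x. \<Sum>j\<in>A. f j x) x = (\<Sum>j\<in>A. partials is (f j) x)"
  using assms(2)
proof (induction A rule: infinite_finite_induct)
  case (insert j A)
  then show ?case using partials_add[OF assms(1) _ smooth_on_sum[OF assms(1)] assms(3), of "f j" A f]
    by auto
qed auto

subsection \<open>Symmetry of mixed derivatives\<close>

text \<open>The mixed second difference, differentiated along direction \<open>j\<close>, is a difference of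
  \<open>partial j f\<close> in direction \<open>i\<close>, so the mean value inequality bounds it by the first-order
  expansion of \<open>partial j f\<close> at \<open>x\<close>.\<close>

lemma second_difference_bound:
  assumes U: "open U" "x \<in> U" and f: "\<And>y. y \<in> U \<Longrightarrow> f differentiable (at y)"
    and fj: "partial j f differentiable (at x)" and e: "e > 0"
  shows "\<exists>d>0. \<forall>h. 0 < h \<and> h < d \<longrightarrow>
    norm ((f (x + h *\<^sub>R axis i 1 + h *\<^sub>R axis j 1) - f (x + h *\<^sub>R axis j 1))
       - (f (x + h *\<^sub>R axis i 1) - f x) - h^2 *\<^sub>R partial i (partial j f) x) \<le> e * h^2"
proof -
  obtain L where L: "(partial j f has_derivative L) (at x)" using fj by (auto simp: differentiable_def)
  interpret L: bounded_linear L using L by (rule has_derivative_bounded_linear)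
  obtain r where r: "r > 0" "ball x r \<subseteq> U" using U openE by blast
  obtain d0 where d0: "d0 > 0" "\<And>y. norm (y - x) < d0 \<Longrightarrow> norm (partial j f y - partial j f x - L (y - x)) \<le> (e/3) * norm (y - x)"
  proof -
    have "e / 3 > 0" using e by simp
    then show ?thesis using L that unfolding has_derivative_at_alt by blast
  qed
  have nax: "norm (axis k (1::real) :: real^'a) = 1" for k by simp
  show ?thesis
  proof (intro exI[of _ "min (d0/2) (r/2)"] conjI allI impI)
    show "0 < min (d0/2) (r/2)" using d0 r by auto
    fix h assume h: "0 < h \<and> h < min (d0/2) (r/2)"
    define ei ej :: "real^'a" where "ei = axis i 1" and "ej = axis j 1"
    define c where "c = partial i (partial j f) x"
    have c: "c = L ei" unfolding c_def ei_def by (rule has_derivative_partial(1)[OF L])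
    \<comment> \<open>By the mean value inequality in \<open>t\<close>, the difference \<open>\<phi> h - \<phi>
      0\<close> is controlled by \<open>\<phi>'\<close>.\<close>
    define \<phi> where "\<phi> t = f (x + h *\<^sub>R ei + t *\<^sub>R ej) - f (x + t *\<^sub>R ej) - (t * h) *\<^sub>R c" for t
    define \<phi>' where "\<phi>' t = partial j f (x + h *\<^sub>R ei + t *\<^sub>R ej) - partial j f (x + t *\<^sub>R ej) - h *\<^sub>R c" for t
    have inU: "x + h *\<^sub>R ei + t *\<^sub>R ej \<in> U" "x + t *\<^sub>R ej \<in> U" 
       "norm (h *\<^sub>R ei + t *\<^sub>R ej) \<le> 2 * h" "norm (t *\<^sub>R ej) \<le> h" if "t \<in> {0..h}" for t
    proof -
      show 1: "norm (h *\<^sub>R ei + t *\<^sub>R ej) \<le> 2 * h"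
        using norm_triangle_ineq[of "h *\<^sub>R ei" "t *\<^sub>R ej"] that h by (simp add: ei_def ej_def)
      show 2: "norm (t *\<^sub>R ej) \<le> h" using that by (simp add: ej_def)
      have "dist x (x + (h *\<^sub>R ei + t *\<^sub>R ej)) < r" "dist x (x + t *\<^sub>R ej) < r"
        using 1 2 h norm_minus_cancel[of "h *\<^sub>R ei + t *\<^sub>R ej"] by (auto simp: dist_norm)
      then show "x + h *\<^sub>R ei + t *\<^sub>R ej \<in> U" "x + t *\<^sub>R ej \<in> U" using r by (auto simp: add.assoc)
    qed
    have der: "((\<lambda>t. f (y + t *\<^sub>R ej)) has_vector_derivative partial j f (y + t *\<^sub>R ej)) (at t)"
      if yU: "y + t *\<^sub>R ej \<in> U" for y t
    proof -
      obtain f' where f': "(f has_derivative f') (at (y + t *\<^sub>R ej))" 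
        using f[OF yU] by (auto simp: differentiable_def)
      have p: "f' (s *\<^sub>R ej) = s *\<^sub>R partial j f (y + t *\<^sub>R ej)" for s
        using has_derivative_partial(1)[OF f', of j] has_derivative_bounded_linear[OF f']
        by (simp add: ej_def bounded_linear.linear linear_simps(5))
      have "((\<lambda>t. y + t *\<^sub>R ej) has_derivative (\<lambda>s. s *\<^sub>R ej)) (at t)"
        by (auto intro!: derivative_eq_intros)
      from has_derivative_compose[OF this f'] show ?thesis
        unfolding has_vector_derivative_def by (simp add: p)
    qed
    have tmul: "((\<lambda>t. (t * h) *\<^sub>R c) has_vector_derivative h *\<^sub>R c) (at t)" for t
      unfolding has_vector_derivative_def by (auto intro!: derivative_eq_intros)
    have 1: "(\<phi> has_vector_derivative \<phi>' t) (at t within {0..h})" if "t \<in> {0..h}" for t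
      unfolding \<phi>_def \<phi>'_def
      by (rule has_vector_derivative_at_within)
        (intro has_vector_derivative_diff der inU[OF that] tmul)
    have 2: "norm (\<phi>' t) \<le> e * h" if "t \<in> {0..h}" for t
    proof -
      have a: "norm (partial j f (x + (h *\<^sub>R ei + t *\<^sub>R ej)) - partial j f x - L (h *\<^sub>R ei + t *\<^sub>R ej)) \<le> (e/3) * norm (h *\<^sub>R ei + t *\<^sub>R ej)"
        using d0(2)[of "x + (h *\<^sub>R ei + t *\<^sub>R ej)"] inU[OF that] h by simp
      have b: "norm (partial j f (x + t *\<^sub>R ej) - partial j f x - L (t *\<^sub>R ej)) \<le> (e/3) * norm (t *\<^sub>R ej)"
        using d0(2)[of "x + t *\<^sub>R ej"] inU[OF that] h by simp
      have "\<phi>' t = (partial j f (x + (h *\<^sub>R ei + t *\<^sub>R ej)) - partial j f x - L (h *\<^sub>R ei + t *\<^sub>R ej)) -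
          (partial j f (x + t *\<^sub>R ej) - partial j f x - L (t *\<^sub>R ej))"
        unfolding \<phi>'_def c by (simp add: L.add L.scaleR algebra_simps)
      then have "norm (\<phi>' t) \<le> (e/3) * norm (h *\<^sub>R ei + t *\<^sub>R ej) + (e/3) * norm (t *\<^sub>R ej)"
        using order_trans[OF norm_triangle_ineq4 add_mono[OF a b]] by simp
      also have "\<dots> \<le> (e/3) * (2*h) + (e/3) * h" 
        by (intro add_mono mult_left_mono inU that) (use e in auto)
      finally show ?thesis by (simp add: field_simps)
    qed
    have "norm (\<phi> h - \<phi> 0) \<le> e * h * norm (h - 0)"
    proof (rule differentiable_bound[where f = \<phi> and f' = "\<lambda>t s. s *\<^sub>R \<phi>' t" and S = "{0..h}"])
      show "(\<phi> has_derivative (\<lambda>s. s *\<^sub>R \<phi>' t)) (at t within {0..h})" if "t \<in> {0..h}" for t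
        using 1[OF that] by (simp add: has_vector_derivative_def)
      show "onorm (\<lambda>s. s *\<^sub>R \<phi>' t) \<le> e * h" if "t \<in> {0..h}" for t
      proof (rule onorm_le)
        fix s :: real
        have "\<bar>s\<bar> * norm (\<phi>' t) \<le> \<bar>s\<bar> * (e * h)" by (intro mult_left_mono 2 that) auto
        then show "norm (s *\<^sub>R \<phi>' t) \<le> e * h * norm s" by (simp add: mult.commute)
      qed
    qed (use h in auto)
    then have "norm (\<phi> h - \<phi> 0) \<le> e * h^2" using h by (simp add: power2_eq_square)
    moreover have "\<phi> h - \<phi> 0 = (f (x + h *\<^sub>R ei + h *\<^sub>R ej) - f (x + h *\<^sub>R ej)) - (f (x + h *\<^sub>R ei) - f x) - h^2 *\<^sub>R c"
      unfolding \<phi>_def by (simp add: power2_eq_square)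
    ultimately show "norm ((f (x + h *\<^sub>R axis i 1 + h *\<^sub>R axis j 1) - f (x + h *\<^sub>R axis j 1))
       - (f (x + h *\<^sub>R axis i 1) - f x) - h^2 *\<^sub>R partial i (partial j f) x) \<le> e * h^2"
      unfolding c_def ei_def ej_def by metis
  qed
qed

text \<open>The mixed second difference is symmetric in the two directions; divided by the square of the step it
  converges to both mixed derivatives.\<close>

lemma partial_commute:
  assumes U: "open U" "x \<in> U" and f: "smooth_on U f"
  shows "partial i (partial j f) x = partial j (partial i f) x"
proof (rule ccontr)
  let ?c = "partial i (partial j f) x" and ?c' = "partial j (partial i f) x"
  assume ne: "?c \<noteq> ?c'"
  define e where "e = norm (?c - ?c') / 3"
  have e: "e > 0" using ne by (simp add: e_def)
  have df: "\<And>y. y \<in> U \<Longrightarrow> f differentiable (at y)" and dp: "\<And>k. partial k f differentiable (at x)"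
    using f U smooth_on_imp_differentiable smooth_on_partial by blast+
  obtain d1 where d1: "d1 > 0" "\<And>h. 0 < h \<Longrightarrow> h < d1 \<Longrightarrow>
    norm ((f (x + h *\<^sub>R axis i 1 + h *\<^sub>R axis j 1) - f (x + h *\<^sub>R axis j 1))
       - (f (x + h *\<^sub>R axis i 1) - f x) - h^2 *\<^sub>R ?c) \<le> e * h^2"
    using second_difference_bound[OF U df dp e, of i j] by blast
  obtain d2 where d2: "d2 > 0" "\<And>h. 0 < h \<Longrightarrow> h < d2 \<Longrightarrow>
    norm ((f (x + h *\<^sub>R axis j 1 + h *\<^sub>R axis i 1) - f (x + h *\<^sub>R axis i 1))
       - (f (x + h *\<^sub>R axis j 1) - f x) - h^2 *\<^sub>R ?c') \<le> e * h^2"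
    using second_difference_bound[OF U df dp e, of j i] by blast
  define h where "h = min d1 d2 / 2"
  have h: "0 < h" "h < d1" "h < d2" using d1 d2 by (auto simp: h_def)
  define a where "a = f (x + h *\<^sub>R axis i 1 + h *\<^sub>R axis j 1) - f (x + h *\<^sub>R axis j 1)
       - (f (x + h *\<^sub>R axis i 1) - f x)"
  have 1: "norm (a - h^2 *\<^sub>R ?c) \<le> e * h^2" using d1(2) h by (simp add: a_def)
  have "x + h *\<^sub>R axis j 1 + h *\<^sub>R axis i 1 = x + h *\<^sub>R axis i 1 + h *\<^sub>R axis j 1" by simp
  then have 2: "norm (a - h^2 *\<^sub>R ?c') \<le> e * h^2" using d2(2)[of h] h by (simp add: a_def algebra_simps)
  have "norm (h^2 *\<^sub>R (?c - ?c')) = norm ((a - h^2 *\<^sub>R ?c') - (a - h^2 *\<^sub>R ?c))"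
    by (simp add: scaleR_diff_right)
  also have "\<dots> \<le> 2 * e * h^2" using norm_triangle_ineq4[of "a - h^2 *\<^sub>R ?c'" "a - h^2 *\<^sub>R ?c"] 1 2 by linarith
  finally have "h^2 * (3 * e) \<le> h^2 * (2 * e)" by (simp add: e_def mult.commute)
  then show False using e h by simp
qed

lemma partials_mset_cong:
  assumes U: "open U" "x \<in> U" and f: "smooth_on U f" and "mset is = mset js"
  shows "partials is f x = partials js f x"
  using assms(2,4)
proof (induction "is" arbitrary: js x)
  case (Cons i "is")
  then have "i \<in> set js" using mset_eq_setD by fastforce
  then obtain l r where js: "js = l @ i # r" by (meson split_list)
  have m: "mset is = mset (l @ r)" using Cons.prems js by simp
  have "partials (i # is) f x = partials (i # l @ r) f x"
    using Cons.IH[OF _ m] by (simp, intro partial_cong_open[OF U(1) Cons.prems(1)]) auto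
  also have "\<dots> = partials js f x"
    unfolding js using Cons.prems(1)
  proof (induction l arbitrary: x)
    case (Cons k l)
    have "partials (i # (k # l) @ r) f x = partials (k # i # l @ r) f x"
      using partial_commute[OF U(1) Cons.prems smooth_on_partials[OF f], of i k "l @ r"] by simp
    also have "\<dots> = partials ((k # l) @ i # r) f x"
      using Cons.IH by (simp, intro partial_cong_open[OF U(1) Cons.prems(1)]) auto
    finally show ?case .
  qed auto
  finally show ?case .
qed auto

section \<open>Leibniz estimates against analytic factors\<close>

text \<open>Pascal's rule in the form in which one more differentiation turns a binomial convolution of order
  \<open>n\<close> into one of order \<open>n + 1\<close>.\<close>

lemma binomial_shift_sum:
  fixes F G :: "nat \<Rightarrow> 'a::comm_ring_1"
  shows "(\<Sum>l\<le>n. of_nat (n choose l) * F (Suc l) * G (n - l)) + (\<Sum>l\<le>n. of_nat (n choose l) * F l * G (Suc n - l))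
       = (\<Sum>l\<le>Suc n. of_nat (Suc n choose l) * F l * G (Suc n - l))"
proof -
  have "(\<Sum>l\<le>Suc n. of_nat (Suc n choose l) * F l * G (Suc n - l)) =
     F 0 * G (Suc n) + (\<Sum>l\<le>n. of_nat (Suc n choose Suc l) * F (Suc l) * G (n - l))"
    by (subst sum.atMost_Suc_shift) simp
  also have "(\<Sum>l\<le>n. of_nat (Suc n choose Suc l) * F (Suc l) * G (n - l)) =
     (\<Sum>l\<le>n. of_nat (n choose l) * F (Suc l) * G (n - l)) + (\<Sum>l\<le>n. of_nat (n choose Suc l) * F (Suc l) * G (n - l))"
    by (simp add: distrib_right sum.distrib)
  also have "F 0 * G (Suc n) + ((\<Sum>l\<le>n. of_nat (n choose l) * F (Suc l) * G (n - l)) + (\<Sum>l\<le>n. of_nat (n choose Suc l) * F (Suc l) * G (n - l)))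
    = (\<Sum>l\<le>n. of_nat (n choose l) * F (Suc l) * G (n - l)) + (\<Sum>l\<le>Suc n. of_nat (n choose l) * F l * G (Suc n - l))"
    using sum.atMost_Suc_shift[of "\<lambda>l. of_nat (n choose l) * F l * G (Suc n - l)" n] by simp
  also have "(\<Sum>l\<le>Suc n. of_nat (n choose l) * F l * G (Suc n - l)) = (\<Sum>l\<le>n. of_nat (n choose l) * F l * G (Suc n - l))"
    by (simp add: binomial_eq_0)
  finally show ?thesis by simp
qed

lemma binomial_shift_sum_pos:
  fixes F G :: "nat \<Rightarrow> real"
  shows "(\<Sum>l\<le>n. real (n choose l) * F (Suc l) * G (n - l)) + (\<Sum>l=1..n. real (n choose l) * F l * G (Suc n - l))
       = (\<Sum>l=1..Suc n. real (Suc n choose l) * F l * G (Suc n - l))"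
proof -
  have *: "sum f {..n} = f 0 + sum f {1..n}" for f :: "nat \<Rightarrow> real" and n
    by (simp add: atMost_atLeast0 sum.atLeast_Suc_atMost)
  show ?thesis using binomial_shift_sum[of n F G] unfolding *[of _ "Suc n"] *[of "\<lambda>l. real (n choose l) * F l * G (Suc n - l)"]
    by simp
qed

lemma partials_mult_bound:
  assumes U: "open U" "x \<in> U" and fg: "smooth_on U f" "smooth_on U g"
    and F: "\<And>js. length js \<le> length is \<Longrightarrow> norm (partials js f x) \<le> F (length js)"
    and G: "\<And>js. length js \<le> length is \<Longrightarrow> norm (partials js g x) \<le> G (length js)"
  shows "norm (partials is (\<lambda>y. f y * g y) x)
    \<le> (\<Sum>l\<le>length is. real (length is choose l) * F l * G (length is - l))"
  using fg F G
proof (induction "is" arbitrary: f g F G rule: rev_induct)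
  case Nil
  have "norm (f x) * norm (g x) \<le> F 0 * G 0"
    using Nil(3)[of "[]"] Nil(4)[of "[]"] order_trans[OF norm_ge_zero, of "f x" "F 0"] by (intro mult_mono) auto
  then show ?case by (simp add: norm_mult)
next
  case (snoc i "is")
  let ?n = "length is"
  have s: "smooth_on U (partial i f)" "smooth_on U (partial i g)" 
    using snoc.prems smooth_on_partial by blast+
  have F': "norm (partials js (partial i f) x) \<le> F (Suc (length js))" if "length js \<le> ?n" for js
    using snoc.prems(3)[of "js @ [i]"] that by simp
  have G': "norm (partials js (partial i g) x) \<le> G (Suc (length js))" if "length js \<le> ?n" for js
    using snoc.prems(4)[of "js @ [i]"] that by simp
  have "partials (is @ [i]) (\<lambda>y. f y * g y) x = partials is (\<lambda>y. partial i f y * g y + f y * partial i g y) x"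
    using partials_cong_open[OF U(1) _ U(2), of "partial i (\<lambda>y. f y * g y)" "\<lambda>y. partial i f y * g y + f y * partial i g y" "is"]
      partial_mult smooth_on_imp_differentiable snoc.prems(1,2) by fastforce
  also have "\<dots> = partials is (\<lambda>y. partial i f y * g y) x + partials is (\<lambda>y. f y * partial i g y) x"
    by (intro partials_add[OF U(1)] smooth_on_mult[OF U(1)] s snoc.prems U)
  finally have "norm (partials (is @ [i]) (\<lambda>y. f y * g y) x) \<le>
     norm (partials is (\<lambda>y. partial i f y * g y) x) + norm (partials is (\<lambda>y. f y * partial i g y) x)"
    by (simp add: norm_triangle_ineq)
  also have "\<dots> \<le> (\<Sum>l\<le>?n. real (?n choose l) * F (Suc l) * G (?n - l)) + (\<Sum>l\<le>?n. real (?n choose l) * F l * G (Suc (?n - l)))"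
    using snoc.IH[OF s(1) snoc.prems(2), of "\<lambda>l. F (Suc l)" G] snoc.IH[OF snoc.prems(1) s(2), of F "\<lambda>l. G (Suc l)"]
      F' G' snoc.prems(3,4) by (intro add_mono) auto
  also have "(\<Sum>l\<le>?n. real (?n choose l) * F l * G (Suc (?n - l))) = (\<Sum>l\<le>?n. real (?n choose l) * F l * G (Suc ?n - l))"
    by (intro sum.cong) (auto simp: Suc_diff_le)
  finally show ?case using binomial_shift_sum[of ?n F G] by simp
qed

text \<open>Without the term in which all derivatives fall on \<open>g\<close>, only lower derivatives of
  \<open>g\<close> enter. This is what makes the quotient estimate below an induction.\<close>

lemma partials_mult_commutator_bound:
  assumes U: "open U" "x \<in> U" and fg: "smooth_on U f" "smooth_on U g"
    and F: "\<And>js. length js \<le> length is \<Longrightarrow> norm (partials js f x) \<le> F (length js)"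
    and G: "\<And>js. length js < length is \<Longrightarrow> norm (partials js g x) \<le> G (length js)"
  shows "norm (partials is (\<lambda>y. f y * g y) x - f x * partials is g x)
    \<le> (\<Sum>l=1..length is. real (length is choose l) * F l * G (length is - l))"
  using fg F G
proof (induction "is" arbitrary: f g F G rule: rev_induct)
  case Nil
  then show ?case by simp
next
  case (snoc i "is")
  let ?n = "length is"
  have s: "smooth_on U (partial i f)" "smooth_on U (partial i g)" 
    using snoc.prems smooth_on_partial by blast+
  have F': "norm (partials js (partial i f) x) \<le> F (Suc (length js))" if "length js \<le> ?n" for js
    using snoc.prems(3)[of "js @ [i]"] that by simp
  have G': "norm (partials js (partial i g) x) \<le> G (Suc (length js))" if "length js < ?n" for js
    using snoc.prems(4)[of "js @ [i]"] that by simp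
  have "partials (is @ [i]) (\<lambda>y. f y * g y) x = partials is (\<lambda>y. partial i f y * g y + f y * partial i g y) x"
    using partials_cong_open[OF U(1) _ U(2), of "partial i (\<lambda>y. f y * g y)" "\<lambda>y. partial i f y * g y + f y * partial i g y" "is"]
      partial_mult smooth_on_imp_differentiable snoc.prems(1,2) by fastforce
  also have "\<dots> = partials is (\<lambda>y. partial i f y * g y) x + partials is (\<lambda>y. f y * partial i g y) x"
    by (intro partials_add[OF U(1)] smooth_on_mult[OF U(1)] s snoc.prems U)
  finally have "norm (partials (is @ [i]) (\<lambda>y. f y * g y) x - f x * partials (is @ [i]) g x) \<le>
     norm (partials is (\<lambda>y. partial i f y * g y) x) + norm (partials is (\<lambda>y. f y * partial i g y) x - f x * partials is (partial i g) x)"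
    using norm_triangle_ineq[of "partials is (\<lambda>y. partial i f y * g y) x"] by (simp add: add_diff_eq[symmetric])
  also have "\<dots> \<le> (\<Sum>l\<le>?n. real (?n choose l) * F (Suc l) * G (?n - l)) + (\<Sum>l=1..?n. real (?n choose l) * F l * G (Suc (?n - l)))"
    using snoc.IH[OF snoc.prems(1) s(2), of F "\<lambda>l. G (Suc l)"] partials_mult_bound[OF U s(1) snoc.prems(2), of "is" "\<lambda>l. F (Suc l)" G]
      F' G' snoc.prems(3,4) by (intro add_mono) auto
  also have "(\<Sum>l=1..?n. real (?n choose l) * F l * G (Suc (?n - l))) = (\<Sum>l=1..?n. real (?n choose l) * F l * G (Suc ?n - l))"
    by (intro sum.cong) (auto simp: Suc_diff_le)
  finally show ?case using binomial_shift_sum_pos[of ?n F G] by simp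
qed

text \<open>Sequences that grow at least like \<open>R^n n!\<close> are stable under Leibniz sums: shifting
  \<open>l\<close> derivatives away from \<open>N\<close> gains the factor \<open>R^l l!\<close>, up to the binomial
  coefficient. The bounds \<open>R^n (n + k)!^2\<close>, and those multiplied by a monotone sequence, are of this
  kind.\<close>

lemma factorial_growth:
  fixes N :: "nat \<Rightarrow> real"
  assumes "\<And>n. N (Suc n) \<ge> R * real (Suc n) * N n" "R > 0" "l \<le> n" "\<And>n. N n \<ge> 0"
  shows "real (n choose l) * fact l * R ^ l * N (n - l) \<le> N n"
  using assms(3)
proof (induction l)
  case (Suc l)
  have "real (n choose Suc l) * fact (Suc l) = real (n choose l) * fact l * real (n - l)"
  proof -
    have "real (Suc l) * real (n choose Suc l) = real (n - l) * real (n choose l)"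
      by (metis binomial_absorb_comp binomial_absorption of_nat_mult)
    then show ?thesis by (simp add: mult.commute mult.left_commute)
  qed
  then have "real (n choose Suc l) * fact (Suc l) * R ^ Suc l * N (n - Suc l)
      = real (n choose l) * fact l * real (n - l) * R ^ Suc l * N (n - Suc l)" by (simp only:)
  also have "\<dots> = real (n choose l) * fact l * R ^ l * (R * real (Suc (n - Suc l)) * N (n - Suc l))"
    using Suc.prems by (simp add: Suc_diff_Suc)
  also have "\<dots> \<le> real (n choose l) * fact l * R ^ l * N (Suc (n - Suc l))"
    using assms by (intro mult_left_mono) auto
  also have "\<dots> \<le> N n" using Suc by (simp add: Suc_diff_Suc)
  finally show ?case .
qed auto

lemma geometric_half_sum_le: "(\<Sum>l\<le>n. (1/2::real) ^ l) \<le> 2"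
proof -
  have "(\<Sum>l\<le>n. (1/2::real) ^ l) = 2 - (1/2)^n" by (induction n) (auto simp: field_simps)
  then show ?thesis by simp
qed

text \<open>A factor with analytic bounds costs only a constant, provided the radius parameter \<open>R\<close>
  exceeds twice that of the factor: by the growth of \<open>N\<close> the Leibniz sum is dominated by a geometric
  series of ratio \<open>1/2\<close>.\<close>

lemma partials_mult_analytic_bound:
  assumes U: "open U" "x \<in> U" and fg: "smooth_on U f" "smooth_on U g"
    and F: "\<And>js. length js \<le> length is \<Longrightarrow> norm (partials js f x) \<le> C * A ^ length js * fact (length js)"
    and G: "\<And>js. length js \<le> length is \<Longrightarrow> norm (partials js g x) \<le> N (length js)"
    and N: "\<And>n. N (Suc n) \<ge> R * real (Suc n) * N n" "\<And>n. N n \<ge> 0" and A: "A \<ge> 0" "R > 0" "R \<ge> 2 * A" and C: "C \<ge> 0"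
  shows "norm (partials is (\<lambda>y. f y * g y) x) \<le> 2 * C * N (length is)"
proof -
  let ?n = "length is"
  have AR: "A ^ l \<le> (1/2)^l * R ^ l" for l
  proof -
    have "A ^ l \<le> (R / 2) ^ l" using A by (intro power_mono) auto
    then show ?thesis by (simp add: power_divide)
  qed
  have "norm (partials is (\<lambda>y. f y * g y) x) \<le> (\<Sum>l\<le>?n. real (?n choose l) * (C * A ^ l * fact l) * N (?n - l))"
    by (rule partials_mult_bound[OF U fg F G])
  also have "\<dots> \<le> (\<Sum>l\<le>?n. C * (1/2)^l * N ?n)"
  proof (rule sum_mono)
    fix l assume l: "l \<in> {..?n}"
    have "real (?n choose l) * (C * A ^ l * fact l) * N (?n - l) = C * (real (?n choose l) * fact l * N (?n - l)) * A ^ l"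
      by (simp add: algebra_simps)
    also have "\<dots> \<le> C * (real (?n choose l) * fact l * N (?n - l)) * ((1/2)^l * R ^ l)"
      using AR N C by (intro mult_left_mono) auto
    also have "\<dots> = C * (1/2)^l * (real (?n choose l) * fact l * R ^ l * N (?n - l))"
      by (simp add: algebra_simps)
    also have "\<dots> \<le> C * (1/2)^l * N ?n"
      using factorial_growth[of R N l ?n, OF N(1) A(2) _ N(2)] l C by (intro mult_left_mono) auto
    finally show "real (?n choose l) * (C * A ^ l * fact l) * N (?n - l) \<le> C * (1/2)^l * N ?n" .
  qed
  also have "\<dots> = C * N ?n * (\<Sum>l\<le>?n. (1/2)^l)"
    unfolding sum_distrib_left by (intro sum.cong) auto
  also have "\<dots> \<le> C * N ?n * 2" using N C by (intro mult_left_mono geometric_half_sum_le) auto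
  finally show ?thesis by (simp add: algebra_simps)
qed

text \<open>Division by a symbol. In the Leibniz formula for \<open>q = p z\<close> the term \<open>p\<close> times
  the derivative of \<open>z\<close> dominates: the others are, by induction on the order, a geometric series whose
  sum is at most half of the claimed bound once \<open>R\<close> is at least \<open>(4 C + 2) A\<close>. All bounds
  are relative to \<open>|p x|\<close>.\<close>

lemma partials_divide_analytic_bound:
  assumes U: "open U" "x \<in> U" and pz: "smooth_on U p" "smooth_on U z" and q: "\<And>y. y \<in> U \<Longrightarrow> p y * z y = q y"
    and p: "\<And>js. norm (partials js p x) \<le> C * A ^ length js * fact (length js) * norm (p x)" and p0: "p x \<noteq> 0"
    and qb: "\<And>js. norm (partials js q x) \<le> N (length js) * norm (p x)"
    and N: "\<And>n. N (Suc n) \<ge> R * real (Suc n) * N n" "\<And>n. N n \<ge> 0" 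
    and A: "A > 0" "R \<ge> (4 * C + 2) * A" and C: "C \<ge> 0"
  shows "norm (partials is z x) \<le> 2 * N (length is)"
proof (induction "length is" arbitrary: "is" rule: less_induct)
  case less
  \<comment> \<open>The ratio \<open>?s\<close> bounds \<open>A / R\<close>; it is small enough for \<open>C *
    ?s\<close> to be at most \<open>1/4\<close>.\<close>
  let ?n = "length is" and ?s = "1 / (4 * C + 2) :: real"
  have s: "0 < ?s" "?s \<le> 1/2" "C * ?s \<le> 1/4" using C by (auto simp: field_simps)
  have R: "R > 0" using A C by (smt (verit, best) mult_pos_pos)
  have AR: "A ^ l \<le> ?s ^ l * R ^ l" for l
  proof -
    have "A \<le> ?s * R" using A C by (simp add: field_simps)
    then have "A ^ l \<le> (?s * R) ^ l" using A by (intro power_mono) auto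
    then show ?thesis by (simp only: power_mult_distrib)
  qed
  have "norm (partials is (\<lambda>y. p y * z y) x - p x * partials is z x) \<le>
     (\<Sum>l=1..?n. real (?n choose l) * ((C * norm (p x)) * A ^ l * fact l) * (2 * N (?n - l)))"
    using partials_mult_commutator_bound[OF U pz, of "is" "\<lambda>l. (C * norm (p x)) * A ^ l * fact l" "\<lambda>l. 2 * N l"] p less
    by (simp add: algebra_simps)
  also have "\<dots> \<le> (\<Sum>l=1..?n. norm (p x) * 2 * C * ?s * (1/2)^(l-1) * N ?n)"
  proof (rule sum_mono)
    fix l assume l: "l \<in> {1..?n}"
    have sl: "?s ^ l \<le> ?s * (1/2)^(l-1)"
    proof -
      have "?s ^ l = ?s * ?s ^ (l-1)" using l by (metis Suc_pred' atLeastAtMost_iff less_eq_Suc_le One_nat_def power_Suc)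
      also have "\<dots> \<le> ?s * (1/2)^(l-1)" using s by (intro mult_left_mono power_mono) auto
      finally show ?thesis .
    qed
    have "real (?n choose l) * ((C * norm (p x)) * A ^ l * fact l) * (2 * N (?n - l)) 
      = norm (p x) * 2 * C * (real (?n choose l) * fact l * N (?n - l)) * A ^ l"
      by (simp add: algebra_simps)
    also have "\<dots> \<le> norm (p x) * 2 * C * (real (?n choose l) * fact l * N (?n - l)) * (?s ^ l * R ^ l)"
      using AR N C by (intro mult_left_mono) auto
    also have "\<dots> = norm (p x) * 2 * C * ?s ^ l * (real (?n choose l) * fact l * R ^ l * N (?n - l))"
      by (simp add: algebra_simps)
    also have "\<dots> \<le> norm (p x) * 2 * C * ?s ^ l * N ?n"
      using factorial_growth[of R N l ?n, OF N(1) R _ N(2)] l C s by (intro mult_left_mono) auto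
    also have "\<dots> \<le> norm (p x) * 2 * C * (?s * (1/2)^(l-1)) * N ?n"
      using sl C N by (intro mult_left_mono mult_right_mono) auto
    finally show "real (?n choose l) * ((C * norm (p x)) * A ^ l * fact l) * (2 * N (?n - l))
      \<le> norm (p x) * 2 * C * ?s * (1/2)^(l-1) * N ?n" by (simp add: mult.assoc)
  qed
  also have "\<dots> = norm (p x) * 2 * C * ?s * N ?n * (\<Sum>l=1..?n. (1/2)^(l-1))"
    unfolding sum_distrib_left by (intro sum.cong) auto
  also have "(\<Sum>l=1..?n. (1/2::real)^(l-1)) \<le> 2"
  proof -
    have "(\<Sum>l=1..?n. (1/2::real)^(l-1)) = (\<Sum>l<?n. (1/2::real)^l)"
      by (rule sum.reindex_bij_witness[of _ Suc "\<lambda>l. l - 1"]) auto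
    also have "\<dots> \<le> (\<Sum>l\<le>?n. (1/2::real)^l)" by (rule sum_mono2) auto
    finally show ?thesis using geometric_half_sum_le[of ?n] by linarith
  qed
  then have "norm (p x) * 2 * C * ?s * N ?n * (\<Sum>l=1..?n. (1/2)^(l-1)) \<le> norm (p x) * 2 * C * ?s * N ?n * 2"
    using C s N by (intro mult_left_mono) auto
  also have "\<dots> = (norm (p x) * N ?n) * (4 * (C * ?s))" by simp
  also have "\<dots> \<le> (norm (p x) * N ?n) * (4 * (1/4))" using s N by (intro mult_left_mono) auto
  finally have 1: "norm (partials is (\<lambda>y. p y * z y) x - p x * partials is z x) \<le> norm (p x) * N ?n" by simp
  have "partials is (\<lambda>y. p y * z y) x = partials is q x"
    using q by (intro partials_cong_open[OF U(1) _ U(2)]) auto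
  then have 2: "norm (partials is (\<lambda>y. p y * z y) x) \<le> norm (p x) * N ?n" using qb[of "is"] by (simp add: mult.commute)
  have "norm (p x) * norm (partials is z x) = norm (partials is (\<lambda>y. p y * z y) x - (partials is (\<lambda>y. p y * z y) x - p x * partials is z x))"
    by (simp add: norm_mult)
  also have "\<dots> \<le> norm (p x) * (2 * N ?n)" using 1 2 norm_triangle_ineq4 
    by (smt (verit) distrib_left mult.commute mult_2)
  finally show ?case using p0 by simp
qed

section \<open>Weight functions and their Young conjugates\<close>

lemma weight_function_exp:
  assumes "weight_function \<omega>"
  shows "0 \<le> \<omega> (exp s)" and "s \<le> t \<Longrightarrow> \<omega> (exp s) \<le> \<omega> (exp t)" and "\<omega> (exp 0) = 0"
  using assms by (auto simp: weight_function_def mono_on_def)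

text \<open>As \<open>log t = o(\<omega>(t))\<close>, the weight \<open>\<omega>(e^s)\<close> eventually exceeds every
  linear function of \<open>s\<close>.\<close>

lemma young_conj_bdd:
  assumes w: "weight_function \<omega>"
  shows "bdd_above ((\<lambda>s. s * t - \<omega> (exp s)) ` {0..})"
proof -
  define c where "c = 1 / (\<bar>t\<bar> + 1)"
  have c: "c > 0" by (simp add: c_def)
  have "\<forall>\<^sub>F x in at_top. norm (ln x) \<le> c * norm (\<omega> x)"
    using w c landau_o.smallD[of ln at_top \<omega> c] by (simp add: weight_function_def)
  then obtain x0 where x0: "\<And>x. x \<ge> x0 \<Longrightarrow> \<bar>ln x\<bar> \<le> c * \<bar>\<omega> x\<bar>"
    by (auto simp: eventually_at_top_linorder)
  define s0 where "s0 = max 0 (ln (max 1 x0))"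
  have "s * t - \<omega> (exp s) \<le> s0 * \<bar>t\<bar>" if "s \<ge> 0" for s
  proof (cases "s \<le> s0")
    case True
    have "s * t \<le> s * \<bar>t\<bar>" using that by (intro mult_left_mono) auto
    also have "\<dots> \<le> s0 * \<bar>t\<bar>" using True by (intro mult_right_mono) auto
    finally show ?thesis using weight_function_exp(1)[OF w, of s] by linarith
  next
    case False
    then have "ln (max 1 x0) \<le> s" by (auto simp: s0_def)
    then have "max 1 x0 \<le> exp s" by (metis exp_ln exp_le_cancel_iff less_max_iff_disj zero_less_one)
    then have "\<bar>ln (exp s)\<bar> \<le> c * \<bar>\<omega> (exp s)\<bar>" by (intro x0) auto
    then have s: "s \<le> c * \<omega> (exp s)" using weight_function_exp(1)[OF w, of s] that by simp
    have "s * t \<le> s * (\<bar>t\<bar> + 1)" using that by (intro mult_left_mono) auto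
    also have "\<dots> \<le> c * \<omega> (exp s) * (\<bar>t\<bar> + 1)" using s by (intro mult_right_mono) auto
    also have "\<dots> = \<omega> (exp s)" by (simp add: c_def)
    finally show ?thesis by (simp add: s0_def order_trans[of _ 0])
  qed
  then show ?thesis by (auto simp: bdd_above_def)
qed

lemma young_conj_ge:
  assumes "weight_function \<omega>" "s \<ge> 0"
  shows "s * t - \<omega> (exp s) \<le> young_conj \<omega> t"
  unfolding young_conj_def by (rule cSUP_upper) (use assms young_conj_bdd in auto)

lemma young_conj_le:
  assumes "\<And>s. s \<ge> 0 \<Longrightarrow> s * t - \<omega> (exp s) \<le> B"
  shows "young_conj \<omega> t \<le> B"
  unfolding young_conj_def by (rule cSUP_least) (use assms in auto)

lemma young_conj_mono:
  assumes "weight_function \<omega>" "t \<le> t'"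
  shows "young_conj \<omega> t \<le> young_conj \<omega> t'"
proof (rule young_conj_le)
  fix s :: real assume s: "s \<ge> 0"
  have "s * t \<le> s * t'" using s assms by (intro mult_left_mono)
  then show "s * t - \<omega> (exp s) \<le> young_conj \<omega> t'" using young_conj_ge[OF assms(1) s, of t'] by linarith
qed

lemma young_conj_nonneg:
  assumes "weight_function \<omega>"
  shows "young_conj \<omega> t \<ge> 0"
  using young_conj_ge[OF assms, of 0 t] weight_function_exp(3)[OF assms] by simp

text \<open>The hypothesis on \<open>\<omega>(t^2)\<close> in the variable \<open>s = log t\<close>: doubling
  \<open>s\<close> costs a constant factor and a shift.\<close>

lemma weight_exp_doubling:
  assumes w: "weight_function \<omega>" and H: "\<exists>H\<ge>1. (\<lambda>t. \<omega> (t\<^sup>2)) \<in> O[at_top](\<lambda>t. \<omega> (H * t))"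
  obtains C a where "C \<ge> 2" "a \<ge> 0" "\<And>s. s \<ge> 0 \<Longrightarrow> \<omega> (exp (2 * s)) \<le> C * \<omega> (exp (s + a)) + C"
proof -
  obtain H where H: "H \<ge> 1" "(\<lambda>t. \<omega> (t\<^sup>2)) \<in> O[at_top](\<lambda>t. \<omega> (H * t))" using H by blast
  obtain c where c: "c > 0" "\<forall>\<^sub>F t in at_top. norm (\<omega> (t\<^sup>2)) \<le> c * norm (\<omega> (H * t))"
    using H(2) by (elim landau_o.bigE)
  then obtain t0 where t0: "\<And>t. t \<ge> t0 \<Longrightarrow> \<bar>\<omega> (t\<^sup>2)\<bar> \<le> c * \<bar>\<omega> (H * t)\<bar>"
    by (auto simp: eventually_at_top_linorder)
  define t1 where "t1 = max t0 1"
  define C where "C = max 2 (max c (\<omega> (t1\<^sup>2)))"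
  show ?thesis
  proof (rule that[of C "ln H"])
    show "C \<ge> 2" "ln H \<ge> 0" using H by (auto simp: C_def)
    fix s :: real assume s: "s \<ge> 0"
    have e: "exp (2 * s) = (exp s)\<^sup>2" by (simp add: exp_double)
    have eH: "exp (s + ln H) = H * exp s" using H by (simp add: exp_add)
    show "\<omega> (exp (2 * s)) \<le> C * \<omega> (exp (s + ln H)) + C"
    proof (cases "exp s \<ge> t1")
      case True
      have pos: "\<omega> (H * exp s) \<ge> 0" using w H by (auto simp: weight_function_def)
      have "\<omega> (exp (2 * s)) \<le> c * \<omega> (H * exp s)"
        using t0[of "exp s"] True pos by (simp add: e t1_def)
      also have "\<dots> \<le> C * \<omega> (H * exp s)" using pos by (intro mult_right_mono) (auto simp: C_def)
      finally show ?thesis by (simp add: eH) (simp add: C_def)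
    next
      case False
      have "(exp s)\<^sup>2 \<le> t1\<^sup>2" using False by (intro power_mono) auto
      then have "\<omega> (exp (2 * s)) \<le> \<omega> (t1\<^sup>2)"
        using w by (auto simp: weight_function_def e mono_on_def)
      also have "\<dots> \<le> C" by (simp add: C_def)
      finally show ?thesis using weight_function_exp(1)[OF w, of "s + ln H"] 
        by (simp add: C_def add_increasing)
    qed
  qed
qed

text \<open>For large \<open>s\<close> the doubling condition bounds \<open>\<omega>(e^s)\<close> by a constant times
  its value at \<open>3 s / 4\<close>, since \<open>s / 2 + a \<le> 3 s / 4\<close>. Iterating gives polynomial growth
  in \<open>s\<close>; comparison with exponentials is all that is needed below.\<close>

lemma weight_subexponential:
  assumes w: "weight_function \<omega>" and C: "C \<ge> 2" "a \<ge> 0"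
    and dbl: "\<And>s. s \<ge> 0 \<Longrightarrow> \<omega> (exp (2 * s)) \<le> C * \<omega> (exp (s + a)) + C" and e: "\<epsilon> > 0"
  obtains D where "D \<ge> 0" "\<And>s. s \<ge> 0 \<Longrightarrow> \<omega> (exp s) \<le> D * exp (\<epsilon> * s)"
proof -
  define F where "F s = \<omega> (exp s) + 1" for s
  have F1: "F s \<ge> 1" and Fm: "s \<le> t \<Longrightarrow> F s \<le> F t" for s t
    using weight_function_exp[OF w] by (auto simp: F_def)
  \<comment> \<open>Beyond \<open>x1\<close> the shift \<open>a\<close> is at most \<open>s / 4\<close>, and the
    constant \<open>C + 1\<close> lost in a step is at most the gain \<open>exp (\<epsilon> s / 4)\<close>.\<close>
  define x1 where "x1 = max 1 (max (4 * a) (4 * ln (C + 1) / \<epsilon>))"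
  have x1: "x1 \<ge> 1" "x1 \<ge> 4 * a" "C + 1 \<le> exp (\<epsilon> * x1 / 4)"
  proof -
    have "4 * ln (C + 1) / \<epsilon> \<le> x1" by (simp add: x1_def)
    then have "ln (C + 1) \<le> \<epsilon> * x1 / 4" using e by (simp add: field_simps)
    then show "C + 1 \<le> exp (\<epsilon> * x1 / 4)" using C by (metis add_nonneg_pos exp_le_cancel_iff exp_ln order_trans zero_le_numeral zero_less_one)
  qed (auto simp: x1_def)
  have step: "F s \<le> (C + 1) * F (3 * s / 4)" if "s \<ge> x1" for s
  proof -
    have "\<omega> (exp s) \<le> C * \<omega> (exp (s / 2 + a)) + C" using dbl[of "s/2"] that x1 by simp
    also have "\<dots> \<le> C * \<omega> (exp (3 * s / 4)) + C"
      using that x1 C by (intro add_right_mono mult_left_mono weight_function_exp(2)[OF w]) auto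
    finally have "F s \<le> C * F (3 * s / 4) + 1" by (simp add: F_def algebra_simps)
    also have "\<dots> \<le> C * F (3 * s / 4) + F (3 * s / 4)" using F1 by simp
    finally show ?thesis by (simp add: algebra_simps)
  qed
  have main: "F s \<le> F x1 * exp (\<epsilon> * s)" if "0 \<le> s" "s \<le> (4/3)^n * x1" for s n
    using that
  proof (induction n arbitrary: s)
    case 0
    have "F s \<le> F x1" using 0 by (intro Fm) auto
    also have "\<dots> \<le> F x1 * exp (\<epsilon> * s)" using 0 e F1[of x1] by (simp add: mult_le_cancel_left1)
    finally show ?case .
  next
    case (Suc n)
    show ?case
    proof (cases "s \<le> x1")
      case True
      have "F s \<le> F x1" using True by (intro Fm) auto
      also have "\<dots> \<le> F x1 * exp (\<epsilon> * s)" using Suc.prems e F1[of x1] by (simp add: mult_le_cancel_left1)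
      finally show ?thesis .
    next
      case False
      have "F s \<le> (C + 1) * F (3 * s / 4)" using False by (intro step) auto
      also have "\<dots> \<le> exp (\<epsilon> * x1 / 4) * (F x1 * exp (\<epsilon> * (3 * s / 4)))"
        using Suc.IH[of "3 * s / 4"] Suc.prems x1 F1[of "3 * s / 4"] C by (intro mult_mono) auto
      also have "\<dots> \<le> exp (\<epsilon> * s / 4) * (F x1 * exp (\<epsilon> * (3 * s / 4)))"
        using False e F1[of x1] by (intro mult_right_mono) auto
      also have "\<dots> = F x1 * (exp (\<epsilon> * s / 4) * exp (\<epsilon> * (3 * s / 4)))" by simp
      also have "exp (\<epsilon> * s / 4) * exp (\<epsilon> * (3 * s / 4)) = exp (\<epsilon> * s)"
        unfolding exp_add[symmetric] by (simp add: field_simps)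
      finally show ?thesis .
    qed
  qed
  show ?thesis
  proof (rule that[of "F x1"])
    show "F x1 \<ge> 0" using F1[of x1] by simp
    fix s :: real assume s: "s \<ge> 0"
    obtain n where n: "s / x1 < (4/3)^n" using real_arch_pow[of "4/3" "s / x1"] by auto
    then have "s \<le> (4/3)^n * x1" using x1(1) by (simp add: field_simps)
    then show "\<omega> (exp s) \<le> F x1 * exp (\<epsilon> * s)" using main[OF s] by (fastforce simp: F_def)
  qed
qed

text \<open>The doubling condition transported to the conjugate: test the supremum defining \<open>young_conj\<close>
  at \<open>2 (s - a)\<close> instead of \<open>s\<close>.\<close>

lemma young_conj_doubling:
  assumes w: "weight_function \<omega>" and C: "C \<ge> 2" "a \<ge> 0"
    and dbl: "\<And>s. s \<ge> 0 \<Longrightarrow> \<omega> (exp (2 * s)) \<le> C * \<omega> (exp (s + a)) + C" and t: "t \<ge> 0"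
  shows "C * young_conj \<omega> t \<le> young_conj \<omega> (C / 2 * t) + a * C * t + C"
proof -
  let ?\<psi> = "young_conj \<omega>"
  have "?\<psi> t \<le> (?\<psi> (C / 2 * t) + a * C * t + C) / C"
  proof (rule young_conj_le)
    fix s :: real assume s: "s \<ge> 0"
    have "C * (s * t - \<omega> (exp s)) \<le> ?\<psi> (C / 2 * t) + a * C * t + C"
    proof (cases "s \<ge> a")
      case True
      have "(2 * (s - a)) * (C / 2 * t) - \<omega> (exp (2 * (s - a))) \<le> ?\<psi> (C / 2 * t)"
        using True by (intro young_conj_ge[OF w]) auto
      moreover have "\<omega> (exp (2 * (s - a))) \<le> C * \<omega> (exp s) + C" using dbl[of "s - a"] True by simp
      ultimately show ?thesis by (simp add: algebra_simps)
    next
      case False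
      then have "s * t \<le> a * t" using t by (intro mult_right_mono) auto
      then have "s * t - \<omega> (exp s) \<le> a * t" using weight_function_exp(1)[OF w, of s] by linarith
      then have "C * (s * t - \<omega> (exp s)) \<le> C * (a * t)" using C by (intro mult_left_mono) auto
      then show ?thesis using young_conj_nonneg[OF w, of "C / 2 * t"] C by (simp add: algebra_simps)
    qed
    then show "s * t - \<omega> (exp s) \<le> (?\<psi> (C / 2 * t) + a * C * t + C) / C" using C by (simp add: field_simps)
  qed
  then show ?thesis using C by (simp add: field_simps)
qed

text \<open>Testing the conjugate at \<open>s = N log l\<close>, where the weight is at most linear in
  \<open>l\<close> by subexponential growth. As \<open>N\<close> is arbitrary, the conjugate dominates every multiple
  of \<open>l log l\<close>, that is, every power of a factorial.\<close>

lemma young_conj_superlinear: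
  assumes w: "weight_function \<omega>" and C: "C \<ge> 2" "a \<ge> 0"
    and dbl: "\<And>s. s \<ge> 0 \<Longrightarrow> \<omega> (exp (2 * s)) \<le> C * \<omega> (exp (s + a)) + C" and N: "N > 0"
  obtains D where "D \<ge> 0" "\<And>h l. l \<ge> 1 \<Longrightarrow> h * l * N * ln l - D * l \<le> young_conj \<omega> (h * l)"
proof -
  obtain D where D: "D \<ge> 0" "\<And>s. s \<ge> 0 \<Longrightarrow> \<omega> (exp s) \<le> D * exp (1 / N * s)"
    using weight_subexponential[OF w C dbl, of "1 / N"] N by auto
  show ?thesis
  proof (rule that[of D])
    fix h l :: real assume l: "l \<ge> 1"
    have nn: "N * ln l \<ge> 0" using N l by simp
    have "(N * ln l) * (h * l) - \<omega> (exp (N * ln l)) \<le> young_conj \<omega> (h * l)"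
      by (rule young_conj_ge[OF w nn])
    moreover have "\<omega> (exp (N * ln l)) \<le> D * l" using D(2)[OF nn] N l by simp
    ultimately show "h * l * N * ln l - D * l \<le> young_conj \<omega> (h * l)" by (simp add: algebra_simps)
  qed (use D in auto)
qed

text \<open>Multiplying the order by \<open>2^m\<close> is compensated by passing from \<open>h\<close> to \<open>C^m
  h\<close>, up to a linear error.\<close>

lemma young_conj_iterated_doubling:
  assumes w: "weight_function \<omega>" and C: "C \<ge> 2" "a \<ge> 0"
    and dbl: "\<And>s. s \<ge> 0 \<Longrightarrow> \<omega> (exp (2 * s)) \<le> C * \<omega> (exp (s + a)) + C" and h: "h > 0"
  shows "\<exists>c\<ge>0. \<forall>l\<ge>0. 1 / h * young_conj \<omega> (h * (2 ^ m * l))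
     \<le> 1 / (C ^ m * h) * young_conj \<omega> (C ^ m * h * l) + c * l + c"
  using h
proof (induction m arbitrary: h)
  case 0
  then show ?case by (intro exI[of _ 0]) auto
next
  case (Suc m)
  let ?\<psi> = "young_conj \<omega>"
  obtain c where c: "c \<ge> 0" "\<And>l. l \<ge> 0 \<Longrightarrow> 1 / (C * h) * ?\<psi> ((C * h) * (2 ^ m * l))
     \<le> 1 / (C ^ m * (C * h)) * ?\<psi> (C ^ m * (C * h) * l) + c * l + c"
    using Suc.IH[of "C * h"] Suc.prems C by (auto simp: zero_less_mult_iff)
  show ?case
  proof (intro exI[of _ "c + a * 2 ^ Suc m + 1 / h"] conjI allI impI)
    show "0 \<le> c + a * 2 ^ Suc m + 1 / h" using c C Suc.prems by simp
    fix l :: real assume l: "l \<ge> 0"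
    let ?t = "2 * h * (2 ^ m * l)"
    have "C * ?\<psi> ?t \<le> ?\<psi> (C / 2 * ?t) + a * C * ?t + C"
      using Suc.prems l by (intro young_conj_doubling[OF w C dbl]) auto
    then have "1 / (C * h) * (C * ?\<psi> ?t) \<le> 1 / (C * h) * (?\<psi> (C / 2 * ?t) + a * C * ?t + C)"
      using Suc.prems C by (intro mult_left_mono) auto
    then have "1 / h * ?\<psi> ?t \<le> 1 / (C * h) * ?\<psi> ((C * h) * (2 ^ m * l)) + a * 2 ^ Suc m * l + 1 / h"
      using Suc.prems C by (simp add: field_simps)
    also have "\<dots> \<le> (1 / (C ^ m * (C * h)) * ?\<psi> (C ^ m * (C * h) * l) + c * l + c) + a * 2 ^ Suc m * l + 1 / h"
      using c(2)[OF l] by (intro add_right_mono)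
    also have "\<dots> \<le> 1 / (C ^ Suc m * h) * ?\<psi> (C ^ Suc m * h * l) + (c + a * 2 ^ Suc m + 1 / h) * l + (c + a * 2 ^ Suc m + 1 / h)"
      using l C Suc.prems by (simp add: algebra_simps)
    finally show "1 / h * ?\<psi> (h * (2 ^ Suc m * l)) \<le> 1 / (C ^ Suc m * h) * ?\<psi> (C ^ Suc m * h * l)
       + (c + a * 2 ^ Suc m + 1 / h) * l + (c + a * 2 ^ Suc m + 1 / h)"
      by (simp add: algebra_simps)
  qed
qed

lemma fact_le_exp_ln: "fact n \<le> exp (real n * ln (real n))" if "n \<ge> 1"
proof -
  have "fact n \<le> real (n ^ n)" using fact_le_power[of n] by simp
  also have "\<dots> = exp (real n * ln (real n))" using that by (simp add: exp_of_nat_mult)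
  finally show ?thesis .
qed

text \<open>The growth condition on the weight enters the proof through this lemma. Passing from \<open>h\<close> to a
  fixed multiple \<open>\<kappa> h\<close> absorbs geometric factors, powers of factorials and a multiplication of the
  order by \<open>q\<close>. The doublings needed to remove \<open>q\<close> give the factor \<open>C^m\<close> in
  \<open>\<kappa>\<close>; one further doubling provides a second copy of the conjugate, which dominates the
  factorials and all linear error terms. The multiple \<open>\<kappa>\<close> does not depend on \<open>h\<close>, so
  the statement serves the Roumieu and the Beurling case alike.\<close>

lemma young_conj_absorb:
  fixes q r :: nat and A :: real
  assumes w: "weight_function \<omega>" and H: "\<exists>H\<ge>1. (\<lambda>t. \<omega> (t\<^sup>2)) \<in> O[at_top](\<lambda>t. \<omega> (H * t))" and A: "A \<ge> 1"
  obtains \<kappa> where "\<kappa> \<ge> 1" "\<And>h. h > 0 \<Longrightarrow> \<exists>B>0. \<forall>l::nat. A ^ (l + 1) * fact (q * (l + 1)) ^ r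
      * exp (1 / h * young_conj \<omega> (h * real (q * (l + 1)))) \<le> B * exp (1 / (\<kappa> * h) * young_conj \<omega> (\<kappa> * h * real l))"
proof -
  let ?\<psi> = "young_conj \<omega>"
  obtain C a where C: "C \<ge> 2" "a \<ge> 0" and dbl: "\<And>s. s \<ge> 0 \<Longrightarrow> \<omega> (exp (2 * s)) \<le> C * \<omega> (exp (s + a)) + C"
    using weight_exp_doubling[OF w H] by blast
  \<comment> \<open>The margin in \<open>2 * q + 1\<close> accounts for replacing \<open>l + 1\<close> by \<open>2 *
    l\<close>.\<close>
  obtain m where m: "2 * q + 1 \<le> 2 ^ m" using less_exp[of "2 * q + 1"] less_imp_le by blast
  define \<kappa> where "\<kappa> = C / 2 * C ^ m"
  have Cm: "1 \<le> C ^ m" using C by (intro one_le_power) auto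
  have \<kappa>: "\<kappa> \<ge> 1" unfolding \<kappa>_def using C mult_mono[of 1 "C/2" 1 "C ^ m"] Cm by simp
  \<comment> \<open>The factorials contribute \<open>2 q r l log l\<close>; one more \<open>l log l\<close> is left
    to dominate the linear terms.\<close>
  define N where "N = real (2 * q * r) + 1"
  obtain D where D: "D \<ge> 0" "\<And>h l. l \<ge> 1 \<Longrightarrow> h * l * N * ln l - D * l \<le> ?\<psi> (h * l)"
  proof (rule young_conj_superlinear[OF w C dbl])
    show "N > 0" unfolding N_def using of_nat_0_le_iff[of "2 * q * r", where 'a = real] by linarith
  qed (use that in blast)+
  show ?thesis
  proof (rule that[OF \<kappa>])
    fix h :: real assume h: "h > 0"
    define h1 where "h1 = C ^ m * h"
    have h1: "h1 > 0" using h Cm by (simp add: h1_def)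
    obtain c where c: "c \<ge> 0" "\<And>l. l \<ge> 0 \<Longrightarrow> 1 / h * ?\<psi> (h * (2 ^ m * l)) \<le> 1 / h1 * ?\<psi> (h1 * l) + c * l + c"
      using young_conj_iterated_doubling[OF w C dbl h, of m] unfolding h1_def by blast
    define c2 where "c2 = 2 * ln A + real (2 * q * r) * ln (real (2 * q + 1)) + c + D / h1 + 2 * a"
    have c2: "c2 \<ge> 0" using A C c D h1 by (auto simp: c2_def)
    define b where "b = c + 2 / h1 + c2 * exp c2"
    define B0 where "B0 = A * fact q ^ r * exp (1 / h * ?\<psi> (h * real q)) + 1"
    show "\<exists>B>0. \<forall>l::nat. A ^ (l + 1) * fact (q * (l + 1)) ^ r
      * exp (1 / h * ?\<psi> (h * real (q * (l + 1)))) \<le> B * exp (1 / (\<kappa> * h) * ?\<psi> (\<kappa> * h * real l))"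
    proof (intro exI[of _ "max B0 (exp b)"] conjI allI)
      show "0 < max B0 (exp b)" by (simp add: less_max_iff_disj)
      fix l :: nat
      show "A ^ (l + 1) * fact (q * (l + 1)) ^ r * exp (1 / h * ?\<psi> (h * real (q * (l + 1)))) 
          \<le> max B0 (exp b) * exp (1 / (\<kappa> * h) * ?\<psi> (\<kappa> * h * real l))"
      proof (cases "l = 0")
        \<comment> \<open>For \<open>l = 0\<close> there is no logarithmic growth to exploit; this single value goes
          into the constant.\<close>
        case True
        have "1 \<le> exp (1 / (\<kappa> * h) * ?\<psi> (\<kappa> * h * real l))"
          using young_conj_nonneg[OF w] \<kappa> h by simp
        then have "B0 * 1 \<le> max B0 (exp b) * exp (1 / (\<kappa> * h) * ?\<psi> (\<kappa> * h * real l))"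
          by (intro mult_mono) (auto simp: le_max_iff_disj)
        then show ?thesis using True by (simp add: B0_def)
      next
        case False
        define x where "x = real l"
        have x: "x \<ge> 1" using False by (simp add: x_def)
        let ?n = "q * (l + 1)"
        have "?n \<le> q * (2 * l)" using False by (intro mult_le_mono2) simp
        then have "real ?n \<le> real (q * (2 * l))" by (simp only: of_nat_le_iff)
        then have nle: "real ?n \<le> real (2 * q) * x" by (simp add: x_def)
        have f1: "ln (fact ?n ^ r) \<le> real (2 * q * r) * x * (ln (real (2 * q + 1)) + ln x)"
        proof (cases "q = 0")
          case True then show ?thesis by simp
        next
          case q: False
          then have n1: "?n \<ge> 1" by simp
          have "ln (fact ?n :: real) \<le> real ?n * ln (real ?n)"
          proof -
            have "ln (fact ?n :: real) \<le> ln (exp (real ?n * ln (real ?n)))"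
              using fact_le_exp_ln[OF n1] by (subst ln_le_cancel_iff) auto
            then show ?thesis by simp
          qed
          also have "\<dots> \<le> (real (2 * q) * x) * ln (real (2 * q + 1) * x)"
          proof (intro mult_mono nle)
            have "real ?n \<le> real (2 * q + 1) * x" using nle x by (simp add: algebra_simps)
            moreover have "0 < real ?n" using n1 by (simp only: of_nat_0_less_iff)
            ultimately show "ln (real ?n) \<le> ln (real (2 * q + 1) * x)" by (intro ln_mono) linarith+
            have "1 \<le> real ?n" using n1 by linarith
            then show "0 \<le> ln (real ?n)" by (rule ln_ge_zero)
          qed (use x in auto)
          also have "ln (real (2 * q + 1) * x) = ln (real (2 * q + 1)) + ln x" using x by (subst ln_mult) auto
          finally have "real r * ln (fact ?n :: real) \<le> real r * (real (2 * q) * x * (ln (real (2 * q + 1)) + ln x))"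
            by (intro mult_left_mono) auto
          then show ?thesis by (simp add: ln_realpow algebra_simps)
        qed
        have f2: "ln (A ^ (l + 1)) \<le> 2 * ln A * x"
        proof -
          have "real (l + 1) * ln A \<le> (2 * x) * ln A" using A x by (intro mult_right_mono) (auto simp: x_def)
          moreover have "ln (A ^ (l + 1)) = real (l + 1) * ln A" by (rule ln_realpow)
          ultimately show ?thesis by (simp only: mult.commute mult.left_commute)
        qed
        have f3: "1 / h * ?\<psi> (h * real ?n) \<le> 1 / h1 * ?\<psi> (h1 * x) + c * x + c"
        proof -
          have "real (2 * q + 1) \<le> real (2 ^ m)" using m by (simp only: of_nat_le_iff)
          then have "real (2 * q) * x \<le> 2 ^ m * x" using x by (intro mult_right_mono) auto
          then have "?\<psi> (h * real ?n) \<le> ?\<psi> (h * (2 ^ m * x))"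
            using h nle by (intro young_conj_mono[OF w] mult_left_mono) auto
          then have "1 / h * ?\<psi> (h * real ?n) \<le> 1 / h * ?\<psi> (h * (2 ^ m * x))" using h by (intro mult_left_mono) auto
          then show ?thesis using c(2)[of x] x by linarith
        qed
        have f4: "N * (x * ln x) - D / h1 * x \<le> 1 / h1 * ?\<psi> (h1 * x)"
        proof -
          have "1 / h1 * (h1 * x * N * ln x - D * x) \<le> 1 / h1 * ?\<psi> (h1 * x)"
            using h1 x by (intro mult_left_mono D(2)) auto
          then show ?thesis using h1 by (simp add: field_simps)
        qed
        \<comment> \<open>The last doubling: two copies of the conjugate at \<open>h1\<close> are bounded by one at
          \<open>\<kappa> h\<close>.\<close>
        have f5: "2 / h1 * ?\<psi> (h1 * x) \<le> 1 / (\<kappa> * h) * ?\<psi> (\<kappa> * h * x) + 2 * a * x + 2 / h1"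
        proof -
          have kh: "\<kappa> * h = C / 2 * h1" by (simp add: \<kappa>_def h1_def)
          have "C * ?\<psi> (h1 * x) \<le> ?\<psi> (C / 2 * (h1 * x)) + a * C * (h1 * x) + C"
            using h1 x by (intro young_conj_doubling[OF w C dbl]) auto
          then have "1 / (\<kappa> * h) * (C * ?\<psi> (h1 * x)) \<le> 1 / (\<kappa> * h) * (?\<psi> (C / 2 * (h1 * x)) + a * C * (h1 * x) + C)"
            using \<kappa> h by (intro mult_left_mono) auto
          then show ?thesis unfolding kh using h1 C by (simp add: field_simps)
        qed
        have f6: "c2 * x \<le> x * ln x + c2 * exp c2"
        proof (cases "ln x \<ge> c2")
          case True
          then have "c2 * x \<le> ln x * x" using x by (intro mult_right_mono) auto
          moreover have "0 \<le> c2 * exp c2" using c2 by simp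
          ultimately show ?thesis by (simp add: mult.commute)
        next
          case False
          then have "exp (ln x) \<le> exp c2" by simp
          then have "x \<le> exp c2" using x by simp
          then have "c2 * x \<le> c2 * exp c2" using c2 by (intro mult_left_mono)
          moreover have "0 \<le> x * ln x" using x by simp
          ultimately show ?thesis by linarith
        qed
        have "ln (A ^ (l + 1)) + ln (fact ?n ^ r) + 1 / h * ?\<psi> (h * real ?n)
           \<le> b + 1 / (\<kappa> * h) * ?\<psi> (\<kappa> * h * x)"
          using f1 f2 f3 f4 f5 f6 unfolding b_def c2_def N_def by (simp add: algebra_simps)
        then have "exp (ln (A ^ (l + 1)) + ln (fact ?n ^ r) + 1 / h * ?\<psi> (h * real ?n))
           \<le> exp (b + 1 / (\<kappa> * h) * ?\<psi> (\<kappa> * h * x))" by simp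
        then have "A ^ (l + 1) * fact ?n ^ r * exp (1 / h * ?\<psi> (h * real ?n)) \<le> exp b * exp (1 / (\<kappa> * h) * ?\<psi> (\<kappa> * h * x))"
          using A by (simp add: exp_add)
        also have "\<dots> \<le> max B0 (exp b) * exp (1 / (\<kappa> * h) * ?\<psi> (\<kappa> * h * x))"
          by (intro mult_right_mono) auto
        finally show ?thesis by (simp add: x_def)
      qed
    qed
  qed
qed

section \<open>Fourier inversion\<close>

text \<open>Fubini, with the bounded kernel as the only link between the two variables.\<close>

lemma integral_swap_bounded_kernel:
  fixes f g :: "'a::euclidean_space \<Rightarrow> complex" and k :: "'a \<Rightarrow> 'a \<Rightarrow> complex"
  assumes f: "integrable lborel f" and g: "integrable lborel g"
    and k[measurable]: "case_prod k \<in> borel_measurable (lborel \<Otimes>\<^sub>M lborel)" and k1: "\<And>x y. norm (k x y) \<le> 1"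
  shows "(\<integral>x. f x * (\<integral>y. g y * k x y \<partial>lborel) \<partial>lborel) = (\<integral>y. g y * (\<integral>x. f x * k x y \<partial>lborel) \<partial>lborel)"
proof -
  have [measurable]: "f \<in> borel_measurable borel" "g \<in> borel_measurable borel"
    using f g by auto
  have k'[measurable]: "(\<lambda>p. k (fst p) (snd p)) \<in> borel_measurable (lborel \<Otimes>\<^sub>M lborel)"
    using k by (simp add: case_prod_beta')
  have prod: "integrable (lborel \<Otimes>\<^sub>M lborel) (\<lambda>p. f (fst p) * g (snd p))"
  proof (rule lborel_pair.Fubini_integrable)
    show "integrable lborel (\<lambda>x. \<integral>y. norm (f (fst (x, y)) * g (snd (x, y))) \<partial>lborel)"
      using f by (simp add: norm_mult)
    show "AE x in lborel. integrable lborel (\<lambda>y. f (fst (x, y)) * g (snd (x, y)))"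
      using g by simp
  qed measurable
  have "integrable (lborel \<Otimes>\<^sub>M lborel) (\<lambda>p. f (fst p) * g (snd p) * k (fst p) (snd p))"
  proof (rule Bochner_Integration.integrable_bound[OF prod])
    show "AE p in lborel \<Otimes>\<^sub>M lborel. norm (f (fst p) * g (snd p) * k (fst p) (snd p)) \<le> norm (f (fst p) * g (snd p))"
      using k1 by (auto simp: norm_mult intro!: mult_left_le)
  qed measurable
  then have "integrable (lborel \<Otimes>\<^sub>M lborel) (\<lambda>(x, y). f x * g y * k x y)"
    by (simp add: case_prod_beta')
  note lborel_pair.Fubini_integral[OF this]
  moreover have "(\<integral>x. f x * g y * k x y \<partial>lborel) = g y * (\<integral>x. f x * k x y \<partial>lborel)" for y
    unfolding integral_mult_right_zero[symmetric] by (simp only: mult.assoc mult.left_commute)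
  moreover have "(\<integral>y. f x * g y * k x y \<partial>lborel) = f x * (\<integral>y. g y * k x y \<partial>lborel)" for x
    unfolding integral_mult_right_zero[symmetric] by (simp only: mult.assoc)
  ultimately show ?thesis by simp
qed

lemma lborel_integral_affine:
  fixes f :: "'a::euclidean_space \<Rightarrow> complex"
  assumes c: "c \<noteq> 0" and f[measurable]: "f \<in> borel_measurable borel"
  shows "(\<integral>x. f x \<partial>lborel) = of_real (\<bar>c\<bar> ^ DIM('a)) * (\<integral>x. f (t + c *\<^sub>R x) \<partial>lborel)"
  by (subst lborel_affine[OF c, of t]) (simp add: integral_density integral_distr scaleR_conv_of_real)

lemma lborel_integrable_affine:
  fixes f :: "'a::euclidean_space \<Rightarrow> complex"
  assumes c: "c \<noteq> 0" and f: "integrable lborel f"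
  shows "integrable lborel (\<lambda>x. f (t + c *\<^sub>R x))"
proof -
  have [measurable]: "f \<in> borel_measurable borel" using f by auto
  have "integrable (density (distr lborel borel (\<lambda>x. t + c *\<^sub>R x)) (\<lambda>_. \<bar>c\<bar> ^ DIM('a))) f"
    using f lborel_affine[OF c, of t] by simp
  then have "integrable lborel (\<lambda>x. (\<bar>c\<bar> ^ DIM('a)) *\<^sub>R f (t + c *\<^sub>R x))"
    by (simp add: integrable_density integrable_distr_eq)
  from integrable_scaleR_right[OF this, of "1 / \<bar>c\<bar> ^ DIM('a)"] show ?thesis using c by simp
qed

lemma product_integral_euclidean:
  fixes f :: "'a::euclidean_space \<Rightarrow> real \<Rightarrow> 'b::{real_normed_field,banach,second_countable_topology}"
  assumes f: "\<And>b. b \<in> Basis \<Longrightarrow> integrable lborel (f b)"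
  shows "(\<integral>x. (\<Prod>b\<in>Basis. f b (x \<bullet> b)) \<partial>lborel) = (\<Prod>b\<in>Basis. (\<integral>x. f b x \<partial>lborel))"
    and "integrable lborel (\<lambda>x::'a. \<Prod>b\<in>Basis. f b (x \<bullet> b))"
proof -
  interpret product_sigma_finite "\<lambda>b::'a. lborel :: real measure" ..
  have [measurable]: "f b \<in> borel_measurable borel" if "b \<in> Basis" for b using f[OF that] by auto
  have m: "(\<lambda>x::'a. \<Prod>b\<in>Basis. f b (x \<bullet> b)) \<in> borel_measurable borel"
    by (rule borel_measurable_prod) measurable
  have s: "(\<Sum>b\<in>Basis. g b *\<^sub>R b) \<bullet> b = g b" if "b \<in> Basis" for g and b :: 'a using that
    by (simp add: inner_sum_left inner_Basis if_distrib cong: if_cong)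
  show "(\<integral>x. (\<Prod>b\<in>Basis. f b (x \<bullet> b)) \<partial>lborel) = (\<Prod>b\<in>Basis. (\<integral>x. f b x \<partial>lborel))"
    by (subst lborel_eq, subst integral_distr) (use m in \<open>auto simp: s f product_integral_prod\<close>)
  show "integrable lborel (\<lambda>x::'a. \<Prod>b\<in>Basis. f b (x \<bullet> b))"
    by (subst lborel_eq, subst integrable_distr_eq) (use m in \<open>auto simp: s f product_integrable_prod\<close>)
qed

text \<open>The standard Gaussian density; as a product over the basis it reduces its mass and its Fourier transform
  to one dimension.\<close>

definition gauss :: "'a::euclidean_space \<Rightarrow> real" where
  "gauss x = (\<Prod>b\<in>Basis. std_normal_density (x \<bullet> b))"

lemma gauss_eq: "gauss (x::'a::euclidean_space) = (1 / sqrt (2 * pi)) ^ DIM('a) * exp (- (norm x)\<^sup>2 / 2)"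
proof -
  have "gauss x = (1 / sqrt (2 * pi)) ^ DIM('a) * (\<Prod>b\<in>Basis. exp (- (x \<bullet> b)\<^sup>2 / 2))"
    unfolding gauss_def std_normal_density_def prod.distrib by (simp only: prod_constant)
  also have "(\<Prod>b\<in>Basis. exp (- (x \<bullet> b)\<^sup>2 / 2)) = exp (\<Sum>b\<in>Basis. - (x \<bullet> b)\<^sup>2 / 2)"
    by (simp add: exp_sum)
  also have "(\<Sum>b\<in>Basis. - (x \<bullet> b)\<^sup>2 / 2) = - (norm x)\<^sup>2 / 2"
    unfolding dot_square_norm[symmetric] euclidean_inner[of x x] 
    by (simp add: sum_negf sum_divide_distrib power2_eq_square)
  finally show ?thesis .
qed

lemma gauss_nonneg: "gauss x \<ge> 0"
  by (simp add: gauss_eq)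

lemma gauss_measurable [measurable]: "(gauss :: 'a::euclidean_space \<Rightarrow> real) \<in> borel_measurable borel"
  unfolding gauss_eq[abs_def] by measurable

lemma gauss_integrable: "integrable lborel gauss" 
  unfolding gauss_def by (rule product_integral_euclidean(2)) simp

lemma gauss_integral: "(\<integral>x. gauss x \<partial>lborel) = 1"
proof -
  have "(\<integral>x. std_normal_density x \<partial>lborel) = 1" by simp
  then show ?thesis unfolding gauss_def by (subst product_integral_euclidean(1)) simp_all
qed

lemma cis_sum: "finite A \<Longrightarrow> cis (\<Sum>a\<in>A. f a) = (\<Prod>a\<in>A. cis (f a))"
  by (induction A rule: finite_induct) (auto simp: cis_mult[symmetric])

lemma std_normal_fourier:
  "(\<integral>x. of_real (std_normal_density x) * cis (t * x) \<partial>lborel) = of_real (exp (- t\<^sup>2 / 2))"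
proof -
  have "char std_normal_distribution t = (\<integral>x. of_real (std_normal_density x) * cis (t * x) \<partial>lborel)"
    unfolding char_def by (subst integral_density) (auto simp: scaleR_conv_of_real cis_conv_exp)
  then show ?thesis by (simp add: char_std_normal_distribution)
qed

lemma gauss_fourier:
  "(\<integral>x. of_real (gauss x) * cis (x \<bullet> \<xi>) \<partial>lborel) = of_real (exp (- (norm (\<xi>::'a::euclidean_space))\<^sup>2 / 2))"
proof -
  have "of_real (gauss x) * cis (x \<bullet> \<xi>) = (\<Prod>b\<in>Basis. of_real (std_normal_density (x \<bullet> b)) * cis ((\<xi> \<bullet> b) * (x \<bullet> b)))" for x :: 'a
    unfolding gauss_def by (subst euclidean_inner) (simp add: cis_sum prod.distrib mult.commute)
  then have "(\<integral>x. of_real (gauss x) * cis (x \<bullet> \<xi>) \<partial>lborel) = (\<Prod>b\<in>Basis. (\<integral>x. of_real (std_normal_density x) * cis ((\<xi> \<bullet> b) * x) \<partial>lborel))"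
  proof (simp only:, subst product_integral_euclidean(1))
    show "integrable lborel (\<lambda>x. complex_of_real (std_normal_density x) * cis (\<xi> \<bullet> b * x))" for b
    proof (rule Bochner_Integration.integrable_bound)
      show "integrable lborel std_normal_density" by simp
      show "(\<lambda>x. complex_of_real (std_normal_density x) * cis (\<xi> \<bullet> b * x)) \<in> borel_measurable lborel"
        unfolding cis_conv_exp by measurable
    qed (auto simp: norm_mult)
  qed simp
  also have "\<dots> = of_real (\<Prod>b\<in>Basis. exp (- (\<xi> \<bullet> b)\<^sup>2 / 2))" by (simp add: std_normal_fourier)
  also have "(\<Prod>b\<in>Basis. exp (- (\<xi> \<bullet> b)\<^sup>2 / 2)) = exp (\<Sum>b\<in>Basis. - (\<xi> \<bullet> b)\<^sup>2 / 2)"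
    by (simp add: exp_sum)
  also have "(\<Sum>b\<in>Basis. - (\<xi> \<bullet> b)\<^sup>2 / 2) = - (norm \<xi>)\<^sup>2 / 2"
    unfolding dot_square_norm[symmetric] euclidean_inner[of \<xi> \<xi>] 
    by (simp add: sum_negf sum_divide_distrib power2_eq_square)
  finally show ?thesis .
qed

lemma cis_inner_measurable [measurable]: 
  fixes \<xi> :: "'a::euclidean_space"
  shows "(\<lambda>x. cis (x \<bullet> \<xi>)) \<in> borel_measurable borel" "(\<lambda>x. cis (\<xi> \<bullet> x)) \<in> borel_measurable borel"
  unfolding cis_conv_exp by measurable

lemma cis_inner_pair_measurable [measurable]: 
  "(\<lambda>(x::'a::euclidean_space, y). cis (s * (x \<bullet> y))) \<in> borel_measurable (lborel \<Otimes>\<^sub>M lborel)"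
proof -
  have "continuous_on UNIV (\<lambda>p::'a \<times> 'a. cis (s * (fst p \<bullet> snd p)))" 
    unfolding cis_conv_exp by (intro continuous_intros)
  then have "(\<lambda>p::'a \<times> 'a. cis (s * (fst p \<bullet> snd p))) \<in> borel_measurable borel"
    by (rule borel_measurable_continuous_onI)
  then show ?thesis by (simp add: case_prod_beta' lborel_prod)
qed

text \<open>The Fourier transforms of wide Gaussians concentrate like an approximate identity as \<open>t
  \<longlonglongrightarrow> 0\<close>.\<close>

lemma gauss_scaled_fourier:
  fixes z :: "'a::euclidean_space"
  assumes t: "t > 0"
  shows "(\<integral>\<xi>. of_real (exp (- (norm (t *\<^sub>R \<xi>))\<^sup>2 / 2)) * cis (z \<bullet> \<xi>) \<partial>lborel)
     = of_real ((2 * pi) ^ DIM('a) / t ^ DIM('a) * gauss (z /\<^sub>R t))"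
proof -
  let ?n = "DIM('a)"
  define c where "c = (1 / sqrt (2 * pi)) ^ ?n"
  have c: "c > 0" by (simp add: c_def)
  have "1 / c = sqrt (2 * pi) ^ ?n" by (simp add: c_def power_one_over)
  then have c2: "1 / c * (1 / c) = (2 * pi) ^ ?n" by (simp only: power_mult_distrib[symmetric]) simp
  have e: "exp (- (norm (t *\<^sub>R \<xi>))\<^sup>2 / 2) = 1 / c * gauss (t *\<^sub>R \<xi>)" for \<xi> :: 'a
    unfolding gauss_eq[of "t *\<^sub>R \<xi>"] c_def[symmetric] using c by simp
  have inner: "z \<bullet> \<xi> = (0 + t *\<^sub>R \<xi>) \<bullet> (z /\<^sub>R t)" for \<xi>
    using t inner_commute[of z \<xi>] by simp
  have "(\<integral>\<xi>. of_real (exp (- (norm (t *\<^sub>R \<xi>))\<^sup>2 / 2)) * cis (z \<bullet> \<xi>) \<partial>lborel)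
     = of_real (1 / c) * (\<integral>\<xi>. of_real (gauss (t *\<^sub>R \<xi>)) * cis (z \<bullet> \<xi>) \<partial>lborel)"
    unfolding e of_real_mult mult.assoc by (rule integral_mult_right_zero)
  also have "(\<integral>\<xi>. of_real (gauss (t *\<^sub>R \<xi>)) * cis (z \<bullet> \<xi>) \<partial>lborel) = 
     (\<integral>\<xi>. of_real (gauss (0 + t *\<^sub>R \<xi>)) * cis ((0 + t *\<^sub>R \<xi>) \<bullet> (z /\<^sub>R t)) \<partial>lborel)"
    unfolding inner by simp
  also have "\<dots> = of_real (1 / t ^ ?n) * (\<integral>\<xi>. of_real (gauss \<xi>) * cis (\<xi> \<bullet> (z /\<^sub>R t)) \<partial>lborel)"
    by (subst lborel_integral_affine[of t "\<lambda>\<xi>. of_real (gauss \<xi>) * cis (\<xi> \<bullet> (z /\<^sub>R t))" 0])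
      (use t in auto)
  also have "(\<integral>\<xi>. of_real (gauss \<xi>) * cis (\<xi> \<bullet> (z /\<^sub>R t)) \<partial>lborel) = of_real (1 / c * gauss (z /\<^sub>R t))"
    unfolding gauss_fourier gauss_eq[of "z /\<^sub>R t"] c_def[symmetric] using c by simp
  also have "of_real (1 / c) * (of_real (1 / t ^ ?n) * complex_of_real (1 / c * gauss (z /\<^sub>R t))) 
     = of_real ((1 / c * (1 / c)) / t ^ ?n * gauss (z /\<^sub>R t))" by simp
  finally show ?thesis unfolding c2 .
qed

lemma integrable_cis:
  fixes f :: "'a::euclidean_space \<Rightarrow> complex"
  assumes f: "integrable lborel f"
  shows "integrable lborel (\<lambda>x. f x * cis (s * (x \<bullet> \<xi>)))" "norm (\<integral>x. f x * cis (s * (x \<bullet> \<xi>)) \<partial>lborel) \<le> (\<integral>x. norm (f x) \<partial>lborel)"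
proof -
  have [measurable]: "f \<in> borel_measurable borel" using f by auto
  show 1: "integrable lborel (\<lambda>x. f x * cis (s * (x \<bullet> \<xi>)))"
    by (rule Bochner_Integration.integrable_bound[OF f]) (auto simp: norm_mult cis_conv_exp)
  have "norm (\<integral>x. f x * cis (s * (x \<bullet> \<xi>)) \<partial>lborel) \<le> (\<integral>x. norm (f x * cis (s * (x \<bullet> \<xi>))) \<partial>lborel)"
    by (rule integral_norm_bound)
  then show "norm (\<integral>x. f x * cis (s * (x \<bullet> \<xi>)) \<partial>lborel) \<le> (\<integral>x. norm (f x) \<partial>lborel)"
    by (simp add: norm_mult)
qed

definition fourier :: "('a::euclidean_space \<Rightarrow> complex) \<Rightarrow> 'a \<Rightarrow> complex" where
  "fourier v \<xi> = (\<integral>x. v x * cis (- (x \<bullet> \<xi>)) \<partial>lborel)"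

lemma fourier_kernel_measurable [measurable]:
  fixes f :: "'a::euclidean_space \<Rightarrow> complex"
  assumes [measurable]: "f \<in> borel_measurable borel"
  shows "(\<lambda>\<xi>. \<integral>x. f x * cis (s * (x \<bullet> \<xi>)) \<partial>lborel) \<in> borel_measurable borel"
proof -
  have "continuous_on UNIV (\<lambda>p::'a \<times> 'a. cis (s * (snd p \<bullet> fst p)))" 
    unfolding cis_conv_exp by (intro continuous_intros)
  then have "(\<lambda>p::'a \<times> 'a. cis (s * (snd p \<bullet> fst p))) \<in> borel_measurable borel"
    by (rule borel_measurable_continuous_onI)
  then have [measurable]: "(\<lambda>p. cis (s * (snd p \<bullet> fst p))) \<in> borel_measurable (borel \<Otimes>\<^sub>M (borel :: 'a measure))"
    by (simp only: borel_prod)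
  have "(\<lambda>p. f (snd p) * cis (s * (snd p \<bullet> fst p))) \<in> borel_measurable (borel \<Otimes>\<^sub>M (borel :: 'a measure))"
    by measurable
  then have "(\<lambda>(\<xi>, x). f x * cis (s * (x \<bullet> \<xi>))) \<in> borel_measurable (borel \<Otimes>\<^sub>M (lborel :: 'a measure))"
    by (simp add: case_prod_beta' measurable_cong_sets[OF sets_pair_measure_cong[OF refl sets_lborel] refl])
  then show ?thesis by (rule lborel.borel_measurable_lebesgue_integral[of _ borel, unfolded case_prod_conv])
qed

text \<open>Inversion tested against \<open>\<phi>\<close>. Damping the frequency integral by wide Gaussians and
  exchanging integrations replaces the inner integral by a Gaussian average of \<open>\<phi>\<close> near
  \<open>y\<close>; both sides converge by dominated convergence. The weak form avoids all statements about almost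
  every point.\<close>

theorem fourier_inversion_weak:
  fixes v \<phi> :: "'a::euclidean_space \<Rightarrow> complex"
  assumes v: "integrable lborel v" and Fv: "integrable lborel (fourier v)"
    and \<phi>: "integrable lborel \<phi>" "continuous_on UNIV \<phi>" and B: "\<And>x. norm (\<phi> x) \<le> B"
  shows "(\<integral>x. v x * \<phi> x \<partial>lborel) = 
     (\<integral>x. \<phi> x * (of_real (1 / (2 * pi) ^ DIM('a)) * (\<integral>\<xi>. fourier v \<xi> * cis (x \<bullet> \<xi>) \<partial>lborel)) \<partial>lborel)"
proof -
  let ?n = "DIM('a)"
  define w :: complex where "w = of_real ((2 * pi) ^ ?n)"
  have w: "w \<noteq> 0" by (simp add: w_def)
  have [measurable]: "v \<in> borel_measurable borel" "fourier v \<in> borel_measurable borel" "\<phi> \<in> borel_measurable borel"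
    using v Fv \<phi> by auto
  define \<Phi> where "\<Phi> \<xi> = (\<integral>x. \<phi> x * cis (x \<bullet> \<xi>) \<partial>lborel)" for \<xi>
  have \<Phi>m[measurable]: "\<Phi> \<in> borel_measurable borel"
    unfolding \<Phi>_def[abs_def] using fourier_kernel_measurable[of \<phi> 1] by simp
  have \<Phi>b: "norm (\<Phi> \<xi>) \<le> (\<integral>x. norm (\<phi> x) \<partial>lborel)" for \<xi>
    unfolding \<Phi>_def using integrable_cis(2)[OF \<phi>(1), of 1] by simp
  define t where "t k = 1 / real (Suc k)" for k
  have t: "t k > 0" for k by (simp add: t_def)
  have t0: "t \<longlonglongrightarrow> 0" unfolding t_def by (rule LIMSEQ_Suc[OF lim_1_over_n])
  define E where "E k \<xi> = complex_of_real (exp (- (norm (t k *\<^sub>R \<xi>))\<^sup>2 / 2))" for k and \<xi> :: 'a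
  have [measurable]: "E k \<in> borel_measurable borel" for k unfolding E_def[abs_def] by measurable
  have E1: "norm (E k \<xi>) \<le> 1" for k \<xi> by (simp add: E_def)
  have Eint: "integrable lborel (E k)" for k
  proof -
    have "integrable lborel (\<lambda>x::'a. of_real (gauss x) :: complex)" by (intro integrable_of_real gauss_integrable)
    then have "integrable lborel (\<lambda>x::'a. of_real (sqrt (2 * pi) ^ ?n) * of_real (gauss x) :: complex)" by simp
    moreover have "of_real (sqrt (2 * pi) ^ ?n) * of_real (gauss x) = (of_real (exp (- (norm x)\<^sup>2 / 2)) :: complex)" for x :: 'a
      unfolding gauss_eq by (simp add: power_one_over)
    ultimately have "integrable lborel (\<lambda>x::'a. of_real (exp (- (norm x)\<^sup>2 / 2)) :: complex)" by (simp only:)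
    from lborel_integrable_affine[OF _ this, of "t k" 0]
    have "integrable lborel (\<lambda>x::'a. of_real (exp (- (norm (t k *\<^sub>R x))\<^sup>2 / 2)) :: complex)" using t[of k] by simp
    then show ?thesis unfolding E_def[abs_def] .
  qed
  \<comment> \<open>The damped double integral, whose limit is computed in both orders of integration.\<close>
  define I where "I k = (\<integral>\<xi>. (\<Phi> \<xi> * E k \<xi>) * fourier v \<xi> \<partial>lborel)" for k
  have lim1: "I \<longlonglongrightarrow> (\<integral>\<xi>. \<Phi> \<xi> * fourier v \<xi> \<partial>lborel)"
    unfolding I_def
  proof (rule integral_dominated_convergence[where w = "\<lambda>\<xi>. (\<integral>x. norm (\<phi> x) \<partial>lborel) * norm (fourier v \<xi>)"])
    show "AE \<xi> in lborel. (\<lambda>k. \<Phi> \<xi> * E k \<xi> * fourier v \<xi>) \<longlonglongrightarrow> \<Phi> \<xi> * fourier v \<xi>"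
    proof (intro AE_I2)
      fix \<xi> :: 'a
      have "(\<lambda>k. E k \<xi>) \<longlonglongrightarrow> of_real (exp (- (norm (0 *\<^sub>R \<xi>))\<^sup>2 / 2))"
        unfolding E_def by (intro tendsto_intros t0) auto
      then have "(\<lambda>k. \<Phi> \<xi> * E k \<xi> * fourier v \<xi>) \<longlonglongrightarrow> \<Phi> \<xi> * 1 * fourier v \<xi>"
        by (intro tendsto_mult tendsto_const) auto
      then show "(\<lambda>k. \<Phi> \<xi> * E k \<xi> * fourier v \<xi>) \<longlonglongrightarrow> \<Phi> \<xi> * fourier v \<xi>" by simp
    qed
    show "AE \<xi> in lborel. norm (\<Phi> \<xi> * E k \<xi> * fourier v \<xi>) \<le> (\<integral>x. norm (\<phi> x) \<partial>lborel) * norm (fourier v \<xi>)" for k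
      unfolding norm_mult
      by (intro AE_I2 mult_right_mono) (use mult_mono[OF \<Phi>b E1] in \<open>auto simp: order_trans\<close>)
  qed (use Fv in auto)
  have e1: "(\<integral>\<xi>. \<Phi> \<xi> * fourier v \<xi> \<partial>lborel) = (\<integral>x. \<phi> x * (\<integral>\<xi>. fourier v \<xi> * cis (x \<bullet> \<xi>) \<partial>lborel) \<partial>lborel)"
  proof -
    have "(\<integral>\<xi>. \<Phi> \<xi> * fourier v \<xi> \<partial>lborel) = (\<integral>\<xi>. fourier v \<xi> * (\<integral>x. \<phi> x * cis (1 * (\<xi> \<bullet> x)) \<partial>lborel) \<partial>lborel)"
      unfolding \<Phi>_def by (intro Bochner_Integration.integral_cong refl) (simp add: inner_commute)
    also have "\<dots> = (\<integral>x. \<phi> x * (\<integral>\<xi>. fourier v \<xi> * cis (1 * (\<xi> \<bullet> x)) \<partial>lborel) \<partial>lborel)"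
      by (rule integral_swap_bounded_kernel[OF Fv \<phi>(1) cis_inner_pair_measurable]) simp
    finally show ?thesis by (simp add: inner_commute)
  qed
  have e2: "I k = (\<integral>y. v y * (w * (\<integral>z. \<phi> (y + t k *\<^sub>R z) * of_real (gauss z) \<partial>lborel)) \<partial>lborel)" for k
  proof -
    have G: "integrable lborel (\<lambda>\<xi>. \<Phi> \<xi> * E k \<xi>)"
    proof (rule Bochner_Integration.integrable_bound)
      show "integrable lborel (\<lambda>\<xi>. of_real (\<integral>x. norm (\<phi> x) \<partial>lborel) * E k \<xi>)" using Eint by simp
      show "AE \<xi> in lborel. norm (\<Phi> \<xi> * E k \<xi>) \<le> norm (complex_of_real (\<integral>x. norm (\<phi> x) \<partial>lborel) * E k \<xi>)"
        using \<Phi>b by (intro AE_I2) (auto simp: norm_mult intro!: mult_right_mono order_trans[OF \<Phi>b])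
    qed measurable
    have K1: "(\<integral>\<xi>. (\<Phi> \<xi> * E k \<xi>) * cis (- (y \<bullet> \<xi>)) \<partial>lborel) = w * (\<integral>z. \<phi> (y + t k *\<^sub>R z) * of_real (gauss z) \<partial>lborel)" for y
    proof -
      have K: "(\<integral>\<xi>. (E k \<xi> * cis (- (y \<bullet> \<xi>))) * cis (x \<bullet> \<xi>) \<partial>lborel) = 
         w * of_real (1 / t k ^ ?n * gauss ((x - y) /\<^sub>R t k))" for x
      proof -
        have "(E k \<xi> * cis (- (y \<bullet> \<xi>))) * cis (x \<bullet> \<xi>) = E k \<xi> * cis ((x - y) \<bullet> \<xi>)" for \<xi>
          by (simp add: mult.assoc cis_mult inner_diff_left)
        then have "(\<integral>\<xi>. (E k \<xi> * cis (- (y \<bullet> \<xi>))) * cis (x \<bullet> \<xi>) \<partial>lborel) = (\<integral>\<xi>. E k \<xi> * cis ((x - y) \<bullet> \<xi>) \<partial>lborel)"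
          by (simp only:)
        also have "\<dots> = of_real ((2 * pi) ^ ?n / t k ^ ?n * gauss ((x - y) /\<^sub>R t k))"
          unfolding E_def by (rule gauss_scaled_fourier[OF t])
        finally show ?thesis by (simp add: w_def)
      qed
      have Ec: "integrable lborel (\<lambda>\<xi>. E k \<xi> * cis (- (y \<bullet> \<xi>)))"
        using integrable_cis(1)[OF Eint, of k "-1" y] by (simp add: inner_commute)
      have "(\<integral>\<xi>. (\<Phi> \<xi> * E k \<xi>) * cis (- (y \<bullet> \<xi>)) \<partial>lborel) = 
         (\<integral>\<xi>. (E k \<xi> * cis (- (y \<bullet> \<xi>))) * (\<integral>x. \<phi> x * cis (x \<bullet> \<xi>) \<partial>lborel) \<partial>lborel)"
        unfolding \<Phi>_def[symmetric] by (intro Bochner_Integration.integral_cong refl) (simp only: mult.commute mult.left_commute)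
      also have "\<dots> = (\<integral>x. \<phi> x * (\<integral>\<xi>. (E k \<xi> * cis (- (y \<bullet> \<xi>))) * cis (x \<bullet> \<xi>) \<partial>lborel) \<partial>lborel)"
      proof -
        have "(\<integral>\<xi>. (E k \<xi> * cis (- (y \<bullet> \<xi>))) * (\<integral>x. \<phi> x * cis (1 * (\<xi> \<bullet> x)) \<partial>lborel) \<partial>lborel)
          = (\<integral>x. \<phi> x * (\<integral>\<xi>. (E k \<xi> * cis (- (y \<bullet> \<xi>))) * cis (1 * (\<xi> \<bullet> x)) \<partial>lborel) \<partial>lborel)"
          by (rule integral_swap_bounded_kernel[OF Ec \<phi>(1) cis_inner_pair_measurable]) simp
        then show ?thesis by (simp only: inner_commute mult_1)
      qed
      also have "\<dots> = (\<integral>x. \<phi> x * (w * of_real (1 / t k ^ ?n * gauss ((x - y) /\<^sub>R t k))) \<partial>lborel)"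
        unfolding K ..
      also have "\<dots> =
        of_real (t k ^ ?n) * (\<integral>z. \<phi> (y + t k *\<^sub>R z) * (w * of_real (1 / t k ^ ?n * gauss z)) \<partial>lborel)"
      proof -
        let ?f = "\<lambda>x. \<phi> x * (w * of_real (1 / t k ^ ?n * gauss ((x - y) /\<^sub>R t k)))"
        have f: "?f \<in> borel_measurable borel" by measurable
        have "(\<integral>x. ?f x \<partial>lborel) = of_real (\<bar>t k\<bar> ^ ?n) * (\<integral>z. ?f (y + t k *\<^sub>R z) \<partial>lborel)"
          by (rule lborel_integral_affine[OF _ f]) (use t[of k] in simp)
        moreover have "(y + t k *\<^sub>R z - y) /\<^sub>R t k = z" for z using t[of k] by simp
        ultimately show ?thesis using t[of k] by (simp only: abs_of_pos)
      qed
      also have "\<dots> = of_real (t k ^ ?n) * (\<integral>z. (of_real (1 / t k ^ ?n) * w) * (\<phi> (y + t k *\<^sub>R z) * of_real (gauss z)) \<partial>lborel)"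
        by (simp only: of_real_mult mult.commute mult.left_commute)
      also have "\<dots> = w * (\<integral>z. \<phi> (y + t k *\<^sub>R z) * of_real (gauss z) \<partial>lborel)"
        using t[of k] by (subst integral_mult_right_zero) simp
      finally show ?thesis .
    qed
    have "I k = (\<integral>y. v y * (\<integral>\<xi>. (\<Phi> \<xi> * E k \<xi>) * cis (- (y \<bullet> \<xi>)) \<partial>lborel) \<partial>lborel)"
    proof -
      have "I k = (\<integral>\<xi>. (\<Phi> \<xi> * E k \<xi>) * (\<integral>y. v y * cis ((-1) * (\<xi> \<bullet> y)) \<partial>lborel) \<partial>lborel)"
        unfolding I_def fourier_def by (simp add: inner_commute)
      also have "\<dots> = (\<integral>y. v y * (\<integral>\<xi>. (\<Phi> \<xi> * E k \<xi>) * cis ((-1) * (\<xi> \<bullet> y)) \<partial>lborel) \<partial>lborel)"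
        by (rule integral_swap_bounded_kernel[OF G v cis_inner_pair_measurable]) simp
      finally show ?thesis by (simp add: inner_commute)
    qed
    then show ?thesis unfolding K1 .
  qed
  have Bn: "B \<ge> 0" using B[of 0] norm_ge_zero order_trans by blast
  have lim2: "I \<longlonglongrightarrow> (\<integral>y. v y * (w * \<phi> y) \<partial>lborel)"
    unfolding e2
  proof (rule integral_dominated_convergence[where w = "\<lambda>y. norm (v y) * (norm w * B)"])
    have inner: "(\<lambda>k. \<integral>z. \<phi> (y + t k *\<^sub>R z) * of_real (gauss z) \<partial>lborel) \<longlonglongrightarrow> \<phi> y" for y
    proof -
      have "(\<lambda>k. \<integral>z. \<phi> (y + t k *\<^sub>R z) * of_real (gauss z) \<partial>lborel) \<longlonglongrightarrow> (\<integral>z. \<phi> y * of_real (gauss (z::'a)) \<partial>lborel)"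
      proof (rule integral_dominated_convergence[where w = "\<lambda>z::'a. B * norm (gauss z)"])
        show "AE z in lborel. (\<lambda>k. \<phi> (y + t k *\<^sub>R z) * of_real (gauss z)) \<longlonglongrightarrow> \<phi> y * of_real (gauss z)"
        proof (intro AE_I2 tendsto_mult tendsto_const)
          fix z
          have "(\<lambda>k. y + t k *\<^sub>R z) \<longlonglongrightarrow> y + 0 *\<^sub>R z" by (intro tendsto_intros t0)
          then show "(\<lambda>k. \<phi> (y + t k *\<^sub>R z)) \<longlonglongrightarrow> \<phi> y"
            using \<phi>(2) continuous_on_tendsto_compose[of UNIV \<phi> _ y] by simp
        qed
        show "AE z in lborel. norm (\<phi> (y + t k *\<^sub>R z) * of_real (gauss z)) \<le> B * norm (gauss z)" for k
          using B by (intro AE_I2) (auto simp: norm_mult intro!: mult_right_mono)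
      qed (use gauss_integrable in auto)
      then show ?thesis by (simp add: gauss_integral)
    qed
    then show "AE y in lborel. (\<lambda>k. v y * (w * (\<integral>z. \<phi> (y + t k *\<^sub>R z) * of_real (gauss z) \<partial>lborel))) \<longlonglongrightarrow> v y * (w * \<phi> y)"
      by (intro AE_I2 tendsto_mult tendsto_const)
    have "norm (\<integral>z. \<phi> (y + t k *\<^sub>R z) * of_real (gauss z) \<partial>lborel) \<le> B" for y k
    proof -
      have b: "norm (\<phi> (y + t k *\<^sub>R z) * of_real (gauss z)) \<le> B * gauss z" for z
        using B[of "y + t k *\<^sub>R z"] by (simp add: norm_mult gauss_nonneg mult_right_mono)
      have i: "integrable lborel (\<lambda>z. \<phi> (y + t k *\<^sub>R z) * of_real (gauss z))"
        by (rule Bochner_Integration.integrable_bound[of _ "\<lambda>z::'a. B * gauss z"])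
          (use gauss_integrable order_trans[OF b abs_ge_self] in auto)
      have "norm (\<integral>z. \<phi> (y + t k *\<^sub>R z) * of_real (gauss z) \<partial>lborel)
         \<le> (\<integral>z. norm (\<phi> (y + t k *\<^sub>R z) * of_real (gauss z)) \<partial>lborel)"
        by (rule Bochner_Integration.integral_norm_bound)
      also have "\<dots> \<le> (\<integral>z. B * gauss (z::'a) \<partial>lborel)"
        by (rule Bochner_Integration.integral_mono) (use i b gauss_integrable in auto)
      finally show ?thesis by (simp add: gauss_integral)
    qed
    then show "AE y in lborel. norm (v y * (w * (\<integral>z. \<phi> (y + t k *\<^sub>R z) * of_real (gauss z) \<partial>lborel))) \<le> norm (v y) * (norm w * B)" for k
      by (intro AE_I2) (auto simp: norm_mult intro!: mult_left_mono)
    show "(\<lambda>y. v y * (w * (\<integral>z. \<phi> (y + t k *\<^sub>R z) * of_real (gauss z) \<partial>lborel))) \<in> borel_measurable lborel" for k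
    proof -
      have "(\<lambda>(y, z). \<phi> (y + t k *\<^sub>R z) * of_real (gauss z)) \<in> borel_measurable (borel \<Otimes>\<^sub>M lborel)"
        by measurable
      then have [measurable]: "(\<lambda>y. \<integral>z. \<phi> (y + t k *\<^sub>R z) * of_real (gauss z) \<partial>lborel) \<in> borel_measurable borel"
        by (rule lborel.borel_measurable_lebesgue_integral[of _ borel, unfolded case_prod_conv])
      show ?thesis by measurable
    qed
  qed (use v in auto)
  have "(\<integral>y. v y * (w * \<phi> y) \<partial>lborel) = (\<integral>x. \<phi> x * (\<integral>\<xi>. fourier v \<xi> * cis (x \<bullet> \<xi>) \<partial>lborel) \<partial>lborel)"
    using LIMSEQ_unique[OF lim2 lim1] e1 by simp
  then have "w * (\<integral>y. v y * \<phi> y \<partial>lborel) = (\<integral>x. \<phi> x * (\<integral>\<xi>. fourier v \<xi> * cis (x \<bullet> \<xi>) \<partial>lborel) \<partial>lborel)"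
    by (simp add: mult.left_commute[of _ w])
  then have "(\<integral>y. v y * \<phi> y \<partial>lborel) = of_real (1 / (2 * pi) ^ ?n) * (\<integral>x. \<phi> x * (\<integral>\<xi>. fourier v \<xi> * cis (x \<bullet> \<xi>) \<partial>lborel) \<partial>lborel)"
    using w by (simp add: w_def field_simps)
  then show ?thesis by (simp add: mult.left_commute[of _ "of_real _"])
qed

text \<open>Differentiation under the integral: the second-order Taylor remainder of the exponential is dominated by
  the second moment of \<open>F\<close>.\<close>

lemma inverse_fourier_has_derivative:
  fixes F :: "'a::euclidean_space \<Rightarrow> complex"
  assumes F: "\<And>m. integrable lborel (\<lambda>\<xi>. of_real (norm \<xi> ^ m) * F \<xi>)"
  shows "((\<lambda>x. \<integral>\<xi>. F \<xi> * cis (x \<bullet> \<xi>) \<partial>lborel) has_derivative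
     (\<lambda>h. \<integral>\<xi>. (\<i> * of_real (h \<bullet> \<xi>) * F \<xi>) * cis (x \<bullet> \<xi>) \<partial>lborel)) (at x)"
proof -
  have F0: "integrable lborel F" using F[of 0] by simp
  then have [measurable]: "F \<in> borel_measurable borel" by auto
  let ?g = "\<lambda>x. \<integral>\<xi>. F \<xi> * cis (x \<bullet> \<xi>) \<partial>lborel"
  let ?g' = "\<lambda>h. \<integral>\<xi>. (\<i> * of_real (h \<bullet> \<xi>) * F \<xi>) * cis (x \<bullet> \<xi>) \<partial>lborel"
  have i0: "integrable lborel (\<lambda>\<xi>. F \<xi> * cis (y \<bullet> \<xi>))" for y
    by (rule Bochner_Integration.integrable_bound[OF F0]) (auto simp: norm_mult)
  have i1: "integrable lborel (\<lambda>\<xi>. (\<i> * of_real (h \<bullet> \<xi>) * F \<xi>) * cis (x \<bullet> \<xi>))" for h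
  proof (rule Bochner_Integration.integrable_bound)
    show "integrable lborel (\<lambda>\<xi>. of_real (norm h) * (of_real (norm \<xi> ^ 1) * F \<xi>))"
      using F[of 1] by simp
    show "AE \<xi> in lborel. norm ((\<i> * of_real (h \<bullet> \<xi>) * F \<xi>) * cis (x \<bullet> \<xi>)) \<le> norm (complex_of_real (norm h) * (of_real (norm \<xi> ^ 1) * F \<xi>))"
    proof (rule AE_I2)
      fix \<xi> :: 'a
      have "\<bar>h \<bullet> \<xi>\<bar> * norm (F \<xi>) \<le> (norm h * norm \<xi>) * norm (F \<xi>)" by (intro mult_right_mono Cauchy_Schwarz_ineq2) auto
      then show "norm ((\<i> * of_real (h \<bullet> \<xi>) * F \<xi>) * cis (x \<bullet> \<xi>)) \<le> norm (complex_of_real (norm h) * (of_real (norm \<xi> ^ 1) * F \<xi>))"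
        by (simp add: norm_mult mult.assoc)
    qed
  qed measurable
  have n2: "integrable lborel (\<lambda>\<xi>. norm \<xi> ^ 2 * norm (F \<xi>))"
    using integrable_norm[OF F[of 2]] by (simp add: norm_mult norm_power)
  define C where "C = (\<integral>\<xi>. norm \<xi> ^ 2 * norm (F \<xi>) \<partial>lborel) / 2"
  have bound: "norm (?g (x + h) - ?g x - ?g' h) \<le> C * norm h ^ 2" for h
  proof -
    have eq: "?g (x + h) - ?g x - ?g' h = (\<integral>\<xi>. F \<xi> * cis ((x + h) \<bullet> \<xi>) - F \<xi> * cis (x \<bullet> \<xi>) - (\<i> * of_real (h \<bullet> \<xi>) * F \<xi>) * cis (x \<bullet> \<xi>) \<partial>lborel)"
      by (simp only: Bochner_Integration.integral_diff i0 i1 Bochner_Integration.integrable_diff)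
    have "norm (\<integral>\<xi>. F \<xi> * cis ((x + h) \<bullet> \<xi>) - F \<xi> * cis (x \<bullet> \<xi>) - (\<i> * of_real (h \<bullet> \<xi>) * F \<xi>) * cis (x \<bullet> \<xi>) \<partial>lborel)
      \<le> (\<integral>\<xi>. norm (F \<xi> * cis ((x + h) \<bullet> \<xi>) - F \<xi> * cis (x \<bullet> \<xi>) - (\<i> * of_real (h \<bullet> \<xi>) * F \<xi>) * cis (x \<bullet> \<xi>)) \<partial>lborel)"
      by (rule Bochner_Integration.integral_norm_bound)
    also have "\<dots> \<le> (\<integral>\<xi>. norm h ^ 2 / 2 * (norm \<xi> ^ 2 * norm (F \<xi>)) \<partial>lborel)"
    proof (rule Bochner_Integration.integral_mono)
      show "integrable lborel (\<lambda>\<xi>. norm (F \<xi> * cis ((x + h) \<bullet> \<xi>) - F \<xi> * cis (x \<bullet> \<xi>) - (\<i> * of_real (h \<bullet> \<xi>) * F \<xi>) * cis (x \<bullet> \<xi>)))"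
        by (intro integrable_norm Bochner_Integration.integrable_diff i0 i1)
      show "integrable lborel (\<lambda>\<xi>. norm h ^ 2 / 2 * (norm \<xi> ^ 2 * norm (F \<xi>)))" using n2 by simp
      fix \<xi> :: 'a
      let ?s = "h \<bullet> \<xi>"
      have e: "norm (cis ?s - 1 - \<i> * of_real ?s) \<le> ?s ^ 2 / 2"
      proof -
        have "(\<Sum>k\<le>1. (\<i> * complex_of_real ?s) ^ k / fact k) = 1 + \<i> * of_real ?s" by simp
        moreover have "\<bar>?s\<bar> ^ Suc 1 / fact (Suc 1) = ?s ^ 2 / 2" by (simp add: power2_eq_square)
        ultimately show ?thesis using iexp_approx1[of ?s 1] unfolding cis_conv_exp diff_diff_eq by (simp only:)
      qed
      have "F \<xi> * cis ((x + h) \<bullet> \<xi>) - F \<xi> * cis (x \<bullet> \<xi>) - (\<i> * of_real ?s * F \<xi>) * cis (x \<bullet> \<xi>)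
         = F \<xi> * cis (x \<bullet> \<xi>) * (cis ?s - 1 - \<i> * of_real ?s)"
        by (simp only: inner_add_left cis_mult[symmetric, of "x \<bullet> \<xi>" "h \<bullet> \<xi>"] right_diff_distrib) (simp add: mult.assoc mult.left_commute)
      then have "norm (F \<xi> * cis ((x + h) \<bullet> \<xi>) - F \<xi> * cis (x \<bullet> \<xi>) - (\<i> * of_real ?s * F \<xi>) * cis (x \<bullet> \<xi>)) 
        = norm (F \<xi>) * norm (cis ?s - 1 - \<i> * of_real ?s)" by (simp add: norm_mult)
      also have "\<dots> \<le> norm (F \<xi>) * (?s ^ 2 / 2)" by (intro mult_left_mono e) auto
      also have "\<dots> \<le> norm (F \<xi>) * ((norm h * norm \<xi>) ^ 2 / 2)"
        using power_mono[OF Cauchy_Schwarz_ineq2[of h \<xi>], of 2] by (intro mult_left_mono divide_right_mono) auto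
      also have "\<dots> = norm h ^ 2 / 2 * (norm \<xi> ^ 2 * norm (F \<xi>))" by (simp add: power_mult_distrib)
      finally show "norm (F \<xi> * cis ((x + h) \<bullet> \<xi>) - F \<xi> * cis (x \<bullet> \<xi>) - (\<i> * of_real ?s * F \<xi>) * cis (x \<bullet> \<xi>))
         \<le> norm h ^ 2 / 2 * (norm \<xi> ^ 2 * norm (F \<xi>))" .
    qed
    also have "\<dots> = C * norm h ^ 2" by (simp add: C_def)
    finally show ?thesis unfolding eq .
  qed
  have lin: "linear ?g'"
  proof (rule linearI)
    let ?A = "\<lambda>h \<xi>. (\<i> * of_real (h \<bullet> \<xi>) * F \<xi>) * cis (x \<bullet> \<xi>)"
    show "?g' (h + k) = ?g' h + ?g' k" for h k
    proof -
      have "?A (h + k) = (\<lambda>\<xi>. ?A h \<xi> + ?A k \<xi>)"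
        by (rule ext) (simp only: inner_add_left of_real_add distrib_left distrib_right)
      then show ?thesis using Bochner_Integration.integral_add[OF i1[of h] i1[of k]] by (simp only:)
    qed
    show "?g' (r *\<^sub>R h) = r *\<^sub>R ?g' h" for r h
    proof -
      have "?A (r *\<^sub>R h) = (\<lambda>\<xi>. r *\<^sub>R ?A h \<xi>)"
        by (rule ext) (simp add: scaleR_conv_of_real)
      then show ?thesis by (simp only: integral_scaleR_right)
    qed
  qed
  show ?thesis
  proof (rule has_derivativeI_sandwich[of 1 ?g' UNIV x ?g "\<lambda>y. C * norm (y - x)"])
    show "bounded_linear ?g'" using lin linear_conv_bounded_linear by blast
    have "((\<lambda>y. C * norm (y - x)) \<longlongrightarrow> C * norm (x - x)) (at x)" by (intro tendsto_intros)
    then show "((\<lambda>y. C * norm (y - x)) \<longlongrightarrow> 0) (at x)" by simp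
    fix y assume "y \<noteq> x"
    then have "norm (?g y - ?g x - ?g' (y - x)) / norm (y - x) \<le> C * norm (y - x) ^ 2 / norm (y - x)"
      using bound[of "y - x"] by (intro divide_right_mono) auto
    then show "norm (?g y - ?g x - ?g' (y - x)) / norm (y - x) \<le> C * norm (y - x)"
      using \<open>y \<noteq> x\<close> by (simp add: power2_eq_square)
  qed auto
qed

lemma inverse_fourier_moment:
  fixes F :: "real ^ 'n::finite \<Rightarrow> complex"
  assumes F: "\<And>m. integrable lborel (\<lambda>\<xi>. of_real (norm \<xi> ^ m) * F \<xi>)"
  shows "integrable lborel (\<lambda>\<xi>. of_real (norm \<xi> ^ m) * (\<i> * of_real (\<xi> $ i) * F \<xi>))"
proof (rule Bochner_Integration.integrable_bound[OF F[of "Suc m"]])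
  have [measurable]: "F \<in> borel_measurable borel" using F[of 0] by auto
  show "(\<lambda>\<xi>. of_real (norm \<xi> ^ m) * (\<i> * of_real (\<xi> $ i) * F \<xi>)) \<in> borel_measurable lborel"
    by measurable
  show "AE \<xi> in lborel. norm (of_real (norm \<xi> ^ m) * (\<i> * of_real (\<xi> $ i) * F \<xi>)) \<le> norm (of_real (norm \<xi> ^ Suc m) * F \<xi>)"
  proof (rule AE_I2)
    fix \<xi> :: "real ^ 'n"
    have "norm \<xi> ^ m * (\<bar>\<xi> $ i\<bar> * norm (F \<xi>)) \<le> norm \<xi> ^ m * (norm \<xi> * norm (F \<xi>))"
      by (intro mult_left_mono mult_right_mono component_le_norm_cart) auto
    then show "norm (of_real (norm \<xi> ^ m) * (\<i> * of_real (\<xi> $ i) * F \<xi>)) \<le> norm (of_real (norm \<xi> ^ Suc m) * F \<xi>)"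
      by (simp add: norm_mult norm_power mult.assoc mult.left_commute)
  qed
qed

text \<open>Each differentiation multiplies \<open>F\<close> by one component of the frequency, which preserves the
  finiteness of all moments and costs one power of its norm.\<close>

lemma inverse_fourier_partials:
  fixes F :: "real ^ 'n::finite \<Rightarrow> complex"
  assumes F: "\<And>m. integrable lborel (\<lambda>\<xi>. of_real (norm \<xi> ^ m) * F \<xi>)"
  shows "smooth_on UNIV (\<lambda>x. \<integral>\<xi>. F \<xi> * cis (x \<bullet> \<xi>) \<partial>lborel)"
    and "norm (partials is (\<lambda>x. \<integral>\<xi>. F \<xi> * cis (x \<bullet> \<xi>) \<partial>lborel) x) \<le> (\<integral>\<xi>. norm \<xi> ^ length is * norm (F \<xi>) \<partial>lborel)"
proof -
  let ?g = "\<lambda>(F :: real ^ 'n \<Rightarrow> complex) (x :: real ^ 'n). \<integral>\<xi>. F \<xi> * cis (x \<bullet> \<xi>) \<partial>lborel"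
  let ?P = "\<lambda>F :: real ^ 'n \<Rightarrow> complex. \<forall>m. integrable lborel (\<lambda>\<xi>. of_real (norm \<xi> ^ m) * F \<xi>)"
  have part: "partial i (?g F) = ?g (\<lambda>\<xi>. \<i> * of_real (\<xi> $ i) * F \<xi>)" if "?P F" for F :: "real ^ 'n \<Rightarrow> complex" and i
  proof
    fix x
    show "partial i (?g F) x = ?g (\<lambda>\<xi>. \<i> * of_real (\<xi> $ i) * F \<xi>) x"
      using has_derivative_partial(1)[OF inverse_fourier_has_derivative[OF that[rule_format]], of i x]
      by (simp add: inner_axis' )
  qed
  have diff: "?g F differentiable (at x)" if "?P F" for F and x :: "real ^ 'n"
    using inverse_fourier_has_derivative[OF that[rule_format]] by (auto simp: differentiable_def)
  show "smooth_on UNIV (?g F)"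
  proof (rule smooth_on_coinduct[of UNIV "\<lambda>f. \<exists>F. ?P F \<and> f = ?g F"])
    show "\<exists>F'. ?P F' \<and> ?g F = ?g F'" using F by blast
    fix f assume "\<exists>F. ?P F \<and> f = ?g F"
    then obtain G where G: "?P G" "f = ?g G" by blast
    have "\<exists>g. (\<exists>F. ?P F \<and> g = ?g F) \<and> (\<forall>x\<in>UNIV. partial i f x = g x)" for i
    proof -
      let ?G = "\<lambda>\<xi>. \<i> * of_real (\<xi> $ i) * G \<xi>"
      have 1: "?P ?G" using inverse_fourier_moment[OF G(1)[rule_format]] by simp
      have 2: "\<forall>x\<in>UNIV. partial i f x = ?g ?G x" unfolding G(2) part[OF G(1)] by simp
      show ?thesis
        by (rule exI[of _ "?g ?G"], rule conjI, rule exI[of _ ?G], rule conjI, rule 1, rule refl, rule 2)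
    qed
    then show "(\<forall>x\<in>UNIV. f differentiable at x) \<and> (\<forall>i. \<exists>g. (\<exists>F. ?P F \<and> g = ?g F) \<and> (\<forall>x\<in>UNIV. partial i f x = g x))"
      using diff[OF G(1)] unfolding G(2) by blast
  qed simp
  show "norm (partials is (?g F) x) \<le> (\<integral>\<xi>. norm \<xi> ^ length is * norm (F \<xi>) \<partial>lborel)"
    using F
  proof (induction "is" arbitrary: F rule: rev_induct)
    case Nil
    have "norm (?g F x) \<le> (\<integral>\<xi>. norm (F \<xi> * cis (x \<bullet> \<xi>)) \<partial>lborel)" by (rule Bochner_Integration.integral_norm_bound)
    then show ?case by (simp add: norm_mult)
  next
    case (snoc i "is")
    let ?F = "\<lambda>\<xi>. \<i> * of_real (\<xi> $ i) * F \<xi>"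
    have P: "?P F" using snoc.prems by blast
    have P': "integrable lborel (\<lambda>\<xi>. of_real (norm \<xi> ^ m) * ?F \<xi>)" for m
      by (rule inverse_fourier_moment[OF snoc.prems])
    have "norm (partials (is @ [i]) (?g F) x) = norm (partials is (?g ?F) x)" by (simp add: part[OF P])
    also have "\<dots> \<le> (\<integral>\<xi>. norm \<xi> ^ length is * norm (?F \<xi>) \<partial>lborel)" by (rule snoc.IH[OF P'])
    also have "\<dots> \<le> (\<integral>\<xi>. norm \<xi> ^ length (is @ [i]) * norm (F \<xi>) \<partial>lborel)"
    proof (rule Bochner_Integration.integral_mono)
      show "integrable lborel (\<lambda>\<xi>. norm \<xi> ^ length is * norm (?F \<xi>))"
        using integrable_norm[OF P'[of "length is"]] by (simp add: norm_mult norm_power)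
      show "integrable lborel (\<lambda>\<xi>. norm \<xi> ^ length (is @ [i]) * norm (F \<xi>))"
        using integrable_norm[OF snoc.prems[of "length (is @ [i])"]] by (simp add: norm_mult norm_power)
      fix \<xi> :: "real ^ 'n"
      have "norm \<xi> ^ length is * (\<bar>\<xi> $ i\<bar> * norm (F \<xi>)) \<le> norm \<xi> ^ length is * (norm \<xi> * norm (F \<xi>))"
        by (intro mult_left_mono mult_right_mono component_le_norm_cart) auto
      then show "norm \<xi> ^ length is * norm (?F \<xi>) \<le> norm \<xi> ^ length (is @ [i]) * norm (F \<xi>)"
        by (simp add: norm_mult mult.assoc mult.left_commute)
    qed
    finally show ?case .
  qed
qed

text \<open>The product weight is integrable by one-dimensional integrals and comparable from below with
  \<open>|x|^(-2n)\<close> at infinity and with a constant on balls; it plays the role of the function \<open>(1 +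
  |x|)^(-2n)\<close> in the frequency estimates.\<close>

lemma integrable_inverse_norm_power:
  defines "W \<equiv> (\<lambda>x::real ^ 'n::finite. \<Prod>b\<in>Basis. 1 / (1 + (x \<bullet> b)\<^sup>2))"
  shows "integrable lborel W" "\<And>x. W x > 0" 
    "\<And>x. norm x \<ge> 1 \<Longrightarrow> 1 / norm x ^ (2 * CARD('n)) \<le> 2 ^ CARD('n) * W x"
    "\<And>x M. norm x \<le> M \<Longrightarrow> M \<ge> 1 \<Longrightarrow> 1 \<le> (2 * M\<^sup>2) ^ CARD('n) * W x"
proof -
  have "integrable lborel (\<lambda>x::real. 1 / (1 + x\<^sup>2))"
    using integrable_inverse_1_plus_square by (simp add: set_integrable_def field_simps)
  then show "integrable lborel W" unfolding W_def by (intro product_integral_euclidean(2))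
  show "W x > 0" for x unfolding W_def by (intro prod_pos) (auto simp: add_pos_nonneg)
  have key: "1 \<le> (1 + M\<^sup>2) ^ CARD('n) * W x" if "norm x \<le> M" for x :: "real ^ 'n" and M
  proof -
    have "(1 / (1 + M\<^sup>2)) ^ CARD('n) = (\<Prod>b\<in>(Basis :: (real ^ 'n) set). 1 / (1 + M\<^sup>2))" by simp
    also have "\<dots> \<le> W x"
      unfolding W_def
    proof (intro prod_mono conjI)
      fix b :: "real ^ 'n" assume "b \<in> Basis"
      then have "\<bar>x \<bullet> b\<bar> \<le> M" using Basis_le_norm[of b x] that by linarith
      then have "\<bar>x \<bullet> b\<bar>\<^sup>2 \<le> M\<^sup>2" by (intro power_mono) auto
      then have "(x \<bullet> b)\<^sup>2 \<le> M\<^sup>2" by simp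
      then show "1 / (1 + M\<^sup>2) \<le> 1 / (1 + (x \<bullet> b)\<^sup>2)" by (intro divide_left_mono) (auto simp: add_pos_nonneg)
    qed (auto simp: add_nonneg_nonneg)
    finally have "(1 / (1 + M\<^sup>2)) ^ CARD('n) \<le> W x" .
    moreover have "1 + M\<^sup>2 > 0" by (simp add: add_pos_nonneg)
    ultimately show ?thesis by (simp add: field_simps)
  qed
  have key2: "1 \<le> (2 * M\<^sup>2) ^ CARD('n) * W x" if "norm x \<le> M" "M \<ge> 1" for x :: "real ^ 'n" and M
  proof -
    have "1 \<le> M\<^sup>2" using that by simp
    then have "(1 + M\<^sup>2) ^ CARD('n) \<le> (2 * M\<^sup>2) ^ CARD('n)" by (intro power_mono) auto
    then have "(1 + M\<^sup>2) ^ CARD('n) * W x \<le> (2 * M\<^sup>2) ^ CARD('n) * W x"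
      using \<open>W x > 0\<close> by (intro mult_right_mono) auto
    then show ?thesis using key[OF that(1)] by linarith
  qed
  show "1 \<le> (2 * M\<^sup>2) ^ CARD('n) * W x" if "norm x \<le> M" "M \<ge> 1" for x M using key2[OF that] .
  show "1 / norm x ^ (2 * CARD('n)) \<le> 2 ^ CARD('n) * W x" if "norm x \<ge> 1" for x
  proof -
    have "norm x > 0" using that by linarith
    then show ?thesis using key2[OF order_refl that] unfolding power_mult by (simp add: field_simps power_mult_distrib)
  qed
qed

section \<open>Gevrey cutoff functions\<close>

text \<open>Gevrey functions of order 2 with global constants. Any order larger than 1 would admit cutoff functions;
  order 2 is the one of \<open>exp (- 1 / t)\<close>. The losses caused by non-analytic cutoffs are factorial powers,
  which the weight absorbs.\<close>

definition gevrey2 :: "(real ^ 'n::finite \<Rightarrow> complex) \<Rightarrow> bool" where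
  "gevrey2 f \<longleftrightarrow> smooth_on UNIV f \<and>
     (\<exists>A\<ge>1. \<forall>is x. norm (partials is f x) \<le> A ^ Suc (length is) * (fact (length is))\<^sup>2)"

lemma gevrey2_const: "gevrey2 (\<lambda>x. c)"
  unfolding gevrey2_def
proof (intro conjI exI[of _ "max 1 (norm c)"] allI)
  fix "is" :: "'a list" and x
  have "norm c * 1 \<le> max 1 (norm c) * 1" by simp
  then show "norm (partials is (\<lambda>x. c) x) \<le> max 1 (norm c) ^ Suc (length is) * (fact (length is))\<^sup>2"
    by (auto simp: partials_const)
qed auto

text \<open>The binomial coefficients in Leibniz' formula are absorbed because \<open>l! (n - l)!\<close> is at most
  \<open>n!\<close>.\<close>

lemma gevrey2_mult:
  assumes "gevrey2 f" "gevrey2 g"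
  shows "gevrey2 (\<lambda>x. f x * g x)"
proof -
  obtain A where A: "A \<ge> 1" "\<And>is x. norm (partials is f x) \<le> A ^ Suc (length is) * (fact (length is))\<^sup>2"
    using assms by (auto simp: gevrey2_def)
  obtain B where B: "B \<ge> 1" "\<And>is x. norm (partials is g x) \<le> B ^ Suc (length is) * (fact (length is))\<^sup>2"
    using assms by (auto simp: gevrey2_def)
  have s: "smooth_on UNIV f" "smooth_on UNIV g" using assms by (auto simp: gevrey2_def)
  show ?thesis
    unfolding gevrey2_def
  proof (intro conjI exI[of _ "A * B + A + B"] allI)
    show "smooth_on UNIV (\<lambda>x. f x * g x)" using s by (intro smooth_on_mult) auto
    show "1 \<le> A * B + A + B" using A B by (smt (verit) mult_nonneg_nonneg)
    fix "is" :: "'a list" and x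
    let ?n = "length is"
    have "norm (partials is (\<lambda>x. f x * g x) x) \<le>
      (\<Sum>l\<le>?n. real (?n choose l) * (A ^ Suc l * (fact l)\<^sup>2) * (B ^ Suc (?n - l) * (fact (?n - l))\<^sup>2))"
      by (rule partials_mult_bound[OF open_UNIV UNIV_I s A(2) B(2)])
    also have "\<dots> \<le> (\<Sum>l\<le>?n. (A * B * (fact ?n)\<^sup>2) * (real (?n choose l) * A ^ l * B ^ (?n - l)))"
    proof (rule sum_mono)
      fix l assume l: "l \<in> {..?n}"
      have "fact l * fact (?n - l) \<le> (fact ?n :: real)"
        using fact_fact_dvd_fact[of l "?n - l"] l dvd_imp_le[of "fact l * fact (?n - l)" "fact ?n :: nat"]
        by (metis atMost_iff fact_nonzero le_add_diff_inverse of_nat_fact of_nat_le_iff of_nat_mult fact_gt_zero)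
      then have "(fact l * fact (?n - l))\<^sup>2 \<le> ((fact ?n)\<^sup>2 :: real)" by (intro power_mono) auto
      then have "(A * B * (real (?n choose l) * A ^ l * B ^ (?n - l))) * (fact l * fact (?n - l))\<^sup>2 \<le>
         (A * B * (real (?n choose l) * A ^ l * B ^ (?n - l))) * (fact ?n)\<^sup>2"
        using A B by (intro mult_left_mono) auto
      then show "real (?n choose l) * (A ^ Suc l * (fact l)\<^sup>2) * (B ^ Suc (?n - l) * (fact (?n - l))\<^sup>2)
        \<le> (A * B * (fact ?n)\<^sup>2) * (real (?n choose l) * A ^ l * B ^ (?n - l))"
        by (simp add: algebra_simps power_mult_distrib)
    qed
    also have "\<dots> = (A * B * (fact ?n)\<^sup>2) * (A + B) ^ ?n"
      by (simp add: sum_distrib_left binomial_ring)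
    also have "\<dots> = A * B * (A + B) ^ ?n * (fact ?n)\<^sup>2" by simp
    also have "\<dots> \<le> (A * B + A + B) * (A * B + A + B) ^ ?n * (fact ?n)\<^sup>2"
      using A B by (intro mult_right_mono mult_mono power_mono) auto
    finally show "norm (partials is (\<lambda>x. f x * g x) x) \<le> (A * B + A + B) ^ Suc ?n * (fact ?n)\<^sup>2" by simp
  qed
qed

lemma gevrey2_one_minus:
  assumes "gevrey2 f"
  shows "gevrey2 (\<lambda>x. 1 - f x)"
proof -
  obtain A where A: "A \<ge> 1" "\<And>is x. norm (partials is f x) \<le> A ^ Suc (length is) * (fact (length is))\<^sup>2"
    using assms by (auto simp: gevrey2_def)
  have s: "smooth_on UNIV f" using assms by (auto simp: gevrey2_def)
  show ?thesis
    unfolding gevrey2_def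
  proof (intro conjI exI[of _ "A + 1"] allI)
    show "smooth_on UNIV (\<lambda>x. 1 - f x)" using s by (intro smooth_on_diff) auto
    show "1 \<le> A + 1" using A by simp
    fix "is" :: "'a list" and x
    let ?n = "length is"
    have "partials is (\<lambda>x. 1 + -1 * f x) x = partials is (\<lambda>x. 1) x + partials is (\<lambda>x. -1 * f x) x"
      by (rule partials_add[of UNIV]) (use smooth_on_cmult[OF open_UNIV s, of "-1"] in auto)
    also have "partials is (\<lambda>x. -1 * f x) x = -1 * partials is f x" by (rule partials_cmult[of UNIV]) (use s in auto)
    finally have "norm (partials is (\<lambda>x. 1 - f x) x) \<le> norm (partials is (\<lambda>x::real^'a. 1) x) + norm (partials is f x)"
      using norm_triangle_ineq4[of "partials is (\<lambda>x. 1) x" "partials is f x"] by simp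
    also have "\<dots> \<le> 1 * (A + 1) ^ ?n * (fact ?n)\<^sup>2 + A * (A + 1) ^ ?n * (fact ?n)\<^sup>2"
    proof (rule add_mono)
      have "1 \<le> (A + 1) ^ ?n * (fact ?n)\<^sup>2" using A 
        by (metis add_increasing fact_ge_1 mult_mono' mult_1 one_le_power order_refl zero_le_one le_numeral_extra(1) add_increasing2)
      then show "norm (partials is (\<lambda>x::real^'a. 1::complex) x) \<le> 1 * (A + 1) ^ ?n * (fact ?n)\<^sup>2"
        by (auto simp: partials_const)
      have "A ^ Suc ?n * (fact ?n)\<^sup>2 \<le> A * (A + 1) ^ ?n * (fact ?n)\<^sup>2"
        using A by (simp, intro mult_left_mono mult_right_mono power_mono) auto
      then show "norm (partials is f x) \<le> A * (A + 1) ^ ?n * (fact ?n)\<^sup>2" using A(2)[of "is" x] by linarith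
    qed
    also have "\<dots> = (A + 1) ^ Suc ?n * (fact ?n)\<^sup>2" by (simp add: algebra_simps)
    finally show "norm (partials is (\<lambda>x. 1 - f x) x) \<le> (A + 1) ^ Suc ?n * (fact ?n)\<^sup>2" .
  qed
qed

lemma gevrey2_prod:
  "(\<And>j. j \<in> S \<Longrightarrow> gevrey2 (f j)) \<Longrightarrow> gevrey2 (\<lambda>x. \<Prod>j\<in>S. f j x)"
  by (induction S rule: infinite_finite_induct) (auto intro: gevrey2_mult gevrey2_const)

text \<open>An antiderivative needs no estimate of its own: beyond order zero its derivatives are those of its partial
  derivatives.\<close>

lemma gevrey2_of_partials:
  assumes d: "\<And>x. f differentiable (at x)" and b: "\<And>x. norm (f x) \<le> C"
    and p: "\<And>i. gevrey2 (partial i f)"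
  shows "gevrey2 f"
proof -
  have "\<forall>i. \<exists>A\<ge>1. \<forall>is x. norm (partials is (partial i f) x) \<le> A ^ Suc (length is) * (fact (length is))\<^sup>2"
    using p by (auto simp: gevrey2_def)
  then obtain A where A: "\<And>i. A i \<ge> 1" "\<And>i is x. norm (partials is (partial i f) x) \<le> A i ^ Suc (length is) * (fact (length is))\<^sup>2"
    by metis
  define B where "B = (\<Sum>i\<in>UNIV. A i) + \<bar>C\<bar> + 1"
  have s0: "0 \<le> (\<Sum>i\<in>UNIV. A i)" using A(1) by (intro sum_nonneg) (meson order_trans zero_le_one)
  have B: "B \<ge> 1" "\<And>i. A i \<le> B" "C \<le> B"
  proof -
    fix i have "A i \<le> (\<Sum>i\<in>UNIV. A i)" using A(1) by (intro member_le_sum) (auto intro: order_trans[OF zero_le_one])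
    then show "A i \<le> B" by (simp add: B_def)
  qed (use s0 in \<open>auto simp: B_def\<close>)
  show ?thesis
    unfolding gevrey2_def
  proof (intro conjI exI[of _ B] allI)
    show "smooth_on UNIV f" using d p by (subst smooth_on_rec) (auto simp: gevrey2_def)
    fix "is" :: "'a list" and x
    show "norm (partials is f x) \<le> B ^ Suc (length is) * (fact (length is))\<^sup>2"
    proof (cases "is" rule: rev_cases)
      case Nil then show ?thesis using b[of x] B by simp
    next
      case (snoc js i)
      let ?m = "length js"
      have "norm (partials is f x) \<le> A i ^ Suc ?m * (fact ?m)\<^sup>2" using A(2)[of js i x] snoc by simp
      also have "\<dots> \<le> B ^ Suc (Suc ?m) * (fact (Suc ?m))\<^sup>2"
      proof (intro mult_mono power_mono)
        have "A i ^ Suc ?m \<le> B ^ Suc ?m" using A(1)[of i] B by (intro power_mono) auto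
        also have "\<dots> \<le> B ^ Suc (Suc ?m)" using B by (intro power_increasing) auto
        finally show "A i ^ Suc ?m \<le> B ^ Suc (Suc ?m)" .
        show "fact ?m \<le> (fact (Suc ?m) :: real)" by (intro fact_mono) auto
      qed (use B in auto)
      finally show ?thesis using snoc by simp
    qed
  qed (use B in auto)
qed

text \<open>The functions \<open>t^(-j) exp (- 1 / t)\<close>, extended by zero. Together they are closed under
  differentiation up to linear combinations.\<close>

definition flat_exp :: "nat \<Rightarrow> real \<Rightarrow> real" where
  "flat_exp j t = (if t > 0 then (1 / t) ^ j * exp (- (1 / t)) else 0)"

fun flat_exp_deriv :: "nat \<Rightarrow> nat \<Rightarrow> real \<Rightarrow> real" where
  "flat_exp_deriv 0 j t = flat_exp j t"
| "flat_exp_deriv (Suc n) j t = flat_exp_deriv n (j + 2) t - real j * flat_exp_deriv n (j + 1) t"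

text \<open>The value at \<open>u = 1 / t\<close> of \<open>u^j exp (- u)\<close> is at most \<open>j!\<close> by the
  exponential series.\<close>

lemma flat_exp_bound: "0 \<le> flat_exp j t" "flat_exp j t \<le> fact j"
proof -
  show "0 \<le> flat_exp j t" by (simp add: flat_exp_def)
  have "s ^ j \<le> fact j * exp s" if "s \<ge> 0" for s :: real
  proof -
    have "s ^ j / fact j \<le> exp s"
    proof -
      have "(\<Sum>k\<in>{j}. s ^ k / fact k) \<le> (\<Sum>k. s ^ k / fact k)"
        using that summable_exp[of s] by (intro sum_le_suminf) (auto simp: field_simps)
      then show ?thesis by (simp add: exp_def field_simps)
    qed
    then show ?thesis by (simp add: field_simps)
  qed
  from this[of "1 / t"] show "flat_exp j t \<le> fact j" by (auto simp: flat_exp_def exp_minus field_simps)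
qed

lemma flat_exp_has_derivative:
  "(flat_exp j has_real_derivative flat_exp (j + 2) t - real j * flat_exp (j + 1) t) (at t)"
proof (cases "t = 0")
  case False
  consider "t > 0" | "t < 0" using False by linarith
  then show ?thesis
  proof cases
    case 1
    have "((\<lambda>t. (1 / t) ^ j * exp (- (1 / t))) has_real_derivative flat_exp (j + 2) t - real j * flat_exp (j + 1) t) (at t)"
      using 1 by (auto intro!: derivative_eq_intros simp: flat_exp_def field_simps power2_eq_square)
        (cases j, auto simp: field_simps power2_eq_square)
    then show ?thesis
      by (rule has_field_derivative_transform_within_open[of _ _ t "{0<..}"]) (use 1 in \<open>auto simp: flat_exp_def\<close>)
  next
    case 2
    have "((\<lambda>t. 0) has_real_derivative flat_exp (j + 2) t - real j * flat_exp (j + 1) t) (at t)"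
      using 2 by (auto simp: flat_exp_def)
    then show ?thesis
      by (rule has_field_derivative_transform_within_open[of _ _ t "{..<0}"]) (use 2 in \<open>auto simp: flat_exp_def\<close>)
  qed
next
  case True
  have "norm (flat_exp j h / h) \<le> \<bar>h\<bar> * fact (j + 2)" for h
  proof (cases "h > 0")
    case True
    then have "flat_exp j h / h = h * flat_exp (j + 2) h" by (simp add: flat_exp_def power_add power2_eq_square)
    then show ?thesis using flat_exp_bound[of "j + 2" h] True by (simp add: abs_mult)
  next
    case False
    then have "flat_exp j h = 0" by (simp add: flat_exp_def)
    moreover have "0 \<le> \<bar>h\<bar> * fact (j + 2)" by (intro mult_nonneg_nonneg) auto
    ultimately show ?thesis by (simp only: div_0 norm_zero)
  qed
  moreover have "((\<lambda>h::real. \<bar>h\<bar> * fact (j + 2)) \<longlongrightarrow> \<bar>0\<bar> * fact (j + 2)) (at 0)" by (intro tendsto_intros)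
  ultimately have "((\<lambda>h. flat_exp j h / h) \<longlongrightarrow> 0) (at 0)"
    by (intro Lim_null_comparison[of "\<lambda>h. flat_exp j h / h" "\<lambda>h. \<bar>h\<bar> * fact (j + 2)"]) auto
  then show ?thesis using True by (simp add: DERIV_def flat_exp_def)
qed

lemma flat_exp_deriv_has_derivative:
  "(flat_exp_deriv n j has_real_derivative flat_exp_deriv (Suc n) j t) (at t)"
proof (induction n arbitrary: j)
  case 0
  have "flat_exp_deriv 0 j = flat_exp j" by auto
  then show ?case using flat_exp_has_derivative[of j t] by simp
next
  case (Suc n)
  have "flat_exp_deriv (Suc n) j = (\<lambda>t. flat_exp_deriv n (j + 2) t - real j * flat_exp_deriv n (j + 1) t)" by auto
  moreover have "((\<lambda>t. flat_exp_deriv n (j + 2) t - real j * flat_exp_deriv n (j + 1) t) has_real_derivative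
     flat_exp_deriv (Suc n) (j + 2) t - real j * flat_exp_deriv (Suc n) (j + 1) t) (at t)"
    by (intro DERIV_diff DERIV_cmult Suc.IH)
  ultimately show ?case by (simp del: flat_exp_deriv.simps add: flat_exp_deriv.simps(2)[of "Suc n"])
qed

text \<open>Each differentiation splits a term into two and raises its index by at most 2, the coefficient
  \<open>j\<close> being absorbed by the factorial; \<open>(2 n)!\<close> is of Gevrey order 2.\<close>

lemma flat_exp_deriv_bound: "\<bar>flat_exp_deriv n j t\<bar> \<le> 2 ^ n * fact (j + 2 * n)"
proof (induction n arbitrary: j)
  case 0 then show ?case using flat_exp_bound[of j t] by simp
next
  case (Suc n)
  have "\<bar>flat_exp_deriv (Suc n) j t\<bar> \<le> \<bar>flat_exp_deriv n (j + 2) t\<bar> + real j * \<bar>flat_exp_deriv n (j + 1) t\<bar>"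
    by (simp add: abs_mult[symmetric] order_trans[OF abs_triangle_ineq4]) (metis abs_mult abs_of_nat abs_triangle_ineq4)
  also have "\<dots> \<le> 2 ^ n * fact (j + 2 + 2 * n) + real j * (2 ^ n * fact (j + 1 + 2 * n))"
    by (intro add_mono mult_left_mono Suc.IH) auto
  also have "real j * (2 ^ n * fact (j + 1 + 2 * n)) \<le> 2 ^ n * fact (j + 2 + 2 * n)"
  proof -
    have "real j * fact (j + 1 + 2 * n) \<le> real (j + 2 + 2 * n) * fact (j + 1 + 2 * n)" by (intro mult_right_mono) auto
    also have "\<dots> = fact (j + 2 + 2 * n)" by (subst (2) fact_reduce) (auto simp: algebra_simps)
    finally show ?thesis by simp
  qed
  also have "2 ^ n * fact (j + 2 + 2 * n) + 2 ^ n * fact (j + 2 + 2 * n) = (2 ^ Suc n * fact (j + 2 * Suc n) :: real)"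
  proof -
    have "j + 2 * Suc n = j + 2 + 2 * n" by simp
    then show ?thesis by (simp only: power_Suc mult_2 distrib_right)
  qed
  finally show ?case by simp
qed

lemma fact_double_le: "fact (2 * n) \<le> (4::real) ^ n * (fact n)\<^sup>2"
proof -
  have "fact n * fact n * ((2 * n) choose n) = (fact (2 * n) :: nat)"
    using binomial_fact_lemma[of n "2 * n"] by simp
  moreover have "(2 * n) choose n \<le> 2 ^ (2 * n)" by (rule binomial_le_pow2)
  ultimately have "fact (2 * n) \<le> fact n * fact n * (2 ^ (2 * n) :: nat)" by (metis mult_le_mono2)
  then have "real (fact (2 * n)) \<le> real (fact n * fact n * 2 ^ (2 * n))" by (simp only: of_nat_le_iff)
  moreover have "(2::real) ^ (2 * n) = 4 ^ n" by (simp add: power_mult)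
  ultimately show ?thesis by (simp add: power2_eq_square mult.commute)
qed

lemma affine_component_has_derivative:
  "((\<lambda>x::real ^ 'n::finite. s * (x $ k) + b) has_derivative (\<lambda>h. s * (h $ k))) (at x)"
  by (auto intro!: derivative_eq_intros bounded_linear_imp_has_derivative bounded_linear_vec_nth)

lemma of_real_affine_has_derivative:
  assumes "\<And>t. (g has_real_derivative g' t) (at t)"
  shows "((\<lambda>x::real ^ 'n::finite. complex_of_real (g (s * (x $ k) + b))) has_derivative
     (\<lambda>h. of_real (g' (s * (x $ k) + b) * (s * (h $ k))))) (at x)"
proof -
  have "(g has_derivative (\<lambda>h. g' (s * (x $ k) + b) * h)) (at (s * (x $ k) + b))"
    using assms by (simp add: has_field_derivative_def)
  from has_derivative_compose[OF affine_component_has_derivative this]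
  show ?thesis by (rule has_derivative_of_real)
qed

lemma gevrey2_flat_exp: "gevrey2 (\<lambda>x::real ^ 'n::finite. complex_of_real (flat_exp 0 (s * (x $ k) + b)))"
proof -
  let ?f = "\<lambda>c n (x::real ^ 'n). complex_of_real (c * flat_exp_deriv n 0 (s * (x $ k) + b))"
  have der: "((?f c n) has_derivative (\<lambda>h. of_real (c * flat_exp_deriv (Suc n) 0 (s * (x $ k) + b) * (s * (h $ k))))) (at x)" for c n x
    using of_real_affine_has_derivative[of "\<lambda>t. c * flat_exp_deriv n 0 t" "\<lambda>t. c * flat_exp_deriv (Suc n) 0 t" s k b x]
      flat_exp_deriv_has_derivative[THEN DERIV_cmult] by blast
  have part: "partial i (?f c n) = ?f (if i = k then c * s else 0) (Suc n)" for i c n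
    by (rule ext) (use has_derivative_partial(1)[OF der] in \<open>auto simp: axis_def\<close>)
  have parts: "\<exists>c. \<bar>c\<bar> \<le> \<bar>s\<bar> ^ length is \<and> partials is (?f 1 0) = ?f c (length is)" for "is" :: "'n list"
  proof (induction "is")
    case Nil
    then show ?case by (intro exI[of _ 1]) auto
  next
    case (Cons i "is")
    then obtain c where c: "\<bar>c\<bar> \<le> \<bar>s\<bar> ^ length is" "partials is (?f 1 0) = ?f c (length is)" by blast
    show ?case
    proof (intro exI[of _ "if i = k then c * s else 0"] conjI)
      show "\<bar>if i = k then c * s else 0\<bar> \<le> \<bar>s\<bar> ^ length (i # is)"
        using mult_right_mono[OF c(1), of "\<bar>s\<bar>"] by (auto simp: abs_mult mult.commute)
      show "partials (i # is) (?f 1 0) = ?f (if i = k then c * s else 0) (length (i # is))"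
        using c(2) part[of i c "length is"] by simp
    qed
  qed
  have "gevrey2 (?f 1 0)"
    unfolding gevrey2_def
  proof (intro conjI exI[of _ "8 * (\<bar>s\<bar> + 1)"] allI)
    show "smooth_on UNIV (?f 1 0)"
      unfolding smooth_on_def
    proof (intro allI ballI)
      fix "is" :: "'n list" and x
      obtain c where "partials is (?f 1 0) = ?f c (length is)" using parts by blast
      then show "partials is (?f 1 0) differentiable at x" using der[of c "length is" x] by (auto simp: differentiable_def)
    qed
    fix "is" :: "'n list" and x
    let ?n = "length is"
    obtain c where c: "\<bar>c\<bar> \<le> \<bar>s\<bar> ^ ?n" "partials is (?f 1 0) = ?f c ?n" using parts by blast
    have "norm (partials is (?f 1 0) x) = \<bar>c\<bar> * \<bar>flat_exp_deriv ?n 0 (s * (x $ k) + b)\<bar>"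
      unfolding c(2) by (simp add: abs_mult flip: of_real_mult)
    also have "\<dots> \<le> \<bar>s\<bar> ^ ?n * (2 ^ ?n * (4 ^ ?n * (fact ?n)\<^sup>2))"
    proof (intro mult_mono c)
      have "\<bar>flat_exp_deriv ?n 0 (s * (x $ k) + b)\<bar> \<le> 2 ^ ?n * fact (2 * ?n)"
        using flat_exp_deriv_bound[of ?n 0] by simp
      also have "\<dots> \<le> 2 ^ ?n * (4 ^ ?n * (fact ?n)\<^sup>2)" by (intro mult_left_mono fact_double_le) auto
      finally show "\<bar>flat_exp_deriv ?n 0 (s * (x $ k) + b)\<bar> \<le> 2 ^ ?n * (4 ^ ?n * (fact ?n)\<^sup>2)" .
    qed auto
    also have "\<dots> = (8 * \<bar>s\<bar>) ^ ?n * (fact ?n)\<^sup>2" by (simp add: power_mult_distrib flip: mult.assoc)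
       (simp flip: power_mult_distrib add: mult.commute)
    also have "\<dots> \<le> (8 * (\<bar>s\<bar> + 1)) ^ Suc ?n * (fact ?n)\<^sup>2"
    proof (intro mult_right_mono)
      have "(8 * \<bar>s\<bar>) ^ ?n \<le> (8 * (\<bar>s\<bar> + 1)) ^ ?n" by (intro power_mono) auto
      also have "\<dots> \<le> (8 * (\<bar>s\<bar> + 1)) ^ Suc ?n" by (intro power_increasing) auto
      finally show "(8 * \<bar>s\<bar>) ^ ?n \<le> (8 * (\<bar>s\<bar> + 1)) ^ Suc ?n" .
    qed auto
    finally show "norm (partials is (?f 1 0) x) \<le> (8 * (\<bar>s\<bar> + 1)) ^ Suc ?n * (fact ?n)\<^sup>2" .
  qed auto
  then show ?thesis by simp
qed

text \<open>The normalised antiderivative of \<open>exp (- 1 / t) exp (- 1 / (1 - t))\<close>. Its derivative is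
  retained in the statement because it is a product of Gevrey functions, which makes the step function one as
  well.\<close>

lemma smooth_step_exists:
  obtains \<sigma> :: "real \<Rightarrow> real" and c where "\<And>t. t \<le> 0 \<Longrightarrow> \<sigma> t = 0" "\<And>t. t \<ge> 1 \<Longrightarrow> \<sigma> t = 1" "\<And>t. 0 \<le> \<sigma> t" "\<And>t. \<sigma> t \<le> 1"
    "\<And>t. (\<sigma> has_real_derivative c * (flat_exp 0 t * flat_exp 0 (1 - t))) (at t)"
proof -
  let ?\<beta> = "\<lambda>t. flat_exp 0 t * flat_exp 0 (1 - t)"
  have cf: "isCont (flat_exp 0) t" for t using flat_exp_has_derivative DERIV_isCont by blast
  have "isCont ?\<beta> t" for t
    by (intro continuous_intros cf isCont_o2[where f = "\<lambda>t. 1 - t"])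
  then have "\<exists>F. \<forall>x. -\<infinity> < ereal x \<longrightarrow> ereal x < \<infinity> \<longrightarrow> (F has_vector_derivative ?\<beta> x) (at x)"
    by (intro einterval_antiderivative) auto
  then obtain H where H: "\<And>t. (H has_real_derivative ?\<beta> t) (at t)"
    by (auto simp: has_real_derivative_iff_has_vector_derivative)
  have H0: "H t = H 0" if "t \<le> 0" for t
  proof -
    have "\<exists>c. \<forall>x\<in>{..0::real}. H x = c"
      by (rule has_field_derivative_zero_constant)
        (use H[THEN has_field_derivative_at_within] in \<open>auto simp: flat_exp_def\<close>, metis (no_types, lifting) H has_field_derivative_at_within mult_zero_left flat_exp_def not_less)
    then show ?thesis using that by auto
  qed
  have H1: "H t = H 1" if "t \<ge> 1" for t
  proof -
    have "(H has_real_derivative 0) (at x within {1..})" if "x \<in> {1..}" for x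
      using H[THEN has_field_derivative_at_within, of x "{1..}"] that by (auto simp: flat_exp_def)
    then have "\<exists>c. \<forall>x\<in>{1::real..}. H x = c" by (intro has_field_derivative_zero_constant) auto
    then show ?thesis using that by auto
  qed
  have "\<exists>z>0. z < 1 \<and> H 1 - H 0 = (1 - 0) * ?\<beta> z" by (rule MVT2) (use H in auto)
  then obtain z where z: "0 < z" "z < 1" "H 1 - H 0 = ?\<beta> z" by auto
  have "?\<beta> z > 0" using z(1,2) by (simp add: flat_exp_def)
  then have pos: "H 0 < H 1" using z(3) by linarith
  have mono: "H s \<le> H t" if "s \<le> t" for s t
    by (rule DERIV_nonneg_imp_nondecreasing[OF that]) (use H flat_exp_bound(1) in \<open>meson mult_nonneg_nonneg\<close>)
  show ?thesis
  proof (rule that[of "\<lambda>t. (H t - H 0) / (H 1 - H 0)" "1 / (H 1 - H 0)"])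
    show "(H t - H 0) / (H 1 - H 0) = 0" if "t \<le> 0" for t using H0[OF that] by simp
    show "(H t - H 0) / (H 1 - H 0) = 1" if "t \<ge> 1" for t using H1[OF that] pos by simp
    show "0 \<le> (H t - H 0) / (H 1 - H 0)" for t
      using H0[of t] mono[of 0 t] pos by (cases "t \<le> 0") auto
    show "(H t - H 0) / (H 1 - H 0) \<le> 1" for t
      using H1[of t] mono[of t 1] pos by (cases "t \<ge> 1") auto
    show "((\<lambda>t. (H t - H 0) / (H 1 - H 0)) has_real_derivative 1 / (H 1 - H 0) * ?\<beta> t) (at t)" for t
      using H[of t] pos by (auto intro!: derivative_eq_intros)
  qed
qed

text \<open>A product of smooth steps in the coordinates.\<close>

lemma gevrey2_cutoff_cube:
  fixes c :: "real ^ 'n::finite"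
  assumes r: "r > 0"
  shows "\<exists>\<eta> :: real ^ 'n \<Rightarrow> real. gevrey2 (\<lambda>x. complex_of_real (\<eta> x)) \<and> (\<forall>x. 0 \<le> \<eta> x) \<and>
    (\<forall>x. (\<forall>i. \<bar>x $ i - c $ i\<bar> \<le> r) \<longrightarrow> \<eta> x = 1) \<and> (\<forall>x i. \<bar>x $ i - c $ i\<bar> \<ge> 2 * r \<longrightarrow> \<eta> x = 0)"
proof -
  obtain \<sigma> :: "real \<Rightarrow> real" and a where \<sigma>: "\<And>t. t \<le> 0 \<Longrightarrow> \<sigma> t = 0" "\<And>t. t \<ge> 1 \<Longrightarrow> \<sigma> t = 1" "\<And>t. 0 \<le> \<sigma> t" "\<And>t. \<sigma> t \<le> 1"
    "\<And>t. (\<sigma> has_real_derivative a * (flat_exp 0 t * flat_exp 0 (1 - t))) (at t)"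
    using smooth_step_exists by blast
  have g: "gevrey2 (\<lambda>x::real ^ 'n. complex_of_real (\<sigma> (s * (x $ k) + b)))" for s k b
  proof (rule gevrey2_of_partials)
    let ?f = "\<lambda>x::real ^ 'n. complex_of_real (\<sigma> (s * (x $ k) + b))"
    have der: "(?f has_derivative (\<lambda>h. of_real (a * (flat_exp 0 (s * (x $ k) + b) * flat_exp 0 (1 - (s * (x $ k) + b))) * (s * (h $ k))))) (at x)" for x
      by (rule of_real_affine_has_derivative) (rule \<sigma>(5))
    show "?f differentiable (at x)" for x using der[of x] by (auto simp: differentiable_def)
    show "norm (?f x) \<le> 1" for x using \<sigma>(3,4) by simp
    fix i
    have "partial i ?f = (\<lambda>x. of_real (if i = k then a * s else 0) * (of_real (flat_exp 0 (s * (x $ k) + b)) * of_real (flat_exp 0 ((- s) * (x $ k) + (1 - b)))))"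
    proof
      fix x
      have "1 - (s * (x $ k) + b) = (- s) * (x $ k) + (1 - b)" by simp
      then show "partial i ?f x = of_real (if i = k then a * s else 0) * (of_real (flat_exp 0 (s * (x $ k) + b)) * of_real (flat_exp 0 ((- s) * (x $ k) + (1 - b))))"
        unfolding has_derivative_partial(1)[OF der] by (simp only:) (simp add: axis_def)
    qed
    then show "gevrey2 (partial i ?f)" by (simp only:) (intro gevrey2_mult gevrey2_const gevrey2_flat_exp)
  qed
  define \<eta> where "\<eta> x = (\<Prod>i\<in>UNIV. \<sigma> ((1 / r) * (x $ i) + (2 - c $ i / r)) * \<sigma> ((- 1 / r) * (x $ i) + (2 + c $ i / r)))" for x :: "real ^ 'n"
  have e: "(1 / r) * (x $ i) + (2 - c $ i / r) = 2 + (x $ i - c $ i) / r" "(- 1 / r) * (x $ i) + (2 + c $ i / r) = 2 - (x $ i - c $ i) / r" for x i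
    using r by (auto simp: field_simps)
  show ?thesis
  proof (intro exI[of _ \<eta>] conjI allI impI)
    show "gevrey2 (\<lambda>x. complex_of_real (\<eta> x))"
      unfolding \<eta>_def of_real_prod of_real_mult by (intro gevrey2_prod gevrey2_mult g)
    show "0 \<le> \<eta> x" for x unfolding \<eta>_def using \<sigma>(3) by (intro prod_nonneg) auto
    fix x
    show "\<eta> x = 1" if "\<forall>i. \<bar>x $ i - c $ i\<bar> \<le> r"
    proof -
      have "2 + (x $ i - c $ i) / r \<ge> 1 \<and> 2 - (x $ i - c $ i) / r \<ge> 1" for i
      proof -
        have "\<bar>(x $ i - c $ i) / r\<bar> \<le> 1" using that r by simp
        then show ?thesis by linarith
      qed
      then show ?thesis unfolding \<eta>_def e by (intro prod.neutral) (auto simp: \<sigma>(2))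
    qed
    fix i assume "\<bar>x $ i - c $ i\<bar> \<ge> 2 * r"
    then have "\<bar>x $ i - c $ i\<bar> / r \<ge> 2" using r by (simp add: pos_le_divide_eq)
    then have "\<bar>(x $ i - c $ i) / r\<bar> \<ge> 2" using r by simp
    then have "2 + (x $ i - c $ i) / r \<le> 0 \<or> 2 - (x $ i - c $ i) / r \<le> 0" by linarith
    then have "\<sigma> (2 + (x $ i - c $ i) / r) * \<sigma> (2 - (x $ i - c $ i) / r) = 0"
      using \<sigma>(1) by auto
    then show "\<eta> x = 0" unfolding \<eta>_def e by (intro prod_zero bexI[of _ i]) simp_all
  qed
qed

text \<open>Cover \<open>K\<close> by finitely many cubes and combine their cutoffs \<open>X\<close> into \<open>1 -
  prod (1 - X)\<close>, which is 1 as soon as one of them is.\<close>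

lemma gevrey2_cutoff:
  fixes K :: "(real ^ 'n::finite) set"
  assumes K: "compact K" "K \<subseteq> \<Omega>" "open \<Omega>"
  obtains \<eta> W where "gevrey2 \<eta>" "compact (supp \<eta>)" "supp \<eta> \<subseteq> \<Omega>" "open W" "K \<subseteq> W" "\<And>x. x \<in> W \<Longrightarrow> \<eta> x = 1"
proof -
  let ?n = "real CARD('n)"
  have exr: "\<forall>x\<in>K. \<exists>r. r > 0 \<and> cball x (2 * r * ?n) \<subseteq> \<Omega>"
  proof
    fix x assume "x \<in> K"
    then have "x \<in> \<Omega>" using K(2) by (rule rev_subsetD)
    then obtain e where e: "e > 0" "cball x e \<subseteq> \<Omega>" using K(3) by (meson open_contains_cball)
    then show "\<exists>r. r > 0 \<and> cball x (2 * r * ?n) \<subseteq> \<Omega>" by (intro exI[of _ "e / (2 * ?n)"]) simp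
  qed
  obtain r where r': "\<forall>x\<in>K. r x > 0 \<and> cball x (2 * r x * ?n) \<subseteq> \<Omega>"
    by (rule exE[OF bchoice[OF exr]]) (rule that)
  have r: "\<And>x. x \<in> K \<Longrightarrow> r x > 0" "\<And>x. x \<in> K \<Longrightarrow> cball x (2 * r x * ?n) \<subseteq> \<Omega>"
    using r' by auto
  have ex: "\<forall>x\<in>K. \<exists>\<eta>. gevrey2 \<eta> \<and> (\<forall>y. (\<forall>i. \<bar>y $ i - x $ i\<bar> \<le> r x) \<longrightarrow> \<eta> y = 1) \<and> (\<forall>y i. \<bar>y $ i - x $ i\<bar> \<ge> 2 * r x \<longrightarrow> \<eta> y = 0)"
  proof
    fix x assume xK: "x \<in> K"
    obtain \<eta> :: "real ^ 'n \<Rightarrow> real" where "gevrey2 (\<lambda>x. complex_of_real (\<eta> x))" "\<forall>y. (\<forall>i. \<bar>y $ i - x $ i\<bar> \<le> r x) \<longrightarrow> \<eta> y = 1" "\<forall>y i. \<bar>y $ i - x $ i\<bar> \<ge> 2 * r x \<longrightarrow> \<eta> y = 0"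
      using gevrey2_cutoff_cube[OF r(1)[OF xK], of x] by blast
    then show "\<exists>\<eta>. gevrey2 \<eta> \<and> (\<forall>y. (\<forall>i. \<bar>y $ i - x $ i\<bar> \<le> r x) \<longrightarrow> \<eta> y = 1) \<and> (\<forall>y i. \<bar>y $ i - x $ i\<bar> \<ge> 2 * r x \<longrightarrow> \<eta> y = 0)" by (intro exI[of _ "\<lambda>x. complex_of_real (\<eta> x)"]) simp
  qed
  obtain X where X': "\<forall>x\<in>K. gevrey2 (X x) \<and> (\<forall>y. (\<forall>i. \<bar>y $ i - x $ i\<bar> \<le> r x) \<longrightarrow> X x y = 1) \<and> (\<forall>y i. \<bar>y $ i - x $ i\<bar> \<ge> 2 * r x \<longrightarrow> X x y = 0)"
    by (rule exE[OF bchoice[OF ex]]) (rule that)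
  have X: "\<And>x. x \<in> K \<Longrightarrow> gevrey2 (X x)" "\<And>x y. x \<in> K \<Longrightarrow> (\<And>i. \<bar>y $ i - x $ i\<bar> \<le> r x) \<Longrightarrow> X x y = 1"
    "\<And>x y i. x \<in> K \<Longrightarrow> \<bar>y $ i - x $ i\<bar> \<ge> 2 * r x \<Longrightarrow> X x y = 0"
    using X' by blast+
  obtain T where T: "T \<subseteq> K" "finite T" "K \<subseteq> (\<Union>x\<in>T. ball x (r x))"
  proof (rule compactE_image[OF K(1), of K "\<lambda>x. ball x (r x)"])
    show "K \<subseteq> (\<Union>x\<in>K. ball x (r x))" using r(1) by force
  qed (use that in auto)
  define \<eta> where "\<eta> y = 1 - (\<Prod>x\<in>T. 1 - X x y)" for y
  let ?S = "\<Union>x\<in>T. cball x (2 * r x * ?n)"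
  have sup: "{y. \<eta> y \<noteq> 0} \<subseteq> ?S"
  proof
    fix y assume "y \<in> {y. \<eta> y \<noteq> 0}"
    then have "(\<Prod>x\<in>T. 1 - X x y) \<noteq> 1" by (auto simp: \<eta>_def)
    moreover have "(\<Prod>x\<in>T. 1 - X x y) = 1" if "\<forall>x\<in>T. X x y = 0" using that by (intro prod.neutral) simp
    ultimately obtain x where x: "x \<in> T" "X x y \<noteq> 0" by blast
    have "\<bar>(y - x) $ i\<bar> \<le> 2 * r x" for i
    proof (rule ccontr)
      assume "\<not> \<bar>(y - x) $ i\<bar> \<le> 2 * r x"
      then have "X x y = 0" using T(1) x(1) by (intro X(3)[of x y i]) auto
      then show False using x(2) by simp
    qed
    then have "norm (y - x) \<le> (\<Sum>i::'n\<in>UNIV. 2 * r x)"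
      by (intro order_trans[OF norm_le_l1_cart] sum_mono) auto
    then have "dist x y \<le> 2 * r x * ?n" by (simp add: dist_norm norm_minus_commute mult.commute mult.left_commute)
    then show "y \<in> ?S" using x by auto
  qed
  have cS: "compact ?S" using T(2) by (intro compact_UN) auto
  have sS: "supp \<eta> \<subseteq> ?S" unfolding supp_def by (intro closure_minimal sup compact_imp_closed cS)
  show ?thesis
  proof (rule that[of \<eta> "\<Union>x\<in>T. ball x (r x)"])
    show "gevrey2 \<eta>" unfolding \<eta>_def[abs_def] using X(1) T(1) by (intro gevrey2_one_minus gevrey2_prod) auto
    show "compact (supp \<eta>)" using compact_Int_closed[OF cS, of "supp \<eta>"] sS by (simp add: supp_def Int_absorb1)
    show "supp \<eta> \<subseteq> \<Omega>" using sS r(2) T(1) by blast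
    fix y assume "y \<in> (\<Union>x\<in>T. ball x (r x))"
    then obtain x where x: "x \<in> T" "dist x y < r x" by auto
    have "\<bar>y $ i - x $ i\<bar> \<le> r x" for i
      using component_le_norm_cart[of "y - x" i] x(2) by (simp add: dist_norm norm_minus_commute)
    then have "X x y = 1" using X(2) x T(1) by blast
    then have "\<exists>a\<in>T. 1 - X a y = 0" using x(1) by (intro bexI[of _ x]) simp_all
    from prod_zero[OF T(2) this] show "\<eta> y = 1" unfolding \<eta>_def by simp
  qed (use T in auto)
qed

section \<open>Cauchy estimates for real-analytic functions\<close>

lemma uniform_tail:
  fixes M :: "nat \<Rightarrow> real"
  assumes "summable M" "e > 0"
  shows "\<forall>\<^sub>F n in sequentially. (\<Sum>i. M (i + n)) \<le> e"
proof -
  have "(\<lambda>n. \<Sum>i. M (i + n)) \<longlonglongrightarrow> 0" using suminf_exist_split2[OF assms(1)] .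
  then have "\<forall>\<^sub>F n in sequentially. (\<Sum>i. M (i + n)) < e" by (rule order_tendstoD(2)) (rule assms(2))
  then show ?thesis by (rule eventually_mono) simp
qed

lemma has_derivative_infsum_nat:
  fixes f :: "nat \<Rightarrow> 'a::real_normed_vector \<Rightarrow> complex"
  assumes S: "convex S" "open S" "x \<in> S" and f: "\<And>n x. x \<in> S \<Longrightarrow> (f n has_derivative f' n x) (at x)"
    and M: "summable M" "\<And>n x h. x \<in> S \<Longrightarrow> norm (f' n x h) \<le> M n * norm h"
    and N: "summable N" "\<And>n x. x \<in> S \<Longrightarrow> norm (f n x) \<le> N n"
  shows "((\<lambda>x. \<Sum>n. f n x) has_derivative (\<lambda>h. \<Sum>n. f' n x h)) (at x)"
proof -
  have sf: "summable (\<lambda>n. f n y)" if "y \<in> S" for y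
    using N that by (intro summable_comparison_test[OF _ N(1)]) auto
  have nf': "summable (\<lambda>n. norm (f' n y h))" if "y \<in> S" for y h
    using M that by (intro summable_comparison_test[OF _ summable_mult2[OF M(1), of "norm h"]]) auto
  have "\<exists>g. \<forall>x\<in>S. (\<lambda>n. f n x) sums (g x) \<and> (g has_derivative (\<lambda>h. \<Sum>n. f' n x h)) (at x within S)"
  proof (rule has_derivative_series[of S f f' "\<lambda>x h. \<Sum>n. f' n x h" x "\<Sum>n. f n x"])
    show "convex S" "x \<in> S" by (rule S)+
    show "(f n has_derivative f' n y) (at y within S)" if "y \<in> S" for n y
      using f[OF that] by (rule has_derivative_at_withinI)
    show "(\<lambda>n. f n x) sums (\<Sum>n. f n x)" using sf[OF S(3)] by (rule summable_sums)
    show "\<forall>\<^sub>F n in sequentially. \<forall>x\<in>S. \<forall>h. norm ((\<Sum>i<n. f' i x h) - (\<Sum>n. f' n x h)) \<le> e * norm h" if e: "e > 0" for e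
      using uniform_tail[OF M(1) e]
    proof eventually_elim
      case (elim n)
      show ?case
      proof (intro ballI allI)
        fix y h assume y: "y \<in> S"
        have "(\<Sum>n. f' n y h) = (\<Sum>i. f' (i + n) y h) + (\<Sum>i<n. f' i y h)"
          by (rule suminf_split_initial_segment[OF summable_norm_cancel[OF nf'[OF y]]])
        then have "norm ((\<Sum>i<n. f' i y h) - (\<Sum>n. f' n y h)) = norm (\<Sum>i. f' (i + n) y h)" by simp
        also have "\<dots> \<le> (\<Sum>i. norm (f' (i + n) y h))"
          by (intro summable_norm summable_ignore_initial_segment nf' y)
        also have "\<dots> \<le> (\<Sum>i. M (i + n) * norm h)"
          by (intro suminf_le M(2) y summable_ignore_initial_segment nf' summable_mult2 M(1))
        also have "\<dots> = (\<Sum>i. M (i + n)) * norm h"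
          by (intro suminf_mult2[symmetric] summable_ignore_initial_segment M(1))
        also have "\<dots> \<le> e * norm h" by (intro mult_right_mono elim) auto
        finally show "norm ((\<Sum>i<n. f' i y h) - (\<Sum>n. f' n y h)) \<le> e * norm h" .
      qed
    qed
  qed
  then obtain g where g: "\<And>x. x \<in> S \<Longrightarrow> (\<lambda>n. f n x) sums (g x)" "(g has_derivative (\<lambda>h. \<Sum>n. f' n x h)) (at x within S)"
    using S(3) by blast
  have "(g has_derivative (\<lambda>h. \<Sum>n. f' n x h)) (at x)" using g(2) unfolding at_within_open[OF S(3,2)] .
  then show ?thesis
  proof (rule has_derivative_transform_within_open[of g _ x UNIV S "\<lambda>x. \<Sum>n. f n x"])
    show "g y = (\<Sum>n. f n y)" if "y \<in> S" for y by (rule sums_unique[OF g(1)[OF that]])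
  qed (rule S)+
qed

text \<open>Multi-indices are summed without order; an enumeration reduces termwise differentiation to
  sequences.\<close>

lemma has_derivative_infsum:
  fixes f :: "'b::countable \<Rightarrow> 'a::real_normed_vector \<Rightarrow> complex"
  assumes inf: "infinite (UNIV :: 'b set)"
    and S: "convex S" "open S" "x \<in> S" and f: "\<And>n x. x \<in> S \<Longrightarrow> (f n has_derivative f' n x) (at x)"
    and M: "M summable_on UNIV" "\<And>n x h. x \<in> S \<Longrightarrow> norm (f' n x h) \<le> M n * norm h" "\<And>n. M n \<ge> (0::real)"
    and N: "N summable_on UNIV" "\<And>n x. x \<in> S \<Longrightarrow> norm (f n x) \<le> N n" "\<And>n. N n \<ge> (0::real)"
  shows "((\<lambda>x. infsum (\<lambda>n. f n x) UNIV) has_derivative (\<lambda>h. infsum (\<lambda>n. f' n x h) UNIV)) (at x)"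
proof -
  define e :: "nat \<Rightarrow> 'b" where "e = from_nat_into UNIV"
  have e: "bij_betw e UNIV UNIV" unfolding e_def by (rule bij_betw_from_nat_into) (use inf in auto)
  have su: "summable (\<lambda>n. F (e n))" if "F summable_on UNIV" for F :: "'b \<Rightarrow> real"
    using summable_on_reindex_bij_betw[OF e, of F] that summable_on_imp_summable by blast
  have eq: "infsum F UNIV = (\<Sum>n. F (e n))" if "\<And>n. norm (F n) \<le> G n" "G summable_on UNIV" for F :: "'b \<Rightarrow> complex" and G
  proof -
    have "(\<lambda>n. norm (F n)) summable_on UNIV"
      by (rule summable_on_comparison_test[OF that(2)]) (use that(1) in auto)
    then have "F summable_on UNIV" by (rule abs_summable_summable)
    then have "(\<lambda>n. F (e n)) summable_on UNIV" using summable_on_reindex_bij_betw[OF e, of F] by simp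
    then have "(\<lambda>n. F (e n)) sums infsum (\<lambda>n. F (e n)) UNIV"
      by (intro has_sum_imp_sums) (simp add: summable_iff_has_sum_infsum)
    then have "(\<Sum>n. F (e n)) = infsum (\<lambda>n. F (e n)) UNIV" by (simp add: sums_iff)
    then show ?thesis using infsum_reindex_bij_betw[OF e, of F] by simp
  qed
  have "((\<lambda>x. \<Sum>n. f (e n) x) has_derivative (\<lambda>h. \<Sum>n. f' (e n) x h)) (at x)"
    by (rule has_derivative_infsum_nat[OF S, of "\<lambda>n. f (e n)" "\<lambda>n. f' (e n)" "\<lambda>n. M (e n)" "\<lambda>n. N (e n)"])
      (use f M N su in auto)
  moreover have "(\<Sum>n. f' (e n) x h) = infsum (\<lambda>n. f' n x h) UNIV" for h
    by (rule eq[of _ "\<lambda>n. M n * norm h", symmetric]) (use M S in \<open>auto intro: summable_on_cmult_left\<close>)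
  ultimately have "((\<lambda>x. \<Sum>n. f (e n) x) has_derivative (\<lambda>h. infsum (\<lambda>n. f' n x h) UNIV)) (at x)" by simp
  then show ?thesis
  proof (rule has_derivative_transform_within_open[of "\<lambda>x. \<Sum>n. f (e n) x" _ x UNIV S])
    show "(\<Sum>n. f (e n) y) = infsum (\<lambda>n. f n y) UNIV" if "y \<in> S" for y
      by (rule eq[of _ N, symmetric]) (use N that in auto)
  qed (use S in auto)
qed

lemma summable_on_multiindex_geometric:
  fixes q :: real
  assumes "0 \<le> q" "q < 1"
  shows "(\<lambda>\<alpha>::'n::finite multiindex. q ^ mi_abs \<alpha>) summable_on UNIV"
proof -
  have s: "summable (\<lambda>k. norm (q ^ k))" using assms by (simp add: summable_geometric_iff)
  have "Infinite_Set_Sum.abs_summable_on (\<lambda>\<alpha>::'n multiindex. \<Prod>i\<in>UNIV. q ^ \<alpha> i) (PiE UNIV (\<lambda>_. UNIV))"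
    using s by (intro abs_summable_on_prod_PiE) (auto simp: abs_summable_on_nat_iff')
  moreover have "PiE UNIV (\<lambda>_::'n. UNIV :: nat set) = UNIV" by (auto simp: PiE_def extensional_def)
  ultimately have "Infinite_Sum.abs_summable_on (\<lambda>\<alpha>::'n multiindex. \<Prod>i\<in>UNIV. q ^ \<alpha> i) UNIV"
    by (simp only: abs_summable_equivalent)
  then have "(\<lambda>\<alpha>::'n multiindex. \<Prod>i\<in>UNIV. q ^ \<alpha> i) summable_on UNIV" by (rule abs_summable_summable)
  then show ?thesis by (simp add: mi_abs_def power_sum)
qed

lemma infinite_multiindex: "infinite (UNIV :: ('n::finite multiindex) set)"
proof -
  have "inj (\<lambda>k (_::'n). k :: nat)" by (auto simp: inj_def fun_eq_iff)
  then have "infinite (range (\<lambda>k (_::'n). k :: nat))" by (rule range_inj_infinite)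
  then show ?thesis by (rule infinite_super[OF subset_UNIV])
qed

definition mi_series :: "real ^ 'n::finite \<Rightarrow> ('n multiindex \<Rightarrow> complex) \<Rightarrow> real ^ 'n \<Rightarrow> complex" where
  "mi_series x0 c x = infsum (\<lambda>\<alpha>. c \<alpha> * of_real (mi_power (x - x0) \<alpha>)) UNIV"

text \<open>The bound that the \<open>k\<close>-th formal derivatives of a power series inherit from geometrically
  bounded coefficients. It is exactly stable under \<open>shift_coeff\<close>, in contrast to a bare geometric bound,
  whose constant would deteriorate with every derivative.\<close>

definition coeff_bound :: "real \<Rightarrow> real \<Rightarrow> nat \<Rightarrow> ('n::finite multiindex \<Rightarrow> complex) \<Rightarrow> bool" where
  "coeff_bound B \<tau> k c \<longleftrightarrow> (\<forall>\<alpha>. norm (c \<alpha>) \<le> B * (fact (mi_abs \<alpha> + k) / fact (mi_abs \<alpha>)) * \<tau> ^ (mi_abs \<alpha> + k))"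

definition shift_coeff :: "'n::finite \<Rightarrow> ('n multiindex \<Rightarrow> complex) \<Rightarrow> 'n multiindex \<Rightarrow> complex" where
  "shift_coeff i c \<beta> = of_nat (Suc (\<beta> i)) * c (\<beta>(i := Suc (\<beta> i)))"

lemma mi_abs_upd_Suc: "mi_abs (\<beta>(i := Suc (\<beta> i))) = Suc (mi_abs (\<beta> :: 'n::finite multiindex))"
  unfolding mi_abs_def by (simp add: sum.remove[of UNIV i])

lemma mi_abs_ge: "\<beta> i \<le> mi_abs (\<beta> :: 'n::finite multiindex)"
  unfolding mi_abs_def by (simp add: sum.remove[of UNIV i])

lemma coeff_bound_shift:
  assumes "coeff_bound B \<tau> k c" "B \<ge> 0" "\<tau> \<ge> 0"
  shows "coeff_bound B \<tau> (Suc k) (shift_coeff i c)"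
  unfolding coeff_bound_def
proof
  fix \<alpha> :: "'a multiindex"
  let ?m = "mi_abs \<alpha>"
  have "norm (shift_coeff i c \<alpha>) = real (Suc (\<alpha> i)) * norm (c (\<alpha>(i := Suc (\<alpha> i))))"
    by (simp add: shift_coeff_def norm_mult del: of_nat_Suc)
  also have "\<dots> \<le> real (Suc ?m) * (B * (fact (Suc ?m + k) / fact (Suc ?m)) * \<tau> ^ (Suc ?m + k))"
    using assms(1)[unfolded coeff_bound_def, rule_format, of "\<alpha>(i := Suc (\<alpha> i))"] mi_abs_ge[of \<alpha> i]
    unfolding mi_abs_upd_Suc by (intro mult_mono) auto
  also have "\<dots> = B * (fact (?m + Suc k) / fact ?m) * \<tau> ^ (?m + Suc k)" 
    by (simp add: field_simps del: of_nat_Suc)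
  finally show "norm (shift_coeff i c \<alpha>) \<le> B * (fact (?m + Suc k) / fact ?m) * \<tau> ^ (?m + Suc k)" .
qed

lemma fact_quotient_bound: "fact (m + k) / fact m \<le> fact k * (2::real) ^ (m + k)"
proof -
  have "fact m * fact k * ((m + k) choose m) = (fact (m + k) :: nat)"
    using binomial_fact_lemma[of m "m + k"] by simp
  moreover have "(m + k) choose m \<le> 2 ^ (m + k)" by (rule binomial_le_pow2)
  ultimately have "fact (m + k) \<le> fact m * fact k * (2 ^ (m + k) :: nat)" by (metis mult_le_mono2)
  then have "real (fact (m + k)) \<le> real (fact m * fact k * 2 ^ (m + k))" by (simp only: of_nat_le_iff)
  then show ?thesis by (simp add: field_simps)
qed

lemma mi_power_bound:
  assumes "norm y \<le> s"
  shows "\<bar>mi_power y \<alpha>\<bar> \<le> s ^ mi_abs \<alpha>"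
proof -
  have "\<bar>mi_power y \<alpha>\<bar> = (\<Prod>i\<in>UNIV. \<bar>y $ i\<bar> ^ \<alpha> i)" by (simp add: mi_power_def abs_prod power_abs)
  also have "\<dots> \<le> (\<Prod>i\<in>UNIV. s ^ \<alpha> i)"
    using assms by (intro prod_mono conjI power_mono) (auto intro: order_trans[OF component_le_norm_cart])
  finally show ?thesis by (simp add: mi_abs_def power_sum)
qed

lemma mi_power_has_derivative:
  "((\<lambda>x. mi_power (x - x0) \<alpha>) has_derivative
     (\<lambda>h. \<Sum>i\<in>UNIV. real (\<alpha> i) * mi_power (x - x0) (\<alpha>(i := \<alpha> i - 1)) * (h $ i))) (at x)"
proof -
  have c: "((\<lambda>x. (x - x0) $ i) has_derivative (\<lambda>h. h $ i)) (at x)" for i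
    by (auto intro!: derivative_eq_intros bounded_linear_imp_has_derivative bounded_linear_vec_nth)
  have "((\<lambda>x. \<Prod>i\<in>UNIV. ((x - x0) $ i) ^ \<alpha> i) has_derivative
     (\<lambda>h. \<Sum>i\<in>UNIV. (of_nat (\<alpha> i) * h $ i * ((x - x0) $ i) ^ (\<alpha> i - 1)) * (\<Prod>j\<in>UNIV - {i}. ((x - x0) $ j) ^ \<alpha> j))) (at x)"
    by (rule has_derivative_prod) (rule has_derivative_power[OF c])
  moreover have "mi_power (x - x0) (\<alpha>(i := \<alpha> i - 1)) = ((x - x0) $ i) ^ (\<alpha> i - 1) * (\<Prod>j\<in>UNIV - {i}. ((x - x0) $ j) ^ \<alpha> j)" for i
    unfolding mi_power_def by (subst prod.remove[of UNIV i]) auto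
  ultimately show ?thesis unfolding mi_power_def[of _ \<alpha>] by (simp add: mult.assoc mult.left_commute mult.commute)
qed

lemma mi_series_term_bound:
  assumes c: "coeff_bound B \<tau> k c" and B: "B \<ge> 0" and t: "\<tau> > 0"
  shows "norm (c \<alpha>) \<le> B * fact k * (2 * \<tau>) ^ k * (2 * \<tau>) ^ mi_abs \<alpha>"
proof -
  have "norm (c \<alpha>) \<le> B * (fact (mi_abs \<alpha> + k) / fact (mi_abs \<alpha>)) * \<tau> ^ (mi_abs \<alpha> + k)"
    using c by (simp add: coeff_bound_def)
  also have "\<dots> \<le> B * (fact k * 2 ^ (mi_abs \<alpha> + k)) * \<tau> ^ (mi_abs \<alpha> + k)"
    using B t by (intro mult_right_mono mult_left_mono fact_quotient_bound) auto
  also have "\<dots> = B * fact k * (2 * \<tau>) ^ k * (2 * \<tau>) ^ mi_abs \<alpha>"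
    by (simp add: power_add power_mult_distrib)
  finally show ?thesis .
qed

text \<open>Within distance \<open>1 / (8 \<tau>)\<close> the terms and their differentials are dominated by a
  geometric series in \<open>|\<alpha>|\<close>. The radius is the same for all \<open>k\<close>, which is why all
  derivatives are controlled on one ball.\<close>

lemma mi_series_bounds:
  fixes x :: "real ^ 'n::finite"
  assumes c: "coeff_bound B \<tau> k c" and B: "B \<ge> 0" and t: "\<tau> > 0" and s: "s = 1 / (8 * \<tau>)" and x: "norm (x - x0) \<le> s"
  shows "norm (c \<alpha> * of_real (mi_power (x - x0) \<alpha>)) \<le> B * fact k * (2 * \<tau>) ^ k * (1/2) ^ mi_abs \<alpha>"
    and "norm (c \<alpha> * of_real (\<Sum>i\<in>UNIV. real (\<alpha> i) * mi_power (x - x0) (\<alpha>(i := \<alpha> i - 1)) * (h $ i)))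
       \<le> B * fact k * (2 * \<tau>) ^ k / s * (1/2) ^ mi_abs \<alpha> * norm h"
proof -
  let ?D = "B * fact k * (2 * \<tau>) ^ k" and ?m = "mi_abs \<alpha>"
  have sp: "s > 0" using s t by simp
  have ts: "(2 * \<tau>) ^ ?m * s ^ ?m = (1/4) ^ ?m" unfolding power_mult_distrib[symmetric] using t by (simp add: s)
  have D: "?D \<ge> 0" using B t by simp
  have "norm (c \<alpha> * of_real (mi_power (x - x0) \<alpha>)) \<le> (?D * (2 * \<tau>) ^ ?m) * s ^ ?m"
    unfolding norm_mult norm_of_real using B t mi_power_bound[OF x, of \<alpha>]
    by (intro mult_mono mi_series_term_bound[OF c]) auto
  also have "\<dots> = ?D * (1/4) ^ ?m" using ts by (simp add: mult.assoc)
  also have "\<dots> \<le> ?D * (1/2) ^ ?m" using D by (intro mult_left_mono power_mono) auto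
  finally show "norm (c \<alpha> * of_real (mi_power (x - x0) \<alpha>)) \<le> ?D * (1/2) ^ ?m" .
  have "\<bar>\<Sum>i\<in>UNIV. real (\<alpha> i) * mi_power (x - x0) (\<alpha>(i := \<alpha> i - 1)) * (h $ i)\<bar> \<le>
     (\<Sum>i\<in>UNIV. real (\<alpha> i) * (s ^ ?m / s) * norm h)"
  proof (rule order_trans[OF sum_abs sum_mono])
    fix i
    show "\<bar>real (\<alpha> i) * mi_power (x - x0) (\<alpha>(i := \<alpha> i - 1)) * (h $ i)\<bar> \<le> real (\<alpha> i) * (s ^ ?m / s) * norm h"
    proof (cases "\<alpha> i = 0")
      case False
      then have "(\<alpha>(i := \<alpha> i - 1))(i := Suc ((\<alpha>(i := \<alpha> i - 1)) i)) = \<alpha>" by auto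
      then have "?m = Suc (mi_abs (\<alpha>(i := \<alpha> i - 1)))" using mi_abs_upd_Suc[of "\<alpha>(i := \<alpha> i - 1)" i] by simp
      then have "\<bar>mi_power (x - x0) (\<alpha>(i := \<alpha> i - 1))\<bar> \<le> s ^ ?m / s"
        using mi_power_bound[OF x, of "\<alpha>(i := \<alpha> i - 1)"] sp by simp
      then show ?thesis unfolding abs_mult
        using sp component_le_norm_cart[of h i] by (intro mult_mono) auto
    qed (use sp in simp)
  qed
  also have "\<dots> = real ?m * (s ^ ?m / s) * norm h" unfolding mi_abs_def of_nat_sum sum_distrib_right ..
  finally have b: "\<bar>\<Sum>i\<in>UNIV. real (\<alpha> i) * mi_power (x - x0) (\<alpha>(i := \<alpha> i - 1)) * (h $ i)\<bar> \<le> real ?m * (s ^ ?m / s) * norm h" .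
  have "norm (c \<alpha> * of_real (\<Sum>i\<in>UNIV. real (\<alpha> i) * mi_power (x - x0) (\<alpha>(i := \<alpha> i - 1)) * (h $ i)))
     \<le> (?D * (2 * \<tau>) ^ ?m) * (real ?m * (s ^ ?m / s) * norm h)"
    unfolding norm_mult norm_of_real using B t b
    by (intro mult_mono mi_series_term_bound[OF c]) auto
  also have "\<dots> = ?D / s * (real ?m * ((2 * \<tau>) ^ ?m * s ^ ?m)) * norm h" by simp
  also have "\<dots> \<le> ?D / s * (1/2) ^ ?m * norm h"
  proof (intro mult_right_mono mult_left_mono)
    have "real ?m \<le> 2 ^ ?m" using less_exp[of ?m] by (metis less_imp_le of_nat_le_iff of_nat_power of_nat_numeral)
    then have "real ?m * (1/4) ^ ?m \<le> 2 ^ ?m * (1/4) ^ ?m" by (intro mult_right_mono) auto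
    also have "\<dots> = (1/2) ^ ?m" unfolding power_mult_distrib[symmetric] by simp
    finally show "real ?m * ((2 * \<tau>) ^ ?m * s ^ ?m) \<le> (1/2) ^ ?m" unfolding ts .
  qed (use D sp in auto)
  finally show "norm (c \<alpha> * of_real (\<Sum>i\<in>UNIV. real (\<alpha> i) * mi_power (x - x0) (\<alpha>(i := \<alpha> i - 1)) * (h $ i)))
       \<le> ?D / s * (1/2) ^ ?m * norm h" .
qed

lemma mi_series_has_derivative:
  fixes x :: "real ^ 'n::finite"
  assumes c: "coeff_bound B \<tau> k c" and B: "B \<ge> 0" and t: "\<tau> > 0" and s: "s = 1 / (8 * \<tau>)" and x: "x \<in> ball x0 s"
  shows "(mi_series x0 c has_derivative
     (\<lambda>h. infsum (\<lambda>\<alpha>. c \<alpha> * of_real (\<Sum>i\<in>UNIV. real (\<alpha> i) * mi_power (x - x0) (\<alpha>(i := \<alpha> i - 1)) * (h $ i))) UNIV)) (at x)"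
proof -
  let ?D = "B * fact k * (2 * \<tau>) ^ k"
  have sp: "s > 0" using s t by simp
  have D: "?D \<ge> 0" using B t by simp
  have g: "(\<lambda>\<alpha>::'n multiindex. (1/2::real) ^ mi_abs \<alpha>) summable_on UNIV"
    by (rule summable_on_multiindex_geometric) auto
  have "((\<lambda>x. infsum (\<lambda>\<alpha>. c \<alpha> * of_real (mi_power (x - x0) \<alpha>)) UNIV) has_derivative
     (\<lambda>h. infsum (\<lambda>\<alpha>. c \<alpha> * of_real (\<Sum>i\<in>UNIV. real (\<alpha> i) * mi_power (x - x0) (\<alpha>(i := \<alpha> i - 1)) * (h $ i))) UNIV)) (at x)"
  proof (rule has_derivative_infsum[where S = "ball x0 s" and M = "\<lambda>\<alpha>. ?D / s * (1/2) ^ mi_abs \<alpha>" and N = "\<lambda>\<alpha>. ?D * (1/2) ^ mi_abs \<alpha>"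
       and f' = "\<lambda>\<alpha> x h. c \<alpha> * of_real (\<Sum>i\<in>UNIV. real (\<alpha> i) * mi_power (x - x0) (\<alpha>(i := \<alpha> i - 1)) * (h $ i))"])
    show "((\<lambda>x. c \<alpha> * of_real (mi_power (x - x0) \<alpha>)) has_derivative
       (\<lambda>h. c \<alpha> * of_real (\<Sum>i\<in>UNIV. real (\<alpha> i) * mi_power (x - x0) (\<alpha>(i := \<alpha> i - 1)) * (h $ i)))) (at x)" for \<alpha> x
      by (intro has_derivative_mult_right has_derivative_of_real mi_power_has_derivative)
    show "(\<lambda>\<alpha>::'n multiindex. ?D / s * (1/2) ^ mi_abs \<alpha>) summable_on UNIV"
      "(\<lambda>\<alpha>::'n multiindex. ?D * (1/2) ^ mi_abs \<alpha>) summable_on UNIV"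
      by (intro summable_on_cmult_right g)+
    fix \<alpha> :: "'n multiindex" and y h :: "real ^ 'n" assume "y \<in> ball x0 s"
    then have y: "norm (y - x0) \<le> s" by (simp add: dist_norm norm_minus_commute)
    show "norm (c \<alpha> * of_real (\<Sum>i\<in>UNIV. real (\<alpha> i) * mi_power (y - x0) (\<alpha>(i := \<alpha> i - 1)) * (h $ i))) \<le> ?D / s * (1/2) ^ mi_abs \<alpha> * norm h"
      by (rule mi_series_bounds(2)[OF c B t s y])
    show "norm (c \<alpha> * of_real (mi_power (y - x0) \<alpha>)) \<le> ?D * (1/2) ^ mi_abs \<alpha>"
      by (rule mi_series_bounds(1)[OF c B t s y])
  qed (use infinite_multiindex x D sp in auto)
  then show ?thesis unfolding mi_series_def[abs_def] .
qed

text \<open>Termwise differentiation, with the sum reindexed by raising the exponent of the differentiated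
  variable.\<close>

lemma mi_series_partial:
  fixes x :: "real ^ 'n::finite"
  assumes c: "coeff_bound B \<tau> k c" and B: "B \<ge> 0" and t: "\<tau> > 0" and s: "s = 1 / (8 * \<tau>)" and x: "x \<in> ball x0 s"
  shows "partial i (mi_series x0 c) x = mi_series x0 (shift_coeff i c) x"
proof -
  let ?up = "\<lambda>\<beta>::'n multiindex. \<beta>(i := Suc (\<beta> i))"
  have inj: "inj ?up"
  proof (rule injI)
    fix \<beta> \<gamma> :: "'n multiindex" assume "?up \<beta> = ?up \<gamma>"
    then have "(?up \<beta>) j = (?up \<gamma>) j" for j by simp
    then have "\<beta> j = \<gamma> j" for j by (cases "j = i") (metis fun_upd_same nat.inject, metis fun_upd_other)
    then show "\<beta> = \<gamma>" by blast
  qed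
  let ?F = "\<lambda>\<alpha>. c \<alpha> * of_real (real (\<alpha> i) * mi_power (x - x0) (\<alpha>(i := \<alpha> i - 1)))"
  have "(\<Sum>j\<in>UNIV. real (\<alpha> j) * mi_power (x - x0) (\<alpha>(j := \<alpha> j - 1)) * ((axis i 1 :: real ^ 'n) $ j))
     = real (\<alpha> i) * mi_power (x - x0) (\<alpha>(i := \<alpha> i - 1))" for \<alpha>
    by (simp add: axis_def if_distrib cong: if_cong)
  then have "partial i (mi_series x0 c) x = infsum ?F UNIV"
    using has_derivative_partial(1)[OF mi_series_has_derivative[OF c B t s x], of i] by simp
  also have "\<dots> = infsum ?F (range ?up)"
  proof (rule infsum_cong_neutral)
    fix \<alpha> :: "'n multiindex" assume "\<alpha> \<in> UNIV - range ?up"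
    moreover have "\<alpha> = ?up (\<alpha>(i := \<alpha> i - 1))" if "\<alpha> i \<noteq> 0" using that by auto
    ultimately have "\<alpha> i = 0" by blast
    then show "?F \<alpha> = 0" by simp
  qed auto
  also have "\<dots> = infsum (?F \<circ> ?up) UNIV" by (rule infsum_reindex[OF inj])
  also have "\<dots> = mi_series x0 (shift_coeff i c) x"
    unfolding mi_series_def shift_coeff_def by (intro infsum_cong) (simp add: algebra_simps del: of_nat_Suc)
  finally show ?thesis .
qed

lemma mi_series_partials_bound:
  fixes x :: "real ^ 'n::finite"
  assumes "coeff_bound B \<tau> k c" and B: "B \<ge> 0" and t: "\<tau> > 0" and s: "s = 1 / (8 * \<tau>)" and x: "x \<in> ball x0 s"
  shows "norm (partials is (mi_series x0 c) x) \<le> B * fact (k + length is) * (2 * \<tau>) ^ (k + length is) * infsum (\<lambda>\<alpha>::'n multiindex. (1/2) ^ mi_abs \<alpha>) UNIV"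
  using assms(1)
proof (induction "is" arbitrary: c k rule: rev_induct)
  case Nil
  let ?D = "B * fact k * (2 * \<tau>) ^ k"
  have xs: "norm (x - x0) \<le> s" using x by (simp add: dist_norm norm_minus_commute)
  have g: "(\<lambda>\<alpha>::'n multiindex. (1/2::real) ^ mi_abs \<alpha>) summable_on UNIV"
    by (rule summable_on_multiindex_geometric) auto
  have Ng: "(\<lambda>\<alpha>::'n multiindex. ?D * (1/2) ^ mi_abs \<alpha>) summable_on UNIV" by (rule summable_on_cmult_right[OF g])
  have tb: "norm (c \<alpha> * of_real (mi_power (x - x0) \<alpha>)) \<le> ?D * (1/2) ^ mi_abs \<alpha>" for \<alpha>
    by (rule mi_series_bounds(1)[OF Nil B t s xs])
  have "(\<lambda>\<alpha>. norm (c \<alpha> * of_real (mi_power (x - x0) \<alpha>))) summable_on UNIV"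
    by (rule summable_on_comparison_test[OF Ng tb]) simp
  then have fs: "(\<lambda>\<alpha>. c \<alpha> * of_real (mi_power (x - x0) \<alpha>)) summable_on UNIV" by (rule abs_summable_summable)
  have "norm (mi_series x0 c x) \<le> infsum (\<lambda>\<alpha>::'n multiindex. ?D * (1/2) ^ mi_abs \<alpha>) UNIV"
    unfolding mi_series_def
    by (rule norm_infsum_le[OF has_sum_infsum[OF fs] has_sum_infsum[OF Ng] tb])
  also have "\<dots> = ?D * infsum (\<lambda>\<alpha>::'n multiindex. (1/2) ^ mi_abs \<alpha>) UNIV" by (rule infsum_cmult_right) (use g in auto)
  finally show ?case by simp
next
  case (snoc i "is")
  have "partials (is @ [i]) (mi_series x0 c) x = partials is (partial i (mi_series x0 c)) x" by simp
  also have "\<dots> = partials is (mi_series x0 (shift_coeff i c)) x"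
    by (rule partials_cong_open[of "ball x0 s"]) (use mi_series_partial[OF snoc.prems B t s] x in auto)
  finally show ?case
    using snoc.IH[OF coeff_bound_shift[OF snoc.prems B less_imp_le[OF t]], of i] by simp
qed

lemma mi_series_smooth:
  assumes c: "coeff_bound B \<tau> k c" and B: "B \<ge> 0" and t: "\<tau> > 0" and s: "s = 1 / (8 * \<tau>)"
  shows "smooth_on (ball x0 s) (mi_series x0 c)"
proof (rule smooth_on_coinduct[of _ "\<lambda>f. \<exists>c k. coeff_bound B \<tau> k c \<and> f = mi_series x0 c"])
  show "\<exists>c' k. coeff_bound B \<tau> k c' \<and> mi_series x0 c = mi_series x0 c'" using c by blast
  fix f assume "\<exists>c k. coeff_bound B \<tau> k c \<and> f = mi_series x0 c"
  then obtain c k where ck: "coeff_bound B \<tau> k c" and f: "f = mi_series x0 c" by blast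
  have "\<exists>g. (\<exists>c k. coeff_bound B \<tau> k c \<and> g = mi_series x0 c) \<and> (\<forall>x\<in>ball x0 s. partial i f x = g x)" for i
    using coeff_bound_shift[OF ck B less_imp_le[OF t], of i] mi_series_partial[OF ck B t s, of _ x0 i] f by blast
  moreover have "\<forall>x\<in>ball x0 s. f differentiable at x"
    using mi_series_has_derivative[OF ck B t s, of _ x0] unfolding f differentiable_def by blast
  ultimately show "(\<forall>x\<in>ball x0 s. f differentiable at x) \<and>
     (\<forall>i. \<exists>g. (\<exists>c k. coeff_bound B \<tau> k c \<and> g = mi_series x0 c) \<and> (\<forall>x\<in>ball x0 s. partial i f x = g x))" by blast
qed simp

text \<open>Convergence at one point with all coordinates displaced by \<open>q\<close> bounds the coefficients
  geometrically; the Cauchy estimates then hold for the formal derivatives.\<close>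

lemma real_analytic_local:
  fixes f :: "real ^ 'n::finite \<Rightarrow> complex"
  assumes "r > 0" and f: "\<And>x. x \<in> ball x0 r \<Longrightarrow> ((\<lambda>\<alpha>. c \<alpha> * of_real (mi_power (x - x0) \<alpha>)) has_sum f x) UNIV"
  shows "\<exists>s>0. \<exists>A\<ge>1. smooth_on (ball x0 s) f \<and>
    (\<forall>x\<in>ball x0 s. \<forall>is. norm (partials is f x) \<le> A ^ Suc (length is) * fact (length is))"
proof -
  define q where "q = r / (2 * real CARD('n))"
  have q: "q > 0" using assms(1) by (simp add: q_def)
  let ?y = "x0 + (\<chi> i. q)"
  have "norm (\<chi> i::'n. q) \<le> (\<Sum>i::'n\<in>UNIV. \<bar>q\<bar>)" using norm_le_l1_cart[of "\<chi> i::'n. q"] by simp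
  also have "\<dots> < r" using assms(1) by (simp add: q_def)
  finally have "?y \<in> ball x0 r" by (simp add: dist_norm)
  moreover have "mi_power (?y - x0) \<alpha> = q ^ mi_abs \<alpha>" for \<alpha> by (simp add: mi_power_def mi_abs_def power_sum)
  ultimately have "((\<lambda>\<alpha>. c \<alpha> * of_real (q ^ mi_abs \<alpha>)) has_sum f ?y) UNIV" using f[of ?y] by simp
  then have "(\<lambda>\<alpha>. c \<alpha> * of_real (q ^ mi_abs \<alpha>)) summable_on UNIV" by (rule has_sum_imp_summable)
  then have sm: "(\<lambda>\<alpha>. norm (c \<alpha> * of_real (q ^ mi_abs \<alpha>))) summable_on UNIV" by (simp add: summable_on_iff_abs_summable_on_complex)
  define B where "B = infsum (\<lambda>\<alpha>. norm (c \<alpha> * of_real (q ^ mi_abs \<alpha>))) UNIV"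
  have B: "B \<ge> 0" unfolding B_def by (rule infsum_nonneg) auto
  define \<tau> where "\<tau> = 1 / q"
  have t: "\<tau> > 0" using q by (simp add: \<tau>_def)
  have "norm (c \<alpha>) \<le> B * \<tau> ^ mi_abs \<alpha>" for \<alpha>
  proof -
    have "infsum (\<lambda>\<alpha>. norm (c \<alpha> * of_real (q ^ mi_abs \<alpha>))) {\<alpha>} \<le> B"
      unfolding B_def by (rule infsum_mono_neutral) (use sm in auto)
    then have "norm (c \<alpha>) * q ^ mi_abs \<alpha> \<le> B" using q by (simp add: norm_mult norm_power)
    then show ?thesis using q by (simp add: \<tau>_def field_simps)
  qed
  then have cb: "coeff_bound B \<tau> 0 c" by (simp add: coeff_bound_def)
  define s where "s = min r (1 / (8 * \<tau>))"
  have s: "s > 0" "s \<le> r" "s \<le> 1 / (8 * \<tau>)" using t assms(1) by (auto simp: s_def)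
  have eq: "mi_series x0 c x = f x" if "x \<in> ball x0 s" for x
    unfolding mi_series_def using f[of x] that s by (intro infsumI) auto
  define Z where "Z = infsum (\<lambda>\<alpha>::'n multiindex. (1/2::real) ^ mi_abs \<alpha>) UNIV"
  have Z: "Z \<ge> 0" unfolding Z_def by (rule infsum_nonneg) auto
  show ?thesis
  proof (rule exI[of _ s], rule conjI[OF s(1)], rule exI[of _ "1 + B * Z + 2 * \<tau>"], intro conjI ballI allI)
    have BZ: "0 \<le> B * Z" using B Z by simp
    show "1 \<le> 1 + B * Z + 2 * \<tau>" using BZ t by simp
    show "smooth_on (ball x0 s) f"
      by (rule smooth_on_cong[of _ "mi_series x0 c"])
        (use eq smooth_on_subset[OF mi_series_smooth[OF cb B t refl] subset_ball[OF s(3)]] in auto)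
    fix x "is" assume x: "x \<in> ball x0 s"
    have "partials is f x = partials is (mi_series x0 c) x"
      by (rule partials_cong_open[of "ball x0 s"]) (use eq x in auto)
    then have "norm (partials is f x) \<le> B * fact (length is) * (2 * \<tau>) ^ length is * Z"
      using mi_series_partials_bound[OF cb B t refl, of x x0 "is"] x s unfolding Z_def by auto
    also have "\<dots> = (B * Z) * (2 * \<tau>) ^ length is * fact (length is)" by simp
    also have "\<dots> \<le> (1 + B * Z + 2 * \<tau>) * (1 + B * Z + 2 * \<tau>) ^ length is * fact (length is)"
      using BZ t by (intro mult_right_mono mult_mono power_mono) auto
    finally show "norm (partials is f x) \<le> (1 + B * Z + 2 * \<tau>) ^ Suc (length is) * fact (length is)" by simp
  qed
qed

lemma real_analytic_on_smooth:
  assumes "real_analytic_on \<Omega> f"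
  shows "smooth_on \<Omega> f"
  unfolding smooth_on_def
proof (intro allI ballI)
  fix "is" x assume "x \<in> \<Omega>"
  then obtain c r where "r > 0" "\<And>y. y \<in> ball x r \<Longrightarrow> ((\<lambda>\<alpha>. c \<alpha> * of_real (mi_power (y - x) \<alpha>)) has_sum f y) UNIV"
    using assms unfolding real_analytic_on_def by blast
  then obtain s where "s > 0" "smooth_on (ball x s) f" using real_analytic_local[of r x c f] by blast
  then show "partials is f differentiable at x" by (auto simp: smooth_on_def)
qed

lemma real_analytic_on_bounds:
  assumes f: "real_analytic_on \<Omega> f" and K: "compact K" "K \<subseteq> \<Omega>"
  obtains A where "A \<ge> 1" "\<And>x is. x \<in> K \<Longrightarrow> norm (partials is f x) \<le> A ^ Suc (length is) * fact (length is)"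
proof -
  have ex: "\<forall>x\<in>K. \<exists>sA. fst sA > 0 \<and> snd sA \<ge> 1 \<and> (\<forall>y\<in>ball x (fst sA). \<forall>is. norm (partials is f y) \<le> (snd sA) ^ Suc (length is) * fact (length is))"
  proof
    fix x assume "x \<in> K"
    then have "x \<in> \<Omega>" using K by blast
    then obtain c r where "r > 0" "\<And>y. y \<in> ball x r \<Longrightarrow> ((\<lambda>\<alpha>. c \<alpha> * of_real (mi_power (y - x) \<alpha>)) has_sum f y) UNIV"
      using f unfolding real_analytic_on_def by blast
    then obtain s A where "s > 0" "A \<ge> 1" "\<forall>y\<in>ball x s. \<forall>is. norm (partials is f y) \<le> A ^ Suc (length is) * fact (length is)"
      using real_analytic_local[of r x c f] by blast
    then show "\<exists>sA. fst sA > 0 \<and> snd sA \<ge> 1 \<and> (\<forall>y\<in>ball x (fst sA). \<forall>is. norm (partials is f y) \<le> (snd sA) ^ Suc (length is) * fact (length is))"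
      by (intro exI[of _ "(s, A)"]) simp
  qed
  obtain S where S: "\<forall>x\<in>K. fst (S x) > 0 \<and> snd (S x) \<ge> 1 \<and> (\<forall>y\<in>ball x (fst (S x)). \<forall>is. norm (partials is f y) \<le> (snd (S x)) ^ Suc (length is) * fact (length is))"
    by (rule exE[OF bchoice[OF ex]]) (rule that)
  obtain T where T: "T \<subseteq> K" "finite T" "K \<subseteq> (\<Union>x\<in>T. ball x (fst (S x)))"
  proof (rule compactE_image[OF K(1), of K "\<lambda>x. ball x (fst (S x))"])
    show "K \<subseteq> (\<Union>x\<in>K. ball x (fst (S x)))" using S by force
  qed (use that in auto)
  have S1: "snd (S x) \<ge> 1" if "x \<in> T" for x using S T(1) that by blast
  define A where "A = 1 + (\<Sum>x\<in>T. snd (S x))"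
  have A: "snd (S x) \<le> A" if "x \<in> T" for x
  proof -
    have "snd (S x) \<le> (\<Sum>x\<in>T. snd (S x))" 
      by (intro member_le_sum that T(2)) (use S1 in \<open>force intro: order_trans[OF zero_le_one]\<close>)
    then show ?thesis by (simp add: A_def)
  qed
  show ?thesis
  proof (rule that[of A])
    show "A \<ge> 1" unfolding A_def using S1 by (simp add: sum_nonneg order_trans[OF zero_le_one])
    fix x "is" assume "x \<in> K"
    then obtain z where z: "z \<in> T" "x \<in> ball z (fst (S z))" using T(3) by blast
    then have "norm (partials is f x) \<le> (snd (S z)) ^ Suc (length is) * fact (length is)" using S T(1) by blast
    also have "\<dots> \<le> A ^ Suc (length is) * fact (length is)"
      using A[OF z(1)] S1[OF z(1)] by (intro mult_right_mono power_mono) auto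
    finally show "norm (partials is f x) \<le> A ^ Suc (length is) * fact (length is)" .
  qed
qed

section \<open>Test functions and regular distributions\<close>

text \<open>The list of directions of a multi-index, in the order in which \<open>mi_partial\<close>
  differentiates.\<close>

definition mi_list :: "'n::finite multiindex \<Rightarrow> 'n list" where
  "mi_list \<alpha> = concat (map (\<lambda>i. replicate (\<alpha> i) i) coords)"

lemma coords: "distinct (coords :: 'n::finite list)" "set (coords :: 'n list) = UNIV"
proof -
  obtain xs :: "'n list" where "set xs = UNIV" "distinct xs" using finite_distinct_list[of "UNIV :: 'n set"] by auto
  then have "distinct (coords :: 'n list) \<and> set (coords :: 'n list) = UNIV"
    unfolding coords_def by (intro someI[of "\<lambda>is. distinct is \<and> set is = UNIV" xs]) simp
  then show "distinct (coords :: 'n list)" "set (coords :: 'n list) = UNIV" by auto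
qed

lemma foldr_funpow_concat: "foldr (\<lambda>i. f i ^^ \<alpha> i) cs x = foldr f (concat (map (\<lambda>i. replicate (\<alpha> i) i) cs)) x"
  by (induction cs) (auto simp: foldr_replicate)

lemma mi_partial_eq: "mi_partial \<alpha> f = partials (mi_list \<alpha>) f"
  unfolding mi_partial_def mi_list_def by (rule foldr_funpow_concat)

lemma length_mi_list: "length (mi_list \<alpha>) = mi_abs \<alpha>"
proof -
  have "length (mi_list \<alpha>) = sum_list (map \<alpha> coords)" by (simp add: mi_list_def length_concat o_def)
  also have "\<dots> = mi_abs \<alpha>" using sum_list_distinct_conv_sum_set[OF coords(1), of \<alpha>] by (simp add: coords mi_abs_def)
  finally show ?thesis .
qed

lemma count_mi_list: "count (mset (mi_list \<alpha>)) i = \<alpha> i"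
proof -
  have c: "count (mset (concat (map (\<lambda>i. replicate (\<alpha> i) i) cs))) i = (if i \<in> set cs then \<alpha> i else 0)" if "distinct cs" for cs
    using that by (induction cs) auto
  show ?thesis unfolding mi_list_def using c[OF coords(1)] by (simp add: coords(2))
qed

lemma mset_mi_list_count: "mset (mi_list (count (mset is))) = mset is"
  by (rule multiset_eqI) (simp add: count_mi_list)

lemma finite_mi_le: "finite {\<alpha> :: 'n::finite multiindex. mi_abs \<alpha> \<le> d}"
proof (rule finite_subset)
  show "{\<alpha> :: 'n multiindex. mi_abs \<alpha> \<le> d} \<subseteq> PiE UNIV (\<lambda>_. {..d})"
  proof
    fix \<alpha> :: "'n multiindex" assume "\<alpha> \<in> {\<alpha>. mi_abs \<alpha> \<le> d}"
    then have "\<alpha> i \<le> d" for i using member_le_sum[of i UNIV \<alpha>] by (auto simp: mi_abs_def)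
    then show "\<alpha> \<in> PiE UNIV (\<lambda>_. {..d})" by auto
  qed
qed (intro finite_PiE, auto)

text \<open>Every list of directions is a rearrangement of the list of its multiplicities, so bounds for multi-indices
  suffice.\<close>

lemma partials_bounds_of_mi_partial:
  assumes U: "open U" "x \<in> U" and f: "smooth_on U f" and b: "\<And>\<alpha>. norm (mi_partial \<alpha> f x) \<le> N (mi_abs \<alpha>)"
  shows "norm (partials is f x) \<le> N (length is)"
proof -
  let ?\<alpha> = "count (mset is)"
  have "length (mi_list ?\<alpha>) = length is" using mset_mi_list_count[of "is"] by (metis size_mset)
  moreover have "partials is f x = mi_partial ?\<alpha> f x"
    unfolding mi_partial_eq by (rule partials_mset_cong[OF U f]) (simp add: mset_mi_list_count)
  ultimately show ?thesis using b[of ?\<alpha>] by (simp add: length_mi_list)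
qed

lemma not_in_supp: "x \<notin> supp \<phi> \<Longrightarrow> \<phi> x = 0"
  unfolding supp_def using closure_subset[of "{x. \<phi> x \<noteq> 0}"] by auto

lemma closed_supp: "closed (supp \<phi>)" by (simp add: supp_def)

lemma supp_minimal: "closed S \<Longrightarrow> (\<And>x. x \<notin> S \<Longrightarrow> \<phi> x = 0) \<Longrightarrow> supp \<phi> \<subseteq> S"
  unfolding supp_def by (rule closure_minimal) auto

lemma smooth_on_UNIV_of_supp:
  assumes "smooth_on U f" "closed S" "S \<subseteq> U" "\<And>x. x \<notin> S \<Longrightarrow> f x = 0"
  shows "smooth_on UNIV f"
proof -
  have "smooth_on (- S) f"
    by (rule smooth_on_cong[of "- S" "\<lambda>x. 0"]) (use assms in auto)
  then have "smooth_on (U \<union> - S) f" using assms(1) by (intro smooth_on_Un)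
  moreover have "U \<union> - S = UNIV" using assms(3) by blast
  ultimately show ?thesis by simp
qed

lemma partials_outside_supp: "closed S \<Longrightarrow> (\<And>x. x \<notin> S \<Longrightarrow> \<phi> x = 0) \<Longrightarrow> x \<notin> S \<Longrightarrow> partials is \<phi> x = 0"
  using partials_cong_open[of "- S" \<phi> "\<lambda>x. 0" x "is"] by auto

lemma test_functionI:
  assumes "smooth_on UNIV \<phi>" "compact K" "K \<subseteq> \<Omega>" "\<And>x. x \<notin> K \<Longrightarrow> \<phi> x = 0"
  shows "\<phi> \<in> test_functions \<Omega>" "supp \<phi> \<subseteq> K"
proof -
  show s: "supp \<phi> \<subseteq> K" by (rule supp_minimal) (use assms compact_imp_closed in auto)
  have "compact (supp \<phi>)" using compact_Int_closed[OF assms(2) closed_supp[of \<phi>]] s by (simp add: Int_absorb1)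
  then show "\<phi> \<in> test_functions \<Omega>" using s assms by (auto simp: test_functions_def)
qed

lemma test_functionsD:
  assumes "\<phi> \<in> test_functions \<Omega>"
  shows "smooth_on UNIV \<phi>" "compact (supp \<phi>)" "supp \<phi> \<subseteq> \<Omega>"
  using assms by (auto simp: test_functions_def)

lemma test_function_mult:
  assumes "open \<Omega>" "\<phi> \<in> test_functions \<Omega>" "smooth_on \<Omega> a"
  shows "(\<lambda>x. a x * \<phi> x) \<in> test_functions \<Omega>" "supp (\<lambda>x. a x * \<phi> x) \<subseteq> supp \<phi>"
proof -
  note t = test_functionsD[OF assms(2)]
  have "smooth_on \<Omega> (\<lambda>x. a x * \<phi> x)" using t(1) assms by (intro smooth_on_mult) (auto intro: smooth_on_subset)
  then have "smooth_on UNIV (\<lambda>x. a x * \<phi> x)"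
    by (rule smooth_on_UNIV_of_supp[OF _ closed_supp t(3)]) (simp add: not_in_supp)
  then show "(\<lambda>x. a x * \<phi> x) \<in> test_functions \<Omega>" "supp (\<lambda>x. a x * \<phi> x) \<subseteq> supp \<phi>"
    using test_functionI[OF _ t(2,3), of "\<lambda>x. a x * \<phi> x"] by (auto simp: not_in_supp)
qed

lemma test_function_partials:
  assumes "\<phi> \<in> test_functions \<Omega>"
  shows "partials is \<phi> \<in> test_functions \<Omega>" "supp (partials is \<phi>) \<subseteq> supp \<phi>"
proof -
  note t = test_functionsD[OF assms]
  have "x \<notin> supp \<phi> \<Longrightarrow> partials is \<phi> x = 0" for x
    by (rule partials_outside_supp[OF closed_supp[of \<phi>]]) (simp_all add: not_in_supp)
  then show "partials is \<phi> \<in> test_functions \<Omega>" "supp (partials is \<phi>) \<subseteq> supp \<phi>"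
    using test_functionI[OF smooth_on_partials[OF t(1)] t(2,3)] by auto
qed

lemma test_function_cmult:
  assumes "open \<Omega>" "\<phi> \<in> test_functions \<Omega>"
  shows "(\<lambda>x. c * \<phi> x) \<in> test_functions \<Omega>" "supp (\<lambda>x. c * \<phi> x) \<subseteq> supp \<phi>"
  using test_function_mult[OF assms, of "\<lambda>_. c"] by auto

lemma test_function_bounded:
  assumes "\<phi> \<in> test_functions \<Omega>"
  obtains B where "B \<ge> 0" "\<And>x. norm (\<phi> x) \<le> B"
proof -
  note t = test_functionsD[OF assms]
  have "continuous_on (supp \<phi>) \<phi>" using smooth_on_continuous_on[OF t(1)] continuous_on_subset by blast
  then have "bounded (\<phi> ` supp \<phi>)" using t(2) compact_continuous_image compact_imp_bounded by blast
  then obtain B where B: "\<forall>x\<in>supp \<phi>. norm (\<phi> x) \<le> B" by (auto simp: bounded_iff)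
  show ?thesis
  proof (rule that[of "max 0 B"])
    fix x show "norm (\<phi> x) \<le> max 0 B" using B not_in_supp[of x \<phi>] by (cases "x \<in> supp \<phi>") (auto simp: le_max_iff_disj)
  qed simp
qed

lemma integrable_continuous_compact_support:
  fixes \<phi> :: "real ^ 'n::finite \<Rightarrow> complex"
  assumes "continuous_on UNIV \<phi>" "compact K" "\<And>x. x \<notin> K \<Longrightarrow> \<phi> x = 0"
  shows "integrable lborel \<phi>"
proof -
  have "integrable lborel (\<lambda>x. indicator K x *\<^sub>R \<phi> x)"
    using assms continuous_on_subset by (intro borel_integrable_compact) blast+
  moreover have "(\<lambda>x. indicator K x *\<^sub>R \<phi> x) = \<phi>" using assms(3) by (auto simp: indicator_def fun_eq_iff)
  ultimately show ?thesis by simp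
qed

lemma test_function_integrable:
  assumes "\<phi> \<in> test_functions \<Omega>"
  shows "integrable lborel \<phi>"
  by (rule integrable_continuous_compact_support[OF smooth_on_continuous_on[OF test_functionsD(1)[OF assms]] test_functionsD(2)[OF assms]])
    (rule not_in_supp)

abbreviation pairing :: "(real ^ 'n::finite) set \<Rightarrow> (real ^ 'n \<Rightarrow> complex) \<Rightarrow> (real ^ 'n \<Rightarrow> complex) \<Rightarrow> complex" where
  "pairing \<Omega> g \<phi> \<equiv> set_lebesgue_integral lebesgue \<Omega> (\<lambda>x. g x * \<phi> x)"

lemma pairing_integrable:
  assumes g: "g \<in> L1_loc \<Omega>" and \<phi>: "\<phi> \<in> test_functions \<Omega>"
  shows "set_integrable lebesgue \<Omega> (\<lambda>x. g x * \<phi> x)"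
proof -
  note t = test_functionsD[OF \<phi>]
  obtain B where B: "B \<ge> 0" "\<And>x. norm (\<phi> x) \<le> B" using test_function_bounded[OF \<phi>] by blast
  have gi: "integrable lebesgue (\<lambda>x. indicator (supp \<phi>) x *\<^sub>R g x)"
    using g t by (auto simp: L1_loc_def set_integrable_def)
  have m: "\<phi> \<in> borel_measurable lebesgue"
    by (rule measurable_completion) (use smooth_on_continuous_on[OF t(1)] borel_measurable_continuous_onI in auto)
  have "integrable lebesgue (\<lambda>x. (indicator (supp \<phi>) x *\<^sub>R g x) * \<phi> x)"
  proof (rule Bochner_Integration.integrable_bound)
    show "integrable lebesgue (\<lambda>x. B *\<^sub>R (indicator (supp \<phi>) x *\<^sub>R g x))" using gi by (rule integrable_scaleR_right)
    show "(\<lambda>x. (indicator (supp \<phi>) x *\<^sub>R g x) * \<phi> x) \<in> borel_measurable lebesgue"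
      by (rule borel_measurable_times[OF _ m]) (use gi in auto)
    have "norm (g x) * norm (\<phi> x) \<le> B * norm (g x)" for x using B(2)[of x] by (simp add: mult.commute mult_right_mono)
    then show "AE x in lebesgue. norm ((indicator (supp \<phi>) x *\<^sub>R g x) * \<phi> x) \<le> norm (B *\<^sub>R (indicator (supp \<phi>) x *\<^sub>R g x))"
      using B(1) by (auto simp: norm_mult indicator_def)
  qed
  moreover have "(\<lambda>x. (indicator (supp \<phi>) x *\<^sub>R g x) * \<phi> x) = (\<lambda>x. indicator \<Omega> x *\<^sub>R (g x * \<phi> x))"
    using t(3) not_in_supp[of _ \<phi>] by (auto simp: fun_eq_iff indicator_def)
  ultimately show ?thesis by (simp add: set_integrable_def)
qed

lemma pairing_sum:
  assumes g: "g \<in> L1_loc \<Omega>" and "finite A" "\<And>j. j \<in> A \<Longrightarrow> \<phi> j \<in> test_functions \<Omega>"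
  shows "pairing \<Omega> g (\<lambda>x. \<Sum>j\<in>A. \<phi> j x) = (\<Sum>j\<in>A. pairing \<Omega> g (\<phi> j))"
proof -
  have "(\<Sum>j\<in>A. pairing \<Omega> g (\<phi> j)) = (\<integral>x. (\<Sum>j\<in>A. indicator \<Omega> x *\<^sub>R (g x * \<phi> j x)) \<partial>lebesgue)"
    unfolding set_lebesgue_integral_def
    by (rule Bochner_Integration.integral_sum[symmetric]) (use pairing_integrable[OF g assms(3)] in \<open>auto simp: set_integrable_def\<close>)
  also have "\<dots> = pairing \<Omega> g (\<lambda>x. \<Sum>j\<in>A. \<phi> j x)"
    unfolding set_lebesgue_integral_def by (simp add: sum_distrib_left scaleR_sum_right)
  finally show ?thesis by simp
qed

lemma pairing_add:
  assumes g: "g \<in> L1_loc \<Omega>" "\<phi> \<in> test_functions \<Omega>" "\<psi> \<in> test_functions \<Omega>"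
  shows "pairing \<Omega> g (\<lambda>x. \<phi> x + \<psi> x) = pairing \<Omega> g \<phi> + pairing \<Omega> g \<psi>"
  using set_integral_add(2)[OF pairing_integrable[OF g(1,2)] pairing_integrable[OF g(1,3)]] by (simp add: distrib_left)

lemma pairing_cmult: "pairing \<Omega> g (\<lambda>x. c * \<phi> x) = c * pairing \<Omega> g \<phi>"
  unfolding mult.left_commute[of _ c] by simp

text \<open>The order-zero estimate that every integrable representative provides; all information about the iterates
  enters through it.\<close>

lemma pairing_bound:
  assumes g: "g \<in> L1_loc \<Omega>" and \<phi>: "\<phi> \<in> test_functions \<Omega>" and K: "compact K" "K \<subseteq> \<Omega>" "\<And>x. x \<notin> K \<Longrightarrow> \<phi> x = 0"
    and B: "B \<ge> 0" "\<And>x. x \<in> K \<Longrightarrow> norm (\<phi> x) \<le> B"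
  shows "norm (pairing \<Omega> g \<phi>) \<le> B * set_lebesgue_integral lebesgue K (\<lambda>x. norm (g x))"
proof -
  have gi: "integrable lebesgue (\<lambda>x. indicator K x *\<^sub>R g x)"
    using g K by (auto simp: L1_loc_def set_integrable_def)
  have gn: "integrable lebesgue (\<lambda>x. indicator K x *\<^sub>R norm (g x))"
    using integrable_norm[OF gi] by (simp add: indicator_def if_distrib cong: if_cong)
  have i: "integrable lebesgue (\<lambda>x. indicator \<Omega> x *\<^sub>R (g x * \<phi> x))"
    using pairing_integrable[OF g \<phi>] by (simp add: set_integrable_def)
  have "norm (pairing \<Omega> g \<phi>) \<le> (\<integral>x. norm (indicator \<Omega> x *\<^sub>R (g x * \<phi> x)) \<partial>lebesgue)"
    unfolding set_lebesgue_integral_def by (rule Bochner_Integration.integral_norm_bound)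
  also have "\<dots> \<le> (\<integral>x. B * (indicator K x *\<^sub>R norm (g x)) \<partial>lebesgue)"
  proof (rule Bochner_Integration.integral_mono)
    show "integrable lebesgue (\<lambda>x. norm (indicator \<Omega> x *\<^sub>R (g x * \<phi> x)))" using i by (rule integrable_norm)
    show "integrable lebesgue (\<lambda>x. B * (indicator K x *\<^sub>R norm (g x)))" using gn by (rule integrable_mult_right)
    fix x show "norm (indicator \<Omega> x *\<^sub>R (g x * \<phi> x)) \<le> B * (indicator K x *\<^sub>R norm (g x))"
    proof (cases "x \<in> K")
      case True
      then have "norm (g x) * norm (\<phi> x) \<le> norm (g x) * B" by (intro mult_left_mono B) auto
      then show ?thesis using True K(2) by (auto simp: norm_mult indicator_def mult.commute)
    qed (use K(3) in auto)
  qed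
  also have "\<dots> = B * set_lebesgue_integral lebesgue K (\<lambda>x. norm (g x))"
    unfolding set_lebesgue_integral_def by (rule integral_mult_right_zero)
  finally show ?thesis .
qed

lemma smooth_on_L1_loc:
  assumes "smooth_on \<Omega> f"
  shows "f \<in> L1_loc \<Omega>"
  unfolding L1_loc_def
proof safe
  fix K assume "compact K" "K \<subseteq> \<Omega>"
  then have "integrable lborel (\<lambda>x. indicator K x *\<^sub>R f x)"
    using smooth_on_continuous_on[OF assms] continuous_on_subset by (intro borel_integrable_compact) blast+
  then show "set_integrable lebesgue K f"
    unfolding set_integrable_def using integrable_completion[OF borel_measurable_integrable] by blast
qed

lemma regular_dist_distribution:
  assumes g: "g \<in> L1_loc \<Omega>" and \<Omega>: "open \<Omega>"
  shows "regular_dist \<Omega> g \<in> distributions \<Omega>"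
proof -
  let ?u = "regular_dist \<Omega> g"
  have u: "?u \<phi> = pairing \<Omega> g \<phi>" if "\<phi> \<in> test_functions \<Omega>" for \<phi> using that by (simp add: regular_dist_def)
  have add: "(\<lambda>x. \<phi> x + \<psi> x) \<in> test_functions \<Omega>" if "\<phi> \<in> test_functions \<Omega>" "\<psi> \<in> test_functions \<Omega>" for \<phi> \<psi>
  proof -
    note t = test_functionsD[OF that(1)] test_functionsD[OF that(2)]
    show ?thesis
      by (rule test_functionI(1)[of _ "supp \<phi> \<union> supp \<psi>"]) (use t in \<open>auto intro: smooth_on_add simp: not_in_supp\<close>)
  qed
  have cont: "\<exists>C N. \<forall>\<phi>\<in>test_functions \<Omega>. supp \<phi> \<subseteq> K \<longrightarrow>
           norm (?u \<phi>) \<le> C * (\<Sum>\<alpha> | mi_abs \<alpha> \<le> N. SUP x. norm (mi_partial \<alpha> \<phi> x))" if K: "compact K" "K \<subseteq> \<Omega>" for K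
  proof (intro exI[of _ "set_lebesgue_integral lebesgue K (\<lambda>x. norm (g x))"] exI[of _ 0] ballI impI)
    fix \<phi> assume \<phi>: "\<phi> \<in> test_functions \<Omega>" "supp \<phi> \<subseteq> K"
    have "{\<alpha> :: 'a multiindex. mi_abs \<alpha> \<le> 0} = {\<lambda>_. 0}" by (auto simp: mi_abs_def)
    moreover have "mi_partial (\<lambda>_. 0) \<phi> = \<phi>"
      using length_mi_list[of "\<lambda>_::'a. 0"] by (simp add: mi_partial_eq mi_abs_def)
    ultimately have eq: "(\<Sum>\<alpha> | mi_abs \<alpha> \<le> 0. SUP x. norm (mi_partial \<alpha> \<phi> x)) = (SUP x. norm (\<phi> x))" by simp
    obtain B where B: "B \<ge> 0" "\<And>x. norm (\<phi> x) \<le> B" using test_function_bounded[OF \<phi>(1)] by blast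
    have bdd: "bdd_above (range (\<lambda>x. norm (\<phi> x)))" using B by (auto simp: bdd_above_def)
    have le: "norm (\<phi> x) \<le> (SUP x. norm (\<phi> x))" for x by (rule cSUP_upper[OF UNIV_I bdd])
    have "norm (pairing \<Omega> g \<phi>) \<le> (SUP x. norm (\<phi> x)) * set_lebesgue_integral lebesgue K (\<lambda>x. norm (g x))"
      by (rule pairing_bound[OF g \<phi>(1) K]) (use \<phi>(2) not_in_supp le order_trans[OF norm_ge_zero le] in auto)
    then show "norm (?u \<phi>) \<le> set_lebesgue_integral lebesgue K (\<lambda>x. norm (g x)) * (\<Sum>\<alpha> | mi_abs \<alpha> \<le> 0. SUP x. norm (mi_partial \<alpha> \<phi> x))"
      unfolding eq u[OF \<phi>(1)] by (simp add: mult.commute)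
  qed
  show ?thesis
    unfolding distributions_def
  proof (intro CollectI conjI ballI allI impI)
    show "?u \<in> extensional (test_functions \<Omega>)" by (simp add: regular_dist_def)
    show "?u (\<lambda>x. \<phi> x + \<psi> x) = ?u \<phi> + ?u \<psi>" if "\<phi> \<in> test_functions \<Omega>" "\<psi> \<in> test_functions \<Omega>" for \<phi> \<psi>
      using u add that pairing_add[OF g that] by simp
    show "?u (\<lambda>x. c * \<phi> x) = c * ?u \<phi>" if "\<phi> \<in> test_functions \<Omega>" for \<phi> c
      using u that test_function_cmult[OF \<Omega> that] pairing_cmult by simp
    show "\<exists>C N. \<forall>\<phi>\<in>test_functions \<Omega>. supp \<phi> \<subseteq> K \<longrightarrow>
           norm (?u \<phi>) \<le> C * (\<Sum>\<alpha> | mi_abs \<alpha> \<le> N. SUP x. norm (mi_partial \<alpha> \<phi> x))" if "compact K \<and> K \<subseteq> \<Omega>" for K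
      using cont that by blast
  qed
qed

subsection \<open>The transposed operator\<close>

text \<open>The formal transpose of \<open>P\<close>: the signs of integration by parts turn \<open>(-
  i)^|\<alpha>|\<close> into \<open>i^|\<alpha>|\<close>.\<close>

definition transpose_op :: "nat \<Rightarrow> ('n::finite multiindex \<Rightarrow> real ^ 'n \<Rightarrow> complex) \<Rightarrow> (real ^ 'n \<Rightarrow> complex) \<Rightarrow> real ^ 'n \<Rightarrow> complex" where
  "transpose_op d a \<phi> x = (\<Sum>\<alpha> | mi_abs \<alpha> \<le> d. \<i> ^ mi_abs \<alpha> * partials (mi_list \<alpha>) (\<lambda>y. a \<alpha> y * \<phi> y) x)"

lemma mi_D_eq: "(- 1) ^ mi_abs \<alpha> * mi_D \<alpha> f x = \<i> ^ mi_abs \<alpha> * partials (mi_list \<alpha>) f x"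
  by (simp add: mi_D_def mi_partial_eq flip: mult.assoc power_mult_distrib)

lemma test_function_sum:
  assumes "open \<Omega>" "finite A" "compact K" "K \<subseteq> \<Omega>" "\<And>j. j \<in> A \<Longrightarrow> \<phi> j \<in> test_functions \<Omega>" "\<And>j. j \<in> A \<Longrightarrow> supp (\<phi> j) \<subseteq> K"
  shows "(\<lambda>x. \<Sum>j\<in>A. \<phi> j x) \<in> test_functions \<Omega>" "supp (\<lambda>x. \<Sum>j\<in>A. \<phi> j x) \<subseteq> K"
proof -
  have "smooth_on UNIV (\<lambda>x. \<Sum>j\<in>A. \<phi> j x)"
    by (intro smooth_on_sum open_UNIV) (rule test_functionsD(1)[OF assms(5)])
  moreover have "(\<Sum>j\<in>A. \<phi> j x) = 0" if "x \<notin> K" for x using assms(6) that by (intro sum.neutral ballI not_in_supp) auto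
  ultimately show "(\<lambda>x. \<Sum>j\<in>A. \<phi> j x) \<in> test_functions \<Omega>" "supp (\<lambda>x. \<Sum>j\<in>A. \<phi> j x) \<subseteq> K"
    using test_functionI[OF _ assms(3,4), of "\<lambda>x. \<Sum>j\<in>A. \<phi> j x"] by auto
qed

lemma transpose_term_test:
  assumes "open \<Omega>" "\<phi> \<in> test_functions \<Omega>" "smooth_on \<Omega> b"
  shows "(\<lambda>x. c * partials is (\<lambda>y. b y * \<phi> y) x) \<in> test_functions \<Omega>" "supp (\<lambda>x. c * partials is (\<lambda>y. b y * \<phi> y) x) \<subseteq> supp \<phi>"
proof -
  note 1 = test_function_mult[OF assms]
  note 2 = test_function_partials[OF 1(1), of "is"]
  note 3 = test_function_cmult[OF assms(1) 2(1), of c]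
  show "(\<lambda>x. c * partials is (\<lambda>y. b y * \<phi> y) x) \<in> test_functions \<Omega>" "supp (\<lambda>x. c * partials is (\<lambda>y. b y * \<phi> y) x) \<subseteq> supp \<phi>"
    using 1(2) 2(2) 3 by blast+
qed

lemma transpose_op_test:
  assumes "open \<Omega>" "\<phi> \<in> test_functions \<Omega>" "\<And>\<alpha>. mi_abs \<alpha> \<le> d \<Longrightarrow> smooth_on \<Omega> (a \<alpha>)"
  shows "transpose_op d a \<phi> \<in> test_functions \<Omega>" "supp (transpose_op d a \<phi>) \<subseteq> supp \<phi>"
proof -
  have t: "(\<lambda>x. \<i> ^ mi_abs \<alpha> * partials (mi_list \<alpha>) (\<lambda>y. a \<alpha> y * \<phi> y) x) \<in> test_functions \<Omega>"
     "supp (\<lambda>x. \<i> ^ mi_abs \<alpha> * partials (mi_list \<alpha>) (\<lambda>y. a \<alpha> y * \<phi> y) x) \<subseteq> supp \<phi>" if "\<alpha> \<in> {\<alpha>. mi_abs \<alpha> \<le> d}" for \<alpha>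
    using transpose_term_test[OF assms(1,2) assms(3)] that by simp_all
  show "transpose_op d a \<phi> \<in> test_functions \<Omega>" "supp (transpose_op d a \<phi>) \<subseteq> supp \<phi>"
    unfolding transpose_op_def[abs_def]
    by (rule test_function_sum[OF assms(1) finite_mi_le test_functionsD(2,3)[OF assms(2)]], rule t, simp, rule t, simp)+
qed

lemma pdo_regular_dist:
  assumes "open \<Omega>" "g \<in> L1_loc \<Omega>" "\<phi> \<in> test_functions \<Omega>" and a: "\<And>\<alpha>. mi_abs \<alpha> \<le> d \<Longrightarrow> smooth_on \<Omega> (a \<alpha>)"
  shows "pdo \<Omega> d a (regular_dist \<Omega> g) \<phi> = pairing \<Omega> g (transpose_op d a \<phi>)"
proof -
  have "dist_mult \<Omega> (a \<alpha>) (dist_D \<Omega> \<alpha> (regular_dist \<Omega> g)) \<phi> = pairing \<Omega> g (\<lambda>x. \<i> ^ mi_abs \<alpha> * partials (mi_list \<alpha>) (\<lambda>y. a \<alpha> y * \<phi> y) x)"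
    if \<alpha>: "mi_abs \<alpha> \<le> d" for \<alpha>
  proof -
    have t: "(\<lambda>y. a \<alpha> y * \<phi> y) \<in> test_functions \<Omega>" by (rule test_function_mult(1)[OF assms(1,3) a[OF \<alpha>]])
    have "mi_D \<alpha> (\<lambda>y. a \<alpha> y * \<phi> y) = (\<lambda>x. (- \<i>) ^ mi_abs \<alpha> * partials (mi_list \<alpha>) (\<lambda>y. a \<alpha> y * \<phi> y) x)"
      by (simp add: mi_D_def[abs_def] mi_partial_eq)
    then have t2: "mi_D \<alpha> (\<lambda>y. a \<alpha> y * \<phi> y) \<in> test_functions \<Omega>"
      using transpose_term_test(1)[OF assms(1,3) a[OF \<alpha>]] by simp
    have "dist_mult \<Omega> (a \<alpha>) (dist_D \<Omega> \<alpha> (regular_dist \<Omega> g)) \<phi> = (- 1) ^ mi_abs \<alpha> * pairing \<Omega> g (mi_D \<alpha> (\<lambda>y. a \<alpha> y * \<phi> y))"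
      using assms(3) t t2 by (simp add: dist_mult_def dist_D_def regular_dist_def)
    then show ?thesis unfolding pairing_cmult[symmetric] mi_D_eq .
  qed
  then have "pdo \<Omega> d a (regular_dist \<Omega> g) \<phi> = (\<Sum>\<alpha> | mi_abs \<alpha> \<le> d. pairing \<Omega> g (\<lambda>x. \<i> ^ mi_abs \<alpha> * partials (mi_list \<alpha>) (\<lambda>y. a \<alpha> y * \<phi> y) x))"
    using assms(3) by (simp add: pdo_def)
  also have "\<dots> = pairing \<Omega> g (\<lambda>x. \<Sum>\<alpha> | mi_abs \<alpha> \<le> d. \<i> ^ mi_abs \<alpha> * partials (mi_list \<alpha>) (\<lambda>y. a \<alpha> y * \<phi> y) x)"
    by (rule pairing_sum[OF assms(2) finite_mi_le, symmetric]) (use transpose_term_test(1)[OF assms(1,3) a] in auto)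
  finally show ?thesis unfolding transpose_op_def .
qed

subsection \<open>Integration by parts\<close>

text \<open>Difference quotients have integral zero by translation invariance and converge boundedly with common
  compact support.\<close>

lemma integral_partial_zero:
  fixes \<psi> :: "real ^ 'n::finite \<Rightarrow> complex"
  assumes \<psi>: "\<psi> \<in> test_functions UNIV"
  shows "(\<integral>x. partial i \<psi> x \<partial>lborel) = 0"
proof -
  note t = test_functionsD[OF \<psi>]
  have p\<psi>: "partial i \<psi> \<in> test_functions UNIV" using test_function_partials(1)[OF \<psi>, of "[i]"] by simp
  obtain B where B: "B \<ge> 0" "\<And>x. norm (partial i \<psi> x) \<le> B" using test_function_bounded[OF p\<psi>] by blast
  let ?e = "axis i 1 :: real ^ 'n"
  have cont: "continuous_on UNIV \<psi>" using smooth_on_continuous_on[OF t(1)] .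
  have [measurable]: "\<psi> \<in> borel_measurable borel" using cont by (rule borel_measurable_continuous_onI)
  obtain R where R: "supp \<psi> \<subseteq> cball 0 R"
    using compact_imp_bounded[OF t(2)] unfolding bounded_iff by (auto simp: subset_iff)
  let ?K = "cball (0 :: real ^ 'n) (R + 1)"
  define s where "s k = 1 / real (Suc k)" for k
  have s: "0 < s k" "s k \<le> 1" for k by (auto simp: s_def)
  have s0: "s \<longlonglongrightarrow> 0" unfolding s_def by (rule LIMSEQ_Suc[OF lim_1_over_n])
  define q where "q k x = (\<psi> (x + s k *\<^sub>R ?e) - \<psi> x) /\<^sub>R s k" for k x
  have vd: "((\<lambda>t. \<psi> (x + t *\<^sub>R ?e)) has_vector_derivative partial i \<psi> (x + t *\<^sub>R ?e)) (at t)" for x t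
  proof -
    obtain f' where f': "(\<psi> has_derivative f') (at (x + t *\<^sub>R ?e))"
      using smooth_on_imp_differentiable[OF t(1)] by (auto simp: differentiable_def)
    have p: "f' (r *\<^sub>R ?e) = r *\<^sub>R partial i \<psi> (x + t *\<^sub>R ?e)" for r
      using has_derivative_partial(1)[OF f', of i] has_derivative_bounded_linear[OF f']
      by (simp add: bounded_linear.linear linear_simps(5))
    have "((\<lambda>t. x + t *\<^sub>R ?e) has_derivative (\<lambda>r. r *\<^sub>R ?e)) (at t)"
      by (auto intro!: derivative_eq_intros)
    from has_derivative_compose[OF this f'] show ?thesis
      unfolding has_vector_derivative_def by (simp add: p)
  qed
  have lip: "norm (\<psi> (x + r *\<^sub>R ?e) - \<psi> x) \<le> B * r" if "r > 0" for x r
  proof -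
    have "norm (\<psi> (x + r *\<^sub>R ?e) - \<psi> (x + 0 *\<^sub>R ?e)) \<le> B * norm (r - 0)"
    proof (rule differentiable_bound[where f = "\<lambda>t. \<psi> (x + t *\<^sub>R ?e)" and f' = "\<lambda>t h. h *\<^sub>R partial i \<psi> (x + t *\<^sub>R ?e)" and S = UNIV])
      show "((\<lambda>t. \<psi> (x + t *\<^sub>R ?e)) has_derivative (\<lambda>h. h *\<^sub>R partial i \<psi> (x + t *\<^sub>R ?e))) (at t)" for t
        using vd[of x t] by (simp add: has_vector_derivative_def)
      show "onorm (\<lambda>h. h *\<^sub>R partial i \<psi> (x + t *\<^sub>R ?e)) \<le> B" for t
      proof (rule onorm_le)
        fix h :: real
        show "norm (h *\<^sub>R partial i \<psi> (x + t *\<^sub>R ?e)) \<le> B * norm h"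
          using mult_left_mono[OF B(2), of "\<bar>h\<bar>"] by (simp add: mult.commute)
      qed
    qed auto
    then show ?thesis using that by simp
  qed
  have "(\<lambda>k. \<integral>x. q k x \<partial>lborel) \<longlonglongrightarrow> (\<integral>x. partial i \<psi> x \<partial>lborel)"
  proof (rule integral_dominated_convergence[where w = "\<lambda>x. indicator ?K x *\<^sub>R B"])
    show "partial i \<psi> \<in> borel_measurable lborel" using test_function_integrable[OF p\<psi>] by auto
    show "q k \<in> borel_measurable lborel" for k unfolding q_def by measurable
    show "integrable lborel (\<lambda>x. indicator ?K x *\<^sub>R B)" by (intro borel_integrable_compact) auto
    show "AE x in lborel. (\<lambda>k. q k x) \<longlonglongrightarrow> partial i \<psi> x"
    proof (rule AE_I2)
      fix x
      have "((\<lambda>t. \<psi> (x + t *\<^sub>R ?e)) has_vector_derivative partial i \<psi> x) (at 0)" using vd[of x 0] by simp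
      then have "((\<lambda>t. (\<psi> (x + t *\<^sub>R ?e) - \<psi> (x + 0 *\<^sub>R ?e) - (t - 0) *\<^sub>R partial i \<psi> x) /\<^sub>R norm (t - 0)) \<longlongrightarrow> 0) (at 0)"
        unfolding has_vector_derivative_def has_derivative_def by simp
      then have l: "((\<lambda>t. (\<psi> (x + t *\<^sub>R ?e) - \<psi> x - t *\<^sub>R partial i \<psi> x) /\<^sub>R \<bar>t\<bar>) \<longlongrightarrow> 0) (at 0)" by simp
      have "filterlim s (at 0) sequentially" using s0 s by (auto simp: filterlim_at less_imp_neq[symmetric])
      from filterlim_compose[OF l this]
      have "(\<lambda>k. (\<psi> (x + s k *\<^sub>R ?e) - \<psi> x - s k *\<^sub>R partial i \<psi> x) /\<^sub>R \<bar>s k\<bar>) \<longlonglongrightarrow> 0" .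
      moreover have "(\<psi> (x + s k *\<^sub>R ?e) - \<psi> x - s k *\<^sub>R partial i \<psi> x) /\<^sub>R \<bar>s k\<bar> = q k x - partial i \<psi> x" for k
        using s(1)[of k] by (simp add: q_def scaleR_diff_right)
      ultimately have "(\<lambda>k. q k x - partial i \<psi> x) \<longlonglongrightarrow> 0" by simp
      then show "(\<lambda>k. q k x) \<longlonglongrightarrow> partial i \<psi> x" by (rule LIM_zero_cancel)
    qed
    fix k
    show "AE x in lborel. norm (q k x) \<le> indicator ?K x *\<^sub>R B"
    proof (rule AE_I2)
      fix x
      show "norm (q k x) \<le> indicator ?K x *\<^sub>R B"
      proof (cases "x \<in> ?K")
        case True
        have "norm (q k x) \<le> (B * s k) / s k"
          using lip[OF s(1)[of k], of x] s(1)[of k] unfolding q_def by (simp add: divide_simps mult.commute)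
        then show ?thesis using True s(1)[of k] by simp
      next
        case False
        then have x: "norm x > R + 1" by simp
        have "norm x \<le> norm (x + s k *\<^sub>R ?e) + norm (s k *\<^sub>R ?e)" by (metis add_diff_cancel norm_triangle_ineq4)
        then have "norm (x + s k *\<^sub>R ?e) > R" using x s[of k] by simp
        then have "x + s k *\<^sub>R ?e \<notin> supp \<psi>" "x \<notin> supp \<psi>" using R x by auto
        then show ?thesis using False by (simp add: q_def not_in_supp)
      qed
    qed
  qed
  moreover have "(\<integral>x. q k x \<partial>lborel) = 0" for k
  proof -
    have i1: "integrable lborel \<psi>" by (rule test_function_integrable[OF \<psi>])
    have i2: "integrable lborel (\<lambda>x. \<psi> (x + s k *\<^sub>R ?e))"
      using lborel_integrable_affine[OF _ i1, of 1 "s k *\<^sub>R ?e"] by (simp add: add.commute)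
    have "(\<integral>x. \<psi> (x + s k *\<^sub>R ?e) \<partial>lborel) = (\<integral>x. \<psi> x \<partial>lborel)"
      using lborel_integral_affine[of 1 \<psi> "s k *\<^sub>R ?e"] by (simp add: add.commute)
    then show ?thesis unfolding q_def using i1 i2 by simp
  qed
  ultimately have "(\<lambda>k::nat. 0::complex) \<longlonglongrightarrow> (\<integral>x. partial i \<psi> x \<partial>lborel)" by simp
  then show ?thesis using LIMSEQ_unique tendsto_const by blast
qed

lemma test_function_UNIV: "\<phi> \<in> test_functions \<Omega> \<Longrightarrow> \<phi> \<in> test_functions UNIV"
  by (auto simp: test_functions_def)

lemma pairing_partial:
  assumes \<Omega>: "open \<Omega>" and f: "smooth_on \<Omega> f" and \<phi>: "\<phi> \<in> test_functions \<Omega>"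
  shows "pairing \<Omega> f (partial i \<phi>) = - pairing \<Omega> (partial i f) \<phi>"
proof -
  note t = test_functionsD[OF \<phi>]
  let ?\<psi> = "\<lambda>x. f x * \<phi> x"
  have \<psi>: "?\<psi> \<in> test_functions \<Omega>" by (rule test_function_mult(1)[OF \<Omega> \<phi> f])
  have p\<phi>: "partial i \<phi> \<in> test_functions \<Omega>" using test_function_partials(1)[OF \<phi>, of "[i]"] by simp
  have p\<psi>: "partial i ?\<psi> \<in> test_functions \<Omega>" using test_function_partials(1)[OF \<psi>, of "[i]"] by simp
  have "pairing \<Omega> (partial i f) \<phi> + pairing \<Omega> f (partial i \<phi>) = set_lebesgue_integral lebesgue \<Omega> (\<lambda>x. partial i f x * \<phi> x + f x * partial i \<phi> x)"
    by (rule set_integral_add(2)[symmetric])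
      (intro pairing_integrable smooth_on_L1_loc smooth_on_partial f \<phi> p\<phi>)+
  also have "\<dots> = (\<integral>x. partial i ?\<psi> x \<partial>lebesgue)"
    unfolding set_lebesgue_integral_def
  proof (rule Bochner_Integration.integral_cong[OF refl])
    fix x
    show "indicator \<Omega> x *\<^sub>R (partial i f x * \<phi> x + f x * partial i \<phi> x) = partial i ?\<psi> x"
    proof (cases "x \<in> \<Omega>")
      case True
      then show ?thesis using partial_mult[of f x \<phi> i] smooth_on_imp_differentiable[OF f True] smooth_on_imp_differentiable[OF t(1)] by simp
    next
      case False
      then have "x \<notin> supp (partial i ?\<psi>)" using test_functionsD(3)[OF p\<psi>] by blast
      then show ?thesis using False by (simp add: not_in_supp)
    qed
  qed
  also have "\<dots> = (\<integral>x. partial i ?\<psi> x \<partial>lborel)"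
    by (rule integral_completion) (use test_function_integrable[OF p\<psi>] in auto)
  also have "\<dots> = 0" by (rule integral_partial_zero[OF test_function_UNIV[OF \<psi>]])
  finally show ?thesis by (simp add: eq_neg_iff_add_eq_0 add.commute)
qed

lemma pairing_cong: "(\<And>x. x \<in> \<Omega> \<Longrightarrow> f x = g x) \<Longrightarrow> pairing \<Omega> f \<phi> = pairing \<Omega> g \<phi>"
  unfolding set_lebesgue_integral_def by (rule Bochner_Integration.integral_cong) (auto simp: indicator_def)

lemma pairing_partials:
  assumes \<Omega>: "open \<Omega>" and "smooth_on \<Omega> f" and \<phi>: "\<phi> \<in> test_functions \<Omega>"
  shows "pairing \<Omega> f (partials is \<phi>) = (- 1) ^ length is * pairing \<Omega> (partials is f) \<phi>"
proof -
  have "pairing \<Omega> f (partials is \<phi>) = (- 1) ^ length is * pairing \<Omega> (partials (rev is) f) \<phi>"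
    using assms(2)
  proof (induction "is" arbitrary: f)
    case (Cons i "is")
    have "pairing \<Omega> f (partials (i # is) \<phi>) = - pairing \<Omega> (partial i f) (partials is \<phi>)"
      using pairing_partial[OF \<Omega> Cons.prems test_function_partials(1)[OF \<phi>, of "is"], of i] by simp
    also have "\<dots> = - ((- 1) ^ length is * pairing \<Omega> (partials (rev is) (partial i f)) \<phi>)"
      using Cons.IH[OF smooth_on_partial[OF Cons.prems]] by simp
    finally show ?case by simp
  qed simp
  also have "pairing \<Omega> (partials (rev is) f) \<phi> = pairing \<Omega> (partials is f) \<phi>"
    by (rule pairing_cong) (rule partials_mset_cong[OF \<Omega> _ assms(2)], auto)
  finally show ?thesis .
qed

definition pdo_fun :: "nat \<Rightarrow> ('n::finite multiindex \<Rightarrow> real ^ 'n \<Rightarrow> complex) \<Rightarrow> (real ^ 'n \<Rightarrow> complex) \<Rightarrow> real ^ 'n \<Rightarrow> complex" where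
  "pdo_fun d a f x = (\<Sum>\<alpha> | mi_abs \<alpha> \<le> d. (- \<i>) ^ mi_abs \<alpha> * (a \<alpha> x * partials (mi_list \<alpha>) f x))"

lemma pdo_fun_smooth:
  assumes "open \<Omega>" "\<And>\<alpha>. mi_abs \<alpha> \<le> d \<Longrightarrow> smooth_on \<Omega> (a \<alpha>)" "smooth_on \<Omega> f"
  shows "smooth_on \<Omega> (pdo_fun d a f)"
  unfolding pdo_fun_def[abs_def] using assms
  by (intro smooth_on_sum smooth_on_cmult smooth_on_mult smooth_on_partials) auto

lemma pairing_transpose:
  assumes \<Omega>: "open \<Omega>" and f: "smooth_on \<Omega> f" and \<phi>: "\<phi> \<in> test_functions \<Omega>" and a: "\<And>\<alpha>. mi_abs \<alpha> \<le> d \<Longrightarrow> smooth_on \<Omega> (a \<alpha>)"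
  shows "pairing \<Omega> f (transpose_op d a \<phi>) = pairing \<Omega> (pdo_fun d a f) \<phi>"
proof -
  have L: "f \<in> L1_loc \<Omega>" by (rule smooth_on_L1_loc[OF f])
  have "pairing \<Omega> f (transpose_op d a \<phi>) = (\<Sum>\<alpha> | mi_abs \<alpha> \<le> d. pairing \<Omega> f (\<lambda>x. \<i> ^ mi_abs \<alpha> * partials (mi_list \<alpha>) (\<lambda>y. a \<alpha> y * \<phi> y) x))"
    unfolding transpose_op_def by (rule pairing_sum[OF L finite_mi_le]) (use transpose_term_test(1)[OF \<Omega> \<phi> a] in auto)
  also have "\<dots> = (\<Sum>\<alpha> | mi_abs \<alpha> \<le> d. set_lebesgue_integral lebesgue \<Omega> (\<lambda>x. ((- \<i>) ^ mi_abs \<alpha> * (a \<alpha> x * partials (mi_list \<alpha>) f x)) * \<phi> x))"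
  proof (rule sum.cong[OF refl])
    fix \<alpha> :: "'a multiindex" assume "\<alpha> \<in> {\<alpha>. mi_abs \<alpha> \<le> d}"
    then have \<alpha>: "mi_abs \<alpha> \<le> d" by simp
    have "pairing \<Omega> f (\<lambda>x. \<i> ^ mi_abs \<alpha> * partials (mi_list \<alpha>) (\<lambda>y. a \<alpha> y * \<phi> y) x)
       = \<i> ^ mi_abs \<alpha> * ((- 1) ^ mi_abs \<alpha> * pairing \<Omega> (partials (mi_list \<alpha>) f) (\<lambda>y. a \<alpha> y * \<phi> y))"
      unfolding pairing_cmult using pairing_partials[OF \<Omega> f test_function_mult(1)[OF \<Omega> \<phi> a[OF \<alpha>]], of "mi_list \<alpha>"] by (simp add: length_mi_list)
    also have "\<dots> = (- \<i>) ^ mi_abs \<alpha> * pairing \<Omega> (partials (mi_list \<alpha>) f) (\<lambda>y. a \<alpha> y * \<phi> y)"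
      by (simp flip: mult.assoc power_mult_distrib)
    also have "\<dots> = set_lebesgue_integral lebesgue \<Omega> (\<lambda>x. (- \<i>) ^ mi_abs \<alpha> * (partials (mi_list \<alpha>) f x * (a \<alpha> x * \<phi> x)))"
      by (rule set_integral_mult_right[symmetric])
    also have "\<dots> = set_lebesgue_integral lebesgue \<Omega> (\<lambda>x. ((- \<i>) ^ mi_abs \<alpha> * (a \<alpha> x * partials (mi_list \<alpha>) f x)) * \<phi> x)"
      by (simp only: mult.assoc mult.left_commute)
    finally show "pairing \<Omega> f (\<lambda>x. \<i> ^ mi_abs \<alpha> * partials (mi_list \<alpha>) (\<lambda>y. a \<alpha> y * \<phi> y) x) = 
      set_lebesgue_integral lebesgue \<Omega> (\<lambda>x. ((- \<i>) ^ mi_abs \<alpha> * (a \<alpha> x * partials (mi_list \<alpha>) f x)) * \<phi> x)" .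
  qed
  also have "\<dots> = pairing \<Omega> (pdo_fun d a f) \<phi>"
  proof -
    have s: "smooth_on \<Omega> (\<lambda>x. (- \<i>) ^ mi_abs \<alpha> * (a \<alpha> x * partials (mi_list \<alpha>) f x))" if "mi_abs \<alpha> \<le> d" for \<alpha>
      by (intro smooth_on_cmult smooth_on_mult smooth_on_partials \<Omega> f a that)
    have "(\<Sum>\<alpha> | mi_abs \<alpha> \<le> d. set_lebesgue_integral lebesgue \<Omega> (\<lambda>x. ((- \<i>) ^ mi_abs \<alpha> * (a \<alpha> x * partials (mi_list \<alpha>) f x)) * \<phi> x))
      = (\<integral>x. (\<Sum>\<alpha> | mi_abs \<alpha> \<le> d. indicator \<Omega> x *\<^sub>R (((- \<i>) ^ mi_abs \<alpha> * (a \<alpha> x * partials (mi_list \<alpha>) f x)) * \<phi> x)) \<partial>lebesgue)"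
      unfolding set_lebesgue_integral_def
      by (rule Bochner_Integration.integral_sum[symmetric]) (use pairing_integrable[OF smooth_on_L1_loc[OF s] \<phi>] in \<open>auto simp: set_integrable_def\<close>)
    also have "\<dots> = pairing \<Omega> (pdo_fun d a f) \<phi>"
      unfolding set_lebesgue_integral_def pdo_fun_def sum_distrib_right scaleR_sum_right ..
    finally show ?thesis .
  qed
  finally show ?thesis .
qed

lemma pdo_iterate_regular_dist:
  assumes \<Omega>: "open \<Omega>" and f: "smooth_on \<Omega> f" and a: "\<And>\<alpha>. mi_abs \<alpha> \<le> d \<Longrightarrow> smooth_on \<Omega> (a \<alpha>)"
  shows "smooth_on \<Omega> ((pdo_fun d a ^^ k) f) \<and> (pdo \<Omega> d a ^^ k) (regular_dist \<Omega> f) = regular_dist \<Omega> ((pdo_fun d a ^^ k) f)"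
proof (induction k)
  case (Suc k)
  let ?h = "(pdo_fun d a ^^ k) f"
  have s: "smooth_on \<Omega> ?h" using Suc by simp
  have "pdo \<Omega> d a (regular_dist \<Omega> ?h) = regular_dist \<Omega> (pdo_fun d a ?h)"
  proof (rule extensionalityI[of _ "test_functions \<Omega>"])
    show "pdo \<Omega> d a (regular_dist \<Omega> ?h) \<in> extensional (test_functions \<Omega>)" by (simp add: pdo_def)
    show "regular_dist \<Omega> (pdo_fun d a ?h) \<in> extensional (test_functions \<Omega>)" by (simp add: regular_dist_def)
    fix \<phi> assume \<phi>: "\<phi> \<in> test_functions \<Omega>"
    have "pdo \<Omega> d a (regular_dist \<Omega> ?h) \<phi> = pairing \<Omega> ?h (transpose_op d a \<phi>)"
      by (rule pdo_regular_dist[OF \<Omega> smooth_on_L1_loc[OF s] \<phi> a])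
    also have "\<dots> = pairing \<Omega> (pdo_fun d a ?h) \<phi>" by (rule pairing_transpose[OF \<Omega> s \<phi> a])
    finally show "pdo \<Omega> d a (regular_dist \<Omega> ?h) \<phi> = regular_dist \<Omega> (pdo_fun d a ?h) \<phi>"
      using \<phi> by (simp add: regular_dist_def)
  qed
  then show ?case using Suc pdo_fun_smooth[OF \<Omega> a s] by simp
qed (use f in auto)

section \<open>The transposed operator on oscillating amplitudes\<close>

abbreviation osc :: "real ^ 'n::finite \<Rightarrow> real ^ 'n \<Rightarrow> complex" where
  "osc \<xi> x \<equiv> cis (- (x \<bullet> \<xi>))"

lemma osc_has_derivative: "((\<lambda>x. c * osc \<xi> x) has_derivative (\<lambda>h. c * (- \<i> * of_real (h \<bullet> \<xi>) * osc \<xi> x))) (at x)"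
proof -
  have "((\<lambda>x. exp (\<i> * of_real (- (x \<bullet> \<xi>)))) has_derivative (\<lambda>h. (\<i> * of_real (- (h \<bullet> \<xi>))) * exp (\<i> * of_real (- (x \<bullet> \<xi>))))) (at x)"
  proof -
    have 1: "((\<lambda>x. \<i> * complex_of_real (- (x \<bullet> \<xi>))) has_derivative (\<lambda>h. \<i> * of_real (- (h \<bullet> \<xi>)))) (at x)"
      by (auto intro!: derivative_eq_intros)
    show ?thesis
      using has_derivative_compose[OF 1 DERIV_exp[unfolded has_field_derivative_def]] by (simp only: mult.commute)
  qed
  then have "((\<lambda>x. osc \<xi> x) has_derivative (\<lambda>h. - \<i> * of_real (h \<bullet> \<xi>) * osc \<xi> x)) (at x)"
    unfolding cis_conv_exp by simp
  then show ?thesis by (rule has_derivative_mult_right)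
qed

lemma partial_osc: "partial j (\<lambda>x. c * osc \<xi> x) x = (- \<i> * of_real (\<xi> $ j) * c) * osc \<xi> x"
  using has_derivative_partial(1)[OF osc_has_derivative, of j c \<xi> x] by (simp add: inner_axis')

lemma smooth_on_osc: "smooth_on U (osc \<xi>)"
proof -
  have "smooth_on UNIV (\<lambda>x. 1 * osc \<xi> x)"
  proof (rule smooth_on_coinduct[of UNIV "\<lambda>f. \<exists>c. f = (\<lambda>x. c * osc \<xi> x)"])
    fix f assume "\<exists>c. f = (\<lambda>x. c * osc \<xi> x)"
    then obtain c where f: "f = (\<lambda>x. c * osc \<xi> x)" by blast
    have "\<exists>g. (\<exists>c. g = (\<lambda>x. c * osc \<xi> x)) \<and> (\<forall>x\<in>UNIV. partial i f x = g x)" for i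
      unfolding f using partial_osc by blast
    moreover have "f differentiable (at x)" for x unfolding f differentiable_def using osc_has_derivative by blast
    ultimately show "(\<forall>x\<in>UNIV. f differentiable at x) \<and> (\<forall>i. \<exists>g. (\<exists>c. g = (\<lambda>x. c * osc \<xi> x)) \<and> (\<forall>x\<in>UNIV. partial i f x = g x))"
      by blast
  qed (simp, rule exI[of _ 1], rule refl)
  then show ?thesis using smooth_on_subset by fastforce
qed

lemma partial_osc_mult:
  assumes "b differentiable (at x)"
  shows "\<i> * partial j (\<lambda>x. osc \<xi> x * b x) x = osc \<xi> x * (of_real (\<xi> $ j) * b x + \<i> * partial j b x)"
proof -
  have "osc \<xi> differentiable (at x)" using smooth_on_imp_differentiable[OF smooth_on_osc[of UNIV]] by simp
  then have 1: "partial j (\<lambda>x. osc \<xi> x * b x) x = partial j (osc \<xi>) x * b x + osc \<xi> x * partial j b x"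
    using assms by (rule partial_mult)
  have 2: "partial j (osc \<xi>) x = - \<i> * of_real (\<xi> $ j) * osc \<xi> x" using partial_osc[of j 1 \<xi> x] by simp
  show ?thesis unfolding 1 2 by (simp add: algebra_simps)
qed

text \<open>Leibniz' rule for one repeated direction: each derivative falling on the exponential produces a factor
  \<open>\<xi> $ j\<close>.\<close>

lemma partials_osc_mult_replicate:
  assumes U: "open U" "x \<in> U" and b: "smooth_on U b"
  shows "\<i> ^ m * partials (replicate m j) (\<lambda>x. osc \<xi> x * b x) x =
     osc \<xi> x * (\<Sum>l\<le>m. of_nat (m choose l) * (\<i> ^ l * partials (replicate l j) b x) * of_real (\<xi> $ j) ^ (m - l))"
  using b
proof (induction m arbitrary: b)
  case 0 then show ?case by simp
next
  case (Suc m)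
  let ?b = "\<lambda>x. of_real (\<xi> $ j) * b x + \<i> * partial j b x"
  have sb: "smooth_on U (\<lambda>x. of_real (\<xi> $ j) * b x)" "smooth_on U (\<lambda>x. \<i> * partial j b x)"
    by (intro smooth_on_cmult smooth_on_partial U Suc.prems)+
  have sb': "smooth_on U ?b" by (intro smooth_on_add sb U)
  have so: "smooth_on U (\<lambda>x. osc \<xi> x * b x)" by (intro smooth_on_mult smooth_on_osc Suc.prems U)
  have rep: "replicate (Suc m) j = replicate m j @ [j]" for m by (simp add: replicate_append_same)
  have "\<i> ^ Suc m * partials (replicate (Suc m) j) (\<lambda>x. osc \<xi> x * b x) x =
     \<i> ^ m * (\<i> * partials (replicate m j) (partial j (\<lambda>x. osc \<xi> x * b x)) x)" unfolding rep by simp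
  also have "\<i> * partials (replicate m j) (partial j (\<lambda>x. osc \<xi> x * b x)) x = partials (replicate m j) (\<lambda>x. \<i> * partial j (\<lambda>x. osc \<xi> x * b x) x) x"
    by (rule partials_cmult[symmetric, OF U(1) smooth_on_partial[OF so] U(2)])
  also have "\<dots> = partials (replicate m j) (\<lambda>x. osc \<xi> x * ?b x) x"
    by (rule partials_cong_open[OF U(1) partial_osc_mult U(2)]) (rule smooth_on_imp_differentiable[OF Suc.prems])
  also have "\<i> ^ m * \<dots> = osc \<xi> x * (\<Sum>l\<le>m. of_nat (m choose l) * (\<i> ^ l * partials (replicate l j) ?b x) * of_real (\<xi> $ j) ^ (m - l))"
    by (rule Suc.IH[OF sb'])
  also have "(\<Sum>l\<le>m. of_nat (m choose l) * (\<i> ^ l * partials (replicate l j) ?b x) * of_real (\<xi> $ j) ^ (m - l)) =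
     (\<Sum>l\<le>m. of_nat (m choose l) * (\<i> ^ Suc l * partials (replicate (Suc l) j) b x) * of_real (\<xi> $ j) ^ (m - l))
     + (\<Sum>l\<le>m. of_nat (m choose l) * (\<i> ^ l * partials (replicate l j) b x) * of_real (\<xi> $ j) ^ (Suc m - l))"
  proof -
    have "partials (replicate l j) ?b x = of_real (\<xi> $ j) * partials (replicate l j) b x + \<i> * partials (replicate (Suc l) j) b x" for l
    proof -
      have "partials (replicate l j) ?b x = partials (replicate l j) (\<lambda>x. of_real (\<xi> $ j) * b x) x + partials (replicate l j) (\<lambda>x. \<i> * partial j b x) x"
        by (rule partials_add[OF U(1) sb U(2)])
      also have "partials (replicate l j) (\<lambda>x. of_real (\<xi> $ j) * b x) x = of_real (\<xi> $ j) * partials (replicate l j) b x"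
        by (rule partials_cmult[OF U(1) Suc.prems U(2)])
      also have "partials (replicate l j) (\<lambda>x. \<i> * partial j b x) x = \<i> * partials (replicate l j) (partial j b) x"
        by (rule partials_cmult[OF U(1) smooth_on_partial[OF Suc.prems] U(2)])
      finally show ?thesis unfolding rep by simp
    qed
    note e = this
    show ?thesis unfolding e sum.distrib[symmetric]
      by (intro sum.cong refl) (simp add: Suc_diff_le algebra_simps)
  qed
  also have "\<dots> = (\<Sum>l\<le>Suc m. of_nat (Suc m choose l) * (\<i> ^ l * partials (replicate l j) b x) * of_real (\<xi> $ j) ^ (Suc m - l))"
    by (rule binomial_shift_sum[of m "\<lambda>l. \<i> ^ l * partials (replicate l j) b x" "\<lambda>l. of_real (\<xi> $ j) ^ l"])
  finally show ?case .
qed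

definition idx_list :: "'n list \<Rightarrow> ('n \<Rightarrow> nat) \<Rightarrow> 'n list" where
  "idx_list cs \<gamma> = concat (map (\<lambda>i. replicate (\<gamma> i) i) cs)"

lemma idx_list_simps [simp]: "idx_list [] \<gamma> = []" "idx_list (c # cs) \<gamma> = replicate (\<gamma> c) c @ idx_list cs \<gamma>"
  by (simp_all add: idx_list_def)

lemma idx_list_cong: "(\<And>i. i \<in> set cs \<Longrightarrow> \<gamma> i = \<gamma>' i) \<Longrightarrow> idx_list cs \<gamma> = idx_list cs \<gamma>'"
  by (induction cs) auto

text \<open>The multi-indices below \<open>\<alpha>\<close> supported in \<open>S\<close>; letting \<open>S\<close>
  grow by one coordinate at a time gives the multivariate Leibniz rule by induction.\<close>

definition idx_box :: "'n set \<Rightarrow> ('n \<Rightarrow> nat) \<Rightarrow> ('n \<Rightarrow> nat) set" where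
  "idx_box S \<alpha> = {\<gamma>. (\<forall>j\<in>S. \<gamma> j \<le> \<alpha> j) \<and> (\<forall>j. j \<notin> S \<longrightarrow> \<gamma> j = 0)}"

definition binom_coeff :: "'n::finite set \<Rightarrow> ('n \<Rightarrow> nat) \<Rightarrow> ('n \<Rightarrow> nat) \<Rightarrow> real ^ 'n \<Rightarrow> complex" where
  "binom_coeff S \<alpha> \<gamma> \<xi> = (\<Prod>j\<in>S. of_nat (\<alpha> j choose \<gamma> j) * of_real (\<xi> $ j) ^ (\<alpha> j - \<gamma> j))"

lemma sum_idx_box_insert:
  assumes "c \<notin> S"
  shows "(\<Sum>\<gamma>\<in>idx_box (insert c S) \<alpha>. F \<gamma>) = (\<Sum>k\<le>\<alpha> c. \<Sum>\<gamma>\<in>idx_box S \<alpha>. F (\<gamma>(c := k)))"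
proof -
  have "(\<Sum>k\<le>\<alpha> c. \<Sum>\<gamma>\<in>idx_box S \<alpha>. F (\<gamma>(c := k))) = (\<Sum>(k, \<gamma>)\<in>{..\<alpha> c} \<times> idx_box S \<alpha>. F (\<gamma>(c := k)))"
    by (rule sum.cartesian_product)
  also have "\<dots> = (\<Sum>\<gamma>\<in>idx_box (insert c S) \<alpha>. F \<gamma>)"
    by (rule sum.reindex_bij_witness[of _ "\<lambda>\<gamma>. (\<gamma> c, \<gamma>(c := 0))" "\<lambda>(k, \<gamma>). \<gamma>(c := k)"])
      (use assms in \<open>auto simp: idx_box_def fun_eq_iff\<close>)
  finally show ?thesis by simp
qed

text \<open>The multivariate Leibniz rule, by adding one coordinate at a time.\<close>

lemma partials_osc_mult_idx:
  assumes U: "open U" and b: "smooth_on U b" and "distinct cs" "x \<in> U"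
  shows "\<i> ^ (\<Sum>j\<in>set cs. \<alpha> j) * partials (idx_list cs \<alpha>) (\<lambda>x. osc \<xi> x * b x) x =
     osc \<xi> x * (\<Sum>\<gamma>\<in>idx_box (set cs) \<alpha>. binom_coeff (set cs) \<alpha> \<gamma> \<xi> * (\<i> ^ (\<Sum>j\<in>set cs. \<gamma> j) * partials (idx_list cs \<gamma>) b x))"
  using assms(3,4)
proof (induction cs arbitrary: x)
  case Nil
  have "idx_box {} \<alpha> = {\<lambda>_. 0}" by (auto simp: idx_box_def)
  then show ?case by (simp add: binom_coeff_def)
next
  case (Cons c cs)
  let ?S = "set cs" let ?m = "\<alpha> c"
  let ?B = "\<lambda>x. \<Sum>\<gamma>\<in>idx_box ?S \<alpha>. binom_coeff ?S \<alpha> \<gamma> \<xi> * (\<i> ^ (\<Sum>j\<in>?S. \<gamma> j) * partials (idx_list cs \<gamma>) b x)"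
  have c: "c \<notin> ?S" "distinct cs" using Cons.prems by auto
  have so: "smooth_on U (\<lambda>x. osc \<xi> x * b x)" by (intro smooth_on_mult smooth_on_osc b U)
  have st: "smooth_on U (\<lambda>x. binom_coeff ?S \<alpha> \<gamma> \<xi> * (\<i> ^ (\<Sum>j\<in>?S. \<gamma> j) * partials (idx_list cs \<gamma>) b x))" for \<gamma>
    by (intro smooth_on_cmult smooth_on_partials U b)
  have sB: "smooth_on U ?B" by (intro smooth_on_sum U st)
  have part: "partials (replicate k c) ?B x = (\<Sum>\<gamma>\<in>idx_box ?S \<alpha>. binom_coeff ?S \<alpha> \<gamma> \<xi> * (\<i> ^ (\<Sum>j\<in>?S. \<gamma> j) * partials (replicate k c @ idx_list cs \<gamma>) b x))" for k
  proof -
    have "partials (replicate k c) ?B x = (\<Sum>\<gamma>\<in>idx_box ?S \<alpha>. partials (replicate k c) (\<lambda>x. binom_coeff ?S \<alpha> \<gamma> \<xi> * (\<i> ^ (\<Sum>j\<in>?S. \<gamma> j) * partials (idx_list cs \<gamma>) b x)) x)"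
      by (rule partials_sum[OF U st Cons.prems(2)])
    also have "\<dots> = (\<Sum>\<gamma>\<in>idx_box ?S \<alpha>. binom_coeff ?S \<alpha> \<gamma> \<xi> * (\<i> ^ (\<Sum>j\<in>?S. \<gamma> j) * partials (replicate k c @ idx_list cs \<gamma>) b x))"
    proof (rule sum.cong[OF refl])
      fix \<gamma>
      show "partials (replicate k c) (\<lambda>x. binom_coeff ?S \<alpha> \<gamma> \<xi> * (\<i> ^ (\<Sum>j\<in>?S. \<gamma> j) * partials (idx_list cs \<gamma>) b x)) x =
        binom_coeff ?S \<alpha> \<gamma> \<xi> * (\<i> ^ (\<Sum>j\<in>?S. \<gamma> j) * partials (replicate k c @ idx_list cs \<gamma>) b x)"
        using partials_cmult[OF U smooth_on_partials[OF b] Cons.prems(2), of "replicate k c" "binom_coeff ?S \<alpha> \<gamma> \<xi> * \<i> ^ (\<Sum>j\<in>?S. \<gamma> j)" "idx_list cs \<gamma>"]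
        by (simp add: mult.assoc)
    qed
    finally show ?thesis .
  qed
  have "\<i> ^ (\<Sum>j\<in>set (c # cs). \<alpha> j) * partials (idx_list (c # cs) \<alpha>) (\<lambda>x. osc \<xi> x * b x) x =
    \<i> ^ ?m * (\<i> ^ (\<Sum>j\<in>?S. \<alpha> j) * partials (replicate ?m c) (partials (idx_list cs \<alpha>) (\<lambda>x. osc \<xi> x * b x)) x)"
    using c by (simp add: power_add)
  also have "\<i> ^ (\<Sum>j\<in>?S. \<alpha> j) * partials (replicate ?m c) (partials (idx_list cs \<alpha>) (\<lambda>x. osc \<xi> x * b x)) x
     = partials (replicate ?m c) (\<lambda>x. \<i> ^ (\<Sum>j\<in>?S. \<alpha> j) * partials (idx_list cs \<alpha>) (\<lambda>x. osc \<xi> x * b x) x) x"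
    by (rule partials_cmult[symmetric, OF U smooth_on_partials[OF so] Cons.prems(2)])
  also have "\<dots> = partials (replicate ?m c) (\<lambda>x. osc \<xi> x * ?B x) x"
    by (rule partials_cong_open[OF U Cons.IH[OF c(2)] Cons.prems(2)])
  also have "\<i> ^ ?m * \<dots> = osc \<xi> x * (\<Sum>k\<le>?m. of_nat (?m choose k) * (\<i> ^ k * partials (replicate k c) ?B x) * of_real (\<xi> $ c) ^ (?m - k))"
    by (rule partials_osc_mult_replicate[OF U Cons.prems(2) sB])
  also have "(\<Sum>k\<le>?m. of_nat (?m choose k) * (\<i> ^ k * partials (replicate k c) ?B x) * of_real (\<xi> $ c) ^ (?m - k)) =
     (\<Sum>k\<le>?m. \<Sum>\<gamma>\<in>idx_box ?S \<alpha>. binom_coeff (set (c # cs)) \<alpha> (\<gamma>(c := k)) \<xi> * (\<i> ^ (\<Sum>j\<in>set (c # cs). (\<gamma>(c := k)) j) * partials (idx_list (c # cs) (\<gamma>(c := k))) b x))"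
  proof (rule sum.cong[OF refl])
    fix k
    have "binom_coeff (set (c # cs)) \<alpha> (\<gamma>(c := k)) \<xi> * (\<i> ^ (\<Sum>j\<in>set (c # cs). (\<gamma>(c := k)) j) * partials (idx_list (c # cs) (\<gamma>(c := k))) b x)
      = of_nat (?m choose k) * of_real (\<xi> $ c) ^ (?m - k) * \<i> ^ k * (binom_coeff ?S \<alpha> \<gamma> \<xi> * (\<i> ^ (\<Sum>j\<in>?S. \<gamma> j) * partials (replicate k c @ idx_list cs \<gamma>) b x))" for \<gamma>
    proof -
      have "binom_coeff (set (c # cs)) \<alpha> (\<gamma>(c := k)) \<xi> = of_nat (?m choose k) * of_real (\<xi> $ c) ^ (?m - k) * binom_coeff ?S \<alpha> \<gamma> \<xi>"
        unfolding binom_coeff_def using c(1) by (simp, intro disjI2 prod.cong) auto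
      moreover have "(\<Sum>j\<in>set (c # cs). (\<gamma>(c := k)) j) = k + (\<Sum>j\<in>?S. \<gamma> j)"
        using c(1) by (simp, intro sum.cong) auto
      moreover have "idx_list cs (\<gamma>(c := k)) = idx_list cs \<gamma>" using c(1) by (intro idx_list_cong) auto
      ultimately show ?thesis by (simp add: power_add)
    qed
    then show "of_nat (?m choose k) * (\<i> ^ k * partials (replicate k c) ?B x) * of_real (\<xi> $ c) ^ (?m - k) =
      (\<Sum>\<gamma>\<in>idx_box ?S \<alpha>. binom_coeff (set (c # cs)) \<alpha> (\<gamma>(c := k)) \<xi> * (\<i> ^ (\<Sum>j\<in>set (c # cs). (\<gamma>(c := k)) j) * partials (idx_list (c # cs) (\<gamma>(c := k))) b x))"
      unfolding part by (simp only: sum_distrib_left[symmetric]) (simp add: mult.assoc mult.left_commute mult.commute)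
  qed
  also have "\<dots> = (\<Sum>\<gamma>\<in>idx_box (set (c # cs)) \<alpha>. binom_coeff (set (c # cs)) \<alpha> \<gamma> \<xi> * (\<i> ^ (\<Sum>j\<in>set (c # cs). \<gamma> j) * partials (idx_list (c # cs) \<gamma>) b x))"
    using sum_idx_box_insert[OF c(1), of "\<lambda>\<gamma>. binom_coeff (set (c # cs)) \<alpha> \<gamma> \<xi> * (\<i> ^ (\<Sum>j\<in>set (c # cs). \<gamma> j) * partials (idx_list (c # cs) \<gamma>) b x)" \<alpha>]
    by simp
  finally show ?case .
qed

lemma partials_osc_mult:
  fixes \<alpha> :: "'n::finite multiindex"
  assumes U: "open U" "x \<in> U" and b: "smooth_on U b" and d: "mi_abs \<alpha> \<le> d"
  shows "\<i> ^ mi_abs \<alpha> * partials (mi_list \<alpha>) (\<lambda>x. osc \<xi> x * b x) x =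
     osc \<xi> x * (\<Sum>\<gamma> | mi_abs \<gamma> \<le> d. binom_coeff UNIV \<alpha> \<gamma> \<xi> * (\<i> ^ mi_abs \<gamma> * partials (mi_list \<gamma>) b x))"
proof -
  have "\<i> ^ mi_abs \<alpha> * partials (mi_list \<alpha>) (\<lambda>x. osc \<xi> x * b x) x =
     osc \<xi> x * (\<Sum>\<gamma>\<in>idx_box UNIV \<alpha>. binom_coeff UNIV \<alpha> \<gamma> \<xi> * (\<i> ^ mi_abs \<gamma> * partials (mi_list \<gamma>) b x))"
    using partials_osc_mult_idx[OF U(1) b coords(1) U(2), of \<alpha> \<xi>] unfolding coords(2) mi_abs_def mi_list_def idx_list_def .
  also have "(\<Sum>\<gamma>\<in>idx_box UNIV \<alpha>. binom_coeff UNIV \<alpha> \<gamma> \<xi> * (\<i> ^ mi_abs \<gamma> * partials (mi_list \<gamma>) b x)) =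
     (\<Sum>\<gamma> | mi_abs \<gamma> \<le> d. binom_coeff UNIV \<alpha> \<gamma> \<xi> * (\<i> ^ mi_abs \<gamma> * partials (mi_list \<gamma>) b x))"
  proof (rule sum.mono_neutral_left[OF finite_mi_le])
    show "idx_box UNIV \<alpha> \<subseteq> {\<gamma>. mi_abs \<gamma> \<le> d}"
      using d by (auto simp: idx_box_def mi_abs_def intro: order_trans[OF sum_mono])
    show "\<forall>\<gamma>\<in>{\<gamma>. mi_abs \<gamma> \<le> d} - idx_box UNIV \<alpha>. binom_coeff UNIV \<alpha> \<gamma> \<xi> * (\<i> ^ mi_abs \<gamma> * partials (mi_list \<gamma>) b x) = 0"
    proof
      fix \<gamma> assume "\<gamma> \<in> {\<gamma>. mi_abs \<gamma> \<le> d} - idx_box UNIV \<alpha>"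
      then obtain j where "\<not> \<gamma> j \<le> \<alpha> j" by (auto simp: idx_box_def)
      then have "binom_coeff UNIV \<alpha> \<gamma> \<xi> = 0"
        unfolding binom_coeff_def by (intro prod_zero bexI[of _ j]) (auto simp: binomial_eq_0)
      then show "binom_coeff UNIV \<alpha> \<gamma> \<xi> * (\<i> ^ mi_abs \<gamma> * partials (mi_list \<gamma>) b x) = 0" by simp
    qed
  qed
  finally show ?thesis .
qed

text \<open>The Taylor coefficient of order \<open>\<gamma>\<close> in \<open>\<xi>\<close> of the symbol, as a
  function of \<open>x\<close>; \<open>symbol_derivative\<close> identifies it with the derivative divided by
  \<open>\<gamma>!\<close>.\<close>

definition symbol_taylor :: "nat \<Rightarrow> ('n::finite multiindex \<Rightarrow> real ^ 'n \<Rightarrow> complex) \<Rightarrow> real ^ 'n \<Rightarrow> 'n multiindex \<Rightarrow> real ^ 'n \<Rightarrow> complex" where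
  "symbol_taylor d a \<xi> \<gamma> x = (\<Sum>\<alpha> | mi_abs \<alpha> \<le> d. binom_coeff UNIV \<alpha> \<gamma> \<xi> * a \<alpha> x)"

lemma symbol_taylor_smooth:
  assumes "open \<Omega>" "\<And>\<alpha>. mi_abs \<alpha> \<le> d \<Longrightarrow> smooth_on \<Omega> (a \<alpha>)"
  shows "smooth_on \<Omega> (symbol_taylor d a \<xi> \<gamma>)"
  unfolding symbol_taylor_def[abs_def] using assms by (intro smooth_on_sum smooth_on_cmult) auto

text \<open>The transposed operator on an oscillating amplitude has the Taylor expansion of the symbol as
  coefficients; derivatives fall on the products of these coefficients with the amplitude.\<close>

lemma transpose_op_osc:
  assumes U: "open U" "x \<in> U" and w: "smooth_on U w" and a: "\<And>\<alpha>. mi_abs \<alpha> \<le> d \<Longrightarrow> smooth_on U (a \<alpha>)"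
  shows "transpose_op d a (\<lambda>x. osc \<xi> x * w x) x =
     osc \<xi> x * (\<Sum>\<gamma> | mi_abs \<gamma> \<le> d. \<i> ^ mi_abs \<gamma> * partials (mi_list \<gamma>) (\<lambda>y. symbol_taylor d a \<xi> \<gamma> y * w y) x)"
proof -
  let ?I = "{\<alpha>. mi_abs \<alpha> \<le> d}"
  have "transpose_op d a (\<lambda>x. osc \<xi> x * w x) x = (\<Sum>\<alpha>\<in>?I. osc \<xi> x * (\<Sum>\<gamma>\<in>?I. binom_coeff UNIV \<alpha> \<gamma> \<xi> * (\<i> ^ mi_abs \<gamma> * partials (mi_list \<gamma>) (\<lambda>y. a \<alpha> y * w y) x)))"
    unfolding transpose_op_def
  proof (rule sum.cong[OF refl])
    fix \<alpha> :: "'a multiindex" assume "\<alpha> \<in> ?I"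
    then have \<alpha>: "mi_abs \<alpha> \<le> d" by simp
    have "\<i> ^ mi_abs \<alpha> * partials (mi_list \<alpha>) (\<lambda>x. osc \<xi> x * (a \<alpha> x * w x)) x =
     osc \<xi> x * (\<Sum>\<gamma>\<in>?I. binom_coeff UNIV \<alpha> \<gamma> \<xi> * (\<i> ^ mi_abs \<gamma> * partials (mi_list \<gamma>) (\<lambda>y. a \<alpha> y * w y) x))"
      by (rule partials_osc_mult[OF U smooth_on_mult[OF U(1) a[OF \<alpha>] w] \<alpha>])
    then show "\<i> ^ mi_abs \<alpha> * partials (mi_list \<alpha>) (\<lambda>y. a \<alpha> y * (osc \<xi> y * w y)) x =
     osc \<xi> x * (\<Sum>\<gamma>\<in>?I. binom_coeff UNIV \<alpha> \<gamma> \<xi> * (\<i> ^ mi_abs \<gamma> * partials (mi_list \<gamma>) (\<lambda>y. a \<alpha> y * w y) x))"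
      by (simp only: mult.left_commute)
  qed
  also have "\<dots> = osc \<xi> x * (\<Sum>\<gamma>\<in>?I. \<Sum>\<alpha>\<in>?I. binom_coeff UNIV \<alpha> \<gamma> \<xi> * (\<i> ^ mi_abs \<gamma> * partials (mi_list \<gamma>) (\<lambda>y. a \<alpha> y * w y) x))"
    unfolding sum_distrib_left[symmetric] by (subst sum.swap) simp
  also have "(\<Sum>\<gamma>\<in>?I. \<Sum>\<alpha>\<in>?I. binom_coeff UNIV \<alpha> \<gamma> \<xi> * (\<i> ^ mi_abs \<gamma> * partials (mi_list \<gamma>) (\<lambda>y. a \<alpha> y * w y) x))
     = (\<Sum>\<gamma>\<in>?I. \<i> ^ mi_abs \<gamma> * partials (mi_list \<gamma>) (\<lambda>y. symbol_taylor d a \<xi> \<gamma> y * w y) x)"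
  proof (rule sum.cong[OF refl])
    fix \<gamma>
    have s: "smooth_on U (\<lambda>y. a \<alpha> y * w y)" if "\<alpha> \<in> ?I" for \<alpha> using that by (intro smooth_on_mult U a w) simp
    have "partials (mi_list \<gamma>) (\<lambda>y. symbol_taylor d a \<xi> \<gamma> y * w y) x = partials (mi_list \<gamma>) (\<lambda>y. \<Sum>\<alpha>\<in>?I. binom_coeff UNIV \<alpha> \<gamma> \<xi> * (a \<alpha> y * w y)) x"
      by (simp add: symbol_taylor_def sum_distrib_right mult.assoc)
    also have "\<dots> = (\<Sum>\<alpha>\<in>?I. partials (mi_list \<gamma>) (\<lambda>y. binom_coeff UNIV \<alpha> \<gamma> \<xi> * (a \<alpha> y * w y)) x)"
      by (rule partials_sum[OF U(1) smooth_on_cmult[OF U(1) s] U(2)])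
    also have "\<dots> = (\<Sum>\<alpha>\<in>?I. binom_coeff UNIV \<alpha> \<gamma> \<xi> * partials (mi_list \<gamma>) (\<lambda>y. a \<alpha> y * w y) x)"
      by (intro sum.cong refl partials_cmult[OF U(1) s U(2)])
    finally show "(\<Sum>\<alpha>\<in>?I. binom_coeff UNIV \<alpha> \<gamma> \<xi> * (\<i> ^ mi_abs \<gamma> * partials (mi_list \<gamma>) (\<lambda>y. a \<alpha> y * w y) x))
      = \<i> ^ mi_abs \<gamma> * partials (mi_list \<gamma>) (\<lambda>y. symbol_taylor d a \<xi> \<gamma> y * w y) x"
      by (simp add: sum_distrib_left mult.left_commute)
  qed
  finally show ?thesis .
qed

subsection \<open>Derivatives of the symbol in the covariable\<close>

lemma partial_monomial: "partial j (\<lambda>\<eta>. c * complex_of_real (mi_power \<eta> \<alpha>)) = (\<lambda>\<eta>. (c * of_nat (\<alpha> j)) * of_real (mi_power \<eta> (\<alpha>(j := \<alpha> j - 1))))"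
  and monomial_differentiable: "(\<lambda>\<eta>. c * complex_of_real (mi_power \<eta> \<alpha>)) differentiable (at x)"
proof -
  have der: "((\<lambda>\<eta>. c * complex_of_real (mi_power \<eta> \<alpha>)) has_derivative
     (\<lambda>h. c * of_real (\<Sum>i\<in>UNIV. real (\<alpha> i) * mi_power \<eta> (\<alpha>(i := \<alpha> i - 1)) * (h $ i)))) (at \<eta>)" for \<eta>
    using mi_power_has_derivative[of 0 \<alpha> \<eta>] by (intro has_derivative_mult_right has_derivative_of_real) simp
  have "(\<Sum>i\<in>UNIV. real (\<alpha> i) * mi_power \<eta> (\<alpha>(i := \<alpha> i - 1)) * ((axis j 1 :: real ^ 'a) $ i)) = real (\<alpha> j) * mi_power \<eta> (\<alpha>(j := \<alpha> j - 1))" for \<eta>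
    by (simp add: axis_def if_distrib cong: if_cong)
  then show "partial j (\<lambda>\<eta>. c * complex_of_real (mi_power \<eta> \<alpha>)) = (\<lambda>\<eta>. (c * of_nat (\<alpha> j)) * of_real (mi_power \<eta> (\<alpha>(j := \<alpha> j - 1))))"
    using has_derivative_partial(1)[OF der, of j] by (auto simp: fun_eq_iff)
  show "(\<lambda>\<eta>. c * complex_of_real (mi_power \<eta> \<alpha>)) differentiable (at x)" using der by (auto simp: differentiable_def)
qed

lemma monomial_smooth: "smooth_on U (\<lambda>\<eta>. c * complex_of_real (mi_power \<eta> \<alpha>))"
proof -
  have "smooth_on UNIV (\<lambda>\<eta>. c * complex_of_real (mi_power \<eta> \<alpha>))"
  proof (rule smooth_on_coinduct[of UNIV "\<lambda>f. \<exists>c \<alpha>. f = (\<lambda>\<eta>. c * complex_of_real (mi_power \<eta> \<alpha>))"])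
    fix f assume "\<exists>c \<alpha>. f = (\<lambda>\<eta>::real^'a. c * complex_of_real (mi_power \<eta> \<alpha>))"
    then obtain c \<alpha> where f: "f = (\<lambda>\<eta>::real^'a. c * complex_of_real (mi_power \<eta> \<alpha>))" by blast
    have "\<exists>g. (\<exists>c \<alpha>. g = (\<lambda>\<eta>. c * complex_of_real (mi_power \<eta> \<alpha>))) \<and> (\<forall>x\<in>UNIV. partial i f x = g x)" for i
      unfolding f partial_monomial by blast
    then show "(\<forall>x\<in>UNIV. f differentiable at x) \<and> (\<forall>i. \<exists>g. (\<exists>c \<alpha>. g = (\<lambda>\<eta>. c * complex_of_real (mi_power \<eta> \<alpha>))) \<and> (\<forall>x\<in>UNIV. partial i f x = g x))"
      using monomial_differentiable unfolding f by blast
  qed (simp, blast)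
  then show ?thesis using smooth_on_subset by fastforce
qed

lemma partials_replicate_monomial:
  "partials (replicate k j) (\<lambda>\<eta>. c * complex_of_real (mi_power \<eta> \<alpha>)) = (\<lambda>\<eta>. (c * (fact k * of_nat (\<alpha> j choose k))) * of_real (mi_power \<eta> (\<alpha>(j := \<alpha> j - k))))"
proof (induction k)
  case (Suc k)
  have "partials (replicate (Suc k) j) (\<lambda>\<eta>. c * complex_of_real (mi_power \<eta> \<alpha>)) = 
     partial j (\<lambda>\<eta>. (c * (fact k * of_nat (\<alpha> j choose k))) * of_real (mi_power \<eta> (\<alpha>(j := \<alpha> j - k))))"
    by (simp only: replicate_Suc foldr_Cons o_apply Suc.IH)
  also have "\<dots> = (\<lambda>\<eta>. (c * (fact k * of_nat (\<alpha> j choose k)) * of_nat (\<alpha> j - k)) * of_real (mi_power \<eta> (\<alpha>(j := \<alpha> j - Suc k))))"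
    unfolding partial_monomial by simp
  also have "fact k * of_nat (\<alpha> j choose k) * of_nat (\<alpha> j - k) = (fact (Suc k) * of_nat (\<alpha> j choose Suc k) :: complex)"
  proof -
    have "(\<alpha> j - k) * (\<alpha> j choose k) = Suc k * (\<alpha> j choose Suc k)" by (metis binomial_absorb_comp binomial_absorption)
    then have "of_nat (\<alpha> j - k) * of_nat (\<alpha> j choose k) = (of_nat (Suc k) * of_nat (\<alpha> j choose Suc k) :: complex)"
      by (metis of_nat_mult)
    then show ?thesis by (simp only: fact_Suc) (simp only: mult.assoc mult.left_commute mult.commute)
  qed
  then have "(\<lambda>\<eta>. (c * (fact k * of_nat (\<alpha> j choose k)) * of_nat (\<alpha> j - k)) * complex_of_real (mi_power \<eta> (\<alpha>(j := \<alpha> j - Suc k)))) =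
     (\<lambda>\<eta>. (c * (fact (Suc k) * of_nat (\<alpha> j choose Suc k))) * of_real (mi_power \<eta> (\<alpha>(j := \<alpha> j - Suc k))))"
    by (simp only: mult.assoc)
  finally show ?case .
qed simp

lemma partials_idx_monomial:
  assumes "distinct cs"
  shows "partials (idx_list cs \<gamma>) (\<lambda>\<eta>. complex_of_real (mi_power \<eta> \<alpha>)) = 
     (\<lambda>\<eta>. (\<Prod>j\<in>set cs. fact (\<gamma> j) * of_nat (\<alpha> j choose \<gamma> j)) * of_real (mi_power \<eta> (\<lambda>j. if j \<in> set cs then \<alpha> j - \<gamma> j else \<alpha> j)))"
  using assms
proof (induction cs)
  case (Cons c cs)
  let ?\<beta> = "\<lambda>j. if j \<in> set cs then \<alpha> j - \<gamma> j else \<alpha> j"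
  have "partials (idx_list (c # cs) \<gamma>) (\<lambda>\<eta>. complex_of_real (mi_power \<eta> \<alpha>)) = partials (replicate (\<gamma> c) c) (\<lambda>\<eta>. (\<Prod>j\<in>set cs. fact (\<gamma> j) * of_nat (\<alpha> j choose \<gamma> j)) * of_real (mi_power \<eta> ?\<beta>))"
    using Cons by simp
  also have "\<dots> = (\<lambda>\<eta>. ((\<Prod>j\<in>set cs. fact (\<gamma> j) * of_nat (\<alpha> j choose \<gamma> j)) * (fact (\<gamma> c) * of_nat (?\<beta> c choose \<gamma> c))) * of_real (mi_power \<eta> (?\<beta>(c := ?\<beta> c - \<gamma> c))))"
    by (rule partials_replicate_monomial)
  also have "?\<beta>(c := ?\<beta> c - \<gamma> c) = (\<lambda>j. if j \<in> set (c # cs) then \<alpha> j - \<gamma> j else \<alpha> j)"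
    using Cons.prems by (auto simp: fun_eq_iff)
  finally show ?case using Cons.prems by (simp add: mult.commute)
qed simp

lemma symbol_derivative:
  fixes a :: "'n::finite multiindex \<Rightarrow> real ^ 'n \<Rightarrow> complex"
  shows "mi_partial \<gamma> (\<lambda>\<eta>. pdo_symbol d a x \<eta>) \<xi> = of_real (mi_fact \<gamma>) * symbol_taylor d a \<xi> \<gamma> x"
proof -
  have mon: "partials (mi_list \<gamma>) (\<lambda>\<eta>. complex_of_real (mi_power \<eta> \<alpha>)) \<xi> = of_real (mi_fact \<gamma>) * binom_coeff UNIV \<alpha> \<gamma> \<xi>" for \<alpha> :: "'n multiindex"
    using partials_idx_monomial[OF coords(1), of \<gamma> \<alpha>] unfolding coords(2) mi_list_def idx_list_def
    by (simp add: mi_fact_def binom_coeff_def mi_power_def prod.distrib)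
  have "mi_partial \<gamma> (\<lambda>\<eta>. pdo_symbol d a x \<eta>) \<xi> = (\<Sum>\<alpha> | mi_abs \<alpha> \<le> d. partials (mi_list \<gamma>) (\<lambda>\<eta>. a \<alpha> x * complex_of_real (mi_power \<eta> \<alpha>)) \<xi>)"
    unfolding mi_partial_eq pdo_symbol_def by (rule partials_sum[of UNIV]) (auto intro: monomial_smooth)
  also have "\<dots> = (\<Sum>\<alpha> | mi_abs \<alpha> \<le> d. of_real (mi_fact \<gamma>) * (binom_coeff UNIV \<alpha> \<gamma> \<xi> * a \<alpha> x))"
  proof (rule sum.cong[OF refl])
    fix \<alpha> :: "'n multiindex"
    have "partials (mi_list \<gamma>) (\<lambda>\<eta>. a \<alpha> x * complex_of_real (mi_power \<eta> \<alpha>)) \<xi> = a \<alpha> x * partials (mi_list \<gamma>) (\<lambda>\<eta>. complex_of_real (mi_power \<eta> \<alpha>)) \<xi>"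
      by (rule partials_cmult[of UNIV]) (use monomial_smooth[of UNIV 1 \<alpha>] in auto)
    then show "partials (mi_list \<gamma>) (\<lambda>\<eta>. a \<alpha> x * complex_of_real (mi_power \<eta> \<alpha>)) \<xi> = of_real (mi_fact \<gamma>) * (binom_coeff UNIV \<alpha> \<gamma> \<xi> * a \<alpha> x)"
      by (simp add: mon)
  qed
  finally show ?thesis by (simp add: symbol_taylor_def sum_distrib_left)
qed

lemma symbol_taylor_zero: "symbol_taylor d a \<xi> (\<lambda>_. 0) x = pdo_symbol d a x \<xi>"
  by (simp add: symbol_taylor_def pdo_symbol_def binom_coeff_def mi_power_def mult.commute)

section \<open>Approximate inversion of the operator on oscillating amplitudes\<close>

lemma mi_fact_pos: "mi_fact \<alpha> > 0"
  by (simp add: mi_fact_def prod_pos)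

lemma mi_fact_le: "mi_fact \<alpha> \<le> fact (mi_abs \<alpha>)"
proof -
  have "(\<Prod>i\<in>S. fact (\<alpha> i)) \<le> (fact (\<Sum>i\<in>S. \<alpha> i) :: real)" if "finite S" for S
    using that
  proof (induction S rule: finite_induct)
    case (insert i S)
    have "(\<Prod>i\<in>insert i S. fact (\<alpha> i)) \<le> fact (\<alpha> i) * (fact (\<Sum>i\<in>S. \<alpha> i) :: real)"
      using insert by (simp add: mult_left_mono)
    also have "\<dots> \<le> fact (\<alpha> i + (\<Sum>i\<in>S. \<alpha> i))"
    proof -
      have "fact (\<alpha> i) * fact (\<Sum>i\<in>S. \<alpha> i) \<le> (fact (\<alpha> i + (\<Sum>i\<in>S. \<alpha> i)) :: nat)"
        using fact_fact_dvd_fact[of "\<alpha> i" "\<Sum>i\<in>S. \<alpha> i"] by (rule dvd_imp_le) simp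
      then have "real (fact (\<alpha> i) * fact (\<Sum>i\<in>S. \<alpha> i)) \<le> real (fact (\<alpha> i + (\<Sum>i\<in>S. \<alpha> i)))" by (simp only: of_nat_le_iff)
      then show ?thesis by simp
    qed
    finally show ?case using insert by simp
  qed simp
  then show ?thesis unfolding mi_fact_def mi_abs_def by simp
qed

lemma class_A_smooth:
  assumes "a \<in> class_A \<Omega> d d' \<rho> \<delta>" "mi_abs \<alpha> \<le> d"
  shows "smooth_on \<Omega> (a \<alpha>)"
  using assms by (intro real_analytic_on_smooth) (auto simp: class_A_def pdo_coeffs_def)

lemma powr_nat_power: "x > 0 \<Longrightarrow> (x powr s) ^ n = x powr (s * real n)" for x :: real
  by (simp add: powr_powr[symmetric] powr_realpow del: powr_powr)

text \<open>The hypotheses on the class, with common constants on one compact set, rewritten for Taylor coefficients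
  of the symbol and for lists of directions. All bounds are relative to the absolute value of the symbol
  itself.\<close>

lemma class_A_bounds:
  assumes a: "a \<in> class_A \<Omega> d d' \<rho> \<delta>" and \<Omega>: "open \<Omega>" and K: "compact K" "K \<subseteq> \<Omega>"
  obtains C A M where "C \<ge> 1" "A \<ge> 1" "M \<ge> 1"
    "\<And>x \<xi>. x \<in> K \<Longrightarrow> norm \<xi> \<ge> M \<Longrightarrow> norm \<xi> powr d' \<le> C * norm (pdo_symbol d a x \<xi>)"
    "\<And>x \<xi> \<gamma> is. x \<in> K \<Longrightarrow> norm \<xi> \<ge> M \<Longrightarrow> norm (partials is (symbol_taylor d a \<xi> \<gamma>) x)
       \<le> (C * A ^ mi_abs \<gamma> * norm \<xi> powr (- \<rho> * real (mi_abs \<gamma>)) * norm (pdo_symbol d a x \<xi>)) * (A * norm \<xi> powr \<delta>) ^ length is * fact (length is)"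
proof -
  note a' = CollectD[OF a[unfolded class_A_def]]
  from mp[OF spec[OF conjunct1[OF conjunct2[OF a']], of K] conjI[OF K]]
  obtain C1 A1 M1 where 1: "C1 > 0" "A1 > 0" "M1 > 0" "\<forall>x\<in>K. \<forall>\<xi>. norm \<xi> \<ge> M1 \<longrightarrow> (\<forall>\<alpha> \<beta>.
      norm (mi_partial \<alpha> (\<lambda>y. mi_partial \<beta> (\<lambda>\<eta>. pdo_symbol d a y \<eta>) \<xi>) x)
                \<le> C1 * A1 ^ (mi_abs \<alpha> + mi_abs \<beta>) * mi_fact \<alpha> * mi_fact \<beta>
                   * norm (pdo_symbol d a x \<xi>) * norm \<xi> powr (- \<rho> * real (mi_abs \<beta>) + \<delta> * real (mi_abs \<alpha>)))"
    by (elim exE conjE) (rule that)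
  from mp[OF spec[OF conjunct2[OF conjunct2[OF a']], of K] conjI[OF K]]
  obtain C2 M2 where 2: "C2 > 0" "M2 > 0" "\<forall>x\<in>K. \<forall>\<xi>. norm \<xi> \<ge> M2 \<longrightarrow> norm \<xi> powr d' \<le> C2 * norm (pdo_symbol d a x \<xi>)"
    by (elim exE conjE) (rule that)
  define C A M where "C = max 1 (max C1 C2)" and "A = max 1 A1" and "M = max 1 (max M1 M2)"
  show ?thesis
  proof (rule that[of C A M])
    show "C \<ge> 1" "A \<ge> 1" "M \<ge> 1" by (simp_all add: C_def A_def M_def)
    fix x and \<xi> :: "real ^ 'a" assume x: "x \<in> K" and \<xi>: "norm \<xi> \<ge> M"
    have "C2 * norm (pdo_symbol d a x \<xi>) \<le> C * norm (pdo_symbol d a x \<xi>)"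
      by (intro mult_right_mono) (auto simp: C_def)
    then show "norm \<xi> powr d' \<le> C * norm (pdo_symbol d a x \<xi>)" using 2(3)[rule_format, OF x, of \<xi>] \<xi> by (simp add: M_def)
    fix \<gamma> "is"
    let ?p = "norm (pdo_symbol d a x \<xi>)" and ?l = "norm \<xi> powr \<delta>"
    have xO: "x \<in> \<Omega>" using x K by blast
    have "norm \<xi> \<ge> 1" using \<xi> by (simp add: M_def)
    then have n\<xi>: "norm \<xi> > 0" by linarith
    have ss: "smooth_on \<Omega> (symbol_taylor d a \<xi> \<gamma>)" by (rule symbol_taylor_smooth[OF \<Omega> class_A_smooth[OF a]])
    show "norm (partials is (symbol_taylor d a \<xi> \<gamma>) x)
       \<le> (C * A ^ mi_abs \<gamma> * norm \<xi> powr (- \<rho> * real (mi_abs \<gamma>)) * ?p) * (A * ?l) ^ length is * fact (length is)"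
    proof (rule partials_bounds_of_mi_partial[OF \<Omega> xO ss, of "\<lambda>n. (C * A ^ mi_abs \<gamma> * norm \<xi> powr (- \<rho> * real (mi_abs \<gamma>)) * ?p) * (A * ?l) ^ n * fact n"])
      fix \<alpha> :: "'a multiindex"
      let ?P = "norm \<xi> powr (- \<rho> * real (mi_abs \<gamma>) + \<delta> * real (mi_abs \<alpha>))"
      have "mi_partial \<alpha> (\<lambda>y. mi_partial \<gamma> (\<lambda>\<eta>. pdo_symbol d a y \<eta>) \<xi>) x = of_real (mi_fact \<gamma>) * mi_partial \<alpha> (symbol_taylor d a \<xi> \<gamma>) x"
        unfolding symbol_derivative unfolding mi_partial_eq by (rule partials_cmult[OF \<Omega> ss xO])
      then have "mi_fact \<gamma> * norm (mi_partial \<alpha> (symbol_taylor d a \<xi> \<gamma>) x) \<le> C1 * A1 ^ (mi_abs \<alpha> + mi_abs \<gamma>) * mi_fact \<alpha> * mi_fact \<gamma> * ?p * ?P"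
        using 1(4)[rule_format, OF x, of \<xi> \<alpha> \<gamma>] \<xi> mi_fact_pos[of \<gamma>] by (simp add: M_def norm_mult)
      then have "mi_fact \<gamma> * norm (mi_partial \<alpha> (symbol_taylor d a \<xi> \<gamma>) x) \<le> mi_fact \<gamma> * (C1 * A1 ^ (mi_abs \<alpha> + mi_abs \<gamma>) * mi_fact \<alpha> * ?p * ?P)"
        by (simp only: mult.assoc mult.left_commute)
      then have "norm (mi_partial \<alpha> (symbol_taylor d a \<xi> \<gamma>) x) \<le> C1 * A1 ^ (mi_abs \<alpha> + mi_abs \<gamma>) * mi_fact \<alpha> * ?p * ?P"
        using mi_fact_pos[of \<gamma>] by simp
      also have "\<dots> \<le> C * A ^ (mi_abs \<alpha> + mi_abs \<gamma>) * fact (mi_abs \<alpha>) * ?p * ?P"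
        using 1(1,2) mi_fact_le[of \<alpha>] less_imp_le[OF mi_fact_pos[of \<alpha>]]
        by (intro mult_right_mono mult_mono power_mono) (auto simp: C_def A_def)
      also have "?P = norm \<xi> powr (- \<rho> * real (mi_abs \<gamma>)) * ?l ^ mi_abs \<alpha>"
        using powr_nat_power[OF n\<xi>, of \<delta> "mi_abs \<alpha>"] by (simp only: powr_add)
      finally show "norm (mi_partial \<alpha> (symbol_taylor d a \<xi> \<gamma>) x)
        \<le> (C * A ^ mi_abs \<gamma> * norm \<xi> powr (- \<rho> * real (mi_abs \<gamma>)) * ?p) * (A * ?l) ^ mi_abs \<alpha> * fact (mi_abs \<alpha>)"
        by (simp add: power_add power_mult_distrib mult.assoc mult.left_commute mult.commute)
    qed
  qed
qed

text \<open>Each derivative of an amplitude costs \<open>\<mu> = |\<xi>|^\<delta>\<close>, a constant and Gevrey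
  growth of order 2. The index \<open>k\<close> counts derivatives spent in earlier steps of the inversion, whose
  powers of \<open>\<mu>\<close> have already been charged to the constant in front.\<close>

definition amp_bound :: "real \<Rightarrow> real \<Rightarrow> nat \<Rightarrow> nat \<Rightarrow> real" where
  "amp_bound R \<mu> k n = \<mu> ^ n * R ^ (n + k) * (fact (n + k))\<^sup>2"

definition amplitude :: "(real ^ 'n::finite) set \<Rightarrow> real \<Rightarrow> real \<Rightarrow> nat \<Rightarrow> real \<Rightarrow> (real ^ 'n \<Rightarrow> complex) \<Rightarrow> bool" where
  "amplitude K R \<mu> k B y \<longleftrightarrow> smooth_on UNIV y \<and> (\<forall>x. x \<notin> K \<longrightarrow> y x = 0) \<and>
     (\<forall>x\<in>K. \<forall>is. norm (partials is y x) \<le> B * amp_bound R \<mu> k (length is))"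

lemma amp_bound_growth:
  assumes "R \<ge> 0" "\<mu> \<ge> 0"
  shows "amp_bound R \<mu> k (Suc n) \<ge> (R * \<mu>) * real (Suc n) * amp_bound R \<mu> k n" and "amp_bound R \<mu> k n \<ge> 0"
proof -
  show nn: "amp_bound R \<mu> k n \<ge> 0" using assms by (simp add: amp_bound_def)
  have "(fact (Suc n + k))\<^sup>2 = (real (Suc (n + k)))\<^sup>2 * (fact (n + k))\<^sup>2"
    by (simp add: power_mult_distrib del: of_nat_Suc)
  then have e: "amp_bound R \<mu> k (Suc n) = (R * \<mu>) * (real (Suc (n + k)))\<^sup>2 * amp_bound R \<mu> k n"
    by (simp add: amp_bound_def del: of_nat_Suc fact_Suc)
  have "real (Suc n) \<le> (real (Suc (n + k)))\<^sup>2"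
  proof -
    have "real (Suc n) * 1 \<le> real (Suc (n + k)) * real (Suc (n + k))" by (intro mult_mono) auto
    then show ?thesis by (simp add: power2_eq_square)
  qed
  then show "amp_bound R \<mu> k (Suc n) \<ge> (R * \<mu>) * real (Suc n) * amp_bound R \<mu> k n"
    unfolding e using assms nn by (intro mult_right_mono mult_left_mono) auto
qed

lemma amp_bound_shift: "amp_bound R \<mu> k (n + g) = \<mu> ^ g * amp_bound R \<mu> (k + g) n"
  by (simp add: amp_bound_def power_add add.assoc add.commute add.left_commute)

lemma amp_bound_mono:
  assumes "R \<ge> 1" "\<mu> \<ge> 0" "k \<le> k'"
  shows "amp_bound R \<mu> k n \<le> amp_bound R \<mu> k' n"
  unfolding amp_bound_def using assms
  by (intro mult_mono power_mono power_increasing fact_mono mult_nonneg_nonneg zero_le_power) auto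

lemma amplitude_test:
  assumes "open \<Omega>" "compact K" "K \<subseteq> \<Omega>" "amplitude K R \<mu> k B y"
  shows "(\<lambda>x. osc \<xi> x * y x) \<in> test_functions \<Omega>"
proof (rule test_functionI(1)[OF _ assms(2,3)])
  show "smooth_on UNIV (\<lambda>x. osc \<xi> x * y x)"
    using assms(4) by (intro smooth_on_mult smooth_on_osc) (auto simp: amplitude_def)
  show "osc \<xi> x * y x = 0" if "x \<notin> K" for x using assms(4) that by (simp add: amplitude_def)
qed

text \<open>Approximate inversion of the transposed operator. With \<open>z = y / p\<close> the leading term of the
  operator on \<open>osc z\<close> is \<open>osc y\<close>, and the remainder \<open>s\<close> collects the terms with
  at least one derivative in \<open>\<xi>\<close>. Such a term of order \<open>|\<gamma>|\<close> gains
  \<open>|\<xi>|^(- \<rho> |\<gamma>|)\<close> from the symbol and loses \<open>|\<xi>|^(\<delta> |\<gamma>|)\<close>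
  through the derivatives falling on \<open>z\<close>, so it is smaller by \<open>|\<xi>|^(- (\<rho> -
  \<delta>))\<close>; the division by \<open>p\<close> itself gains \<open>|\<xi>|^(- d')\<close>.\<close>

lemma amplitude_step:
  fixes a :: "'n::finite multiindex \<Rightarrow> real ^ 'n \<Rightarrow> complex"
  assumes \<Omega>: "open \<Omega>" and K: "compact K" "K \<subseteq> \<Omega>" and a: "\<And>\<alpha>. mi_abs \<alpha> \<le> d \<Longrightarrow> smooth_on \<Omega> (a \<alpha>)"
    and \<xi>: "norm \<xi> \<ge> 1" and C: "C \<ge> 1" "A \<ge> 1" and \<mu>: "\<mu> = norm \<xi> powr \<delta>" and \<delta>: "0 \<le> \<delta>" "\<delta> < \<rho>"
    and low: "\<And>x. x \<in> K \<Longrightarrow> norm \<xi> powr d' \<le> C * norm (pdo_symbol d a x \<xi>)"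
    and st: "\<And>x \<gamma> is. x \<in> K \<Longrightarrow> norm (partials is (symbol_taylor d a \<xi> \<gamma>) x)
       \<le> (C * A ^ mi_abs \<gamma> * norm \<xi> powr (- \<rho> * real (mi_abs \<gamma>)) * norm (pdo_symbol d a x \<xi>)) * (A * \<mu>) ^ length is * fact (length is)"
    and R: "R \<ge> (4 * C + 2) * A" and y: "amplitude K R \<mu> k B y" and B: "B \<ge> 0"
  shows "\<exists>z s. amplitude K R \<mu> k (2 * C * norm \<xi> powr (- d') * B) z \<and>
    amplitude K R \<mu> (k + d) (4 * C * A ^ d * real (card {\<gamma> :: 'n multiindex. mi_abs \<gamma> \<le> d}) * norm \<xi> powr (- (\<rho> - \<delta>)) * B) s \<and>
    (\<forall>x. osc \<xi> x * y x = transpose_op d a (\<lambda>x. osc \<xi> x * z x) x + osc \<xi> x * s x)"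
proof -
  let ?p = "\<lambda>x. pdo_symbol d a x \<xi>" and ?N = "amp_bound R \<mu> k" and ?I = "{\<gamma> :: 'n multiindex. mi_abs \<gamma> \<le> d}"
  have p_eq: "?p = symbol_taylor d a \<xi> (\<lambda>_. 0)" by (rule ext) (simp add: symbol_taylor_zero)
  have sst: "smooth_on \<Omega> (symbol_taylor d a \<xi> \<gamma>)" for \<gamma> by (rule symbol_taylor_smooth[OF \<Omega> a])
  have sp: "smooth_on \<Omega> ?p" unfolding p_eq by (rule sst)
  have \<mu>1: "\<mu> \<ge> 1" unfolding \<mu> using \<xi> \<delta> by (simp add: ge_one_powr_ge_zero)
  have "1 \<le> 4 * C + 2" using C by linarith
  also have "\<dots> \<le> (4 * C + 2) * A" using mult_left_mono[of 1 A "4 * C + 2"] C by simp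
  also have "\<dots> \<le> R" by (rule R)
  finally have R1: "R \<ge> 1" .
  have R2: "R * \<mu> \<ge> (4 * C + 2) * (A * \<mu>)" using mult_right_mono[OF R, of \<mu>] \<mu>1 by (simp add: mult.assoc)
  have "2 * (A * \<mu>) \<le> (4 * C + 2) * (A * \<mu>)" using C \<mu>1 by (intro mult_right_mono) auto
  also note R2
  finally have R3: "R * \<mu> \<ge> 2 * (A * \<mu>)" .
  have xpos: "norm \<xi> > 0" using \<xi> by linarith
  have pK: "?p x \<noteq> 0" if "x \<in> K" for x
    using low[OF that] xpos by (metis mult_zero_right norm_zero not_le powr_gt_zero less_numeral_extra(3))
  \<comment> \<open>Outside \<open>K\<close> the symbol may vanish; quotients are only formed on \<open>U\<close>
    and extended by zero from \<open>K\<close>.\<close>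
  define U where "U = {x \<in> \<Omega>. ?p x \<noteq> 0}"
  have U: "open U" 
  proof -
    have "open (\<Omega> \<inter> ?p -` (- {0}))"
      by (rule continuous_open_preimage[OF smooth_on_continuous_on[OF sp] \<Omega>]) auto
    moreover have "\<Omega> \<inter> ?p -` (- {0}) = U" by (auto simp: U_def)
    ultimately show ?thesis by simp
  qed
  have KU: "K \<subseteq> U" using pK K by (auto simp: U_def)
  have UO: "U \<subseteq> \<Omega>" by (auto simp: U_def)
  have ys: "smooth_on UNIV y" and y0: "\<And>x. x \<notin> K \<Longrightarrow> y x = 0" and yb: "\<And>x is. x \<in> K \<Longrightarrow> norm (partials is y x) \<le> B * ?N (length is)"
    using y by (auto simp: amplitude_def)
  define z where "z x = y x / ?p x" for x
  have z0: "z x = 0" if "x \<notin> K" for x using y0[OF that] by (simp add: z_def)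
  have zU: "smooth_on U z" unfolding z_def
    by (rule smooth_on_divide[OF U smooth_on_subset[OF ys subset_UNIV] smooth_on_subset[OF sp UO]]) (simp add: U_def)
  have zs: "smooth_on UNIV z" by (rule smooth_on_UNIV_of_supp[OF zU compact_imp_closed[OF K(1)] KU z0])
  have Npos: "?N n \<ge> 0" for n using R1 \<mu>1 by (intro amp_bound_growth(2)) auto
  have zb: "norm (partials is z x) \<le> 2 * (B * ?N (length is) / norm (?p x))" if x: "x \<in> K" for x "is"
  proof (rule partials_divide_analytic_bound[where U = U and p = ?p and q = y and C = C and A = "A * \<mu>" and R = "R * \<mu>" and N = "\<lambda>n. B * ?N n / norm (?p x)"])
    show "open U" "x \<in> U" "smooth_on U ?p" "smooth_on U z" "?p x \<noteq> 0" "C \<ge> 0" "A * \<mu> > 0" "R * \<mu> \<ge> (4 * C + 2) * (A * \<mu>)"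
      using U KU x smooth_on_subset[OF sp UO] zU pK C \<mu>1 R2 by auto
    show "?p w * z w = y w" if "w \<in> U" for w using that by (simp add: z_def U_def)
    show "norm (partials js ?p x) \<le> C * (A * \<mu>) ^ length js * fact (length js) * norm (?p x)" for js
      using st[OF x, of js "\<lambda>_. 0"] xpos unfolding p_eq[symmetric] by (simp add: mi_abs_def mult.assoc mult.left_commute mult.commute)
    show "norm (partials js y x) \<le> B * ?N (length js) / norm (?p x) * norm (?p x)" for js
      using yb[OF x, of js] pK[OF x] by simp
    show "R * \<mu> * real (Suc n) * (B * ?N n / norm (?p x)) \<le> B * ?N (Suc n) / norm (?p x)" for n
    proof -
      have "B * ((R * \<mu>) * real (Suc n) * ?N n) / norm (?p x) \<le> B * ?N (Suc n) / norm (?p x)"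
        using amp_bound_growth(1)[of R \<mu> n k] R1 \<mu>1 B by (intro divide_right_mono mult_left_mono) auto
      then show ?thesis by (simp only: mult.assoc mult.left_commute times_divide_eq_right)
    qed
    show "0 \<le> B * ?N n / norm (?p x)" for n using B Npos by simp
  qed
  have pinv: "1 / norm (?p x) \<le> C * norm \<xi> powr (- d')" if "x \<in> K" for x
  proof -
    have "norm (?p x) > 0" using pK[OF that] by simp
    moreover have "norm \<xi> powr d' > 0" using xpos by simp
    ultimately show ?thesis using low[OF that] by (simp add: powr_minus field_simps)
  qed
  have zamp: "amplitude K R \<mu> k (2 * C * norm \<xi> powr (- d') * B) z"
    unfolding amplitude_def
  proof (intro conjI allI impI ballI)
    fix x "is" assume x: "x \<in> K"
    have "norm (partials is z x) \<le> (2 * B * ?N (length is)) * (1 / norm (?p x))" using zb[OF x, of "is"] by simp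
    also have "\<dots> \<le> (2 * B * ?N (length is)) * (C * norm \<xi> powr (- d'))"
      using B Npos by (intro mult_left_mono pinv x) auto
    finally show "norm (partials is z x) \<le> 2 * C * norm \<xi> powr (- d') * B * ?N (length is)"
      by (simp add: mult.assoc mult.left_commute mult.commute)
  qed (use zs z0 in auto)
  have ztest: "(\<lambda>x. osc \<xi> x * z x) \<in> test_functions \<Omega>" by (rule amplitude_test[OF \<Omega> K zamp])
  let ?T = "transpose_op d a (\<lambda>x. osc \<xi> x * z x)"
  have Tt: "?T \<in> test_functions \<Omega>" "supp ?T \<subseteq> supp (\<lambda>x. osc \<xi> x * z x)"
    using a by (auto intro!: transpose_op_test[OF \<Omega> ztest])
  \<comment> \<open>The remainder is defined by the identity it has to satisfy; its expansion is derived on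
    \<open>U\<close> below.\<close>
  define s where "s x = y x - cis (x \<bullet> \<xi>) * ?T x" for x
  have T0: "?T x = 0" if "x \<notin> K" for x
  proof -
    have "supp (\<lambda>x. osc \<xi> x * z x) \<subseteq> K" by (rule supp_minimal) (use z0 K compact_imp_closed in auto)
    then show ?thesis using Tt(2) that not_in_supp[of x ?T] by blast
  qed
  have s0: "s x = 0" if "x \<notin> K" for x using T0[OF that] y0[OF that] by (simp add: s_def)
  have cx: "cis (x \<bullet> \<xi>) = osc (- \<xi>) x" for x by simp
  have ss: "smooth_on UNIV s"
    unfolding s_def cx by (intro smooth_on_diff smooth_on_mult smooth_on_osc ys test_functionsD(1)[OF Tt(1)] open_UNIV)
  have id: "osc \<xi> x * y x = ?T x + osc \<xi> x * s x" for x
  proof -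
    have "osc \<xi> x * cis (x \<bullet> \<xi>) = 1" by (simp add: cis_mult)
    then show ?thesis by (simp add: s_def right_diff_distrib flip: mult.assoc)
  qed
  let ?v = "\<lambda>\<gamma> x. symbol_taylor d a \<xi> \<gamma> x * z x"
  \<comment> \<open>The term of order zero reproduces \<open>y\<close>, so only proper derivatives of the symbol
    remain.\<close>
  let ?J = "?I - {\<lambda>_. 0}"
  have sv: "smooth_on U (?v \<gamma>)" for \<gamma> by (intro smooth_on_mult U zU smooth_on_subset[OF sst UO])
  have s_eq: "s x = (\<Sum>\<gamma>\<in>?J. (- (\<i> ^ mi_abs \<gamma>)) * partials (mi_list \<gamma>) (?v \<gamma>) x)" if x: "x \<in> U" for x
  proof -
    have fin: "finite ?I" by (rule finite_mi_le)
    have m0: "mi_abs (\<lambda>_::'n. 0) = 0" by (simp add: mi_abs_def)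
    then have "mi_list (\<lambda>_::'n. 0) = []" using length_mi_list[of "\<lambda>_::'n. 0"] by simp
    then have v0: "\<i> ^ mi_abs (\<lambda>_::'n. 0) * partials (mi_list (\<lambda>_. 0)) (?v (\<lambda>_. 0)) x = y x"
      using x m0 by (simp add: symbol_taylor_zero z_def U_def)
    have "cis (x \<bullet> \<xi>) * ?T x = (\<Sum>\<gamma>\<in>?I. \<i> ^ mi_abs \<gamma> * partials (mi_list \<gamma>) (?v \<gamma>) x)"
    proof -
      have "?T x = osc \<xi> x * (\<Sum>\<gamma>\<in>?I. \<i> ^ mi_abs \<gamma> * partials (mi_list \<gamma>) (?v \<gamma>) x)"
        by (rule transpose_op_osc[OF U x zU]) (rule smooth_on_subset[OF a UO])
      moreover have "cis (x \<bullet> \<xi>) * osc \<xi> x = 1" by (simp add: cis_mult)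
      ultimately show ?thesis by (simp flip: mult.assoc)
    qed
    also have "\<dots> = y x + (\<Sum>\<gamma>\<in>?J. \<i> ^ mi_abs \<gamma> * partials (mi_list \<gamma>) (?v \<gamma>) x)"
      using sum.remove[OF fin, of "\<lambda>_. 0" "\<lambda>\<gamma>. \<i> ^ mi_abs \<gamma> * partials (mi_list \<gamma>) (?v \<gamma>) x"] v0 m0 by simp
    finally show ?thesis by (simp add: s_def sum_negf)
  qed
  let ?G = "4 * C * A ^ d * norm \<xi> powr (- (\<rho> - \<delta>)) * B"
  have tbound: "norm (partials is (\<lambda>x. (- (\<i> ^ mi_abs \<gamma>)) * partials (mi_list \<gamma>) (?v \<gamma>) x) x) \<le> ?G * amp_bound R \<mu> (k + d) (length is)"
    if x: "x \<in> K" and \<gamma>: "\<gamma> \<in> ?J" for x \<gamma> "is"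
  proof -
    let ?g = "mi_abs \<gamma>" let ?c = "C * A ^ ?g * norm \<xi> powr (- \<rho> * real ?g) * norm (?p x)"
    have xU: "x \<in> U" using x KU by blast
    have gd: "?g \<le> d" using \<gamma> by simp
    have g1: "1 \<le> ?g"
    proof (rule ccontr)
      assume "\<not> 1 \<le> ?g"
      then have "\<gamma> i = 0" for i using mi_abs_ge[of \<gamma> i] by linarith
      then have "\<gamma> = (\<lambda>_. 0)" by (simp add: fun_eq_iff)
      then show False using \<gamma> by simp
    qed
    have "partials is (\<lambda>x. (- (\<i> ^ ?g)) * partials (mi_list \<gamma>) (?v \<gamma>) x) x = (- (\<i> ^ ?g)) * partials is (partials (mi_list \<gamma>) (?v \<gamma>)) x"
      by (rule partials_cmult[OF U smooth_on_partials[OF sv] xU])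
    then have "norm (partials is (\<lambda>x. (- (\<i> ^ ?g)) * partials (mi_list \<gamma>) (?v \<gamma>) x) x) = norm (partials (is @ mi_list \<gamma>) (?v \<gamma>) x)"
      by (simp add: norm_mult norm_power)
    also have "\<dots> \<le> 2 * ?c * (2 * (B * ?N (length (is @ mi_list \<gamma>)) / norm (?p x)))"
    proof (rule partials_mult_analytic_bound[where U = U and N = "\<lambda>n. 2 * (B * ?N n / norm (?p x))" and A = "A * \<mu>" and R = "R * \<mu>" and C = ?c])
      show "open U" "x \<in> U" "smooth_on U (symbol_taylor d a \<xi> \<gamma>)" "smooth_on U z" "A * \<mu> \<ge> 0" "R * \<mu> > 0" "R * \<mu> \<ge> 2 * (A * \<mu>)" "?c \<ge> 0"
        using U xU smooth_on_subset[OF sst UO] zU C \<mu>1 R1 R3 by auto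
      show "norm (partials js (symbol_taylor d a \<xi> \<gamma>) x) \<le> ?c * (A * \<mu>) ^ length js * fact (length js)" for js
        by (rule st[OF x])
      show "norm (partials js z x) \<le> 2 * (B * ?N (length js) / norm (?p x))" for js by (rule zb[OF x])
      show "R * \<mu> * real (Suc n) * (2 * (B * ?N n / norm (?p x))) \<le> 2 * (B * ?N (Suc n) / norm (?p x))" for n
      proof -
        have "2 * (B * ((R * \<mu>) * real (Suc n) * ?N n) / norm (?p x)) \<le> 2 * (B * ?N (Suc n) / norm (?p x))"
          using amp_bound_growth(1)[of R \<mu> n k] R1 \<mu>1 B by (intro divide_right_mono mult_left_mono) auto
        then show ?thesis by (simp only: mult.assoc mult.left_commute times_divide_eq_right)
      qed
      show "0 \<le> 2 * (B * ?N n / norm (?p x))" for n using B Npos by simp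
    qed
    also have "\<dots> = 4 * C * A ^ ?g * norm \<xi> powr (- \<rho> * real ?g) * B * ?N (length is + ?g)"
      using pK[OF x] by (simp add: length_mi_list)
    also have "\<dots> = 4 * C * A ^ ?g * (norm \<xi> powr (- \<rho> * real ?g) * \<mu> ^ ?g) * B * amp_bound R \<mu> (k + ?g) (length is)"
      unfolding amp_bound_shift by simp
    also have "norm \<xi> powr (- \<rho> * real ?g) * \<mu> ^ ?g = norm \<xi> powr (- ((\<rho> - \<delta>) * real ?g))"
    proof -
      have "\<mu> ^ ?g = norm \<xi> powr (\<delta> * real ?g)" unfolding \<mu> by (rule powr_nat_power[OF xpos])
      then show ?thesis by (simp add: powr_add[symmetric] algebra_simps)
    qed
    also have "4 * C * A ^ ?g * norm \<xi> powr (- ((\<rho> - \<delta>) * real ?g)) * B * amp_bound R \<mu> (k + ?g) (length is)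
      \<le> 4 * C * A ^ d * norm \<xi> powr (- (\<rho> - \<delta>)) * B * amp_bound R \<mu> (k + d) (length is)"
    proof (intro mult_mono)
      show "A ^ ?g \<le> A ^ d" using C gd by (intro power_increasing) auto
      have "(\<rho> - \<delta>) * 1 \<le> (\<rho> - \<delta>) * real ?g" using \<delta> g1 by (intro mult_left_mono) auto
      then show "norm \<xi> powr (- ((\<rho> - \<delta>) * real ?g)) \<le> norm \<xi> powr (- (\<rho> - \<delta>))" using \<xi> by (intro powr_mono) auto
      show "amp_bound R \<mu> (k + ?g) (length is) \<le> amp_bound R \<mu> (k + d) (length is)" using R1 \<mu>1 gd by (intro amp_bound_mono) auto
    qed (use C B R1 \<mu>1 in \<open>auto intro!: mult_nonneg_nonneg amp_bound_growth(2)\<close>)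
    finally show ?thesis .
  qed
  have Gpos: "0 \<le> ?G * amp_bound R \<mu> (k + d) n" for n
    using C B R1 \<mu>1 by (intro mult_nonneg_nonneg amp_bound_growth(2)) auto
  have samp: "amplitude K R \<mu> (k + d) (4 * C * A ^ d * real (card ?I) * norm \<xi> powr (- (\<rho> - \<delta>)) * B) s"
    unfolding amplitude_def
  proof (intro conjI allI impI ballI)
    fix x "is" assume x: "x \<in> K"
    then have xU: "x \<in> U" using KU by blast
    have "partials is s x = partials is (\<lambda>x. \<Sum>\<gamma>\<in>?J. (- (\<i> ^ mi_abs \<gamma>)) * partials (mi_list \<gamma>) (?v \<gamma>) x) x"
      by (rule partials_cong_open[OF U s_eq xU])
    also have "\<dots> = (\<Sum>\<gamma>\<in>?J. partials is (\<lambda>x. (- (\<i> ^ mi_abs \<gamma>)) * partials (mi_list \<gamma>) (?v \<gamma>) x) x)"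
      by (rule partials_sum[OF U smooth_on_cmult[OF U smooth_on_partials[OF sv]] xU])
    finally have "norm (partials is s x) \<le> (\<Sum>\<gamma>\<in>?J. ?G * amp_bound R \<mu> (k + d) (length is))"
      using tbound[OF x] by (simp only:) (rule sum_norm_le)
    also have "\<dots> \<le> (\<Sum>\<gamma>\<in>?I. ?G * amp_bound R \<mu> (k + d) (length is))"
      by (rule sum_mono2[OF finite_mi_le]) (use Gpos in auto)
    also have "\<dots> = 4 * C * A ^ d * real (card ?I) * norm \<xi> powr (- (\<rho> - \<delta>)) * B * amp_bound R \<mu> (k + d) (length is)"
      by (simp add: mult.assoc mult.left_commute mult.commute)
    finally show "norm (partials is s x) \<le> 4 * C * A ^ d * real (card ?I) * norm \<xi> powr (- (\<rho> - \<delta>)) * B * amp_bound R \<mu> (k + d) (length is)" .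
  qed (use ss s0 in auto)
  show ?thesis using zamp samp id by blast
qed

text \<open>Iterating the step: in each of \<open>m\<close> rounds the term with \<open>z\<close> moves one power of
  the operator onto the distribution, and the term with \<open>s\<close> stays, while both gain \<open>|\<xi>|^(-
  \<epsilon>)\<close>. After \<open>m\<close> rounds only the order-zero estimates for the first \<open>m\<close>
  iterates are used. Both branches are kept in one induction by bounding them with the sum of the norms of all
  iterates up to \<open>m\<close>.\<close>

lemma amplitude_pairing_decay:
  fixes a :: "'n::finite multiindex \<Rightarrow> real ^ 'n \<Rightarrow> complex"
  assumes \<Omega>: "open \<Omega>" and K: "compact K" "K \<subseteq> \<Omega>" and a: "\<And>\<alpha>. mi_abs \<alpha> \<le> d \<Longrightarrow> smooth_on \<Omega> (a \<alpha>)"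
    and \<xi>: "norm \<xi> \<ge> 1" and C: "C \<ge> 1" "A \<ge> 1" and \<mu>: "\<mu> = norm \<xi> powr \<delta>" and \<delta>: "0 \<le> \<delta>" "\<delta> < \<rho>"
    and low: "\<And>x. x \<in> K \<Longrightarrow> norm \<xi> powr d' \<le> C * norm (pdo_symbol d a x \<xi>)"
    and st: "\<And>x \<gamma> is. x \<in> K \<Longrightarrow> norm (partials is (symbol_taylor d a \<xi> \<gamma>) x)
       \<le> (C * A ^ mi_abs \<gamma> * norm \<xi> powr (- \<rho> * real (mi_abs \<gamma>)) * norm (pdo_symbol d a x \<xi>)) * (A * \<mu>) ^ length is * fact (length is)"
    and R: "R \<ge> (4 * C + 2) * A" and g: "\<And>j. g j \<in> L1_loc \<Omega>"
    and gP: "\<And>j \<phi>. \<phi> \<in> test_functions \<Omega> \<Longrightarrow> pairing \<Omega> (g (Suc j)) \<phi> = pairing \<Omega> (g j) (transpose_op d a \<phi>)"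
    and \<epsilon>: "\<epsilon> \<le> d'" "\<epsilon> \<le> \<rho> - \<delta>" and E: "E = 2 * C + 4 * C * A ^ d * real (card {\<gamma> :: 'n multiindex. mi_abs \<gamma> \<le> d})"
    and y: "amplitude K R \<mu> k B y" and B: "B \<ge> 0"
  shows "norm (pairing \<Omega> (g j) (\<lambda>x. osc \<xi> x * y x)) \<le>
     (E * norm \<xi> powr (- \<epsilon>)) ^ m * B * (R ^ (k + d * m) * (fact (k + d * m))\<^sup>2) * (\<Sum>i\<le>m. set_lebesgue_integral lebesgue K (\<lambda>x. norm (g (j + i) x)))"
  using y B
proof (induction m arbitrary: j k B y)
  case 0
  have t: "(\<lambda>x. osc \<xi> x * y x) \<in> test_functions \<Omega>" by (rule amplitude_test[OF \<Omega> K 0(1)])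
  have "norm (pairing \<Omega> (g j) (\<lambda>x. osc \<xi> x * y x)) \<le> (B * amp_bound R \<mu> k 0) * set_lebesgue_integral lebesgue K (\<lambda>x. norm (g j x))"
  proof (rule pairing_bound[OF g t K])
    have "(4 * C + 2) * A \<ge> 0" using C by simp
    then have "R \<ge> 0" using R by linarith
    then show "B * amp_bound R \<mu> k 0 \<ge> 0" using 0(2) by (simp add: amp_bound_def)
    show "norm (osc \<xi> x * y x) \<le> B * amp_bound R \<mu> k 0" if "x \<in> K" for x
      using 0(1) that unfolding amplitude_def by (auto simp: norm_mult dest!: bspec[of _ _ x] spec[of _ "[]"])
    show "osc \<xi> x * y x = 0" if "x \<notin> K" for x using 0(1) that by (simp add: amplitude_def)
  qed
  then show ?case by (simp add: amp_bound_def)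
next
  case (Suc m)
  let ?S = "\<lambda>j m. \<Sum>i\<le>m. set_lebesgue_integral lebesgue K (\<lambda>x. norm (g (j + i) x))"
  let ?card = "real (card {\<gamma> :: 'n multiindex. mi_abs \<gamma> \<le> d})" let ?e = "norm \<xi> powr (- \<epsilon>)"
  have "\<exists>z s. amplitude K R \<mu> k (2 * C * norm \<xi> powr (- d') * B) z \<and>
     amplitude K R \<mu> (k + d) (4 * C * A ^ d * ?card * norm \<xi> powr (- (\<rho> - \<delta>)) * B) s \<and>
     (\<forall>x. osc \<xi> x * y x = transpose_op d a (\<lambda>x. osc \<xi> x * z x) x + osc \<xi> x * s x)"
    by (rule amplitude_step[OF \<Omega> K a \<xi> C \<mu> \<delta> low st R Suc.prems])
  then obtain z s where z: "amplitude K R \<mu> k (2 * C * norm \<xi> powr (- d') * B) z"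
    and s: "amplitude K R \<mu> (k + d) (4 * C * A ^ d * ?card * norm \<xi> powr (- (\<rho> - \<delta>)) * B) s"
    and id: "\<And>x. osc \<xi> x * y x = transpose_op d a (\<lambda>x. osc \<xi> x * z x) x + osc \<xi> x * s x"
    by blast
  have "1 \<le> 4 * C + 2" using C by linarith
  also have "\<dots> \<le> (4 * C + 2) * A" using mult_left_mono[of 1 A "4 * C + 2"] C by simp
  also have "\<dots> \<le> R" by (rule R)
  finally have R1: "R \<ge> 1" .
  have zt: "(\<lambda>x. osc \<xi> x * z x) \<in> test_functions \<Omega>" by (rule amplitude_test[OF \<Omega> K z])
  have stt: "(\<lambda>x. osc \<xi> x * s x) \<in> test_functions \<Omega>" by (rule amplitude_test[OF \<Omega> K s])
  have Gn: "set_lebesgue_integral lebesgue K (\<lambda>x. norm (g j x)) \<ge> 0" for j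
    unfolding set_lebesgue_integral_def by (rule Bochner_Integration.integral_nonneg) (simp add: indicator_def)
  have Sn: "?S j m \<ge> 0" for j m by (intro sum_nonneg Gn)
  have E0: "E * ?e \<ge> 0" unfolding E using C by simp
  have X: "R ^ (k + d * m) * (fact (k + d * m))\<^sup>2 \<le> R ^ (k + d * Suc m) * (fact (k + d * Suc m) :: real)\<^sup>2"
    using R1 by (intro mult_mono power_mono power_increasing fact_mono) auto
  let ?X = "R ^ (k + d * Suc m) * (fact (k + d * Suc m) :: real)\<^sup>2"
  have X0: "?X \<ge> 0" and X1: "R ^ (k + d * m) * (fact (k + d * m))\<^sup>2 \<ge> 0" using R1 by simp_all
  have mono4: "u * c1 * X1 * S1 \<le> u * c2 * X2 * S2"
    if "0 \<le> u" "0 \<le> c1" "c1 \<le> c2" "0 \<le> X1" "X1 \<le> X2" "0 \<le> S1" "S1 \<le> S2" for u c1 c2 X1 X2 S1 S2 :: real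
    using that by (intro mult_mono mult_nonneg_nonneg) auto
  have pm: "norm \<xi> powr (- d') \<le> ?e" "norm \<xi> powr (- (\<rho> - \<delta>)) \<le> ?e" using \<xi> \<epsilon> by (auto intro!: powr_mono)
  \<comment> \<open>The transposed operator in the first term is moved onto \<open>g j\<close>, which becomes
    \<open>g (Suc j)\<close>.\<close>
  have "pairing \<Omega> (g j) (\<lambda>x. osc \<xi> x * y x) = pairing \<Omega> (g j) (transpose_op d a (\<lambda>x. osc \<xi> x * z x)) + pairing \<Omega> (g j) (\<lambda>x. osc \<xi> x * s x)"
    unfolding id by (rule pairing_add[OF g transpose_op_test(1)[OF \<Omega> zt a] stt])
  also have "\<dots> = pairing \<Omega> (g (Suc j)) (\<lambda>x. osc \<xi> x * z x) + pairing \<Omega> (g j) (\<lambda>x. osc \<xi> x * s x)" using gP[OF zt] by simp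
  finally have "norm (pairing \<Omega> (g j) (\<lambda>x. osc \<xi> x * y x)) \<le> norm (pairing \<Omega> (g (Suc j)) (\<lambda>x. osc \<xi> x * z x)) + norm (pairing \<Omega> (g j) (\<lambda>x. osc \<xi> x * s x))"
    by (simp add: norm_triangle_ineq)
  also have "\<dots> \<le> (E * ?e) ^ m * (2 * C * ?e * B) * ?X * ?S j (Suc m) + (E * ?e) ^ m * (4 * C * A ^ d * ?card * ?e * B) * ?X * ?S j (Suc m)"
  proof (rule add_mono)
    have "norm (pairing \<Omega> (g (Suc j)) (\<lambda>x. osc \<xi> x * z x)) \<le> (E * ?e) ^ m * (2 * C * norm \<xi> powr (- d') * B) * (R ^ (k + d * m) * (fact (k + d * m))\<^sup>2) * ?S (Suc j) m"
      by (rule Suc.IH[OF z]) (use C Suc.prems in simp)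
    also have "\<dots> \<le> (E * ?e) ^ m * (2 * C * ?e * B) * ?X * ?S j (Suc m)"
    proof (rule mono4)
      show "0 \<le> ?S (Suc j) m" by (rule Sn)
      show "0 \<le> R ^ (k + d * m) * (fact (k + d * m))\<^sup>2" by (rule X1)
      show "R ^ (k + d * m) * (fact (k + d * m))\<^sup>2 \<le> ?X" by (rule X)
      have "?S j (Suc m) = set_lebesgue_integral lebesgue K (\<lambda>x. norm (g (j + 0) x)) + ?S (Suc j) m"
        by (subst sum.atMost_Suc_shift) simp
      then show "?S (Suc j) m \<le> ?S j (Suc m)" using Gn[of "j + 0"] by linarith
      show "2 * C * norm \<xi> powr (- d') * B \<le> 2 * C * ?e * B" using pm C Suc.prems by (intro mult_right_mono mult_left_mono) auto
    qed (use C Suc.prems in \<open>auto intro!: mult_nonneg_nonneg zero_le_power E0 X X1 Sn\<close>)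
    finally show "norm (pairing \<Omega> (g (Suc j)) (\<lambda>x. osc \<xi> x * z x)) \<le> (E * ?e) ^ m * (2 * C * ?e * B) * ?X * ?S j (Suc m)" .
    have "norm (pairing \<Omega> (g j) (\<lambda>x. osc \<xi> x * s x)) \<le> (E * ?e) ^ m * (4 * C * A ^ d * ?card * norm \<xi> powr (- (\<rho> - \<delta>)) * B) * (R ^ (k + d + d * m) * (fact (k + d + d * m))\<^sup>2) * ?S j m"
      by (rule Suc.IH[OF s]) (use C Suc.prems in simp)
    also have "k + d + d * m = k + d * Suc m" by simp
    also have "(E * ?e) ^ m * (4 * C * A ^ d * ?card * norm \<xi> powr (- (\<rho> - \<delta>)) * B) * ?X * ?S j m \<le> (E * ?e) ^ m * (4 * C * A ^ d * ?card * ?e * B) * ?X * ?S j (Suc m)"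
    proof (rule mono4)
      show "?S j m \<le> ?S j (Suc m)" using Gn[of "j + Suc m"] by simp
      show "4 * C * A ^ d * ?card * norm \<xi> powr (- (\<rho> - \<delta>)) * B \<le> 4 * C * A ^ d * ?card * ?e * B"
        using pm C Suc.prems by (intro mult_right_mono mult_left_mono) auto
      show "0 \<le> ?X" by (rule X0)
      show "0 \<le> ?S j m" by (rule Sn)
    qed (use C Suc.prems in \<open>auto intro!: mult_nonneg_nonneg zero_le_power E0\<close>)
    finally show "norm (pairing \<Omega> (g j) (\<lambda>x. osc \<xi> x * s x)) \<le> (E * ?e) ^ m * (4 * C * A ^ d * ?card * ?e * B) * ?X * ?S j (Suc m)" .
  qed
  also have "\<dots> = (E * ?e) ^ Suc m * B * ?X * ?S j (Suc m)"
  proof -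
    have "u * (2 * C * e * B) * X * T + u * (4 * C * A ^ d * ?card * e * B) * X * T = (u * (E * e)) * B * X * T" for u e X T :: real
      unfolding E by (simp add: distrib_left distrib_right mult.assoc mult.left_commute mult.commute)
    then show ?thesis by (simp only: power_Suc2)
  qed
  finally show ?case .
qed

section \<open>Smoothness of solutions with integrable iterates\<close>

lemma relatively_compact_nbhd:
  fixes K :: "(real ^ 'n::finite) set"
  assumes "compact K" "K \<subseteq> \<Omega>" "open \<Omega>"
  shows "\<exists>V. open V \<and> K \<subseteq> V \<and> compact (closure V) \<and> closure V \<subseteq> \<Omega>"
proof -
  obtain \<eta> W where \<eta>: "gevrey2 \<eta>" "compact (supp \<eta>)" "supp \<eta> \<subseteq> \<Omega>" "open W" "K \<subseteq> W" "\<And>x. x \<in> W \<Longrightarrow> \<eta> x = 1"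
    using gevrey2_cutoff[OF assms] by blast
  have "W \<subseteq> supp \<eta>" using \<eta>(6) not_in_supp[of _ \<eta>] by (metis one_neq_zero subsetI)
  then have c: "closure W \<subseteq> supp \<eta>" by (rule closure_minimal) (rule closed_supp)
  have "compact (closure W)" using compact_Int_closed[OF \<eta>(2), of "closure W"] c by (simp add: Int_absorb1)
  then show ?thesis using \<eta> c by blast
qed

text \<open>Fubini's theorem is applied over the Borel sigma-algebra, so a Lebesgue integrable function is replaced by
  an equivalent Borel function, with equality only claimed for integrals.\<close>

lemma borel_representative:
  fixes f :: "real ^ 'n::finite \<Rightarrow> complex"
  assumes f: "integrable lebesgue f"
  shows "\<exists>v. integrable lborel v \<and> (\<forall>\<phi>\<in>borel_measurable borel. (\<integral>x. f x * \<phi> x \<partial>lebesgue) = (\<integral>x. v x * \<phi> x \<partial>lborel))"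
proof -
  have fm: "f \<in> borel_measurable lebesgue" using f by auto
  then have "(\<lambda>x. Re (f x)) \<in> borel_measurable lebesgue" "(\<lambda>x. Im (f x)) \<in> borel_measurable lebesgue" by measurable
  note rep = this[THEN completion_ex_borel_measurable_real]
  obtain g1 where g1: "g1 \<in> borel_measurable lborel" "AE x in lborel. Re (f x) = g1 x" by (rule bexE[OF rep(1)]) (rule that)
  obtain g2 where g2: "g2 \<in> borel_measurable lborel" "AE x in lborel. Im (f x) = g2 x" by (rule bexE[OF rep(2)]) (rule that)
  note g = g1 g2
  define v where "v = (\<lambda>x. of_real (g1 x) + \<i> * of_real (g2 x) :: complex)"
  have vm: "v \<in> borel_measurable lborel" unfolding v_def using g(1,3) by measurable
  have vm': "v \<in> borel_measurable lebesgue" by (rule measurable_completion[OF vm])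
  have "AE x in lborel. f x = v x" using g(2,4) by eventually_elim (simp add: v_def complex_eq_iff)
  then have ae: "AE x in lebesgue. f x = v x" by (rule AE_completion)
  show ?thesis
  proof (intro exI[of _ v] conjI ballI)
    have "integrable lebesgue v"
      using integrable_cong_AE[THEN iffD1, OF fm vm' ae f] .
    then show "integrable lborel v" using integrable_completion[OF vm] by blast
    fix \<phi> :: "real ^ 'n \<Rightarrow> complex" assume \<phi>: "\<phi> \<in> borel_measurable borel"
    then have pl: "\<phi> \<in> borel_measurable lborel" by simp
    then have pm: "\<phi> \<in> borel_measurable lebesgue" by (rule measurable_completion)
    have vp: "(\<lambda>x. v x * \<phi> x) \<in> borel_measurable lborel" using vm pl by measurable
    have "(\<integral>x. f x * \<phi> x \<partial>lebesgue) = (\<integral>x. v x * \<phi> x \<partial>lebesgue)"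
      by (rule Bochner_Integration.integral_cong_AE)
        (use fm vm' pm ae in \<open>auto intro!: borel_measurable_times\<close>)
    also have "\<dots> = (\<integral>x. v x * \<phi> x \<partial>lborel)" by (rule integral_completion[OF vp])
    finally show "(\<integral>x. f x * \<phi> x \<partial>lebesgue) = (\<integral>x. v x * \<phi> x \<partial>lborel)" .
  qed
qed

text \<open>Rapid decay of the Fourier transform makes the inverse transform a smooth representative, with bounds for
  its derivatives read off from the decay.\<close>

lemma fourier_decay_smooth:
  fixes v :: "real ^ 'n::finite \<Rightarrow> complex"
  assumes v: "integrable lborel v" and W: "integrable lborel W"
    and N: "\<And>l \<xi>. norm \<xi> ^ l * norm (fourier v \<xi>) \<le> N l * W \<xi>"
  shows "\<exists>h. smooth_on UNIV h \<and> (\<forall>is x. norm (partials is h x) \<le> N (length is) * (\<integral>\<xi>. W \<xi> \<partial>lborel)) \<and>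
    (\<forall>\<phi>\<in>test_functions UNIV. (\<integral>x. v x * \<phi> x \<partial>lborel) = (\<integral>x. h x * \<phi> x \<partial>lborel))"
proof -
  let ?c = "of_real (1 / (2 * pi) ^ CARD('n)) :: complex"
  let ?g = "\<lambda>x. \<integral>\<xi>. fourier v \<xi> * cis (x \<bullet> \<xi>) \<partial>lborel"
  have vb: "v \<in> borel_measurable borel" using v by auto
  have fm: "fourier v \<in> borel_measurable borel"
    using fourier_kernel_measurable[OF vb, of "-1"] by (simp add: fourier_def[abs_def])
  have int: "integrable lborel (\<lambda>\<xi>. of_real (norm \<xi> ^ m) * fourier v \<xi>)" for m
  proof (rule Bochner_Integration.integrable_bound)
    show "integrable lborel (\<lambda>\<xi>. N m * W \<xi>)" using W by simp
    show "(\<lambda>\<xi>. of_real (norm \<xi> ^ m) * fourier v \<xi>) \<in> borel_measurable lborel" using fm by measurable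
    show "AE \<xi> in lborel. norm (of_real (norm \<xi> ^ m) * fourier v \<xi>) \<le> norm (N m * W \<xi>)"
    proof (rule AE_I2)
      fix \<xi> show "norm (of_real (norm \<xi> ^ m) * fourier v \<xi>) \<le> norm (N m * W \<xi>)"
        using order_trans[OF N[of \<xi> m] abs_ge_self] by (simp add: norm_mult norm_power)
    qed
  qed
  have sg: "smooth_on UNIV ?g" and bg: "norm (partials is ?g x) \<le> (\<integral>\<xi>. norm \<xi> ^ length is * norm (fourier v \<xi>) \<partial>lborel)" for "is" x
    using inverse_fourier_partials[of "fourier v", OF int] by blast+
  have c1: "norm ?c \<le> 1"
  proof -
    have "1 \<le> (2 * pi) ^ CARD('n)" using pi_ge_two by (intro one_le_power) linarith
    then show ?thesis by (simp add: norm_divide norm_power norm_mult)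
  qed
  show ?thesis
  proof (intro exI[of _ "\<lambda>x. ?c * ?g x"] conjI allI ballI)
    show "smooth_on UNIV (\<lambda>x. ?c * ?g x)" using sg by (intro smooth_on_cmult) auto
    fix "is" :: "'n list" and x
    have "partials is (\<lambda>x. ?c * ?g x) x = ?c * partials is ?g x" by (rule partials_cmult[OF open_UNIV sg]) simp
    then have "norm (partials is (\<lambda>x. ?c * ?g x) x) = norm ?c * norm (partials is ?g x)" by (simp only: norm_mult)
    also have "\<dots> \<le> 1 * norm (partials is ?g x)" by (rule mult_right_mono[OF c1]) simp
    also have "\<dots> \<le> (\<integral>\<xi>. norm \<xi> ^ length is * norm (fourier v \<xi>) \<partial>lborel)" using bg by simp
    also have "\<dots> \<le> (\<integral>\<xi>. N (length is) * W \<xi> \<partial>lborel)"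
    proof (rule integral_mono)
      show "integrable lborel (\<lambda>\<xi>. norm \<xi> ^ length is * norm (fourier v \<xi>))"
        using integrable_norm[OF int[of "length is"]] by (simp add: norm_mult norm_power)
      show "integrable lborel (\<lambda>\<xi>. N (length is) * W \<xi>)" using W by simp
    qed (rule N)
    also have "\<dots> = N (length is) * (\<integral>\<xi>. W \<xi> \<partial>lborel)" by simp
    finally show "norm (partials is (\<lambda>x. ?c * ?g x) x) \<le> N (length is) * (\<integral>\<xi>. W \<xi> \<partial>lborel)" .
  next
    fix \<phi> :: "real ^ 'n \<Rightarrow> complex" assume \<phi>: "\<phi> \<in> test_functions UNIV"
    have c: "continuous_on UNIV \<phi>" using smooth_on_continuous_on[OF test_functionsD(1)[OF \<phi>]] .
    obtain B where B: "\<And>x. norm (\<phi> x) \<le> B" using test_function_bounded[OF \<phi>] by blast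
    have fi: "integrable lborel (fourier v)" using int[of 0] by simp
    have pi: "integrable lborel \<phi>" by (rule test_function_integrable[OF \<phi>])
    have "(\<integral>x. v x * \<phi> x \<partial>lborel) = (\<integral>x. \<phi> x * (of_real (1 / (2 * pi) ^ DIM(real ^ 'n)) * ?g x) \<partial>lborel)"
      by (rule fourier_inversion_weak[OF v fi pi c B])
    then show "(\<integral>x. v x * \<phi> x \<partial>lborel) = (\<integral>x. (?c * ?g x) * \<phi> x \<partial>lborel)"
      by (simp add: mult.commute)
  qed
qed

text \<open>The Fourier transform of the localised representative is its pairing with \<open>osc \<eta>\<close>. For a
  derivative of order \<open>l\<close> one needs decay of order \<open>l + 2n\<close>, which
  \<open>amplitude_pairing_decay\<close> gives after a number \<open>m = q0 (l + 1)\<close> of rounds proportional to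
  the order; this is where the bounds come to involve the iterates up to a multiple of \<open>l + 1\<close>. Small
  frequencies are covered by the trivial estimate.\<close>

lemma local_regularity:
  fixes a :: "'n::finite multiindex \<Rightarrow> real ^ 'n \<Rightarrow> complex"
  assumes \<Omega>: "open \<Omega>" and a: "a \<in> class_A \<Omega> d d' \<rho> \<delta>" and \<delta>: "0 \<le> \<delta>" "\<delta> < \<rho>" and d': "d' > 0"
    and K: "compact K" "K \<subseteq> \<Omega>" and g: "\<And>j. g j \<in> L1_loc \<Omega>"
    and gP: "\<And>j \<phi>. \<phi> \<in> test_functions \<Omega> \<Longrightarrow> pairing \<Omega> (g (Suc j)) \<phi> = pairing \<Omega> (g j) (transpose_op d a \<phi>)"
  shows "\<exists>K1 W h D q. compact K1 \<and> K1 \<subseteq> \<Omega> \<and> open W \<and> K \<subseteq> W \<and> smooth_on UNIV h \<and> D \<ge> 1 \<and>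
    (\<forall>\<phi>\<in>test_functions \<Omega>. supp \<phi> \<subseteq> W \<longrightarrow> pairing \<Omega> (g 0) \<phi> = pairing \<Omega> h \<phi>) \<and>
    (\<forall>is x. norm (partials is h x) \<le> D ^ Suc (length is) * (fact (q * Suc (length is)))\<^sup>2 *
       (\<Sum>i\<le>q * Suc (length is). set_lebesgue_integral lebesgue K1 (\<lambda>x. norm (g i x))))"
proof -
  let ?n = "CARD('n)"
  obtain \<eta> V where \<eta>: "gevrey2 \<eta>" "compact (supp \<eta>)" "supp \<eta> \<subseteq> \<Omega>" "open V" "K \<subseteq> V" "\<And>x. x \<in> V \<Longrightarrow> \<eta> x = 1"
    using gevrey2_cutoff[OF K \<Omega>] by blast
  define K1 where "K1 = supp \<eta>"
  have K1: "compact K1" "K1 \<subseteq> \<Omega>" using \<eta> by (simp_all add: K1_def)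
  obtain Y where Y: "Y \<ge> 1" "\<And>is x. norm (partials is \<eta> x) \<le> Y ^ Suc (length is) * (fact (length is))\<^sup>2"
    using \<eta>(1) unfolding gevrey2_def by blast
  have s\<eta>: "smooth_on UNIV \<eta>" using \<eta>(1) by (simp add: gevrey2_def)
  have \<eta>1: "norm (\<eta> x) \<le> Y" for x using Y(2)[of "[]" x] by simp
  have \<eta>0: "\<eta> x = 0" if "x \<notin> K1" for x using that not_in_supp by (simp add: K1_def)
  obtain C A M where C: "C \<ge> 1" "A \<ge> 1" "M \<ge> 1"
    and low: "\<And>x \<xi>. x \<in> K1 \<Longrightarrow> norm \<xi> \<ge> M \<Longrightarrow> norm \<xi> powr d' \<le> C * norm (pdo_symbol d a x \<xi>)"
    and st: "\<And>x \<xi> \<gamma> is. x \<in> K1 \<Longrightarrow> norm \<xi> \<ge> M \<Longrightarrow> norm (partials is (symbol_taylor d a \<xi> \<gamma>) x)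
       \<le> (C * A ^ mi_abs \<gamma> * norm \<xi> powr (- \<rho> * real (mi_abs \<gamma>)) * norm (pdo_symbol d a x \<xi>)) * (A * norm \<xi> powr \<delta>) ^ length is * fact (length is)"
    using class_A_bounds[OF a \<Omega> K1] by blast
  \<comment> \<open>\<open>R\<close> has to serve both the inversion and the cutoff function, the amplitude of the
    first round.\<close>
  define R where "R = max ((4 * C + 2) * A) Y"
  have R: "R \<ge> (4 * C + 2) * A" "R \<ge> Y" by (simp_all add: R_def)
  have R1: "R \<ge> 1" using R(2) Y(1) by linarith
  define \<epsilon> where "\<epsilon> = min d' (\<rho> - \<delta>)"
  have \<epsilon>: "\<epsilon> > 0" "\<epsilon> \<le> d'" "\<epsilon> \<le> \<rho> - \<delta>" using \<delta> d' by (simp_all add: \<epsilon>_def)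
  define E where "E = 2 * C + 4 * C * A ^ d * real (card {\<gamma> :: 'n multiindex. mi_abs \<gamma> \<le> d})"
  have "4 * C * A ^ d * real (card {\<gamma> :: 'n multiindex. mi_abs \<gamma> \<le> d}) \<ge> 0" using C by simp
  then have E1: "E \<ge> 1" using C unfolding E_def by linarith
  \<comment> \<open>After \<open>q0 (l + 1)\<close> rounds the gain \<open>|\<xi>|^(- \<epsilon> q0 (l + 1))\<close>
    beats \<open>|\<xi>|^(l + 2n)\<close>, as needed for a derivative of order \<open>l\<close> and for
    integrability.\<close>
  define q0 where "q0 = nat \<lceil>(2 * real ?n + 1) / \<epsilon>\<rceil>"
  have "(2 * real ?n + 1) / \<epsilon> \<le> real q0" unfolding q0_def by (rule real_nat_ceiling_ge)
  then have q0: "2 * real ?n + 1 \<le> \<epsilon> * real q0" using \<epsilon>(1) by (simp add: field_simps)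
  let ?W = "\<lambda>x::real ^ 'n. \<Prod>b\<in>Basis. 1 / (1 + (x \<bullet> b)\<^sup>2)"
  define W where "W = ?W"
  have W: "integrable lborel W" "\<And>x. W x > 0" "\<And>x. norm x \<ge> 1 \<Longrightarrow> 1 / norm x ^ (2 * ?n) \<le> 2 ^ ?n * W x"
    "\<And>x. norm x \<le> M \<Longrightarrow> 1 \<le> (2 * M\<^sup>2) ^ ?n * W x"
    unfolding W_def using integrable_inverse_norm_power C(3) by blast+
  define G where "G i = set_lebesgue_integral lebesgue K1 (\<lambda>x. norm (g i x))" for i
  have G0: "G i \<ge> 0" for i
    unfolding G_def set_lebesgue_integral_def by (rule Bochner_Integration.integral_nonneg) (simp add: indicator_def)
  define S where "S l = (\<Sum>i\<le>q0 * Suc l. G i)" for l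
  have S0: "S l \<ge> 0" for l unfolding S_def by (intro sum_nonneg G0)
  have \<eta>t: "\<eta> \<in> test_functions \<Omega>" by (rule test_functionI(1)[OF s\<eta> K1 \<eta>0])
  \<comment> \<open>The cutoff is included before passing to a Borel representative, to have an integrable function
    on the whole space.\<close>
  let ?u = "\<lambda>x. indicator \<Omega> x *\<^sub>R (g 0 x * \<eta> x)"
  have "integrable lebesgue ?u" using pairing_integrable[OF g \<eta>t, of 0] by (simp add: set_integrable_def)
  then obtain v where v: "integrable lborel v"
    and vp: "\<And>\<phi>. \<phi> \<in> borel_measurable borel \<Longrightarrow> (\<integral>x. ?u x * \<phi> x \<partial>lebesgue) = (\<integral>x. v x * \<phi> x \<partial>lborel)"
    using borel_representative by blast
  have v_pairing: "(\<integral>x. v x * \<phi> x \<partial>lborel) = pairing \<Omega> (g 0) (\<lambda>x. \<phi> x * \<eta> x)" if "\<phi> \<in> borel_measurable borel" for \<phi>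
    unfolding vp[OF that, symmetric] set_lebesgue_integral_def by (simp add: mult.assoc mult.left_commute mult.commute)
  have four: "fourier v \<xi> = pairing \<Omega> (g 0) (\<lambda>x. osc \<xi> x * \<eta> x)" for \<xi>
  proof -
    have "osc \<xi> \<in> borel_measurable borel"
      using smooth_on_continuous_on[OF smooth_on_osc[of UNIV \<xi>]] borel_measurable_continuous_onI by blast
    from v_pairing[OF this] show ?thesis by (simp add: fourier_def)
  qed
  have osct: "(\<lambda>x. osc \<xi> x * \<eta> x) \<in> test_functions \<Omega>" for \<xi>
    by (rule test_functionI(1)[OF _ K1]) (use s\<eta> \<eta>0 in \<open>auto intro!: smooth_on_mult smooth_on_osc\<close>)
  have small: "norm (fourier v \<xi>) \<le> Y * G 0" for \<xi>
    unfolding four G_def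
    by (rule pairing_bound[OF g osct K1]) (use \<eta>0 \<eta>1 Y(1) in \<open>auto simp: norm_mult\<close>)
  have large: "norm (fourier v \<xi>) \<le> (E * norm \<xi> powr (- \<epsilon>)) ^ m * Y * (R ^ (d * m) * (fact (d * m))\<^sup>2) * (\<Sum>i\<le>m. G i)"
    if \<xi>: "norm \<xi> \<ge> M" for \<xi> m
  proof -
    let ?\<mu> = "norm \<xi> powr \<delta>"
    have \<xi>1: "norm \<xi> \<ge> 1" using \<xi> C(3) by linarith
    have \<mu>1: "?\<mu> \<ge> 1" using \<xi>1 \<delta>(1) by (rule ge_one_powr_ge_zero)
    have amp: "amplitude K1 R ?\<mu> 0 Y \<eta>"
      unfolding amplitude_def amp_bound_def
    proof (intro conjI allI ballI impI)
      fix x and "is" :: "'n list"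
      have "Y ^ Suc (length is) * (fact (length is))\<^sup>2 = Y * (Y ^ length is * (fact (length is))\<^sup>2)" by simp
      also have "\<dots> \<le> Y * ((?\<mu> ^ length is * R ^ length is) * (fact (length is))\<^sup>2)"
      proof (intro mult_left_mono mult_right_mono)
        have "1 * Y ^ length is \<le> ?\<mu> ^ length is * R ^ length is"
          using Y(1) R \<mu>1 by (intro mult_mono power_mono one_le_power) auto
        then show "Y ^ length is \<le> ?\<mu> ^ length is * R ^ length is" by simp
      qed (use Y in auto)
      finally show "norm (partials is \<eta> x) \<le> Y * (?\<mu> ^ length is * R ^ (length is + 0) * (fact (length is + 0))\<^sup>2)"
        using Y(2)[of "is" x] by simp
    qed (use s\<eta> \<eta>0 in auto)
    have "norm (pairing \<Omega> (g 0) (\<lambda>x. osc \<xi> x * \<eta> x)) \<le>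
     (E * norm \<xi> powr (- \<epsilon>)) ^ m * Y * (R ^ (0 + d * m) * (fact (0 + d * m))\<^sup>2) * (\<Sum>i\<le>m. set_lebesgue_integral lebesgue K1 (\<lambda>x. norm (g (0 + i) x)))"
    proof (rule amplitude_pairing_decay[where a = a and d = d and \<Omega> = \<Omega> and g = g and K = K1 and \<xi> = \<xi> and C = C and A = A
          and \<mu> = ?\<mu> and \<delta> = \<delta> and \<rho> = \<rho> and d' = d' and R = R and \<epsilon> = \<epsilon> and E = E and k = 0 and B = Y and y = \<eta> and j = 0 and m = m])
      show "smooth_on \<Omega> (a \<alpha>)" if "mi_abs \<alpha> \<le> d" for \<alpha> by (rule class_A_smooth[OF a that])
      show "norm \<xi> powr d' \<le> C * norm (pdo_symbol d a x \<xi>)" if "x \<in> K1" for x by (rule low[OF that \<xi>])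
      show "norm (partials is (symbol_taylor d a \<xi> \<gamma>) x)
       \<le> (C * A ^ mi_abs \<gamma> * norm \<xi> powr (- \<rho> * real (mi_abs \<gamma>)) * norm (pdo_symbol d a x \<xi>)) * (A * ?\<mu>) ^ length is * fact (length is)"
        if "x \<in> K1" for x \<gamma> "is" by (rule st[OF that \<xi>])
      show "Y \<ge> 0" using Y(1) by simp
    qed (rule \<Omega> K1 \<xi>1 C(1) C(2) refl \<delta> R(1) g gP \<epsilon>(2) \<epsilon>(3) E_def amp | assumption)+
    then show ?thesis by (simp add: four G_def)
  qed
  let ?T = "Y * (2 * M\<^sup>2) ^ ?n * 2 ^ ?n"
  \<comment> \<open>The largest of the constants from the two frequency ranges, so that one bound holds for all
    frequencies.\<close>
  define X where "X l = M ^ l * E ^ (q0 * Suc l) * R ^ (d * (q0 * Suc l)) * (fact (d * (q0 * Suc l)))\<^sup>2" for l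
  have X0: "X l \<ge> 0" for l unfolding X_def using C(3) E1 R1 by (intro mult_nonneg_nonneg) auto
  define N where "N l = ?T * X l * S l" for l
  have M2: "1 \<le> 2 * M\<^sup>2" using one_le_power[OF C(3), of 2] by linarith
  have M2n: "1 \<le> (2 * M\<^sup>2) ^ ?n" by (rule one_le_power[OF M2])
  have T1: "?T \<ge> 1" using mult_mono[OF mult_mono[OF Y(1) M2n] one_le_power[of "2::real" ?n]] Y(1) M2 by simp
  have YT: "Y \<le> ?T" "Y * (2 * M\<^sup>2) ^ ?n \<le> ?T" "Y * 2 ^ ?n \<le> ?T"
  proof -
    have "Y * 1 * 1 \<le> ?T" using M2n Y(1) by (intro mult_mono mult_nonneg_nonneg) auto
    then show "Y \<le> ?T" by simp
    have "Y * (2 * M\<^sup>2) ^ ?n * 1 \<le> ?T" using M2n Y(1) by (intro mult_mono mult_nonneg_nonneg) auto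
    then show "Y * (2 * M\<^sup>2) ^ ?n \<le> ?T" by simp
    have "Y * 1 * 2 ^ ?n \<le> ?T" using M2n Y(1) by (intro mult_mono mult_nonneg_nonneg) auto
    then show "Y * 2 ^ ?n \<le> ?T" by simp
  qed
  have fact1: "1 \<le> (fact k :: real)\<^sup>2" for k by (rule one_le_power) (rule fact_ge_1)
  have N: "norm \<xi> ^ l * norm (fourier v \<xi>) \<le> N l * W \<xi>" for l \<xi>
  proof (cases "norm \<xi> \<ge> M")
    case False
    then have \<xi>: "norm \<xi> \<le> M" by simp
    have "M ^ l * 1 * 1 * 1 \<le> X l"
      unfolding X_def using C(3) E1 R1 fact1 by (intro mult_mono mult_nonneg_nonneg one_le_power) auto
    then have MX: "M ^ l \<le> X l" by simp
    have GS: "G 0 \<le> S l" unfolding S_def using G0 by (intro member_le_sum) auto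
    have "norm \<xi> ^ l * norm (fourier v \<xi>) \<le> M ^ l * (Y * G 0)"
      using \<xi> small[of \<xi>] C(3) by (intro mult_mono power_mono) auto
    also have "\<dots> \<le> X l * (Y * S l)" using MX GS C(3) Y(1) G0[of 0] X0[of l] by (intro mult_mono mult_nonneg_nonneg) auto
    also have "\<dots> \<le> X l * (Y * S l) * ((2 * M\<^sup>2) ^ ?n * W \<xi>)"
    proof -
      have "X l * (Y * S l) * 1 \<le> X l * (Y * S l) * ((2 * M\<^sup>2) ^ ?n * W \<xi>)"
      proof (rule mult_left_mono[OF W(4)[OF \<xi>]])
        show "0 \<le> X l * (Y * S l)" using X0[of l] Y(1) S0[of l] by (intro mult_nonneg_nonneg) linarith+
      qed
      then show ?thesis by simp
    qed
    also have "\<dots> = (Y * (2 * M\<^sup>2) ^ ?n) * (X l * S l * W \<xi>)" by (simp only: mult.assoc mult.left_commute mult.commute)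
    also have "\<dots> \<le> ?T * (X l * S l * W \<xi>)"
    proof (rule mult_right_mono[OF YT(2)])
      show "0 \<le> X l * S l * W \<xi>" using X0[of l] S0[of l] W(2)[of \<xi>] by (intro mult_nonneg_nonneg) linarith+
    qed
    finally show ?thesis by (simp only: N_def mult.assoc)
  next
    case True
    let ?m = "q0 * Suc l" let ?r = "norm \<xi>"
    have r1: "?r \<ge> 1" using True C(3) by linarith
    have r0: "?r > 0" using r1 by linarith
    let ?Z = "E ^ ?m * R ^ (d * ?m) * (fact (d * ?m))\<^sup>2"
    have Z0: "?Z \<ge> 0" using E1 R1 by simp
    have pw: "?r ^ l * (?r powr (- \<epsilon>)) ^ ?m \<le> 1 / ?r ^ (2 * ?n)"
    proof -
      have "2 * real ?n + real l \<le> (2 * real ?n + 1) * real (Suc l)" by (simp add: algebra_simps)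
      also have "\<dots> \<le> \<epsilon> * real q0 * real (Suc l)" by (rule mult_right_mono[OF q0]) simp
      finally have le: "2 * real ?n + real l \<le> \<epsilon> * real ?m" by (simp only: of_nat_mult mult.assoc)
      have "?r ^ l * (?r powr (- \<epsilon>)) ^ ?m = ?r powr (real l + - \<epsilon> * real ?m)"
        using powr_nat_power[OF r0, of "- \<epsilon>" ?m] r0 by (simp only: powr_add powr_realpow)
      also have "\<dots> \<le> ?r powr (- real (2 * ?n))" using le by (intro powr_mono[OF _ r1]) simp
      also have "\<dots> = 1 / ?r ^ (2 * ?n)" using r0 by (simp only: powr_minus powr_realpow inverse_eq_divide)
      finally show ?thesis .
    qed
    have "?r ^ l * norm (fourier v \<xi>) \<le> ?r ^ l * ((E * ?r powr (- \<epsilon>)) ^ ?m * Y * (R ^ (d * ?m) * (fact (d * ?m))\<^sup>2) * (\<Sum>i\<le>?m. G i))"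
      by (rule mult_left_mono[OF large[OF True]]) simp
    also have "\<dots> = (?r ^ l * (?r powr (- \<epsilon>)) ^ ?m) * (Y * (?Z * S l))"
      by (simp only: power_mult_distrib S_def mult.assoc mult.left_commute mult.commute)
    also have "\<dots> \<le> (2 ^ ?n * W \<xi>) * (Y * (?Z * S l))"
      by (rule mult_right_mono[OF order_trans[OF pw W(3)[OF r1]]]) (use Y(1) Z0 S0[of l] in \<open>auto intro!: mult_nonneg_nonneg\<close>)
    also have "\<dots> = (Y * 2 ^ ?n) * (1 * ?Z * S l * W \<xi>)" by (simp only: mult.assoc mult.left_commute mult.commute mult_1_left)
    also have "\<dots> \<le> ?T * (M ^ l * ?Z * S l * W \<xi>)"
    proof -
      have gen: "b * (1 * z * s * w) \<le> t * (p * z * s * w)" if "0 \<le> b" "b \<le> t" "1 \<le> p" "0 \<le> z" "0 \<le> s" "0 \<le> w" for b t p z s w :: real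
        using that by (intro mult_mono mult_nonneg_nonneg) auto
      show ?thesis by (rule gen[OF _ YT(3) one_le_power[OF C(3)] Z0 S0 less_imp_le[OF W(2)]]) (use Y(1) in simp)
    qed
    also have "\<dots> = N l * W \<xi>" by (simp only: N_def X_def mult.assoc mult.left_commute mult.commute)
    finally show ?thesis .
  qed
  obtain h where h: "smooth_on UNIV h" "\<And>is x. norm (partials is h x) \<le> N (length is) * (\<integral>\<xi>. W \<xi> \<partial>lborel)"
    "\<And>\<phi>. \<phi> \<in> test_functions UNIV \<Longrightarrow> (\<integral>x. v x * \<phi> x \<partial>lborel) = (\<integral>x. h x * \<phi> x \<partial>lborel)"
    using fourier_decay_smooth[OF v W(1) N] by blast
  define I where "I = (\<integral>\<xi>. W \<xi> \<partial>lborel)"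
  have I0: "I \<ge> 0" unfolding I_def by (rule Bochner_Integration.integral_nonneg) (rule less_imp_le[OF W(2)])
  define T where "T = ?T * (1 + I)"
  have T1': "T \<ge> 1" unfolding T_def using mult_mono[OF T1, of 1 "1 + I"] I0 T1 by simp
  define Q where "Q = M * E ^ q0 * R ^ (d * q0)"
  define q where "q = Suc d * q0"
  have Q1: "Q \<ge> 1"
  proof -
    have "1 * 1 * 1 \<le> Q" unfolding Q_def using C(3) E1 R1 by (intro mult_mono mult_nonneg_nonneg one_le_power) auto
    then show ?thesis by simp
  qed
  have fin: "norm (partials is h x) \<le> (T * Q) ^ Suc (length is) * (fact (q * Suc (length is)))\<^sup>2 * (\<Sum>i\<le>q * Suc (length is). G i)" for "is" x
  proof -
    let ?l = "length is"
    have "norm (partials is h x) \<le> N ?l * I" using h(2) by (simp add: I_def)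
    also have "\<dots> = (?T * I) * (X ?l * S ?l)" by (simp only: N_def mult.assoc mult.left_commute mult.commute)
    also have "\<dots> \<le> T ^ Suc ?l * ((Q ^ Suc ?l * (fact (q * Suc ?l))\<^sup>2) * (\<Sum>i\<le>q * Suc ?l. G i))"
    proof (rule mult_mono[OF _ mult_mono])
      have "?T * I \<le> T" unfolding T_def using T1 by (simp add: distrib_left)
      moreover have "T ^ 1 \<le> T ^ Suc ?l" by (rule power_increasing[OF _ T1']) simp
      ultimately show "?T * I \<le> T ^ Suc ?l" by simp
      have "X ?l \<le> (M ^ Suc ?l * E ^ (q0 * Suc ?l) * R ^ (d * (q0 * Suc ?l))) * (fact (q * Suc ?l))\<^sup>2"
        unfolding X_def
      proof (rule mult_mono)
        show "M ^ ?l * E ^ (q0 * Suc ?l) * R ^ (d * (q0 * Suc ?l)) \<le> M ^ Suc ?l * E ^ (q0 * Suc ?l) * R ^ (d * (q0 * Suc ?l))"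
          using C E1 R1 by (intro mult_right_mono power_increasing) auto
        have "d * (q0 * Suc ?l) \<le> q * Suc ?l" by (simp add: q_def algebra_simps)
        then show "(fact (d * (q0 * Suc ?l)) :: real)\<^sup>2 \<le> (fact (q * Suc ?l))\<^sup>2" by (intro power_mono fact_mono) auto
      qed (use C E1 R1 in auto)
      also have "M ^ Suc ?l * E ^ (q0 * Suc ?l) * R ^ (d * (q0 * Suc ?l)) = Q ^ Suc ?l"
        by (simp only: Q_def power_mult_distrib power_mult mult.assoc[symmetric])
      finally show "X ?l \<le> Q ^ Suc ?l * (fact (q * Suc ?l))\<^sup>2" .
      show "S ?l \<le> (\<Sum>i\<le>q * Suc ?l. G i)" unfolding S_def
        by (rule sum_mono2) (use G0 in \<open>auto simp: q_def algebra_simps\<close>)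
      show "0 \<le> X ?l * S ?l" by (rule mult_nonneg_nonneg[OF X0 S0])
    qed (use S0 T1' Q1 in auto)
    finally show ?thesis by (simp only: power_mult_distrib mult.assoc mult.left_commute mult.commute)
  qed
  have pair: "pairing \<Omega> (g 0) \<phi> = pairing \<Omega> h \<phi>" if \<phi>: "\<phi> \<in> test_functions \<Omega>" "supp \<phi> \<subseteq> V" for \<phi>
  proof -
    have b: "\<phi> \<in> borel_measurable borel" 
      using smooth_on_continuous_on[OF test_functionsD(1)[OF \<phi>(1)]] borel_measurable_continuous_onI by blast
    have hb: "h \<in> borel_measurable borel" 
      using smooth_on_continuous_on[OF h(1)] borel_measurable_continuous_onI by blast
    have "\<phi> x = \<phi> x * \<eta> x" for x using \<eta>(6)[of x] \<phi>(2) not_in_supp[of x \<phi>] by (cases "x \<in> V") auto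
    then have "pairing \<Omega> (g 0) \<phi> = pairing \<Omega> (g 0) (\<lambda>x. \<phi> x * \<eta> x)" by presburger
    also have "\<dots> = (\<integral>x. h x * \<phi> x \<partial>lborel)" using v_pairing[OF b] h(3)[OF test_function_UNIV[OF \<phi>(1)]] by simp
    also have "\<dots> = (\<integral>x. h x * \<phi> x \<partial>lebesgue)"
      by (rule integral_completion[symmetric]) (use b hb in auto)
    also have "\<dots> = pairing \<Omega> h \<phi>"
      unfolding set_lebesgue_integral_def
      by (rule Bochner_Integration.integral_cong) (use not_in_supp[of _ \<phi>] test_functionsD(3)[OF \<phi>(1)] in \<open>auto simp: indicator_def\<close>)
    finally show ?thesis .
  qed
  have TQ: "T * Q \<ge> 1" using mult_mono[OF T1' Q1] T1' by simp
  show ?thesis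
    by (rule exI[of _ K1], rule exI[of _ V], rule exI[of _ h], rule exI[of _ "T * Q"], rule exI[of _ q])
      (use K1 \<eta>(4,5) h(1) TQ pair fin[unfolded G_def] in blast)
qed

text \<open>Near a point where the functions differ, testing with a nonnegative cutoff and multiplying by the
  conjugate of the difference gives an integral with positive real part.\<close>

lemma smooth_eq_of_pairing:
  fixes f1 f2 :: "real ^ 'n::finite \<Rightarrow> complex"
  assumes U: "open U" "U \<subseteq> \<Omega>" and s: "smooth_on U f1" "smooth_on U f2"
    and p: "\<And>\<phi>. \<phi> \<in> test_functions \<Omega> \<Longrightarrow> supp \<phi> \<subseteq> U \<Longrightarrow> pairing \<Omega> f1 \<phi> = pairing \<Omega> f2 \<phi>"
    and x0: "x0 \<in> U"
  shows "f1 x0 = f2 x0"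
proof (rule ccontr)
  assume ne: "f1 x0 \<noteq> f2 x0"
  let ?n = "real CARD('n)"
  define c where "c = f1 x0 - f2 x0"
  \<comment> \<open>Multiplication by the conjugate of the difference at \<open>x0\<close> makes its real part
    positive near \<open>x0\<close>.\<close>
  define w where "w = (\<lambda>x. Re (cnj c * (f1 x - f2 x)))"
  have c0: "c \<noteq> 0" using ne by (simp add: c_def)
  have "cnj c * c = of_real ((norm c)\<^sup>2)" using complex_norm_square[of c] by (simp only: mult.commute)
  then have "w x0 = (norm c)\<^sup>2" unfolding w_def c_def[symmetric] by (simp only: Re_complex_of_real)
  then have w0: "w x0 > 0" using c0 by simp
  have wc: "continuous_on U w"
    unfolding w_def by (intro continuous_intros smooth_on_continuous_on[OF s(1)] smooth_on_continuous_on[OF s(2)])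
  then have "open (U \<inter> w -` {w x0 / 2<..})" by (intro continuous_open_preimage U(1)) auto
  moreover have "x0 \<in> U \<inter> w -` {w x0 / 2<..}" using x0 w0 by simp
  ultimately obtain e where e: "e > 0" "cball x0 e \<subseteq> U \<inter> w -` {w x0 / 2<..}" by (meson open_contains_cball)
  define r where "r = e / (2 * ?n)"
  have r: "r > 0" using e by (simp add: r_def)
  obtain \<eta> :: "real ^ 'n \<Rightarrow> real" where \<eta>: "gevrey2 (\<lambda>x. complex_of_real (\<eta> x))" "\<And>x. 0 \<le> \<eta> x"
    "\<And>x. (\<forall>i. \<bar>x $ i - x0 $ i\<bar> \<le> r) \<Longrightarrow> \<eta> x = 1" "\<And>x i. \<bar>x $ i - x0 $ i\<bar> \<ge> 2 * r \<Longrightarrow> \<eta> x = 0"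
    using gevrey2_cutoff_cube[OF r, of x0] by blast
  let ?K = "cball x0 e"
  let ?\<phi> = "\<lambda>x. complex_of_real (\<eta> x)"
  have out: "\<eta> x = 0" if "x \<notin> ?K" for x
  proof -
    have "\<exists>i. \<bar>x $ i - x0 $ i\<bar> \<ge> 2 * r"
    proof (rule ccontr)
      assume no: "\<not> ?thesis"
      have "\<bar>(x - x0) $ i\<bar> \<le> 2 * r" for i
      proof -
        have "\<not> 2 * r \<le> \<bar>x $ i - x0 $ i\<bar>" using no by blast
        then show ?thesis by simp
      qed
      then have "(\<Sum>i\<in>UNIV. \<bar>(x - x0) $ i\<bar>) \<le> ?n * (2 * r)" by (rule sum_bounded_above)
      then have "norm (x - x0) \<le> e" using norm_le_l1_cart[of "x - x0"] by (simp add: r_def)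
      then show False using that by (simp add: dist_norm norm_minus_commute)
    qed
    then show ?thesis using \<eta>(4) by blast
  qed
  have sm: "smooth_on UNIV ?\<phi>" using \<eta>(1) by (simp add: gevrey2_def)
  have KU: "?K \<subseteq> U" using e by blast
  have t: "?\<phi> \<in> test_functions \<Omega>" "supp ?\<phi> \<subseteq> ?K"
    using test_functionI[OF sm compact_cball, of x0 e \<Omega>] KU U(2) out by auto
  have fint: "integrable lebesgue (\<lambda>x. indicator ?K x *\<^sub>R (f x * ?\<phi> x))" if "smooth_on U f" for f
  proof -
    have "integrable lborel (\<lambda>x. indicator ?K x *\<^sub>R (f x * ?\<phi> x))"
      using continuous_on_subset[OF smooth_on_continuous_on[OF that] KU]
        continuous_on_subset[OF smooth_on_continuous_on[OF sm], of ?K]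
      by (intro borel_integrable_compact continuous_on_mult) auto
    then show ?thesis using integrable_completion[OF borel_measurable_integrable] by blast
  qed
  have pe: "pairing \<Omega> f ?\<phi> = (\<integral>x. indicator ?K x *\<^sub>R (f x * ?\<phi> x) \<partial>lebesgue)" for f
    unfolding set_lebesgue_integral_def
    by (rule Bochner_Integration.integral_cong) (use out KU U(2) in \<open>auto simp: indicator_def\<close>)
  let ?F = "\<lambda>x. indicator ?K x *\<^sub>R (f1 x * ?\<phi> x) - indicator ?K x *\<^sub>R (f2 x * ?\<phi> x)"
  have Fi: "integrable lebesgue ?F" using fint[OF s(1)] fint[OF s(2)] by (rule Bochner_Integration.integrable_diff)
  have "(\<integral>x. ?F x \<partial>lebesgue) = 0"
    using p[OF t(1)] t(2) KU fint[OF s(1)] fint[OF s(2)] by (simp add: pe)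
  then have "Re (\<integral>x. cnj c * ?F x \<partial>lebesgue) = 0" by simp
  then have z: "(\<integral>x. Re (cnj c * ?F x) \<partial>lebesgue) = 0"
    using integral_Re[OF integrable_mult_right[OF Fi, of "cnj c"]] by simp
  have cb: "emeasure lebesgue (ball x0 r) = ennreal (measure lborel (ball x0 r))" "measure lborel (ball x0 r) > 0"
    using content_ball_pos[OF r, of x0] emeasure_lborel_ball_finite[of x0 r] by (auto simp: emeasure_eq_ennreal_measure)
  have "0 < w x0 / 2 * measure lebesgue (ball x0 r)" using w0 content_ball_pos[OF r, of x0] by simp
  also have "\<dots> = (\<integral>x. indicator (ball x0 r) x * (w x0 / 2) \<partial>lebesgue)" by simp
  also have "\<dots> \<le> (\<integral>x. Re (cnj c * ?F x) \<partial>lebesgue)"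
  proof (rule Bochner_Integration.integral_mono)
    show "integrable lebesgue (\<lambda>x. indicator (ball x0 r) x * (w x0 / 2))"
      using emeasure_lborel_ball_finite[of x0 r] by (intro integrable_mult_left integrable_real_indicator) auto
    show "integrable lebesgue (\<lambda>x. Re (cnj c * ?F x))"
      by (intro integrable_Re integrable_mult_right Fi)
    fix x
    have Fw: "Re (cnj c * ?F x) = indicator ?K x * (w x * \<eta> x)"
      by (simp add: w_def indicator_def algebra_simps)
    show "indicator (ball x0 r) x * (w x0 / 2) \<le> Re (cnj c * ?F x)"
    proof (cases "x \<in> ball x0 r")
      case True
      have "\<bar>x $ i - x0 $ i\<bar> \<le> r" for i
        using component_le_norm_cart[of "x - x0" i] True by (simp add: dist_norm norm_minus_commute)
      then have 1: "\<eta> x = 1" using \<eta>(3) by blast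
      have "CARD('n) \<ge> 1" by (simp add: Suc_leI)
      then have "2 * ?n \<ge> 1" by linarith
      then have "r \<le> e" using e(1) unfolding r_def by (simp add: divide_le_eq mult_le_cancel_left1)
      then have "x \<in> ?K" using True by simp
      then show ?thesis unfolding Fw using 1 e(2) True by (auto simp: indicator_def)
    next
      case False
      have "w x \<ge> 0" if "x \<in> ?K" using e(2) w0 that by force
      then show ?thesis unfolding Fw using False \<eta>(2)[of x] by (simp add: indicator_def)
    qed
  qed
  finally show False using z by simp
qed

text \<open>An operator of order 0 has a symbol constant in \<open>\<xi>\<close>, which cannot dominate a positive
  power of \<open>|\<xi>|\<close>.\<close>

lemma class_A_order_pos:
  assumes a: "a \<in> class_A \<Omega> d d' \<rho> \<delta>" and d': "d' > 0"
  shows "d \<ge> 1"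
proof (rule ccontr)
  assume "\<not> d \<ge> 1"
  then have d0: "d = 0" by simp
  note a' = CollectD[OF a[unfolded class_A_def]]
  obtain x where x: "x \<in> \<Omega>" using conjunct1[OF a'] unfolding pdo_coeffs_def by blast
  have K: "compact {x}" "{x} \<subseteq> \<Omega>" using x by auto
  from mp[OF spec[OF conjunct2[OF conjunct2[OF a']], of "{x}"] conjI[OF K]]
  obtain C L where C: "C > 0" "L > 0" "\<forall>y\<in>{x}. \<forall>\<xi>. norm \<xi> \<ge> L \<longrightarrow> norm \<xi> powr d' \<le> C * norm (pdo_symbol d a y \<xi>)"
    by (elim exE conjE) (rule that)
  have z: "mi_power \<xi> \<alpha> = 1" if "mi_abs \<alpha> \<le> 0" for \<xi> and \<alpha> :: "'a multiindex"
  proof -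
    have "\<alpha> i = 0" for i using that by (simp add: mi_abs_def)
    then show ?thesis by (simp add: mi_power_def)
  qed
  define s where "s = (\<Sum>\<alpha> | mi_abs \<alpha> \<le> 0. a \<alpha> x)"
  have sy: "pdo_symbol d a x \<xi> = s" for \<xi> unfolding pdo_symbol_def s_def d0 by (rule sum.cong) (auto simp: z)
  \<comment> \<open>A frequency so large that its power \<open>d'\<close> exceeds the constant symbol.\<close>
  define t where "t = max L ((C * norm s + 1) powr (1 / d'))"
  have pos: "C * norm s + 1 > 0" using C(1) by (simp add: add_nonneg_pos)
  have t: "t \<ge> L" "t > 0" "t \<ge> (C * norm s + 1) powr (1 / d')" using C(2) by (auto simp: t_def)
  have "C * norm s + 1 = ((C * norm s + 1) powr (1 / d')) powr d'" using pos d' by (simp add: powr_powr)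
  also have "\<dots> \<le> t powr d'" using t(3) d' by (intro powr_mono2) auto
  also have "t powr d' = norm (t *\<^sub>R axis undefined (1::real) :: real ^ 'a) powr d'" using t(2) by (simp add: norm_axis_1)
  also have "\<dots> \<le> C * norm s"
    using C(3)[rule_format, of x "t *\<^sub>R axis undefined 1"] t unfolding sy by (simp add: norm_axis_1)
  finally show False by simp
qed

text \<open>The local representatives are determined by their pairings, so they agree where their domains meet and
  glue to one function.\<close>

lemma global_regularity:
  fixes a :: "'n::finite multiindex \<Rightarrow> real ^ 'n \<Rightarrow> complex"
  assumes \<Omega>: "open \<Omega>" and a: "a \<in> class_A \<Omega> d d' \<rho> \<delta>" and \<delta>: "0 \<le> \<delta>" "\<delta> < \<rho>" and d': "d' > 0"
    and g: "\<And>j. g j \<in> L1_loc \<Omega>"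
    and gP: "\<And>j \<phi>. \<phi> \<in> test_functions \<Omega> \<Longrightarrow> pairing \<Omega> (g (Suc j)) \<phi> = pairing \<Omega> (g j) (transpose_op d a \<phi>)"
  shows "\<exists>f. smooth_on \<Omega> f \<and> (\<forall>\<phi>\<in>test_functions \<Omega>. pairing \<Omega> (g 0) \<phi> = pairing \<Omega> f \<phi>) \<and>
    (\<forall>K. compact K \<and> K \<subseteq> \<Omega> \<longrightarrow> (\<exists>K1 D q. compact K1 \<and> K1 \<subseteq> \<Omega> \<and> D \<ge> 1 \<and>
      (\<forall>x\<in>K. \<forall>is. norm (partials is f x) \<le> D ^ Suc (length is) * (fact (q * Suc (length is)))\<^sup>2 *
       (\<Sum>i\<le>q * Suc (length is). set_lebesgue_integral lebesgue K1 (\<lambda>x. norm (g i x))))))"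
proof -
  define P where "P = (\<lambda>W h. open W \<and> smooth_on UNIV h \<and> (\<forall>\<phi>\<in>test_functions \<Omega>. supp \<phi> \<subseteq> W \<longrightarrow> pairing \<Omega> (g 0) \<phi> = pairing \<Omega> h \<phi>))"
  have PD: "open W" "smooth_on UNIV h" "\<And>\<phi>. \<phi> \<in> test_functions \<Omega> \<Longrightarrow> supp \<phi> \<subseteq> W \<Longrightarrow> pairing \<Omega> (g 0) \<phi> = pairing \<Omega> h \<phi>"
    if "P W h" for W h using that unfolding P_def by blast+
  have ex: "\<exists>K1 W h D q. compact K1 \<and> K1 \<subseteq> \<Omega> \<and> K \<subseteq> W \<and> P W h \<and> D \<ge> 1 \<and>
    (\<forall>is x. norm (partials is h x) \<le> D ^ Suc (length is) * (fact (q * Suc (length is)))\<^sup>2 *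
       (\<Sum>i\<le>q * Suc (length is). set_lebesgue_integral lebesgue K1 (\<lambda>x. norm (g i x))))"
    if K: "compact K" "K \<subseteq> \<Omega>" for K
  proof -
    have "\<exists>K1 W h D q. compact K1 \<and> K1 \<subseteq> \<Omega> \<and> open W \<and> K \<subseteq> W \<and> smooth_on UNIV h \<and> D \<ge> 1 \<and>
      (\<forall>\<phi>\<in>test_functions \<Omega>. supp \<phi> \<subseteq> W \<longrightarrow> pairing \<Omega> (g 0) \<phi> = pairing \<Omega> h \<phi>) \<and>
      (\<forall>is x. norm (partials is h x) \<le> D ^ Suc (length is) * (fact (q * Suc (length is)))\<^sup>2 *
         (\<Sum>i\<le>q * Suc (length is). set_lebesgue_integral lebesgue K1 (\<lambda>x. norm (g i x))))"
      by (rule local_regularity[where g = g, OF \<Omega> a \<delta> d' K g gP])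
    then obtain K1 W h D q where 1: "compact K1" "K1 \<subseteq> \<Omega>" "open W" "K \<subseteq> W" "smooth_on UNIV h" "D \<ge> 1"
      "\<forall>\<phi>\<in>test_functions \<Omega>. supp \<phi> \<subseteq> W \<longrightarrow> pairing \<Omega> (g 0) \<phi> = pairing \<Omega> h \<phi>"
      "\<forall>is x. norm (partials is h x) \<le> D ^ Suc (length is) * (fact (q * Suc (length is)))\<^sup>2 *
       (\<Sum>i\<le>q * Suc (length is). set_lebesgue_integral lebesgue K1 (\<lambda>x. norm (g i x)))"
      by (elim exE conjE) (rule that)
    have "P W h" using 1(3,5,7) by (simp only: P_def simp_thms)
    with 1 show ?thesis by (intro exI conjI)
  qed
  have "\<forall>x\<in>\<Omega>. \<exists>Wh. x \<in> fst Wh \<and> P (fst Wh) (snd Wh)"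
  proof
    fix x assume "x \<in> \<Omega>"
    then have "compact {x}" "{x} \<subseteq> \<Omega>" by auto
    from ex[OF this] obtain W h where "{x} \<subseteq> W" "P W h" by (elim exE conjE) (rule that)
    then show "\<exists>Wh. x \<in> fst Wh \<and> P (fst Wh) (snd Wh)" by (intro exI[of _ "(W, h)"]) simp
  qed
  then obtain c where c: "\<forall>x\<in>\<Omega>. x \<in> fst (c x) \<and> P (fst (c x)) (snd (c x))" by (rule exE[OF bchoice]) (rule that)
  \<comment> \<open>The value at \<open>x\<close> is taken from a local representative near \<open>x\<close>; it is
    the value of every local representative by uniqueness.\<close>
  define f where "f = (\<lambda>x. snd (c x) x)"
  have feq: "f y = h y" if p: "P W h" and y: "y \<in> W" "y \<in> \<Omega>" for W h y
  proof -
    have cy: "y \<in> fst (c y)" and pc: "P (fst (c y)) (snd (c y))" using c y(2) by auto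
    let ?U = "W \<inter> fst (c y) \<inter> \<Omega>"
    show ?thesis unfolding f_def
    proof (rule smooth_eq_of_pairing[where U = ?U and \<Omega> = \<Omega> and ?f1.0 = "snd (c y)" and ?f2.0 = h and ?x0.0 = y])
      show "open ?U" using PD(1)[OF p] PD(1)[OF pc] \<Omega> by (intro open_Int)
      show "smooth_on ?U (snd (c y))" "smooth_on ?U h"
        by (rule smooth_on_subset[OF PD(2)[OF pc] subset_UNIV], rule smooth_on_subset[OF PD(2)[OF p] subset_UNIV])
      show "pairing \<Omega> (snd (c y)) \<phi> = pairing \<Omega> h \<phi>" if "\<phi> \<in> test_functions \<Omega>" "supp \<phi> \<subseteq> ?U" for \<phi>
        using PD(3)[OF p that(1)] PD(3)[OF pc that(1)] that(2) by simp
    qed (use cy y in auto)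
  qed
  have part: "partials is f y = partials is h y" if p: "P W h" and y: "y \<in> W" "y \<in> \<Omega>" for W h y "is"
    by (rule partials_cong_open[of "W \<inter> \<Omega>"]) (use PD(1)[OF p] \<Omega> y feq[OF p] in auto)
  show ?thesis
  proof (intro exI[of _ f] conjI ballI allI impI)
    show "smooth_on \<Omega> f" unfolding smooth_on_def
    proof (intro allI ballI)
      fix "is" :: "'n list" and x assume x: "x \<in> \<Omega>"
      then have cx: "x \<in> fst (c x)" and pc: "P (fst (c x)) (snd (c x))" using c by auto
      have "smooth_on (fst (c x) \<inter> \<Omega>) f"
        by (rule smooth_on_cong[of _ "snd (c x)"])
          (use PD(1)[OF pc] \<Omega> feq[OF pc] smooth_on_subset[OF PD(2)[OF pc]] in auto)
      then show "partials is f differentiable (at x)" using cx x unfolding smooth_on_def by blast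
    qed
    fix \<phi> assume \<phi>: "\<phi> \<in> test_functions \<Omega>"
    note t = test_functionsD[OF \<phi>]
    from ex[OF t(2,3)] obtain W h where Wh: "supp \<phi> \<subseteq> W" "P W h" by (elim exE conjE) (rule that)
    have "h x * \<phi> x = f x * \<phi> x" if "x \<in> \<Omega>" for x
      using feq[OF Wh(2) _ that] Wh(1) not_in_supp[of x \<phi>] by (cases "x \<in> supp \<phi>") auto
    then have "pairing \<Omega> h \<phi> = pairing \<Omega> f \<phi>" unfolding set_lebesgue_integral_def
      by (intro Bochner_Integration.integral_cong) (auto simp: indicator_def)
    then show "pairing \<Omega> (g 0) \<phi> = pairing \<Omega> f \<phi>" using PD(3)[OF Wh(2) \<phi> Wh(1)] by simp
  next
    fix K assume "compact K \<and> K \<subseteq> \<Omega>"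
    then have K: "compact K" "K \<subseteq> \<Omega>" by auto
    from ex[OF K] obtain K1 W h D q where 1: "compact K1" "K1 \<subseteq> \<Omega>" "K \<subseteq> W" "P W h" "D \<ge> 1"
      "\<forall>is x. norm (partials is h x) \<le> D ^ Suc (length is) * (fact (q * Suc (length is)))\<^sup>2 *
       (\<Sum>i\<le>q * Suc (length is). set_lebesgue_integral lebesgue K1 (\<lambda>x. norm (g i x)))"
      by (elim exE conjE) (rule that)
    show "\<exists>K1 D q. compact K1 \<and> K1 \<subseteq> \<Omega> \<and> D \<ge> 1 \<and>
      (\<forall>x\<in>K. \<forall>is. norm (partials is f x) \<le> D ^ Suc (length is) * (fact (q * Suc (length is)))\<^sup>2 *
       (\<Sum>i\<le>q * Suc (length is). set_lebesgue_integral lebesgue K1 (\<lambda>x. norm (g i x))))"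
    proof (intro exI[of _ K1] exI[of _ D] exI[of _ q] conjI ballI allI 1(1) 1(2) 1(5))
      fix x "is" assume "x \<in> K"
      then have x: "x \<in> W" "x \<in> \<Omega>" using 1(3) K(2) by auto
      show "norm (partials is f x) \<le> D ^ Suc (length is) * (fact (q * Suc (length is)))\<^sup>2 *
       (\<Sum>i\<le>q * Suc (length is). set_lebesgue_integral lebesgue K1 (\<lambda>x. norm (g i x)))"
        unfolding part[OF 1(4) x] by (rule spec[OF spec[OF 1(6)]])
    qed
  qed
qed

section \<open>Iterates of the operator on smooth functions\<close>

text \<open>One application of the operator raises the order by at most \<open>d\<close> and, by Leibniz' rule with
  analytic coefficients, costs a constant and the growth of \<open>R^n n! N n\<close>, a sequence stable under such
  products.\<close>

lemma pdo_iterates_bound: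
  fixes a :: "'n::finite multiindex \<Rightarrow> real ^ 'n \<Rightarrow> complex"
  assumes \<Omega>: "open \<Omega>" and a: "\<And>\<alpha>. mi_abs \<alpha> \<le> d \<Longrightarrow> real_analytic_on \<Omega> (a \<alpha>)" and d: "d \<ge> 1"
    and K: "compact K" "K \<subseteq> \<Omega>" and f: "smooth_on \<Omega> f"
  shows "\<exists>D\<ge>1. \<forall>N. mono N \<longrightarrow> (\<forall>n. N n \<ge> 0) \<longrightarrow> (\<forall>x\<in>K. \<forall>is. norm (partials is f x) \<le> N (length is)) \<longrightarrow>
    (\<forall>k. \<forall>x\<in>K. norm ((pdo_fun d a ^^ k) f x) \<le> D ^ (d * k) * fact (d * k) * N (d * k))"
proof -
  let ?I = "{\<alpha> :: 'n multiindex. mi_abs \<alpha> \<le> d}"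
  note as = real_analytic_on_smooth[OF a]
  have "\<forall>\<alpha>\<in>?I. \<exists>A. A \<ge> 1 \<and> (\<forall>x\<in>K. \<forall>is. norm (partials is (a \<alpha>) x) \<le> A ^ Suc (length is) * fact (length is))"
  proof
    fix \<alpha> :: "'n multiindex" assume "\<alpha> \<in> ?I"
    then have "real_analytic_on \<Omega> (a \<alpha>)" using a by simp
    then show "\<exists>A. A \<ge> 1 \<and> (\<forall>x\<in>K. \<forall>is. norm (partials is (a \<alpha>) x) \<le> A ^ Suc (length is) * fact (length is))"
      by (rule real_analytic_on_bounds[OF _ K]) blast
  qed
  then obtain Af where Af: "\<forall>\<alpha>\<in>?I. Af \<alpha> \<ge> 1 \<and> (\<forall>x\<in>K. \<forall>is. norm (partials is (a \<alpha>) x) \<le> Af \<alpha> ^ Suc (length is) * fact (length is))"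
    by (rule exE[OF bchoice]) (rule that)
  \<comment> \<open>One radius for the finitely many coefficients.\<close>
  define A where "A = 1 + sum Af ?I"
  have Ale: "Af \<alpha> \<le> A" if "\<alpha> \<in> ?I" for \<alpha>
  proof -
    have "Af \<alpha> \<le> sum Af ?I" using that Af finite_mi_le by (intro member_le_sum) (auto intro: order_trans[of 0 1])
    then show ?thesis by (simp add: A_def)
  qed
  have "sum Af ?I \<ge> 0" using Af by (intro sum_nonneg) (auto intro: order_trans[of 0 1])
  then have A1: "A \<ge> 1" by (simp add: A_def)
  have Ab: "norm (partials is (a \<alpha>) x) \<le> A * A ^ length is * fact (length is)" if "\<alpha> \<in> ?I" "x \<in> K" for \<alpha> x "is"
  proof -
    have "norm (partials is (a \<alpha>) x) \<le> Af \<alpha> ^ Suc (length is) * fact (length is)" using Af that by blast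
    also have "\<dots> \<le> A ^ Suc (length is) * fact (length is)"
      using Ale[OF that(1)] Af that(1) by (intro mult_right_mono power_mono) (auto intro: order_trans[of 0 1])
    finally show ?thesis by simp
  qed
  define E where "E = 2 * A * real (card ?I)"
  have "card ?I > 0" using finite_mi_le[of d] by (subst card_gt_0_iff) (auto intro!: exI[of _ "\<lambda>_. 0"] simp: mi_abs_def)
  then have "1 \<le> real (card ?I)" by linarith
  then have E1: "E \<ge> 1" using mult_mono[of 1 "2 * A" 1 "real (card ?I)"] A1 by (simp add: E_def)
  define R where "R = 2 * A"
  have R: "R \<ge> 1" "R > 0" "R \<ge> 2 * A" using A1 by (simp_all add: R_def)
  have sm: "smooth_on \<Omega> ((pdo_fun d a ^^ k) f)" for k
    by (rule conjunct1, rule pdo_iterate_regular_dist[OF \<Omega> f], rule as)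
  have main: "norm (partials is ((pdo_fun d a ^^ k) f) x) \<le> E ^ k * (R ^ (length is + d * k) * fact (length is + d * k) * N (length is + d * k))"
    if N: "mono N" "\<forall>n. N n \<ge> 0" "\<forall>x\<in>K. \<forall>is. norm (partials is f x) \<le> N (length is)" and x: "x \<in> K" for N k x "is"
  proof (induction k arbitrary: "is")
    case 0
    have "norm (partials is f x) \<le> N (length is)" using N x by blast
    also have "1 * 1 * N (length is) \<le> R ^ length is * fact (length is) * N (length is)"
      using R N(2) by (intro mult_right_mono mult_mono one_le_power) auto
    finally show ?case by simp
  next
    case (Suc k)
    let ?F = "(pdo_fun d a ^^ k) f"
    have xO: "x \<in> \<Omega>" using x K by blast
    \<comment> \<open>The order is raised by the full \<open>d\<close> instead of \<open>|\<alpha>|\<close>, so that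
      one sequence bounds all terms of the operator.\<close>
    define G where "G n = E ^ k * (R ^ (n + d + d * k) * fact (n + d + d * k) * N (n + d + d * k))" for n
    have G0: "G n \<ge> 0" for n unfolding G_def using E1 R N(2) by (intro mult_nonneg_nonneg) auto
    have Gg: "G (Suc n) \<ge> R * real (Suc n) * G n" for n
    proof -
      let ?m = "n + d + d * k"
      have "R * real (Suc n) * G n = (E ^ k * R ^ Suc ?m) * ((real (Suc n) * fact ?m) * N ?m)"
        unfolding G_def by (simp only: power_Suc mult.assoc mult.left_commute mult.commute)
      also have "\<dots> \<le> (E ^ k * R ^ Suc ?m) * (fact (Suc ?m) * N (Suc ?m))"
      proof (intro mult_left_mono[OF mult_mono])
        show "real (Suc n) * fact ?m \<le> fact (Suc ?m)" unfolding fact_Suc by (intro mult_right_mono) auto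
        show "N ?m \<le> N (Suc ?m)" using N(1) by (rule monoD) simp
      qed (use E1 R N(2) in auto)
      also have "\<dots> = G (Suc n)" unfolding G_def by (simp only: add_Suc mult.assoc)
      finally show ?thesis .
    qed
    have tb: "norm (partials is (\<lambda>y. a \<alpha> y * partials (mi_list \<alpha>) ?F y) x) \<le> 2 * A * G (length is)" if \<alpha>: "\<alpha> \<in> ?I" for \<alpha>
    proof (rule partials_mult_analytic_bound[OF \<Omega> xO])
      show "smooth_on \<Omega> (a \<alpha>)" using as \<alpha> by simp
      show "smooth_on \<Omega> (partials (mi_list \<alpha>) ?F)" by (rule smooth_on_partials[OF sm])
      show "norm (partials js (a \<alpha>) x) \<le> A * A ^ length js * fact (length js)" for js by (rule Ab[OF \<alpha> x])
      fix js :: "'n list"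
      let ?l = "length js + mi_abs \<alpha> + d * k"
      have "norm (partials js (partials (mi_list \<alpha>) ?F) x) = norm (partials (js @ mi_list \<alpha>) ?F x)" by simp
      also have "\<dots> \<le> E ^ k * (R ^ ?l * fact ?l * N ?l)" using Suc.IH[of "js @ mi_list \<alpha>"] by (simp only: length_append length_mi_list)
      also have "\<dots> \<le> G (length js)" unfolding G_def
      proof (intro mult_left_mono mult_mono power_increasing fact_mono monoD[OF N(1)])
        show "?l \<le> length js + d + d * k" "?l \<le> length js + d + d * k" "?l \<le> length js + d + d * k" using \<alpha> by auto
      qed (use E1 R N(2) in auto)
      finally show "norm (partials js (partials (mi_list \<alpha>) ?F) x) \<le> G (length js)" .
    qed (use Gg G0 A1 R in auto)
    have st: "smooth_on \<Omega> (\<lambda>y. a \<alpha> y * partials (mi_list \<alpha>) ?F y)" if "\<alpha> \<in> ?I" for \<alpha>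
      using that by (intro smooth_on_mult[OF \<Omega>] as smooth_on_partials sm) auto
    have pf: "pdo_fun d a F = (\<lambda>x. \<Sum>\<alpha>\<in>?I. (- \<i>) ^ mi_abs \<alpha> * (a \<alpha> x * partials (mi_list \<alpha>) F x))" for F
      by (rule ext) (rule pdo_fun_def)
    have "partials is (pdo_fun d a ?F) x = (\<Sum>\<alpha>\<in>?I. (- \<i>) ^ mi_abs \<alpha> * partials is (\<lambda>y. a \<alpha> y * partials (mi_list \<alpha>) ?F y) x)"
      unfolding pf[of ?F]
      by (subst partials_sum[OF \<Omega> _ xO])
        (use st xO \<Omega> in \<open>auto intro!: sum.cong partials_cmult[OF \<Omega>] smooth_on_cmult[OF \<Omega>]\<close>)
    then have "norm (partials is ((pdo_fun d a ^^ Suc k) f) x) \<le> (\<Sum>\<alpha>\<in>?I. norm ((- \<i>) ^ mi_abs \<alpha> * partials is (\<lambda>y. a \<alpha> y * partials (mi_list \<alpha>) ?F y) x))"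
      by (simp only: funpow.simps(2) o_apply norm_sum)
    also have "\<dots> \<le> real (card ?I) * (2 * A * G (length is))"
      by (rule sum_bounded_above) (use tb in \<open>simp add: norm_mult norm_power\<close>)
    also have "\<dots> = E ^ Suc k * (R ^ (length is + d * Suc k) * fact (length is + d * Suc k) * N (length is + d * Suc k))"
    proof -
      have e: "length is + d + d * k = length is + d * Suc k" by simp
      show ?thesis unfolding G_def E_def e by (simp only: power_Suc mult.assoc mult.left_commute mult.commute)
    qed
    finally show ?case .
  qed
  show ?thesis
  proof (intro exI[of _ "E * R"] conjI allI impI ballI)
    show "E * R \<ge> 1" using mult_mono[OF E1 R(1)] E1 by simp
    fix N :: "nat \<Rightarrow> real" and k x
    assume N: "mono N" "\<forall>n. N n \<ge> 0" "\<forall>x\<in>K. \<forall>is. norm (partials is f x) \<le> N (length is)" and x: "x \<in> K"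
    have "norm ((pdo_fun d a ^^ k) f x) \<le> E ^ k * (R ^ (d * k) * fact (d * k) * N (d * k))"
      using main[OF N x, of "[]" k] by simp
    also have "\<dots> \<le> E ^ (d * k) * (R ^ (d * k) * fact (d * k) * N (d * k))"
      using d R N(2) by (intro mult_right_mono power_increasing E1 mult_nonneg_nonneg) auto
    finally show "norm ((pdo_fun d a ^^ k) f x) \<le> (E * R) ^ (d * k) * fact (d * k) * N (d * k)"
      by (simp only: power_mult_distrib mult.assoc)
  qed
qed

section \<open>The theorem of the iterates\<close>

text \<open>The estimate of \<open>global_regularity\<close> in terms of the weight: the sum over the iterates, the
  squared factorial and the geometric factor all disappear in a change of \<open>h\<close>.\<close>

lemma absorb_sum:
  fixes d q :: nat and D :: real
  assumes w: "weight_function \<omega>" and H: "\<exists>H\<ge>1. (\<lambda>t. \<omega> (t\<^sup>2)) \<in> O[at_top](\<lambda>t. \<omega> (H * t))" and D: "D \<ge> 1"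
  shows "\<exists>\<kappa>\<ge>1. \<forall>h>0. \<forall>C>0. \<exists>B>0. \<forall>G. (\<forall>k. G k \<le> C * exp (1 / h * young_conj \<omega> (h * real d * real k))) \<longrightarrow>
    (\<forall>l. D ^ Suc l * (fact (q * Suc l))\<^sup>2 * (\<Sum>i\<le>q * Suc l. G i) \<le> B * exp (1 / (\<kappa> * h) * young_conj \<omega> (\<kappa> * h * real l)))"
proof -
  \<comment> \<open>With this multiple the order \<open>d i\<close> of every iterate involved, and the number of
    iterates, are bounded through \<open>?q (l + 1)\<close>.\<close>
  let ?q = "Suc d * q"
  have A: "D * 2 ^ ?q \<ge> 1" using mult_mono[OF D one_le_power[of "2::real" ?q]] D by simp
  obtain \<kappa> where \<kappa>: "\<kappa> \<ge> 1" "\<And>h. h > 0 \<Longrightarrow> \<exists>B>0. \<forall>l::nat. (D * 2 ^ ?q) ^ (l + 1) * fact (?q * (l + 1)) ^ 2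
      * exp (1 / h * young_conj \<omega> (h * real (?q * (l + 1)))) \<le> B * exp (1 / (\<kappa> * h) * young_conj \<omega> (\<kappa> * h * real l))"
    by (rule young_conj_absorb[OF w H A, of ?q 2]) (rule that)
  show ?thesis
  proof (rule exI[of _ \<kappa>], intro conjI \<kappa>(1) allI impI)
    fix h C :: real assume h: "h > 0" and C: "C > 0"
    obtain B where B: "B > 0" "\<And>l::nat. (D * 2 ^ ?q) ^ (l + 1) * fact (?q * (l + 1)) ^ 2
      * exp (1 / h * young_conj \<omega> (h * real (?q * (l + 1)))) \<le> B * exp (1 / (\<kappa> * h) * young_conj \<omega> (\<kappa> * h * real l))"
      using \<kappa>(2)[OF h] by blast
    have est: "D ^ Suc l * (fact (q * Suc l))\<^sup>2 * (\<Sum>i\<le>q * Suc l. G i) \<le> (C * B) * exp (1 / (\<kappa> * h) * young_conj \<omega> (\<kappa> * h * real l))"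
      if G: "\<forall>k. G k \<le> C * exp (1 / h * young_conj \<omega> (h * real d * real k))" for G :: "nat \<Rightarrow> real" and l
    proof -
      let ?m = "?q * Suc l"
      let ?e = "exp (1 / h * young_conj \<omega> (h * real ?m))"
      have "G i \<le> C * ?e" if i: "i \<in> {..q * Suc l}" for i
      proof -
        have "d * i \<le> d * (q * Suc l)" using i by (intro mult_left_mono) auto
        then have "d * i \<le> ?m" by (simp add: algebra_simps)
        then have "h * real (d * i) \<le> h * real ?m" using h by (intro mult_left_mono) (simp_all only: of_nat_le_iff)
        then have "young_conj \<omega> (h * real d * real i) \<le> young_conj \<omega> (h * real ?m)"
          by (intro young_conj_mono[OF w]) (simp add: mult.assoc)
        then have "exp (1 / h * young_conj \<omega> (h * real d * real i)) \<le> ?e" using h by (simp add: divide_right_mono)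
        then have "C * exp (1 / h * young_conj \<omega> (h * real d * real i)) \<le> C * ?e" using C by simp
        then show ?thesis using G by (meson order_trans)
      qed
      then have "(\<Sum>i\<le>q * Suc l. G i) \<le> real (card {..q * Suc l}) * (C * ?e)" by (rule sum_bounded_above)
      also have "\<dots> \<le> 2 ^ ?m * (C * ?e)"
      proof (rule mult_right_mono)
        have "card {..q * Suc l} \<le> Suc ?m" by (simp add: algebra_simps)
        also have "\<dots> \<le> 2 ^ ?m" using less_exp[of ?m] by (simp only: Suc_le_eq)
        finally have "real (card {..q * Suc l}) \<le> real (2 ^ ?m)" by (simp only: of_nat_le_iff)
        then show "real (card {..q * Suc l}) \<le> 2 ^ ?m" by simp
      qed (use C in simp)
      finally have s: "(\<Sum>i\<le>q * Suc l. G i) \<le> 2 ^ ?m * (C * ?e)" .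
      have "q * Suc l \<le> ?m" by (simp add: algebra_simps)
      then have f: "(fact (q * Suc l) :: real)\<^sup>2 \<le> (fact ?m)\<^sup>2" by (intro power_mono fact_mono) auto
      have "D ^ Suc l * (fact (q * Suc l))\<^sup>2 * (\<Sum>i\<le>q * Suc l. G i) \<le> D ^ Suc l * (fact (q * Suc l))\<^sup>2 * (2 ^ ?m * (C * ?e))"
        by (rule mult_left_mono[OF s]) (use D in simp)
      also have "\<dots> \<le> D ^ Suc l * (fact ?m)\<^sup>2 * (2 ^ ?m * (C * ?e))"
        by (intro mult_right_mono mult_left_mono f) (use C D in auto)
      also have "\<dots> = C * ((D * 2 ^ ?q) ^ (l + 1) * fact (?q * (l + 1)) ^ 2 * exp (1 / h * young_conj \<omega> (h * real (?q * (l + 1)))))"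
        by (simp only: power_mult_distrib power_mult Suc_eq_plus1 mult.assoc mult.left_commute mult.commute)
      also have "\<dots> \<le> C * (B * exp (1 / (\<kappa> * h) * young_conj \<omega> (\<kappa> * h * real l)))"
        using B(2)[of l] C by (intro mult_left_mono) auto
      finally show ?thesis by (simp only: mult.assoc)
    qed
    show "\<exists>B>0. \<forall>G. (\<forall>k. G k \<le> C * exp (1 / h * young_conj \<omega> (h * real d * real k))) \<longrightarrow>
      (\<forall>l. D ^ Suc l * (fact (q * Suc l))\<^sup>2 * (\<Sum>i\<le>q * Suc l. G i) \<le> B * exp (1 / (\<kappa> * h) * young_conj \<omega> (\<kappa> * h * real l)))"
      by (intro exI[of _ "C * B"] conjI allI impI est) (use B(1) C in auto)
  qed
qed

lemma norm_mi_D: "norm (mi_D \<alpha> f x) = norm (partials (mi_list \<alpha>) f x)"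
  by (simp add: mi_D_def mi_partial_eq norm_mult norm_power)

text \<open>The regularity half in a form common to both classes: bounds for the iterates with parameter
  \<open>h\<close> give bounds for the derivatives with parameter \<open>\<kappa> h\<close>, where
  \<open>\<kappa>\<close> depends only on the compact set and not on \<open>h\<close>.\<close>

lemma iterates_regularity:
  fixes a :: "'n::finite multiindex \<Rightarrow> real ^ 'n \<Rightarrow> complex"
  assumes \<Omega>: "open \<Omega>" and w: "weight_function \<omega>" and H: "\<exists>H\<ge>1. (\<lambda>t. \<omega> (t\<^sup>2)) \<in> O[at_top](\<lambda>t. \<omega> (H * t))"
    and \<delta>: "0 \<le> \<delta>" "\<delta> < \<rho>" and d': "d' > 0" and a: "a \<in> class_A \<Omega> d d' \<rho> \<delta>"
    and g: "\<And>k. g k \<in> L1_loc \<Omega>" and P: "\<And>k. (pdo \<Omega> d a ^^ k) u = regular_dist \<Omega> (g k)"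
  shows "\<exists>f. smooth_on \<Omega> f \<and> u = regular_dist \<Omega> f \<and> (\<forall>K. compact K \<and> K \<subseteq> \<Omega> \<longrightarrow>
    (\<exists>V \<kappa>. open V \<and> compact (closure V) \<and> closure V \<subseteq> \<Omega> \<and> \<kappa> \<ge> 1 \<and> (\<forall>h>0. \<forall>C>0.
      (\<forall>k. set_lebesgue_integral lebesgue V (\<lambda>x. norm (g k x)) \<le> C * exp (1 / h * young_conj \<omega> (h * real d * real k))) \<longrightarrow>
      (\<exists>B>0. \<forall>\<alpha>. \<forall>x\<in>K. norm (mi_D \<alpha> f x) \<le> B * exp (1 / (\<kappa> * h) * young_conj \<omega> (\<kappa> * h * real (mi_abs \<alpha>)))))))"
proof -
  have gP: "pairing \<Omega> (g (Suc j)) \<phi> = pairing \<Omega> (g j) (transpose_op d a \<phi>)" if \<phi>: "\<phi> \<in> test_functions \<Omega>" for j \<phi>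
  proof -
    have "regular_dist \<Omega> (g (Suc j)) = pdo \<Omega> d a (regular_dist \<Omega> (g j))" using P[of "Suc j"] P[of j] by simp
    then have "regular_dist \<Omega> (g (Suc j)) \<phi> = pairing \<Omega> (g j) (transpose_op d a \<phi>)"
      by (simp only:) (rule pdo_regular_dist[OF \<Omega> g \<phi>], rule class_A_smooth[OF a])
    then show ?thesis using \<phi> by (simp add: regular_dist_def)
  qed
  have "\<exists>f. smooth_on \<Omega> f \<and> (\<forall>\<phi>\<in>test_functions \<Omega>. pairing \<Omega> (g 0) \<phi> = pairing \<Omega> f \<phi>) \<and>
    (\<forall>K. compact K \<and> K \<subseteq> \<Omega> \<longrightarrow> (\<exists>K1 D q. compact K1 \<and> K1 \<subseteq> \<Omega> \<and> D \<ge> 1 \<and>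
      (\<forall>x\<in>K. \<forall>is. norm (partials is f x) \<le> D ^ Suc (length is) * (fact (q * Suc (length is)))\<^sup>2 *
       (\<Sum>i\<le>q * Suc (length is). set_lebesgue_integral lebesgue K1 (\<lambda>x. norm (g i x))))))"
    by (rule global_regularity[where g = g, OF \<Omega> a \<delta> d' g gP])
  then obtain f where f: "smooth_on \<Omega> f" "\<forall>\<phi>\<in>test_functions \<Omega>. pairing \<Omega> (g 0) \<phi> = pairing \<Omega> f \<phi>"
    and b: "\<forall>K. compact K \<and> K \<subseteq> \<Omega> \<longrightarrow> (\<exists>K1 D q. compact K1 \<and> K1 \<subseteq> \<Omega> \<and> D \<ge> 1 \<and>
      (\<forall>x\<in>K. \<forall>is. norm (partials is f x) \<le> D ^ Suc (length is) * (fact (q * Suc (length is)))\<^sup>2 *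
       (\<Sum>i\<le>q * Suc (length is). set_lebesgue_integral lebesgue K1 (\<lambda>x. norm (g i x)))))"
    by (elim exE conjE) (rule that)
  show ?thesis
  proof (intro exI[of _ f] conjI allI impI f(1))
    have "u = regular_dist \<Omega> (g 0)" using P[of 0] by simp
    also have "\<dots> = regular_dist \<Omega> f" unfolding regular_dist_def by (rule restrict_ext) (use f(2) in simp)
    finally show "u = regular_dist \<Omega> f" .
    fix K assume K: "compact K \<and> K \<subseteq> \<Omega>"
    from b[rule_format, OF K] obtain K1 D q where K1: "compact K1" "K1 \<subseteq> \<Omega>" and D: "D \<ge> 1"
      and bd: "\<forall>x\<in>K. \<forall>is. norm (partials is f x) \<le> D ^ Suc (length is) * (fact (q * Suc (length is)))\<^sup>2 *
       (\<Sum>i\<le>q * Suc (length is). set_lebesgue_integral lebesgue K1 (\<lambda>x. norm (g i x)))"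
      by (elim exE conjE) (rule that)
    obtain V where V: "open V" "K1 \<subseteq> V" "compact (closure V)" "closure V \<subseteq> \<Omega>"
      using relatively_compact_nbhd[OF K1 \<Omega>] by blast
    from absorb_sum[OF w H D, of d q] obtain \<kappa> where \<kappa>: "\<kappa> \<ge> 1"
      and ab: "\<forall>h>0. \<forall>C>0. \<exists>B>0. \<forall>G. (\<forall>k. G k \<le> C * exp (1 / h * young_conj \<omega> (h * real d * real k))) \<longrightarrow>
        (\<forall>l. D ^ Suc l * (fact (q * Suc l))\<^sup>2 * (\<Sum>i\<le>q * Suc l. G i) \<le> B * exp (1 / (\<kappa> * h) * young_conj \<omega> (\<kappa> * h * real l)))"
      by (elim exE conjE) (rule that)
    have sub: "set_lebesgue_integral lebesgue K1 (\<lambda>x. norm (g k x)) \<le> set_lebesgue_integral lebesgue V (\<lambda>x. norm (g k x))" for k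
    proof -
      have c: "set_integrable lebesgue (closure V) (\<lambda>x. norm (g k x))"
        by (rule set_integrable_norm) (use g V in \<open>auto simp: L1_loc_def\<close>)
      have i: "set_integrable lebesgue V (\<lambda>x. norm (g k x))"
        by (rule set_integrable_subset[OF c]) (use V(1) closure_subset in auto)
      have i1: "set_integrable lebesgue K1 (\<lambda>x. norm (g k x))"
        by (rule set_integrable_subset[OF i]) (use V(2) fmeasurableD[OF lmeasurable_compact[OF K1(1)]] in auto)
      show ?thesis unfolding set_lebesgue_integral_def
        by (rule Bochner_Integration.integral_mono) (use i i1 V(2) in \<open>auto simp: set_integrable_def indicator_def\<close>)
    qed
    show "\<exists>V \<kappa>. open V \<and> compact (closure V) \<and> closure V \<subseteq> \<Omega> \<and> \<kappa> \<ge> 1 \<and> (\<forall>h>0. \<forall>C>0.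
      (\<forall>k. set_lebesgue_integral lebesgue V (\<lambda>x. norm (g k x)) \<le> C * exp (1 / h * young_conj \<omega> (h * real d * real k))) \<longrightarrow>
      (\<exists>B>0. \<forall>\<alpha>. \<forall>x\<in>K. norm (mi_D \<alpha> f x) \<le> B * exp (1 / (\<kappa> * h) * young_conj \<omega> (\<kappa> * h * real (mi_abs \<alpha>)))))"
    proof (rule exI[of _ V], rule exI[of _ \<kappa>], intro conjI V(1) V(3) V(4) \<kappa> allI impI)
      fix h C :: real assume h: "h > 0" and C: "C > 0"
        and le: "\<forall>k. set_lebesgue_integral lebesgue V (\<lambda>x. norm (g k x)) \<le> C * exp (1 / h * young_conj \<omega> (h * real d * real k))"
      from ab[rule_format, OF h C] obtain B where B: "B > 0" "\<forall>G. (\<forall>k. G k \<le> C * exp (1 / h * young_conj \<omega> (h * real d * real k))) \<longrightarrow>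
        (\<forall>l. D ^ Suc l * (fact (q * Suc l))\<^sup>2 * (\<Sum>i\<le>q * Suc l. G i) \<le> B * exp (1 / (\<kappa> * h) * young_conj \<omega> (\<kappa> * h * real l)))"
        by (elim exE conjE) (rule that)
      let ?G = "\<lambda>k. set_lebesgue_integral lebesgue K1 (\<lambda>x. norm (g k x))"
      have "\<forall>k. ?G k \<le> C * exp (1 / h * young_conj \<omega> (h * real d * real k))" using sub le by (meson order_trans)
      with B(2) have l: "D ^ Suc l * (fact (q * Suc l))\<^sup>2 * (\<Sum>i\<le>q * Suc l. ?G i) \<le> B * exp (1 / (\<kappa> * h) * young_conj \<omega> (\<kappa> * h * real l))" for l
        by simp
      show "\<exists>B>0. \<forall>\<alpha>. \<forall>x\<in>K. norm (mi_D \<alpha> f x) \<le> B * exp (1 / (\<kappa> * h) * young_conj \<omega> (\<kappa> * h * real (mi_abs \<alpha>)))"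
      proof (intro exI[of _ B] conjI B(1) allI ballI)
        fix \<alpha> :: "'n multiindex" and x assume "x \<in> K"
        then have "norm (mi_D \<alpha> f x) \<le> D ^ Suc (mi_abs \<alpha>) * (fact (q * Suc (mi_abs \<alpha>)))\<^sup>2 * (\<Sum>i\<le>q * Suc (mi_abs \<alpha>). ?G i)"
          using bspec[OF bd, of x] spec[of _ "mi_list \<alpha>"] unfolding norm_mi_D length_mi_list[symmetric] by blast
        also have "\<dots> \<le> B * exp (1 / (\<kappa> * h) * young_conj \<omega> (\<kappa> * h * real (mi_abs \<alpha>)))" by (rule l)
        finally show "norm (mi_D \<alpha> f x) \<le> B * exp (1 / (\<kappa> * h) * young_conj \<omega> (\<kappa> * h * real (mi_abs \<alpha>)))" .
      qed
    qed
  qed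
qed

text \<open>The converse half, again with a change of \<open>h\<close> by a factor independent of
  \<open>h\<close>.\<close>

lemma iterates_estimate:
  fixes a :: "'n::finite multiindex \<Rightarrow> real ^ 'n \<Rightarrow> complex"
  assumes \<Omega>: "open \<Omega>" and w: "weight_function \<omega>" and H: "\<exists>H\<ge>1. (\<lambda>t. \<omega> (t\<^sup>2)) \<in> O[at_top](\<lambda>t. \<omega> (H * t))"
    and a: "\<And>\<alpha>. mi_abs \<alpha> \<le> d \<Longrightarrow> real_analytic_on \<Omega> (a \<alpha>)" and d: "d \<ge> 1"
    and f: "smooth_on \<Omega> f" and V: "open V" "compact (closure V)" "closure V \<subseteq> \<Omega>"
  shows "\<exists>\<kappa>\<ge>1. \<forall>h>0. \<forall>C>0.
      (\<forall>\<alpha>. \<forall>x\<in>closure V. norm (mi_D \<alpha> f x) \<le> C * exp (1 / h * young_conj \<omega> (h * real (mi_abs \<alpha>)))) \<longrightarrow>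
      (\<exists>B>0. \<forall>k. set_lebesgue_integral lebesgue V (\<lambda>x. norm ((pdo_fun d a ^^ k) f x)) \<le> B * exp (1 / (\<kappa> * h) * young_conj \<omega> (\<kappa> * h * real d * real k)))"
proof -
  have "\<exists>D\<ge>1. \<forall>N. mono N \<longrightarrow> (\<forall>n. N n \<ge> 0) \<longrightarrow> (\<forall>x\<in>closure V. \<forall>is. norm (partials is f x) \<le> N (length is)) \<longrightarrow>
    (\<forall>k. \<forall>x\<in>closure V. norm ((pdo_fun d a ^^ k) f x) \<le> D ^ (d * k) * fact (d * k) * N (d * k))"
    by (rule pdo_iterates_bound[OF \<Omega> a d V(2,3) f])
  then obtain D where D: "D \<ge> 1" and it: "\<forall>N. mono N \<longrightarrow> (\<forall>n. N n \<ge> 0) \<longrightarrow> (\<forall>x\<in>closure V. \<forall>is. norm (partials is f x) \<le> N (length is)) \<longrightarrow>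
    (\<forall>k. \<forall>x\<in>closure V. norm ((pdo_fun d a ^^ k) f x) \<le> D ^ (d * k) * fact (d * k) * N (d * k))"
    by (elim exE conjE) (rule that)
  obtain \<kappa> where \<kappa>: "\<kappa> \<ge> 1" "\<And>h. h > 0 \<Longrightarrow> \<exists>B>0. \<forall>l::nat. D ^ (l + 1) * fact (1 * (l + 1)) ^ 1
      * exp (1 / h * young_conj \<omega> (h * real (1 * (l + 1)))) \<le> B * exp (1 / (\<kappa> * h) * young_conj \<omega> (\<kappa> * h * real l))"
    by (rule young_conj_absorb[OF w H D, of 1 1]) (rule that)
  define m where "m = measure lebesgue V"
  have m0: "m \<ge> 0" by (simp add: m_def)
  have Vf: "emeasure lebesgue V < \<infinity>"
    using emeasure_bounded_finite[OF bounded_subset[OF compact_imp_bounded[OF V(2)] closure_subset]] V(1) by simp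
  show ?thesis
  proof (rule exI[of _ \<kappa>], intro conjI \<kappa>(1) allI impI)
    fix h C :: real assume h: "h > 0" and C: "C > 0"
      and le: "\<forall>\<alpha>. \<forall>x\<in>closure V. norm (mi_D \<alpha> f x) \<le> C * exp (1 / h * young_conj \<omega> (h * real (mi_abs \<alpha>)))"
    obtain B where B: "B > 0" "\<And>l::nat. D ^ (l + 1) * fact (l + 1)
      * exp (1 / h * young_conj \<omega> (h * real (l + 1))) \<le> B * exp (1 / (\<kappa> * h) * young_conj \<omega> (\<kappa> * h * real l))"
      using \<kappa>(2)[OF h] unfolding mult_1 power_one_right by blast
    define N where "N n = C * exp (1 / h * young_conj \<omega> (h * real n))" for n
    have Nm: "N n \<le> N n'" if "n \<le> n'" for n n'
      unfolding N_def using that h C by (intro mult_left_mono) (auto intro!: divide_right_mono young_conj_mono[OF w])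
    have N0: "N n \<ge> 0" for n using C by (simp add: N_def)
    have Nb: "norm (partials is f x) \<le> N (length is)" if "x \<in> closure V" for x "is"
    proof (rule partials_bounds_of_mi_partial[OF \<Omega> _ f])
      show "x \<in> \<Omega>" using that V by blast
      show "norm (mi_partial \<alpha> f x) \<le> N (mi_abs \<alpha>)" for \<alpha>
        using le that unfolding norm_mi_D mi_partial_eq N_def by blast
    qed
    have pw: "norm ((pdo_fun d a ^^ k) f x) \<le> C * (B * exp (1 / (\<kappa> * h) * young_conj \<omega> (\<kappa> * h * real d * real k)))" if x: "x \<in> closure V" for k x
    proof -
      let ?l = "d * k"
      have "norm ((pdo_fun d a ^^ k) f x) \<le> D ^ ?l * fact ?l * N ?l"
        using it[rule_format, of N x k] Nm N0 Nb x by (auto simp: mono_def)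
      also have "\<dots> \<le> D ^ (?l + 1) * fact (?l + 1) * N (?l + 1)"
        by (intro mult_mono power_increasing fact_mono Nm D N0 mult_nonneg_nonneg) (use D in auto)
      also have "\<dots> = C * (D ^ (?l + 1) * fact (?l + 1) * exp (1 / h * young_conj \<omega> (h * real (?l + 1))))"
        by (simp only: N_def mult.assoc mult.left_commute mult.commute)
      also have "\<dots> \<le> C * (B * exp (1 / (\<kappa> * h) * young_conj \<omega> (\<kappa> * h * real ?l)))"
        using B(2)[of ?l] C by (intro mult_left_mono) auto
      finally show ?thesis by (simp only: of_nat_mult mult.assoc)
    qed
    show "\<exists>B>0. \<forall>k. set_lebesgue_integral lebesgue V (\<lambda>x. norm ((pdo_fun d a ^^ k) f x)) \<le> B * exp (1 / (\<kappa> * h) * young_conj \<omega> (\<kappa> * h * real d * real k))"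
    proof (intro exI[of _ "(m + 1) * (C * B)"] conjI allI)
      show "(m + 1) * (C * B) > 0" using m0 C B(1) by simp
      fix k
      let ?c = "C * (B * exp (1 / (\<kappa> * h) * young_conj \<omega> (\<kappa> * h * real d * real k)))"
      have c0: "?c \<ge> 0" using C B(1) by simp
      have "set_lebesgue_integral lebesgue V (\<lambda>x. norm ((pdo_fun d a ^^ k) f x)) \<le> (\<integral>x. indicator V x * ?c \<partial>lebesgue)"
        unfolding set_lebesgue_integral_def
      proof (rule Bochner_Integration.integral_mono')
        show "integrable lebesgue (\<lambda>x. indicator V x * ?c)"
          using Vf V(1) by (intro integrable_mult_left integrable_real_indicator) auto
        fix x show "indicator V x *\<^sub>R norm ((pdo_fun d a ^^ k) f x) \<le> indicator V x * ?c"
          using pw[of x k] closure_subset[of V] by (auto simp: indicator_def)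
        show "0 \<le> indicator V x * ?c" using c0 by (simp add: indicator_def)
      qed
      also have "\<dots> = m * ?c" using V(1) by (simp add: m_def)
      also have "\<dots> \<le> (m + 1) * ?c" using c0 by (intro mult_right_mono) auto
      finally show "set_lebesgue_integral lebesgue V (\<lambda>x. norm ((pdo_fun d a ^^ k) f x)) \<le> (m + 1) * (C * B) * exp (1 / (\<kappa> * h) * young_conj \<omega> (\<kappa> * h * real d * real k))"
        by (simp only: mult.assoc)
    qed
  qed
qed

theorem theorem2p4:
  fixes \<Omega> :: "(real ^ 'n::finite) set"
    and \<omega> :: "real \<Rightarrow> real"
    and \<rho> \<delta> d' :: real
    and d :: nat
    and a :: "'n multiindex \<Rightarrow> real ^ 'n \<Rightarrow> complex"
  assumes "open \<Omega>"
    and "weight_function \<omega>"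
    and "\<exists>H\<ge>1. (\<lambda>t. \<omega> (t\<^sup>2)) \<in> O[at_top](\<lambda>t. \<omega> (H * t))"
    and "0 \<le> \<delta>" and "\<delta> < \<rho>" and "\<rho> \<le> 1" and "d' > 0"
    and "a \<in> class_A \<Omega> d d' \<rho> \<delta>"
  shows "E_roumieu_P \<omega> \<Omega> d a = regular_dist \<Omega> ` E_roumieu \<omega> \<Omega> \<and>
         E_beurling_P \<omega> \<Omega> d a = regular_dist \<Omega> ` E_beurling \<omega> \<Omega>"
proof -
  note \<Omega> = assms(1) and w = assms(2) and H = assms(3) and \<delta> = assms(4,5) and d' = assms(7) and a = assms(8)
  let ?\<psi> = "young_conj \<omega>"
  let ?I = "\<lambda>V g (k::nat). set_lebesgue_integral lebesgue V (\<lambda>x. norm (g k x))"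
  let ?adm = "\<lambda>V. open V \<and> compact (closure V) \<and> closure V \<subseteq> \<Omega>"
  have d1: "d \<ge> 1" by (rule class_A_order_pos[OF a d'])
  have an: "real_analytic_on \<Omega> (a \<alpha>)" if "mi_abs \<alpha> \<le> d" for \<alpha>
    using conjunct1[OF CollectD[OF a[unfolded class_A_def]]] that unfolding pdo_coeffs_def by blast
  define rep where "rep u g \<longleftrightarrow> (\<forall>k. g k \<in> L1_loc \<Omega> \<and> (pdo \<Omega> d a ^^ k) u = regular_dist \<Omega> (g k))" for u g
  \<comment> \<open>Both classes quantify differently over \<open>h\<close> but share these implications, in which \<open>\<kappa>\<close> precedes \<open>h\<close>.\<close>
  have fwd: "\<exists>f. smooth_on \<Omega> f \<and> u = regular_dist \<Omega> f \<and> (\<forall>K. compact K \<and> K \<subseteq> \<Omega> \<longrightarrow>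
      (\<exists>V \<kappa>. ?adm V \<and> \<kappa> \<ge> 1 \<and> (\<forall>h>0. \<forall>C>0.
        (\<forall>k. ?I V g k \<le> C * exp (1 / h * ?\<psi> (h * real d * real k))) \<longrightarrow>
        (\<exists>B>0. \<forall>\<alpha>. \<forall>x\<in>K. norm (mi_D \<alpha> f x) \<le> B * exp (1 / (\<kappa> * h) * ?\<psi> (\<kappa> * h * real (mi_abs \<alpha>)))))))"
    if u: "u \<in> distributions \<Omega>" "rep u g" for u g
  proof -
    have g: "g k \<in> L1_loc \<Omega>" and P: "(pdo \<Omega> d a ^^ k) u = regular_dist \<Omega> (g k)" for k
      using u(2) by (simp_all add: rep_def)
    show ?thesis using iterates_regularity[OF \<Omega> w H \<delta> d' a g P] by (simp only: conj_assoc)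
  qed
  have bwd: "regular_dist \<Omega> f \<in> distributions \<Omega> \<and> rep (regular_dist \<Omega> f) (\<lambda>k. (pdo_fun d a ^^ k) f)" if f: "smooth_on \<Omega> f" for f
  proof -
    have it: "smooth_on \<Omega> ((pdo_fun d a ^^ k) f) \<and> (pdo \<Omega> d a ^^ k) (regular_dist \<Omega> f) = regular_dist \<Omega> ((pdo_fun d a ^^ k) f)" for k
      by (rule pdo_iterate_regular_dist[OF \<Omega> f class_A_smooth[OF a]])
    show ?thesis using it smooth_on_L1_loc regular_dist_distribution[OF smooth_on_L1_loc[OF f] \<Omega>] by (auto simp: rep_def)
  qed
  have bwd_est: "\<exists>\<kappa>\<ge>1. \<forall>h>0. \<forall>C>0.
      (\<forall>\<alpha>. \<forall>x\<in>closure V. norm (mi_D \<alpha> f x) \<le> C * exp (1 / h * ?\<psi> (h * real (mi_abs \<alpha>)))) \<longrightarrow>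
      (\<exists>B>0. \<forall>k. ?I V (\<lambda>k. (pdo_fun d a ^^ k) f) k \<le> B * exp (1 / (\<kappa> * h) * ?\<psi> (\<kappa> * h * real d * real k)))"
    if "smooth_on \<Omega> f" "?adm V" for f V
    by (rule iterates_estimate[OF \<Omega> w H an d1 that(1)]) (use that(2) in auto)
  have RP: "u \<in> E_roumieu_P \<omega> \<Omega> d a \<longleftrightarrow> u \<in> distributions \<Omega> \<and> (\<exists>g. rep u g \<and>
      (\<forall>V. ?adm V \<longrightarrow> (\<exists>C>0. \<exists>h>0. \<forall>k. ?I V g k \<le> C * exp (1 / h * ?\<psi> (h * real d * real k)))))" for u
    by (simp only: E_roumieu_P_def rep_def mem_Collect_eq)
  have BP: "u \<in> E_beurling_P \<omega> \<Omega> d a \<longleftrightarrow> u \<in> distributions \<Omega> \<and> (\<exists>g. rep u g \<and>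
      (\<forall>V. ?adm V \<longrightarrow> (\<forall>h>0. \<exists>C>0. \<forall>k. ?I V g k \<le> C * exp (1 / h * ?\<psi> (h * real d * real k)))))" for u
    by (simp only: E_beurling_P_def rep_def mem_Collect_eq)
  have R: "f \<in> E_roumieu \<omega> \<Omega> \<longleftrightarrow> smooth_on \<Omega> f \<and> (\<forall>K. compact K \<and> K \<subseteq> \<Omega> \<longrightarrow> (\<exists>C>0. \<exists>h>0. \<forall>\<alpha>. \<forall>x\<in>K.
        norm (mi_D \<alpha> f x) \<le> C * exp (1 / h * ?\<psi> (h * real (mi_abs \<alpha>)))))" for f :: "real ^ 'n \<Rightarrow> complex"
    by (simp only: E_roumieu_def mem_Collect_eq)
  have Be: "f \<in> E_beurling \<omega> \<Omega> \<longleftrightarrow> smooth_on \<Omega> f \<and> (\<forall>K. compact K \<and> K \<subseteq> \<Omega> \<longrightarrow> (\<forall>h>0. \<exists>C>0. \<forall>\<alpha>. \<forall>x\<in>K.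
        norm (mi_D \<alpha> f x) \<le> C * exp (1 / h * ?\<psi> (h * real (mi_abs \<alpha>)))))" for f :: "real ^ 'n \<Rightarrow> complex"
    by (simp only: E_beurling_def mem_Collect_eq)
  \<comment> \<open>In the Roumieu case a bound with parameter \<open>h\<close> becomes one with \<open>\<kappa> * h\<close>; in the Beurling case
    the bound with parameter \<open>h\<close> is obtained from the one with \<open>h / \<kappa>\<close>.\<close>
  have div: "h / \<kappa> > 0" "\<kappa> * (h / \<kappa>) = h" if "\<kappa> \<ge> 1" "h > 0" for \<kappa> h :: real using that by auto
  have R1: "u \<in> regular_dist \<Omega> ` E_roumieu \<omega> \<Omega>" if "u \<in> E_roumieu_P \<omega> \<Omega> d a" for u
  proof -
    from that obtain g where u: "u \<in> distributions \<Omega>" "rep u g"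
      and est: "\<forall>V. ?adm V \<longrightarrow> (\<exists>C>0. \<exists>h>0. \<forall>k. ?I V g k \<le> C * exp (1 / h * ?\<psi> (h * real d * real k)))"
      unfolding RP by (elim exE conjE) (rule that)
    from fwd[OF u] obtain f where f: "smooth_on \<Omega> f" "u = regular_dist \<Omega> f"
      and D: "\<forall>K. compact K \<and> K \<subseteq> \<Omega> \<longrightarrow> (\<exists>V \<kappa>. ?adm V \<and> \<kappa> \<ge> 1 \<and> (\<forall>h>0. \<forall>C>0.
        (\<forall>k. ?I V g k \<le> C * exp (1 / h * ?\<psi> (h * real d * real k))) \<longrightarrow>
        (\<exists>B>0. \<forall>\<alpha>. \<forall>x\<in>K. norm (mi_D \<alpha> f x) \<le> B * exp (1 / (\<kappa> * h) * ?\<psi> (\<kappa> * h * real (mi_abs \<alpha>))))))"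
      by (elim exE conjE) (rule that)
    have "f \<in> E_roumieu \<omega> \<Omega>" unfolding R
    proof (intro conjI f(1) allI impI)
      fix K assume K: "compact K \<and> K \<subseteq> \<Omega>"
      from D[rule_format, OF K] obtain V \<kappa> where V: "?adm V" and \<kappa>: "\<kappa> \<ge> 1" and imp: "\<forall>h>0. \<forall>C>0.
        (\<forall>k. ?I V g k \<le> C * exp (1 / h * ?\<psi> (h * real d * real k))) \<longrightarrow>
        (\<exists>B>0. \<forall>\<alpha>. \<forall>x\<in>K. norm (mi_D \<alpha> f x) \<le> B * exp (1 / (\<kappa> * h) * ?\<psi> (\<kappa> * h * real (mi_abs \<alpha>))))" by blast
      from est[rule_format, OF V] obtain C h where C: "C > 0" "h > 0"
        and le: "\<forall>k. ?I V g k \<le> C * exp (1 / h * ?\<psi> (h * real d * real k))" by blast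
      from imp C le obtain B where "B > 0" "\<forall>\<alpha>. \<forall>x\<in>K. norm (mi_D \<alpha> f x) \<le> B * exp (1 / (\<kappa> * h) * ?\<psi> (\<kappa> * h * real (mi_abs \<alpha>)))" by blast
      moreover have "\<kappa> * h > 0" using \<kappa> C(2) by simp
      ultimately show "\<exists>C>0. \<exists>h>0. \<forall>\<alpha>. \<forall>x\<in>K. norm (mi_D \<alpha> f x) \<le> C * exp (1 / h * ?\<psi> (h * real (mi_abs \<alpha>)))" by blast
    qed
    then show ?thesis using f(2) by blast
  qed
  have B1: "u \<in> regular_dist \<Omega> ` E_beurling \<omega> \<Omega>" if "u \<in> E_beurling_P \<omega> \<Omega> d a" for u
  proof -
    from that obtain g where u: "u \<in> distributions \<Omega>" "rep u g"
      and est: "\<forall>V. ?adm V \<longrightarrow> (\<forall>h>0. \<exists>C>0. \<forall>k. ?I V g k \<le> C * exp (1 / h * ?\<psi> (h * real d * real k)))"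
      unfolding BP by (elim exE conjE) (rule that)
    from fwd[OF u] obtain f where f: "smooth_on \<Omega> f" "u = regular_dist \<Omega> f"
      and D: "\<forall>K. compact K \<and> K \<subseteq> \<Omega> \<longrightarrow> (\<exists>V \<kappa>. ?adm V \<and> \<kappa> \<ge> 1 \<and> (\<forall>h>0. \<forall>C>0.
        (\<forall>k. ?I V g k \<le> C * exp (1 / h * ?\<psi> (h * real d * real k))) \<longrightarrow>
        (\<exists>B>0. \<forall>\<alpha>. \<forall>x\<in>K. norm (mi_D \<alpha> f x) \<le> B * exp (1 / (\<kappa> * h) * ?\<psi> (\<kappa> * h * real (mi_abs \<alpha>))))))"
      by (elim exE conjE) (rule that)
    have "f \<in> E_beurling \<omega> \<Omega>" unfolding Be
    proof (intro conjI f(1) allI impI)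
      fix K and h :: real assume K: "compact K \<and> K \<subseteq> \<Omega>" and h: "h > 0"
      from D[rule_format, OF K] obtain V \<kappa> where V: "?adm V" and \<kappa>: "\<kappa> \<ge> 1" and imp: "\<forall>h>0. \<forall>C>0.
        (\<forall>k. ?I V g k \<le> C * exp (1 / h * ?\<psi> (h * real d * real k))) \<longrightarrow>
        (\<exists>B>0. \<forall>\<alpha>. \<forall>x\<in>K. norm (mi_D \<alpha> f x) \<le> B * exp (1 / (\<kappa> * h) * ?\<psi> (\<kappa> * h * real (mi_abs \<alpha>))))" by blast
      note h' = div[OF \<kappa> h]
      from est[rule_format, OF V h'(1)] obtain C where C: "C > 0"
        and le: "\<forall>k. ?I V g k \<le> C * exp (1 / (h / \<kappa>) * ?\<psi> (h / \<kappa> * real d * real k))" by blast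
      show "\<exists>C>0. \<forall>\<alpha>. \<forall>x\<in>K. norm (mi_D \<alpha> f x) \<le> C * exp (1 / h * ?\<psi> (h * real (mi_abs \<alpha>)))"
        using mp[OF mp[OF spec[OF mp[OF spec[OF imp, of "h / \<kappa>"] h'(1)], of C] C] le] unfolding h'(2) .
    qed
    then show ?thesis using f(2) by blast
  qed
  have R2: "regular_dist \<Omega> f \<in> E_roumieu_P \<omega> \<Omega> d a" if "f \<in> E_roumieu \<omega> \<Omega>" for f
  proof -
    from that have f: "smooth_on \<Omega> f" and est: "\<forall>K. compact K \<and> K \<subseteq> \<Omega> \<longrightarrow> (\<exists>C>0. \<exists>h>0. \<forall>\<alpha>. \<forall>x\<in>K.
        norm (mi_D \<alpha> f x) \<le> C * exp (1 / h * ?\<psi> (h * real (mi_abs \<alpha>))))" unfolding R by (rule conjunct1, rule conjunct2)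
    show ?thesis unfolding RP
    proof (intro conjI exI[of _ "\<lambda>k. (pdo_fun d a ^^ k) f"] bwd[OF f, THEN conjunct1] bwd[OF f, THEN conjunct2] allI impI)
      fix V assume V: "?adm V"
      then have cV: "compact (closure V) \<and> closure V \<subseteq> \<Omega>" by simp
      from est[rule_format, OF cV] obtain C h where C: "C > 0" "h > 0"
        and le: "\<forall>\<alpha>. \<forall>x\<in>closure V. norm (mi_D \<alpha> f x) \<le> C * exp (1 / h * ?\<psi> (h * real (mi_abs \<alpha>)))"
        by (elim exE conjE) (rule that)
      from bwd_est[OF f V] obtain \<kappa> where \<kappa>: "\<kappa> \<ge> 1" and imp: "\<forall>h>0. \<forall>C>0.
        (\<forall>\<alpha>. \<forall>x\<in>closure V. norm (mi_D \<alpha> f x) \<le> C * exp (1 / h * ?\<psi> (h * real (mi_abs \<alpha>)))) \<longrightarrow>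
        (\<exists>B>0. \<forall>k. ?I V (\<lambda>k. (pdo_fun d a ^^ k) f) k \<le> B * exp (1 / (\<kappa> * h) * ?\<psi> (\<kappa> * h * real d * real k)))"
        by (elim exE conjE) (rule that)
      have "\<kappa> * h > 0" using \<kappa> C(2) by simp
      moreover from mp[OF mp[OF spec[OF mp[OF spec[OF imp, of h] C(2)], of C] C(1)] le] obtain B where
        "B > 0" "\<forall>k. ?I V (\<lambda>k. (pdo_fun d a ^^ k) f) k \<le> B * exp (1 / (\<kappa> * h) * ?\<psi> (\<kappa> * h * real d * real k))"
        by (elim exE conjE) (rule that)
      ultimately show "\<exists>C>0. \<exists>h>0. \<forall>k. ?I V (\<lambda>k. (pdo_fun d a ^^ k) f) k \<le> C * exp (1 / h * ?\<psi> (h * real d * real k))"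
        by blast
    qed
  qed
  have B2: "regular_dist \<Omega> f \<in> E_beurling_P \<omega> \<Omega> d a" if "f \<in> E_beurling \<omega> \<Omega>" for f
  proof -
    from that have f: "smooth_on \<Omega> f" and est: "\<forall>K. compact K \<and> K \<subseteq> \<Omega> \<longrightarrow> (\<forall>h>0. \<exists>C>0. \<forall>\<alpha>. \<forall>x\<in>K.
        norm (mi_D \<alpha> f x) \<le> C * exp (1 / h * ?\<psi> (h * real (mi_abs \<alpha>))))" unfolding Be by (rule conjunct1, rule conjunct2)
    show ?thesis unfolding BP
    proof (intro conjI exI[of _ "\<lambda>k. (pdo_fun d a ^^ k) f"] bwd[OF f, THEN conjunct1] bwd[OF f, THEN conjunct2] allI impI)
      fix V and h :: real assume V: "?adm V" and h: "h > 0"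
      then have cV: "compact (closure V) \<and> closure V \<subseteq> \<Omega>" by simp
      from bwd_est[OF f V] obtain \<kappa> where \<kappa>: "\<kappa> \<ge> 1" and imp: "\<forall>h>0. \<forall>C>0.
        (\<forall>\<alpha>. \<forall>x\<in>closure V. norm (mi_D \<alpha> f x) \<le> C * exp (1 / h * ?\<psi> (h * real (mi_abs \<alpha>)))) \<longrightarrow>
        (\<exists>B>0. \<forall>k. ?I V (\<lambda>k. (pdo_fun d a ^^ k) f) k \<le> B * exp (1 / (\<kappa> * h) * ?\<psi> (\<kappa> * h * real d * real k)))"
        by (elim exE conjE) (rule that)
      note h' = div[OF \<kappa> h]
      from est[rule_format, OF cV h'(1)] obtain C where C: "C > 0"
        and le: "\<forall>\<alpha>. \<forall>x\<in>closure V. norm (mi_D \<alpha> f x) \<le> C * exp (1 / (h / \<kappa>) * ?\<psi> (h / \<kappa> * real (mi_abs \<alpha>)))"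
        by (elim exE conjE) (rule that)
      show "\<exists>C>0. \<forall>k. ?I V (\<lambda>k. (pdo_fun d a ^^ k) f) k \<le> C * exp (1 / h * ?\<psi> (h * real d * real k))"
        using mp[OF mp[OF spec[OF mp[OF spec[OF imp, of "h / \<kappa>"] h'(1)], of C] C] le] unfolding h'(2) .
    qed
  qed
  show ?thesis using R1 R2 B1 B2 by blast
qed

end
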